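(* Let $0<s\le n\le k$ be integers and let $\{(X_{A_t}^s,0)\}_{t\in D}$ be a $d$-dimensional family of determinantal singularities defined by the germs of matrices $A_t=((a_{ij})_t):(\mathbb{C}^m,0)\to (M_{n,k},0)$ with holomorphic entries. Suppose that $X_{A_0}^s$ has an isolated singularity at $0$ and that, for all $t\in D$, the matrix $A_t$ satisfies the following conditions: (1) the matrix $A_t$ is Newton non-degenerate; (2) the Newton polyhedra $\Delta_j^t$ of $(a_{ij})_t$ are convenient and independent of $t$. Then the family $\{(X_{A_t}^s,0)\}_{t\in D}$ is Whitney equisingular.
   Context: Determinantal varieties. $M_{n,k}$ is the set of complex $n\times k$ matrices and $M_{n,k}^s\subset M_{n,k}$ the subset of matrices of rank less than $s$; it has codimension $(n-s+1)(k-s+1)$. For a holomorphic map germ $A=(a_{ij}):(\mathbb{C}^m,0)\to(M_{n,k},0)$ put $X_A^s=A^{-1}(M_{n,k}^s)$, with the analytic structure given by the $s\times s$ minors of $A(x)$. $X_A^s$ is a determinantal variety of type $(n,k;s)$ if its dimension equals $m-(n-s+1)(k-s+1)$. $S(X)$ denotes the singular set of $X$ (defined via the Jacobian matrix of the defining equations). Families. The family is given by a holomorphic map germ $\mathcal{A}:(\mathbb{C}^m\times\mathbb{C},0)\to(M_{n,k},0)$, $A_t(x)=\mathcal{A}(x,t)$, where $X_{A_0}^s$ is a determinantal variety; $X_{A_t}^s=A_t^{-1}(M_{n,k}^s)$ and $X_{\mathcal{A}}^s=\mathcal{A}^{-1}(M_{n,k}^s)$ is the total space. $D\subset\mathbb{C}$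 is an open disc around the origin; representatives (and hence $D$) are fixed small enough. Write $T=\{0\}\times D$ and let $B_\varepsilon\subset\mathbb{C}^m$ be the open ball of radius $\varepsilon$ centred at $0$. The family is good if there is $\varepsilon>0$ with $S(X_{A_t}^s)=\{0\}$ on $B_\varepsilon$ for all $t\in D$. The family is Whitney equisingular if it is good and $\{X_{\mathcal{A}}^s\setminus T,\,T\}$ satisfies the Whitney conditions. Newton polyhedra. A Newton polyhedron is a set $\Delta\subset\mathbb{R}^m_+$ which is the convex hull of $\{p+v: p\in P,\ v\in\mathbb{R}^m_+\}$ for some $P\subset\mathbb{Z}^m_+$. It is convenient if it touches all the coordinate axes. For $f=\sum_a c_ax^a$, $\mathrm{supp}(f)=\{a: c_a\ne0\}$, and the Newton polyhedron $\Delta_f$ is the one determined by $P=\mathrm{supp}(f)$. For a face $\Gamma$ of $\Delta_f$, $f|_\Gamma=\sum_{a\in\Gamma}c_ax^a$. Convention: for each column index $j=1,\dots,k$ all entries $a_{ij}$, $i=1,\dots,n$, have the same Newton polyhedron, denoted $\Delta_j$ (respectively $\Delta_j^t$ for $A_t$). Newton non-degeneracy. The matrix $A=(a_{ij})$ is Newton non-degenerate (with respect to the given $s$) if for each collection of faces $\Gamma_j\subset\Delta_j$ ($j=1,\dots,k$) such that the Minkowski sum $\sum_{j=1}^k\Gamma_j$ is a bounded face of $\sum_{j=1}^k\Delta_j$, the polynomial matrix $(a_{ij}|_{\Gamma_j})$ defines in $(\mathbb{C}\setminus\{0\})^m$ either a non-singular determinantal variety of type $(n,k;s)$ or the empty set.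 The faces may have arbitrary dimension. *)

theory Defs
  imports
    "HOL-Analysis.Analysis"
    "HOL-Library.Set_Algebras"
    "Jordan_Normal_Form.DL_Rank_Submatrix"
begin

no_notation vec_index (infixl "$" 100)


section \<open>Several complex variables\<close>

text \<open>Complex affine space is \<^typ>\<open>complex^'m\<close>.  A function is holomorphic on an open set if it has a
  complex-linear Frechet derivative at every point.\<close>

definition holomorphic_Cn_on :: "(complex^'m \<Rightarrow> complex) \<Rightarrow> (complex^'m) set \<Rightarrow> bool" where
  "holomorphic_Cn_on f U \<longleftrightarrow>
     (\<forall>z\<in>U. \<exists>f'. (f has_derivative f') (at z) \<and> (\<forall>c v. f' (c *s v) = c * f' v))"

definition gradient :: "(complex^'m \<Rightarrow> complex) \<Rightarrow> complex^'m \<Rightarrow> complex^'m" where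
  "gradient f z = (\<chi> i. deriv (\<lambda>w. f (z + w *s axis i 1)) 0)"

text \<open>\<open>X\<close> is, near its point \<open>p\<close>, a complex submanifold of (complex) dimension \<open>d\<close>: some
  biholomorphic chart straightens \<open>X\<close> to a complex linear subspace.\<close>

definition submanifold_at :: "(complex^'m) set \<Rightarrow> complex^'m \<Rightarrow> nat \<Rightarrow> bool" where
  "submanifold_at X p d \<longleftrightarrow> p \<in> X \<and>
     (\<exists>U V (\<phi> :: complex^'m \<Rightarrow> complex^'m) \<psi> L. open U \<and> open V \<and> p \<in> U \<and> homeomorphism U V \<phi> \<psi> \<and>
        (\<forall>i. holomorphic_Cn_on (\<lambda>z. \<phi> z $ i) U) \<and> (\<forall>i. holomorphic_Cn_on (\<lambda>w. \<psi> w $ i) V) \<and>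
        vec.subspace L \<and> vec.dim L = d \<and>
        \<phi> ` (X \<inter> U) = L \<inter> V)"

text \<open>The dimension of a nonempty analytic set is the largest dimension occurring at its manifold
  points.  No number is the dimension of the empty set.\<close>

definition has_dimension :: "(complex^'m) set \<Rightarrow> nat \<Rightarrow> bool" where
  "has_dimension X d \<longleftrightarrow>
     (\<exists>p. submanifold_at X p d) \<and> (\<forall>p e. submanifold_at X p e \<longrightarrow> e \<le> d)"


section \<open>Determinantal varieties\<close>

definition det_locus :: "nat \<Rightarrow> nat \<Rightarrow> (complex^'m \<Rightarrow> complex mat) \<Rightarrow> (complex^'m) set" where
  "det_locus n s A = {x. vec_space.rank n (A x) < s}"

definition det_codim :: "nat \<Rightarrow> nat \<Rightarrow> nat \<Rightarrow> nat" where
  "det_codim n k s = (n - s + 1) * (k - s + 1)"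

text \<open>The part of the locus inside an open set \<open>U\<close> is a determinantal variety of type \<open>(n,k;s)\<close>.\<close>

definition determinantal_variety ::
    "nat \<Rightarrow> nat \<Rightarrow> nat \<Rightarrow> (complex^'m \<Rightarrow> complex mat) \<Rightarrow> (complex^'m) set \<Rightarrow> bool" where
  "determinantal_variety n k s A U \<longleftrightarrow>
     (\<exists>d. has_dimension (det_locus n s A \<inter> U) d \<and> d + det_codim n k s = CARD('m))"

text \<open>The rows of the Jacobian matrix of the defining equations, the \<open>s \<times> s\<close> minors of \<open>A\<close>.\<close>

definition jacobian_rows ::
    "nat \<Rightarrow> nat \<Rightarrow> nat \<Rightarrow> (complex^'m \<Rightarrow> complex mat) \<Rightarrow> complex^'m \<Rightarrow> (complex^'m) set" where
  "jacobian_rows n k s A x =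
     {gradient (\<lambda>y. Determinant.det (submatrix (A y) I J)) x | I J.
        I \<subseteq> {..<n} \<and> J \<subseteq> {..<k} \<and> card I = s \<and> card J = s}"

text \<open>Singular points: the rank of the Jacobian matrix (the dimension of its row space) is less than
  the codimension of a determinantal variety of type \<open>(n,k;s)\<close>.\<close>

definition singular_set ::
    "nat \<Rightarrow> nat \<Rightarrow> nat \<Rightarrow> (complex^'m \<Rightarrow> complex mat) \<Rightarrow> (complex^'m) set" where
  "singular_set n k s A =
     {x \<in> det_locus n s A. vec.dim (jacobian_rows n k s A x) < det_codim n k s}"


section \<open>Newton polyhedra\<close>

definition monomial_Cn :: "nat^'m \<Rightarrow> complex^'m \<Rightarrow> complex" where
  "monomial_Cn a x = (\<Prod>i\<in>UNIV. (x $ i) ^ (a $ i))"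

text \<open>The coefficients of the power series expansion at the origin, which exists and is unique
  for a function that is holomorphic near the origin.\<close>

definition taylor_coeff :: "(complex^'m \<Rightarrow> complex) \<Rightarrow> nat^'m \<Rightarrow> complex" where
  "taylor_coeff f = (THE c. \<forall>\<^sub>F x in nhds 0. ((\<lambda>a. c a * monomial_Cn a x) has_sum f x) UNIV)"

definition lattice_point :: "nat^'m \<Rightarrow> real^'m" where
  "lattice_point a = (\<chi> i. real (a $ i))"

definition newton_polyhedron :: "(complex^'m \<Rightarrow> complex) \<Rightarrow> (real^'m) set" where
  "newton_polyhedron f =
     convex hull {lattice_point a + v | a v. taylor_coeff f a \<noteq> 0 \<and> (\<forall>i. 0 \<le> v $ i)}"

definition convenient :: "(real^'m) set \<Rightarrow> bool" where
  "convenient \<Delta> \<longleftrightarrow> (\<forall>i. \<exists>c. c *\<^sub>R axis i 1 \<in> \<Delta>)"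

text \<open>The restriction of \<open>f\<close> to \<open>\<Gamma>\<close>; it is only used for bounded \<open>\<Gamma>\<close>, where the sum is finite.\<close>

definition restrict_to_face ::
    "(complex^'m \<Rightarrow> complex) \<Rightarrow> (real^'m) set \<Rightarrow> complex^'m \<Rightarrow> complex" where
  "restrict_to_face f \<Gamma> x = (\<Sum>a | lattice_point a \<in> \<Gamma>. taylor_coeff f a * monomial_Cn a x)"

definition restrict_matrix ::
    "nat \<Rightarrow> nat \<Rightarrow> (complex^'m \<Rightarrow> complex mat) \<Rightarrow> (nat \<Rightarrow> (real^'m) set) \<Rightarrow> complex^'m \<Rightarrow> complex mat"
  where
  "restrict_matrix n k A \<Gamma> x =
     mat n k (\<lambda>(i, j). restrict_to_face (\<lambda>y. A y $$ (i, j)) (\<Gamma> j) x)"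

definition complex_torus :: "(complex^'m) set" where
  "complex_torus = {x. \<forall>i. x $ i \<noteq> 0}"

text \<open>\<open>\<Delta> j\<close> is the common Newton polyhedron of the entries of the \<open>j\<close>-th column, and the sums of
  sets are Minkowski sums.  The library's \<^const>\<open>face_of\<close> also admits the empty set, which is not a
  face here.  As all \<open>\<Gamma> j\<close> are nonempty, boundedness of their sum makes each of them bounded.\<close>

definition newton_nondegenerate ::
    "nat \<Rightarrow> nat \<Rightarrow> nat \<Rightarrow> (nat \<Rightarrow> (real^'m) set) \<Rightarrow> (complex^'m \<Rightarrow> complex mat) \<Rightarrow> bool" where
  "newton_nondegenerate n k s \<Delta> A \<longleftrightarrow>
     (\<forall>\<Gamma>. (\<forall>j<k. \<Gamma> j face_of \<Delta> j \<and> \<Gamma> j \<noteq> {}) \<and>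
           (\<Sum>j<k. \<Gamma> j) face_of (\<Sum>j<k. \<Delta> j) \<and> bounded (\<Sum>j<k. \<Gamma> j) \<longrightarrow>
        det_locus n s (restrict_matrix n k A \<Gamma>) \<inter> complex_torus = {} \<or>
        (determinantal_variety n k s (restrict_matrix n k A \<Gamma>) complex_torus \<and>
         singular_set n k s (restrict_matrix n k A \<Gamma>) \<inter> complex_torus = {}))"


section \<open>Whitney conditions\<close>

text \<open>At a point of a submanifold the velocities of curves in it form its tangent space.\<close>

definition tangent_space :: "'a::real_normed_vector set \<Rightarrow> 'a \<Rightarrow> 'a set" where
  "tangent_space X p =
     {v. \<exists>\<gamma> :: real \<Rightarrow> 'a. \<gamma> 0 = p \<and> (\<forall>\<tau>. \<gamma> \<tau> \<in> X) \<and> (\<gamma> has_vector_derivative v) (at 0)}"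

text \<open>Convergence in the Grassmannian, identifying a subspace with the orthogonal projection onto
  it, which is \<^term>\<open>closest_point L\<close>.\<close>

definition subspaces_tendsto :: "(nat \<Rightarrow> 'a::euclidean_space set) \<Rightarrow> 'a set \<Rightarrow> bool" where
  "subspaces_tendsto L L0 \<longleftrightarrow> Real_Vector_Spaces.subspace L0 \<and>
     (\<forall>v. (\<lambda>i. closest_point (L i) v) \<longlonglongrightarrow> closest_point L0 v)"

definition whitney_a :: "'a::euclidean_space set \<Rightarrow> 'a set \<Rightarrow> bool" where
  "whitney_a X Y \<longleftrightarrow>
     (\<forall>x y L. (\<forall>i. x i \<in> X) \<and> y \<in> Y \<and> x \<longlonglongrightarrow> y \<and>
        subspaces_tendsto (\<lambda>i. tangent_space X (x i)) L \<longrightarrow> tangent_space Y y \<subseteq> L)"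

definition whitney_b :: "'a::euclidean_space set \<Rightarrow> 'a set \<Rightarrow> bool" where
  "whitney_b X Y \<longleftrightarrow>
     (\<forall>x y y0 L l. (\<forall>i. x i \<in> X \<and> y i \<in> Y \<and> x i \<noteq> y i) \<and> y0 \<in> Y \<and> x \<longlonglongrightarrow> y0 \<and> y \<longlonglongrightarrow> y0 \<and>
        subspaces_tendsto (\<lambda>i. tangent_space X (x i)) L \<and>
        subspaces_tendsto (\<lambda>i. Real_Vector_Spaces.span {x i - y i}) l \<longrightarrow> l \<subseteq> L)"

text \<open>The conditions are for pairs of submanifolds.  Secants are spanned over the reals; since the
  limits of tangent spaces of complex submanifolds are complex, complex secants give the same
  condition.\<close>

definition whitney_conditions :: "(complex^'m) set \<Rightarrow> (complex^'m) set \<Rightarrow> bool" where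
  "whitney_conditions X Y \<longleftrightarrow>
     (\<forall>p\<in>X. \<exists>d. submanifold_at X p d) \<and> (\<forall>p\<in>Y. \<exists>d. submanifold_at Y p d) \<and>
     whitney_a X Y \<and> whitney_b X Y"


section \<open>Families\<close>

text \<open>The product of \<^typ>\<open>complex^'m\<close> and the parameter line is \<^typ>\<open>complex^('m option)\<close>, with the
  parameter \<open>t\<close> as coordinate \<^const>\<open>None\<close>.\<close>

definition with_param :: "complex^'m \<Rightarrow> complex \<Rightarrow> complex^('m option)" where
  "with_param x t = (\<chi> i. case i of None \<Rightarrow> t | Some j \<Rightarrow> x $ j)"

definition family_member ::
    "(complex^('m option) \<Rightarrow> complex mat) \<Rightarrow> complex \<Rightarrow> complex^'m \<Rightarrow> complex mat" where
  "family_member F t x = F (with_param x t)"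

definition good_on ::
    "nat \<Rightarrow> nat \<Rightarrow> nat \<Rightarrow> (complex^('m::finite option) \<Rightarrow> complex mat) \<Rightarrow> real \<Rightarrow> complex set \<Rightarrow> bool" where
  "good_on n k s F \<epsilon> D \<longleftrightarrow>
     (\<forall>t\<in>D. singular_set n k s (family_member F t) \<inter> ball 0 \<epsilon> = {0})"

text \<open>A property of the germ of \<open>F\<close> at the origin, \<open>F\<close> being given on the neighbourhood \<open>W\<close>: it holds
  for the representatives on some product of a ball and a disc inside \<open>W\<close>, and then also with any
  smaller disc.\<close>

definition whitney_equisingular ::
    "nat \<Rightarrow> nat \<Rightarrow> nat \<Rightarrow> (complex^('m::finite option)) set \<Rightarrow> (complex^('m option) \<Rightarrow> complex mat) \<Rightarrow> bool"
  where
  "whitney_equisingular n k s W F \<longleftrightarrow>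
     (\<exists>\<epsilon>>0. \<exists>\<delta>>0.
        let B = {with_param x t | x t. x \<in> ball 0 \<epsilon> \<and> t \<in> ball 0 \<delta>};
            T = {with_param 0 t | t. t \<in> ball 0 \<delta>}
        in B \<subseteq> W \<and> good_on n k s F \<epsilon> (ball 0 \<delta>) \<and>
           whitney_conditions (det_locus n s F \<inter> B - T) T)"

end

theory Submission
  imports Defs "HOL-Complex_Analysis.Cauchy_Integral_Formula"
begin

text \<open>The theorem reduces to one asymptotic statement about conormal vectors.  Let points \<open>z = (x, t)\<close> of the
  total space with \<open>x ~= 0\<close> tend to a point of the parameter axis, let \<open>\<Phi>\<close> be a nonzero conormal vector of the
  rank stratification at the matrix \<open>F z\<close> and let \<open>\<eta> = (\<eta>_x, \<eta>_t)\<close> be its pull-back.  Then, after passing to a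
  subsequence, \<open>\<eta>_x ~= 0\<close>, the quotient of \<open>\<eta>_t\<close> by \<open>\<eta>\<close> tends to zero, and so does the quotient of the pairing of \<open>x\<close> with
  \<open>\<eta>_x\<close> by the product of the norms (lemma \<open>conormal_asymptotics\<close>).  The first assertion says that the members of
  the family have no singular points except the origin, and the other two are the Whitney conditions (a) and (b), since
  the pull-backs are exactly the functionals that vanish on the tangent space.

  No curve selection is used.  Along a sequence \<open>x \<rightarrow> 0\<close>, compactness of the logarithms of the monomials gives a positive
  weight \<open>w\<close>, a point \<open>y\<close> of the torus and a scaling factor for each column, such that every scaled monomial tends
  to its value at \<open>y\<close> if it lies on the face of minimal weight, and to zero otherwise (\<open>newton_limit\<close>).  Polyhedra that
  are convenient let finitely many monomials dominate all others; therefore the scaled entries converge to the face restrictions, the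
  logarithmic derivatives converge to those of the face restrictions, and the derivatives by the parameter stay bounded, because the
  supports of all members lie in the same polyhedra (\<open>entry_limits\<close>, \<open>face_limit\<close>).  Nondegeneracy at \<open>y\<close> then forces
  the normalised limit \<open>\<theta>\<close> of the products \<open>x_l \<eta>_l\<close> to be nonzero.  That controls \<open>\<eta>\<close> from below, and a homogeneity
  relation of Euler type for \<open>\<theta>\<close> gives the condition (b).

  The origin has to be a singular point of each member.  For \<open>s \<ge> 2\<close> all minors vanish there to the second order.  For
  \<open>s = 1\<close> this says that the linear parts of the entries are dependent.  That is known for the parameter zero, and dependence is not
  an open condition.  The polyhedra determine the supports of the linear parts, so independence for one parameter gives a counting
  condition of Hall type on these supports.  If the linear parts at the parameter zero were dependent, this
  condition would allow the construction of a curve along which all scaled entries tend to zero, while the face restrictions of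
  the columns of lowest order have dependent gradients, contrary to nondegeneracy (\<open>linear_parts_dependent\<close>).\<close>

section \<open>Partial derivatives in several complex variables\<close>

definition vupd :: "'a^'n => 'n => 'a => 'a^'n" where
 "vupd z i w = (\<chi> l. if l = i then w else z $ l)"

definition polydisc :: "real => (complex^'n) set" where
 "polydisc R = {z. \<forall>i. norm (z $ i) < R}"

text \<open>Continuous functions that are holomorphic in each variable: a class that is closed under partial
 derivatives by one-variable Cauchy theory.\<close>

definition sep_holo :: "real => (complex^'n => complex) => bool" where
 "sep_holo R f \<longleftrightarrow> continuous_on (polydisc R) f \<and>
   (\<forall>z\<in>polydisc R. \<forall>i. (%w. f (vupd z i w)) holomorphic_on ball 0 R)"

text \<open>A derivative of a function of one variable in the coordinate itself, so that one-variable theorems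
 apply literally.\<close>

definition pderivative :: "'n => (complex^'n => complex) => complex^'n => complex" where
 "pderivative i f z = deriv (%w. f (vupd z i w)) (z $ i)"

lemma vupd_nth: "vupd z i w $ l = (if l = i then w else z $ l)"
 by (simp add: vupd_def)

lemma vupd_vupd [simp]: "vupd (vupd z i v) i w = vupd z i w"
 by (simp add: Finite_Cartesian_Product.vec_eq_iff vupd_nth)

lemma vupd_same [simp]: "vupd z i (z $ i) = z"
 by (simp add: Finite_Cartesian_Product.vec_eq_iff vupd_nth)

lemma vupd_commute: "i ~= k ==> vupd (vupd z i v) k w = vupd (vupd z k w) i v"
 by (simp add: Finite_Cartesian_Product.vec_eq_iff vupd_nth)

lemma vupd_polydisc: "z \<in> polydisc R ==> norm w < R ==> vupd z i w \<in> polydisc R"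
 by (simp add: polydisc_def vupd_nth)

lemma polydisc_mono: "R \<le> R' ==> polydisc R \<subseteq> polydisc R'"
 by (auto simp: polydisc_def intro: less_le_trans)

lemma polydisc_eq_Inter: "polydisc R = (\<Inter>i. (%z. z $ i) -` ball 0 R)"
 by (auto simp: polydisc_def)

lemma open_polydisc: "open (polydisc R)"
 unfolding polydisc_eq_Inter
 by (intro open_INT ballI open_vimage) (auto intro!: continuous_intros)

lemma continuous_on_vupd [continuous_intros]:
 assumes "continuous_on S g" "continuous_on S h"
 shows "continuous_on S (%x. vupd (g x) i (h x))"
proof -
 have "continuous_on S (%x. if l = i then h x else g x $ l)" for l
  by (cases "l = i") (auto intro!: continuous_intros assms)
 then show ?thesis
  unfolding vupd_def by (intro continuous_on_vec_lambda) auto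
qed

lemma sep_holo_vupd:
 assumes "sep_holo R h" "norm w < R"
 shows "sep_holo R (%z. h (vupd z i w))"
proof -
 have "continuous_on (polydisc R) (%z. h (vupd z i w))"
  by (rule continuous_on_compose2[of "polydisc R" h])
    (use assms in \<open>auto simp: sep_holo_def vupd_polydisc intro!: continuous_intros\<close>)
 moreover have "(%v. h (vupd (vupd z k v) i w)) holomorphic_on ball 0 R"
  if "z \<in> polydisc R" for z k
 proof (cases "k = i")
  case False
  then show ?thesis
   using assms vupd_polydisc[OF that assms(2)] by (simp add: vupd_commute sep_holo_def)
 qed auto
 ultimately show ?thesis by (simp add: sep_holo_def)
qed

lemma pderivative_vupd: "pderivative i f (vupd z i w) = deriv (%v. f (vupd z i v)) w"
 by (simp add: pderivative_def vupd_nth)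

lemma sep_holo_has_deriv:
 assumes "sep_holo R f" "z \<in> polydisc R" "norm w < R"
 shows "((%v. f (vupd z i v)) has_field_derivative pderivative i f (vupd z i w)) (at w)"
 unfolding pderivative_vupd
 by (rule holomorphic_derivI[of _ "ball 0 R"]) (use assms in \<open>auto simp: sep_holo_def\<close>)

lemma norm_axis: "norm (axis i w :: 'a::real_normed_vector^'n) = norm w"
proof -
 have "(\<Sum>l\<in>UNIV. (norm ((axis i w :: 'a^'n) $ l))\<^sup>2) = (\<Sum>l\<in>UNIV. if l = i then (norm w)\<^sup>2 else 0)"
  by (rule sum.cong) (auto simp: axis_def)
 then show ?thesis by (simp add: norm_vec_def L2_set_def)
qed

lemma dist_vupd_shift:
 fixes z z' :: "complex^'n"
 shows
 "dist (vupd z i (z $ i + w)) (vupd z' i (z' $ i + w)) = dist z z'"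
proof -
 have "vupd z i (z $ i + w) - vupd z' i (z' $ i + w) = z - z'"
  by (auto simp: Finite_Cartesian_Product.vec_eq_iff vupd_nth)
 then show ?thesis by (simp add: dist_norm)
qed

text \<open>By Cauchy's inequality.\<close>

lemma continuous_on_pderivative:
 fixes f :: "complex^'n => complex"
 assumes f: "sep_holo R f"
 shows "continuous_on (polydisc R) (pderivative i f)"
 unfolding continuous_on_iff
proof (intro ballI allI impI)
 fix z :: "complex^'n" and e :: real
 assume z: "z \<in> polydisc R" and e: "0 < e"
 have "open (polydisc R :: (complex^'n) set)" by (rule open_polydisc)
 then obtain s where s: "s > 0" "cball z s \<subseteq> polydisc R"
  using z open_contains_cball by blast
 define r where "r = s / 2"
 have r: "r > 0" using s by (simp add: r_def)
 have "uniformly_continuous_on (cball z s) f"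
  by (rule compact_uniformly_continuous)
    (use f s in \<open>auto simp: sep_holo_def intro: continuous_on_subset\<close>)
 then obtain d where d: "d > 0" "\<And>x y. x \<in> cball z s ==> y \<in> cball z s ==> dist y x < d ==> dist (f y) (f x) < e * r / 2"
  using e r unfolding uniformly_continuous_on_def by (metis (no_types) half_gt_zero mult_pos_pos)
 have near: "vupd z' i (z' $ i + w) \<in> cball z s" if "dist z' z < r" "norm w \<le> r" for z' w
 proof -
  have "vupd z' i (z' $ i + w) = z' + axis i w"
   by (auto simp: Finite_Cartesian_Product.vec_eq_iff vupd_nth axis_def)
  then have "dist z' (vupd z' i (z' $ i + w)) = norm w"
   by (simp add: dist_norm norm_axis)
  then have "dist z (vupd z' i (z' $ i + w)) \<le> dist z z' + norm w"
   using dist_triangle[of z "vupd z' i (z' $ i + w)" z'] by simp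
  then show ?thesis using that by (auto simp: dist_commute r_def)
 qed
 have hol: "((%w. f (vupd z' i (z' $ i + w))) has_field_derivative pderivative i f (vupd z' i (z' $ i + w))) (at w)"
  if "dist z' z < r" "norm w \<le> r" for z' w
 proof -
  have in1: "vupd z' i (z' $ i + w) \<in> polydisc R" using near[OF that] s by blast
  have "norm (z' $ i + w) < R" using in1 unfolding polydisc_def mem_Collect_eq by (metis vupd_nth)
  moreover have "z' \<in> polydisc R" using near[of z' 0] that s r by auto
  ultimately have "((%v. f (vupd z' i v)) has_field_derivative pderivative i f (vupd z' i (z' $ i + w))) (at (z' $ i + w))"
   by (intro sep_holo_has_deriv[OF f])
  then show ?thesis
   using DERIV_shift[of "%v. f (vupd z' i v)" _ w "z' $ i"] unfolding add.commute[of _ "z' $ i"] by blast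
 qed
 show "\<exists>d>0. \<forall>x'\<in>polydisc R. dist x' z < d \<longrightarrow> dist (pderivative i f x') (pderivative i f z) < e"
 proof (intro exI[of _ "min d r"] conjI ballI impI)
  show "0 < min d r" using d r by simp
  fix z' assume z': "z' \<in> polydisc R" "dist z' z < min d r"
  define g where "g = (%w. f (vupd z' i (z' $ i + w)) - f (vupd z i (z $ i + w)))"
  have dg: "(g has_field_derivative (pderivative i f (vupd z' i (z' $ i + w)) - pderivative i f (vupd z i (z $ i + w)))) (at w)"
   if "norm w \<le> r" for w
   unfolding g_def by (intro DERIV_diff hol) (use z' r that in auto)
  have bd: "norm (g w) \<le> e * r / 2" if "norm w \<le> r" for w
   using d(2)[of "vupd z i (z $ i + w)" "vupd z' i (z' $ i + w)"] near[of z' w] near[of z w] z' r that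
   by (auto simp: g_def dist_norm[symmetric] dist_vupd_shift less_imp_le)
  have "norm ((deriv ^^ 1) g 0) \<le> fact 1 * (e * r / 2) / r ^ 1"
  proof (rule Cauchy_inequality)
   show "g holomorphic_on ball 0 r"
    unfolding holomorphic_on_open[OF open_ball] using dg by (meson less_imp_le mem_ball_0)
   show "continuous_on (cball 0 r) g"
    by (rule continuous_at_imp_continuous_on) (auto intro!: DERIV_isCont[OF dg])
   show "norm (g x) \<le> e * r / 2" if "norm (0 - x) = r" for x
    by (rule bd) (use that in auto)
  qed (use r in auto)
  moreover have "deriv g 0 = pderivative i f z' - pderivative i f z"
   using dg[of 0] r by (simp add: DERIV_imp_deriv)
  ultimately have "norm (pderivative i f z' - pderivative i f z) \<le> e / 2"
   using r by (simp add: field_simps)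
  then show "dist (pderivative i f z') (pderivative i f z) < e"
   using e by (simp add: dist_norm)
 qed
qed


text \<open>In a second variable the derivative is holomorphic because Cauchy's integral formula for it can
 be differentiated under the integral sign.\<close>

lemma sep_holo_pderivative:
 fixes f :: "complex^'n => complex"
 assumes f: "sep_holo R f"
 shows "sep_holo R (pderivative i f)"
 unfolding sep_holo_def
proof (intro conjI ballI allI)
 show "continuous_on (polydisc R) (pderivative i f)" by (rule continuous_on_pderivative[OF f])
 fix z :: "complex^'n" and k assume z: "z \<in> polydisc R"
 show "(%w. pderivative i f (vupd z k w)) holomorphic_on ball 0 R"
 proof (cases "k = i")
  case True
  have "deriv (%v. f (vupd z i v)) holomorphic_on ball 0 R"
   by (rule holomorphic_deriv) (use f z in \<open>auto simp: sep_holo_def\<close>)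
  then show ?thesis using True by (simp add: pderivative_vupd[abs_def])
 next
  case False
  define \<rho> where "\<rho> = (norm (z $ i) + R) / 2"
  have zi: "norm (z $ i) < R" using z by (simp add: polydisc_def)
  have \<rho>: "norm (z $ i) < \<rho>" "\<rho> < R" "0 < \<rho>"
   using zi le_less_trans[OF norm_ge_zero zi] by (simp_all add: \<rho>_def add_nonneg_pos)
  define c where "c = (%t. circlepath 0 \<rho> t)"
  have cn: "norm (c t) = \<rho>" for t
   using \<rho> by (simp add: c_def circlepath norm_mult)
  have ccont: "continuous_on UNIV c"
   unfolding c_def circlepath by (intro continuous_intros)
  have cne: "c t ~= z $ i" for t using cn[of t] \<rho> by auto
  define F where "F = (%w t. f (vupd (vupd z k w) i (c t)) / (c t - z $ i)\<^sup>2 * vector_derivative (circlepath 0 \<rho>) (at t))"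
  define dF where "dF = (%w t. pderivative k f (vupd (vupd z k w) i (c t)) / (c t - z $ i)\<^sup>2 * vector_derivative (circlepath 0 \<rho>) (at t))"
  have dom: "vupd (vupd z k w) i (c t) \<in> polydisc R" if "norm w < R" for w t
   using z that \<rho> cn by (intro vupd_polydisc) auto
  have vd: "continuous_on UNIV (%t. vector_derivative (circlepath 0 \<rho>) (at t))"
   by (simp add: vector_derivative_circlepath) (intro continuous_intros)
  have hol: "(%w. integral (cbox 0 1) (F w)) holomorphic_on ball 0 R"
  proof (rule leibniz_rule_holomorphic)
   fix w t assume w: "w \<in> ball (0::complex) R"
   have "((%v. f (vupd (vupd z i (c t)) k v)) has_field_derivative pderivative k f (vupd (vupd z i (c t)) k w)) (at w)"
    by (rule sep_holo_has_deriv[OF f]) (use w z \<rho> cn in \<open>auto intro: vupd_polydisc\<close>)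
   then have "((%v. f (vupd (vupd z k v) i (c t))) has_field_derivative pderivative k f (vupd (vupd z k w) i (c t))) (at w within ball 0 R)"
    using False by (simp add: vupd_commute[of k i] has_field_derivative_at_within)
   then show "((%w. F w t) has_field_derivative dF w t) (at w within ball 0 R)"
    unfolding F_def dF_def
    by (auto intro!: DERIV_cmult_right[of _ _ _ _ "vector_derivative (circlepath 0 \<rho>) (at t) / (c t - z $ i)\<^sup>2", simplified])
  next
   fix w assume "w \<in> ball (0::complex) R"
   have "continuous_on (cbox 0 1) (%t. f (vupd (vupd z k w) i (c t)))"
    by (rule continuous_on_compose2[of "polydisc R" f])
      (use f dom \<open>w \<in> _\<close> in \<open>auto simp: sep_holo_def intro!: continuous_intros continuous_on_subset[OF ccont]\<close>)
   then have "continuous_on (cbox 0 1) (F w)"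
    unfolding F_def
    by (intro continuous_intros continuous_on_subset[OF ccont] continuous_on_subset[OF vd]) (auto simp: cne)
   then show "F w integrable_on cbox 0 1" by (rule integrable_continuous)
  next
   have 1: "continuous_on (ball 0 R \<times> cbox 0 1) (%x. c (snd x))"
    by (rule continuous_on_compose2[OF ccont]) (auto intro!: continuous_intros)
   have 2: "continuous_on (ball 0 R \<times> cbox 0 1) (%x. vector_derivative (circlepath 0 \<rho>) (at (snd x)))"
    by (rule continuous_on_compose2[OF vd]) (auto intro!: continuous_intros)
   have "continuous_on (ball 0 R \<times> cbox 0 1) (%x. pderivative k f (vupd (vupd z k (fst x)) i (c (snd x))))"
    by (rule continuous_on_compose2[OF continuous_on_pderivative[OF f]])
      (use dom 1 in \<open>auto intro!: continuous_intros\<close>)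
   then show "continuous_on (ball 0 R \<times> cbox 0 1) (%(w, t). dF w t)"
    unfolding dF_def case_prod_unfold by (intro continuous_intros 1 2) (auto simp: cne)
  qed auto
  have eq: "pderivative i f (vupd z k w) = 1 / (2 * of_real pi * \<i>) * integral (cbox 0 1) (F w)"
   if w: "w \<in> ball 0 R" for w
  proof -
   have zk: "vupd z k w \<in> polydisc R" using z w by (auto intro: vupd_polydisc)
   have h: "(%v. f (vupd (vupd z k w) i v)) holomorphic_on ball 0 R"
    using f zk by (simp add: sep_holo_def)
   have "((%v. f (vupd (vupd z k w) i v)) has_field_derivative
     1 / (2 * complex_of_real pi * \<i>) *
      contour_integral (circlepath 0 \<rho>) (%u. f (vupd (vupd z k w) i u) / (u - z $ i)\<^sup>2)) (at (z $ i))"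
   proof (rule Cauchy_derivative_integral_circlepath(2))
    show "continuous_on (cball 0 \<rho>) (%v. f (vupd (vupd z k w) i v))"
     by (rule continuous_on_subset[OF holomorphic_on_imp_continuous_on[OF h]]) (use \<rho> in auto)
    show "(%v. f (vupd (vupd z k w) i v)) holomorphic_on ball 0 \<rho>"
     by (rule holomorphic_on_subset[OF h]) (use \<rho> in auto)
   qed (use \<rho> in auto)
   then have "pderivative i f (vupd z k w) = 1 / (2 * complex_of_real pi * \<i>) *
      contour_integral (circlepath 0 \<rho>) (%u. f (vupd (vupd z k w) i u) / (u - z $ i)\<^sup>2)"
    using False by (simp add: pderivative_def vupd_nth DERIV_imp_deriv)
   then show ?thesis
    by (simp add: contour_integral_integral F_def c_def)
  qed
  have "(%w. 1 / (2 * of_real pi * \<i>) * integral (cbox 0 1) (F w)) holomorphic_on ball 0 R"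
   by (intro holomorphic_intros hol)
  then show ?thesis by (rule holomorphic_transform) (simp add: eq)
 qed
qed

lemma sep_holo_higher_deriv:
 fixes f :: "complex^'n => complex"
 assumes "sep_holo R f" "0 < R"
 shows "sep_holo R (%z. (deriv ^^ n) (%w. f (vupd z i w)) 0)"
proof -
 have 1: "sep_holo R ((pderivative i ^^ n) f)" by (induction n) (auto simp: assms sep_holo_pderivative)
 have "(deriv ^^ n) (%w. f (vupd z i w)) = (%w. (pderivative i ^^ n) f (vupd z i w))" for z
  by (induction n) (auto simp: pderivative_vupd)
 then show ?thesis using sep_holo_vupd[OF 1, of 0 i] assms by simp
qed

section \<open>Power series on polydiscs\<close>

lemma summable_on_geometric_multi:
 fixes q :: "'n::finite => real"
 assumes q: "\<And>i. 0 \<le> q i" "\<And>i. q i < 1"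
 shows "(%b::nat^'n. \<Prod>i\<in>UNIV. q i ^ (b $ i)) summable_on UNIV"
proof (rule nonneg_bdd_above_summable_on)
 show "bdd_above (sum (%b::nat^'n. \<Prod>i\<in>UNIV. q i ^ (b $ i)) ` {F. F \<subseteq> UNIV \<and> finite F})"
 proof (rule bdd_aboveI2)
  fix F :: "(nat^'n) set" assume "F \<in> {F. F \<subseteq> UNIV \<and> finite F}"
  then have F: "finite F" by simp
  define N where "N = Max (insert 0 ((%(b, i). b $ i) ` (F \<times> UNIV)))"
  have N: "b $ i \<le> N" if "b \<in> F" for b i
   unfolding N_def by (rule Max_ge) (use F that in force)+
  have "(\<Sum>b\<in>F. \<Prod>i\<in>UNIV. q i ^ (b $ i)) = (\<Sum>g\<in>vec_nth ` F. \<Prod>i\<in>UNIV. q i ^ g i)"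
   by (subst sum.reindex) (auto simp: inj_on_def vec_nth_inject)
  also have "\<dots> \<le> (\<Sum>g\<in>PiE UNIV (%_. {..N}). \<Prod>i\<in>UNIV. q i ^ g i)"
   by (rule sum_mono2) (use N q in \<open>auto intro!: prod_nonneg finite_PiE\<close>)
  also have "\<dots> = (\<Prod>i\<in>UNIV. \<Sum>n\<le>N. q i ^ n)"
   by (rule prod_sum_PiE[symmetric]) auto
  also have "\<dots> \<le> (\<Prod>i\<in>UNIV. 1 / (1 - q i))"
  proof (rule prod_mono, intro conjI)
   fix i
   show "0 \<le> (\<Sum>n\<le>N. q i ^ n)" by (intro sum_nonneg) (simp add: q)
   have "(\<Sum>n\<le>N. q i ^ n) \<le> (\<Sum>n. q i ^ n)"
    by (rule sum_le_suminf) (use q in \<open>auto intro: summable_geometric\<close>)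
   then show "(\<Sum>n\<le>N. q i ^ n) \<le> 1 / (1 - q i)"
    using q by (simp add: suminf_geometric)
  qed
  finally show "(\<Sum>b\<in>F. \<Prod>i\<in>UNIV. q i ^ (b $ i)) \<le> (\<Prod>i\<in>UNIV. 1 / (1 - q i))" .
 qed
qed (use q in \<open>auto intro!: prod_nonneg\<close>)

lemma norm_monomial: "norm (monomial_Cn b z) = (\<Prod>i\<in>UNIV. norm (z $ i) ^ (b $ i))"
 by (simp add: monomial_Cn_def prod_norm[symmetric] norm_power)

text \<open>Absolute convergence, from the bounds that Cauchy's inequalities give.\<close>

lemma norm_power_series_term_le:
 fixes C :: "nat^'n::finite => complex"
 assumes "norm c \<le> M / r ^ (\<Sum>i\<in>UNIV. b $ i)"
 shows "norm (c * monomial_Cn b z) \<le> M * (\<Prod>i\<in>UNIV. (norm (z $ i) / r) ^ (b $ i))"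
proof -
 have "norm (c * monomial_Cn b z) \<le> M / r ^ (\<Sum>i\<in>UNIV. b $ i) * (\<Prod>i\<in>UNIV. norm (z $ i) ^ (b $ i))"
  unfolding norm_mult norm_monomial
  by (intro mult_right_mono assms prod_nonneg) auto
 also have "\<dots> = M * (\<Prod>i\<in>UNIV. (norm (z $ i) / r) ^ (b $ i))"
  by (simp add: power_divide prod_dividef power_sum)
 finally show ?thesis .
qed

lemma one_variable_expansion:
 fixes g :: "complex => complex"
 assumes g: "g holomorphic_on ball 0 R" "\<And>w. norm w < R ==> norm (g w) \<le> M"
  and r: "0 < r" "r < R"
 shows "norm ((deriv ^^ n) g 0 / fact n) \<le> M / r ^ n"
  and "norm w < r ==> ((%n. (deriv ^^ n) g 0 / fact n * w ^ n) has_sum g w) UNIV"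
proof -
 have bd: "norm ((deriv ^^ n) g 0 / fact n) \<le> M / r ^ n" for n
 proof -
  have "norm ((deriv ^^ n) g 0) \<le> fact n * M / r ^ n"
  proof (rule Cauchy_inequality)
   show "g holomorphic_on ball 0 r" by (rule holomorphic_on_subset[OF g(1)]) (use r in auto)
   show "continuous_on (cball 0 r) g"
    by (rule continuous_on_subset[OF holomorphic_on_imp_continuous_on[OF g(1)]]) (use r in auto)
  qed (use r g in auto)
  then show ?thesis by (simp add: norm_divide field_simps)
 qed
 show "norm ((deriv ^^ n) g 0 / fact n) \<le> M / r ^ n" by (rule bd)
 assume w: "norm w < r"
 have "summable (%n. norm ((deriv ^^ n) g 0 / fact n * w ^ n))"
 proof (rule summable_comparison_test')
  have "summable (%n. (norm w / r) ^ n)" using w r by (intro summable_geometric) auto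
  then show "summable (%n. M * (norm w / r) ^ n)" by (rule summable_mult)
  show "norm (norm ((deriv ^^ n) g 0 / fact n * w ^ n)) \<le> M * (norm w / r) ^ n" for n
   using mult_right_mono[OF bd[of n], of "norm w ^ n"] by (simp add: norm_mult norm_power norm_divide power_divide)
 qed
 moreover have "(%n. (deriv ^^ n) g 0 / fact n * w ^ n) sums g w"
  using holomorphic_power_series[OF g(1), of w] w r by simp
 ultimately show "((%n. (deriv ^^ n) g 0 / fact n * w ^ n) has_sum g w) UNIV"
  by (rule norm_summable_imp_has_sum)
qed

lemma monomial_vupd:
 "monomial_Cn (vupd b i n) (vupd z i w) = w ^ n * (\<Prod>l\<in>UNIV - {i}. (z $ l) ^ (b $ l))"
 unfolding monomial_Cn_def
 by (subst prod.remove[of _ i]) (auto simp: vupd_nth intro!: prod.cong)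

text \<open>Expansion one variable at a time: after the variables in \<open>S\<close> have been used, the coefficients
 are functions of the others.\<close>

lemma partial_power_series:
 fixes f :: "complex^'n::finite => complex"
 assumes f: "sep_holo R f" "\<And>z. z \<in> polydisc R ==> norm (f z) \<le> M"
  and r: "0 < r" "r < R"
  and S: "finite S"
 defines "ex \<equiv> %S. {b :: nat^'n. \<forall>i. i \<notin> S \<longrightarrow> b $ i = 0}"
 shows "\<exists>g. (\<forall>b\<in>ex S. sep_holo R (g b) \<and> (\<forall>z\<in>polydisc R. norm (g b z) \<le> M / r ^ (\<Sum>i\<in>UNIV. b $ i)) \<and>
   (\<forall>z z'. (\<forall>i. i \<notin> S \<longrightarrow> z $ i = z' $ i) \<longrightarrow> g b z = g b z')) \<and>
   (\<forall>z\<in>polydisc r. ((%b. g b z * monomial_Cn b z) has_sum f z) (ex S))"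
 using S
proof (induction S)
 case empty
 have "ex {} = {0}" by (auto simp: ex_def Finite_Cartesian_Product.vec_eq_iff)
 moreover have "z = z'" if "\<forall>i. z $ i = z' $ i" for z z' :: "complex^'n"
  using that by (simp add: Finite_Cartesian_Product.vec_eq_iff)
 ultimately show ?case
  using f by (intro exI[of _ "%_. f"]) (auto simp: monomial_Cn_def intro!: has_sum_finiteI)
next
 case (insert i S)
 obtain g where g0: "(\<forall>b\<in>ex S. sep_holo R (g b) \<and> (\<forall>z\<in>polydisc R. norm (g b z) \<le> M / r ^ (\<Sum>i\<in>UNIV. b $ i)) \<and>
   (\<forall>z z'. (\<forall>i. i \<notin> S \<longrightarrow> z $ i = z' $ i) \<longrightarrow> g b z = g b z')) \<and>
   (\<forall>z\<in>polydisc r. ((%b. g b z * monomial_Cn b z) has_sum f z) (ex S))"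
  using insert.IH by blast
 note g1 = g0[THEN conjunct1, rule_format]
 have g: "sep_holo R (g b)" "\<And>z. z \<in> polydisc R ==> norm (g b z) \<le> M / r ^ (\<Sum>i\<in>UNIV. b $ i)"
  if "b \<in> ex S" for b
  using g1[OF that, THEN conjunct1] g1[OF that, THEN conjunct2, THEN conjunct1] by blast+
 have gindep: "g b z = g b z'" if "b \<in> ex S" "\<And>i. i \<notin> S ==> z $ i = z' $ i" for b z z'
  by (rule g1[OF that(1), THEN conjunct2, THEN conjunct2, rule_format, OF that(2)])
 have gsum: "((%b. g b z * monomial_Cn b z) has_sum f z) (ex S)" if "z \<in> polydisc r" for z
  using g0[THEN conjunct2] that by blast
 have R: "0 < R" using r by simp
 define h where "h = (%b n z. (deriv ^^ n) (%w. g b (vupd z i w)) 0 / fact n)"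
 define g' where "g' = (%b. h (vupd b i 0) (b $ i))"
 have exS: "vupd b i 0 \<in> ex S" if "b \<in> ex (insert i S)" for b
  using that by (auto simp: ex_def vupd_nth)
 have h: "sep_holo R (h b n)" if "b \<in> ex S" for b n
  using sep_holo_higher_deriv[OF g(1)[OF that] R, of n i]
  unfolding h_def sep_holo_def by (auto intro!: continuous_intros holomorphic_intros)
 have one: "norm (h b n z) \<le> M / r ^ (\<Sum>l\<in>UNIV. b $ l) / r ^ n"
   "norm w < r ==> ((%n. h b n z * w ^ n) has_sum g b (vupd z i w)) UNIV"
  if "b \<in> ex S" "z \<in> polydisc R" for b n z w
 proof -
  have 1: "(%w. g b (vupd z i w)) holomorphic_on ball 0 R"
   using g(1)[OF that(1)] that(2) by (simp add: sep_holo_def)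
  have 2: "norm (g b (vupd z i w)) \<le> M / r ^ (\<Sum>l\<in>UNIV. b $ l)" if "norm w < R" for w
   by (rule g(2)) (use \<open>b \<in> ex S\<close> \<open>z \<in> _\<close> that in \<open>auto intro: vupd_polydisc\<close>)
  show "norm (h b n z) \<le> M / r ^ (\<Sum>l\<in>UNIV. b $ l) / r ^ n"
   unfolding h_def by (rule one_variable_expansion(1)[OF 1 2 r])
  show "norm w < r ==> ((%n. h b n z * w ^ n) has_sum g b (vupd z i w)) UNIV"
   unfolding h_def by (rule one_variable_expansion(2)[OF 1 2 r])
 qed
 have sumb: "(\<Sum>l\<in>UNIV. vupd b i 0 $ l) + b $ i = (\<Sum>l\<in>UNIV. b $ l)" for b :: "nat^'n"
 proof -
  have "(\<Sum>l\<in>UNIV. vupd b i 0 $ l) = (\<Sum>l\<in>UNIV - {i}. b $ l)"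
   by (subst sum.remove[of _ i]) (auto simp: vupd_nth intro!: sum.cong)
  then show ?thesis by (subst sum.remove[of _ i]) auto
 qed
 have g'bd: "norm (g' b z) \<le> M / r ^ (\<Sum>l\<in>UNIV. b $ l)" if "b \<in> ex (insert i S)" "z \<in> polydisc R" for b z
 proof -
  have "norm (g' b z) \<le> M / r ^ ((\<Sum>l\<in>UNIV. vupd b i 0 $ l) + b $ i)"
   using one(1)[OF exS[OF that(1)] that(2), of "b $ i"] by (simp add: g'_def power_add)
  then show ?thesis by (simp only: sumb)
 qed
 have g'sum: "((%b. g' b z * monomial_Cn b z) has_sum f z) (ex (insert i S))" if z: "z \<in> polydisc r" for z
 proof -
  have zR: "z \<in> polydisc R" using z polydisc_mono[of r R] r by auto
  have zi: "norm (z $ l) < r" for l using z by (simp add: polydisc_def)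
  have "(%b::nat^'n. M * (\<Prod>l\<in>UNIV. (norm (z $ l) / r) ^ (b $ l))) summable_on UNIV"
   by (intro summable_on_cmult_right summable_on_geometric_multi) (use zi r in auto)
  then have "(%b. M * (\<Prod>l\<in>UNIV. (norm (z $ l) / r) ^ (b $ l))) summable_on (ex (insert i S))"
   by (rule summable_on_subset_banach) auto
  then have "(%b. norm (g' b z * monomial_Cn b z)) summable_on (ex (insert i S))"
   by (rule Infinite_Sum.abs_summable_on_comparison_test'[where f = "%b. g' b z * monomial_Cn b z"])
     (intro norm_power_series_term_le g'bd zR)
  then have "(%b. g' b z * monomial_Cn b z) summable_on (ex (insert i S))"
   by (rule abs_summable_summable)
  then obtain s where s: "((%b. g' b z * monomial_Cn b z) has_sum s) (ex (insert i S))"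
   by (auto simp: summable_on_def)
  have bij: "bij_betw (%(b, n). vupd b i n) (ex S \<times> UNIV) (ex (insert i S))"
   unfolding bij_betw_def
  proof
   show "inj_on (%(b, n). vupd b i n) (ex S \<times> UNIV)"
    using insert.hyps by (auto simp: inj_on_def ex_def Finite_Cartesian_Product.vec_eq_iff vupd_nth split: if_splits)
   show "(%(b, n). vupd b i n) ` (ex S \<times> UNIV) = ex (insert i S)"
   proof (intro equalityI subsetI)
    fix b assume b: "b \<in> ex (insert i S)"
    have "b = (%(b, n). vupd b i n) (vupd b i 0, b $ i)" by simp
    then show "b \<in> (%(b, n). vupd b i n) ` (ex S \<times> UNIV)" using exS[OF b] by blast
   qed (auto simp: ex_def vupd_nth)
  qed
  have "((%p. g' (case p of (b, n) => vupd b i n) z * monomial_Cn (case p of (b, n) => vupd b i n) z) has_sum s) (ex S \<times> UNIV)"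
   using s has_sum_reindex_bij_betw[OF bij, of "%b. g' b z * monomial_Cn b z" s] by simp
  moreover have "((%n. g' (case (b, n) of (b, n) => vupd b i n) z * monomial_Cn (case (b, n) of (b, n) => vupd b i n) z)
    has_sum g b z * monomial_Cn b z) UNIV" if b: "b \<in> ex S" for b
  proof -
   have bi: "b $ i = 0" using b insert.hyps by (simp add: ex_def)
   have vb: "vupd b i 0 = b" using bi by (metis vupd_same)
   have "((%n. h b n z * (z $ i) ^ n * monomial_Cn b z) has_sum g b (vupd z i (z $ i)) * monomial_Cn b z) UNIV"
    by (intro has_sum_cmult_left one(2) b zR zi)
   moreover have "monomial_Cn (vupd b i n) z = (z $ i) ^ n * monomial_Cn b z" for n
    using monomial_vupd[of b i n z "z $ i"] monomial_vupd[of b i 0 z "z $ i"] by (simp add: vb)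
   ultimately show ?thesis by (simp add: g'_def vupd_nth vb mult.assoc)
  qed
  ultimately have "((%b. g b z * monomial_Cn b z) has_sum s) (ex S)"
   by (rule has_sum_SigmaD)
  with gsum[OF z] have "s = f z" by (metis has_sum_unique)
  then show ?thesis using s by simp
 qed
 show ?case
 proof (intro exI[of _ g'] conjI ballI allI impI)
  fix b assume b: "b \<in> ex (insert i S)"
  show "sep_holo R (g' b)" unfolding g'_def by (rule h[OF exS[OF b]])
  fix z z' :: "complex^'n" assume zz: "\<forall>l. l \<notin> insert i S \<longrightarrow> z $ l = z' $ l"
  have "(%w. g (vupd b i 0) (vupd z i w)) = (%w. g (vupd b i 0) (vupd z' i w))"
   by (rule ext, rule gindep[OF exS[OF b]]) (use zz in \<open>auto simp: vupd_nth\<close>)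
  then show "g' b z = g' b z'" by (simp only: g'_def h_def)
 next
  fix b and z :: "complex^'n" assume "b \<in> ex (insert i S)" "z \<in> polydisc R"
  then show "norm (g' b z) \<le> M / r ^ (\<Sum>i\<in>UNIV. b $ i)" by (rule g'bd)
 next
  fix z :: "complex^'n" assume "z \<in> polydisc r"
  then show "((%b. g' b z * monomial_Cn b z) has_sum f z) (ex (insert i S))" by (rule g'sum)
 qed
qed

lemma power_series_expansion:
 fixes f :: "complex^'n::finite => complex"
 assumes "sep_holo R f" "\<And>z. z \<in> polydisc R ==> norm (f z) \<le> M" "0 < r" "r < R"
 obtains C where "\<And>b. norm (C b) \<le> M / r ^ (\<Sum>i\<in>UNIV. b $ i)"
  "\<And>z. z \<in> polydisc r ==> ((%b. C b * monomial_Cn b z) has_sum f z) UNIV"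
proof -
 from partial_power_series[OF assms finite_class.finite_UNIV]
 obtain g where g0: "(\<forall>b\<in>{b::nat^'n. \<forall>i. i \<notin> UNIV \<longrightarrow> b $ i = 0}. sep_holo R (g b) \<and>
    (\<forall>z\<in>polydisc R. norm (g b z) \<le> M / r ^ (\<Sum>i\<in>UNIV. b $ i)) \<and>
    (\<forall>z z'. (\<forall>i. i \<notin> UNIV \<longrightarrow> z $ i = z' $ i) \<longrightarrow> g b z = g b z')) \<and>
   (\<forall>z\<in>polydisc r. ((%b. g b z * monomial_Cn b z) has_sum f z) {b::nat^'n. \<forall>i. i \<notin> UNIV \<longrightarrow> b $ i = 0})"
  by (rule exE)
 have UNIV_eq: "{b::nat^'n. \<forall>i. i \<notin> UNIV \<longrightarrow> b $ i = 0} = UNIV" by simp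
 note g1 = g0[unfolded UNIV_eq, THEN conjunct1, THEN bspec, OF UNIV_I]
 have g: "norm (g b z) \<le> M / r ^ (\<Sum>i\<in>UNIV. b $ i)" if "z \<in> polydisc R" for b z
  by (rule g1[THEN conjunct2, THEN conjunct1, rule_format, OF that])
 have gconst: "g b z = g b z'" for b z z'
  by (rule g1[THEN conjunct2, THEN conjunct2, rule_format]) simp
 have gsum: "((%b. g b z * monomial_Cn b z) has_sum f z) UNIV" if "z \<in> polydisc r" for z
  by (rule g0[unfolded UNIV_eq, THEN conjunct2, rule_format, OF that])
 show thesis
 proof (rule that[of "%b. g b 0"])
  show "norm (g b 0) \<le> M / r ^ (\<Sum>i\<in>UNIV. b $ i)" for b
   by (rule g) (use assms in \<open>simp add: polydisc_def\<close>)
  show "((%b. g b 0 * monomial_Cn b z) has_sum f z) UNIV" if "z \<in> polydisc r" for z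
   using gsum[OF that] unfolding gconst[of _ z 0] .
 qed
qed

section \<open>Termwise differentiation and Taylor coefficients\<close>

lemma holomorphic_Cn_derivative:
 fixes f :: "complex^'n::finite => complex"
 assumes "(f has_derivative f') (at z)" "\<And>c v. f' (c *s v) = c * f' v"
 shows "((%w. f (vupd z i w)) has_field_derivative f' (axis i 1)) (at (z $ i))"
  and "pderivative i f z = f' (axis i 1)"
  and "f' v = (\<Sum>i\<in>UNIV. pderivative i f z * v $ i)"
proof -
 have lin: "linear f'" by (rule has_derivative_linear[OF assms(1)])
 have "((%w. vupd z i w) has_derivative (%h. h *s axis i 1)) (at (z $ i))" for i
 proof -
  have ax: "h *s axis i 1 = axis i h" for h :: complex
   by (auto simp: Finite_Cartesian_Product.vec_eq_iff axis_def)
  have "bounded_linear (axis i :: complex => complex^'n)"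
   unfolding linear_conv_bounded_linear[symmetric]
   by (auto simp: linear_iff Finite_Cartesian_Product.vec_eq_iff axis_def)
  then have der: "((%w. vupd z i 0 + axis i w) has_derivative (%h. 0 + axis i h)) (at (z $ i))"
   by (intro has_derivative_add has_derivative_const bounded_linear_imp_has_derivative)
  have eqv: "vupd z i 0 + axis i w = vupd z i w" for w
   by (auto simp: Finite_Cartesian_Product.vec_eq_iff vupd_nth axis_def)
  show ?thesis using der unfolding ax eqv add_0_left .
 qed
 then have c: "((%w. f (vupd z i w)) has_derivative (%h. f' (h *s axis i 1))) (at (z $ i))" for i
  by (rule has_derivative_compose) (simp add: assms(1))
 have d: "((%w. f (vupd z i w)) has_field_derivative f' (axis i 1)) (at (z $ i))" for i
 proof -
  have "(%h. f' (h *s axis i 1)) = (*) (f' (axis i 1))"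
   by (rule ext) (simp only: assms(2) mult.commute)
  with c[of i] show ?thesis unfolding has_field_derivative_def by (rule back_subst)
 qed
 then show "((%w. f (vupd z i w)) has_field_derivative f' (axis i 1)) (at (z $ i))" .
 show p: "pderivative i f z = f' (axis i 1)" for i
  unfolding pderivative_def by (rule DERIV_imp_deriv[OF d])
 have "f' v = f' (\<Sum>i\<in>UNIV. v $ i *s axis i 1)" by (simp add: basis_expansion)
 also have "\<dots> = (\<Sum>i\<in>UNIV. v $ i * f' (axis i 1))" by (simp add: linear_sum[OF lin] assms(2))
 finally show "f' v = (\<Sum>i\<in>UNIV. pderivative i f z * v $ i)" by (simp add: p mult.commute)
qed

lemma holomorphic_Cn_on_has_derivative:
 assumes "holomorphic_Cn_on f U" "z \<in> U"
 shows "(f has_derivative (%v. \<Sum>i\<in>UNIV. pderivative i f z * v $ i)) (at z)"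
proof -
 obtain f' where f': "(f has_derivative f') (at z)" "\<And>c v. f' (c *s v) = c * f' v"
  using assms unfolding holomorphic_Cn_on_def by blast
 have "f' = (%v. \<Sum>i\<in>UNIV. pderivative i f z * v $ i)"
  by (rule ext) (rule holomorphic_Cn_derivative(3)[OF f'])
 then show ?thesis
  by (rule subst[where P = "%g. (f has_derivative g) (at z)"]) (rule f'(1))
qed

lemma holomorphic_Cn_onI:
 assumes "\<And>z. z \<in> U ==> \<exists>c. (f has_derivative (%v. \<Sum>i\<in>UNIV. c i * v $ i)) (at z)"
 shows "holomorphic_Cn_on f U"
 unfolding holomorphic_Cn_on_def
proof
 fix z assume "z \<in> U"
 then obtain c where "(f has_derivative (%v. \<Sum>i\<in>UNIV. c i * v $ i)) (at z)" using assms by blast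
 then show "\<exists>f'. (f has_derivative f') (at z) \<and> (\<forall>c v. f' (c *s v) = c * f' v)"
  by (intro exI[of _ "%v. \<Sum>i\<in>UNIV. c i * v $ i"]) (auto simp: sum_distrib_left mult_ac)
qed

lemma gradient_nth: "gradient f z $ i = pderivative i f z"
proof -
 have "vupd z i (z $ i + w) = z + w *s axis i 1" for w
  by (auto simp: Finite_Cartesian_Product.vec_eq_iff vupd_nth axis_def)
 then show ?thesis
  by (simp add: gradient_def pderivative_def deriv_shift_0[of _ "z $ i"] o_def)
qed

lemma pderivative_unique:
 assumes "(f has_derivative (%v. \<Sum>i\<in>UNIV. c i * v $ i)) (at z)"
 shows "pderivative i f z = c i"
proof -
 have "pderivative i f z = (\<Sum>l\<in>UNIV. c l * axis i 1 $ l)"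
  by (rule holomorphic_Cn_derivative(2)[OF assms]) (auto simp: sum_distrib_left mult_ac)
 also have "\<dots> = (\<Sum>l\<in>UNIV. if l = i then c l else 0)" by (rule sum.cong) (auto simp: axis_def)
 finally show ?thesis by simp
qed

lemma holomorphic_Cn_on_translate:
 assumes "holomorphic_Cn_on f U" "p + z \<in> U"
 shows "((%z. f (p + z)) has_derivative (%v. \<Sum>i\<in>UNIV. pderivative i f (p + z) * v $ i)) (at z)"
  and "pderivative i (%z. f (p + z)) z = pderivative i f (p + z)"
proof -
 have 1: "((%z. p + z) has_derivative (%v. v)) (at z)" by (auto intro!: derivative_eq_intros)
 show d: "((%z. f (p + z)) has_derivative (%v. \<Sum>i\<in>UNIV. pderivative i f (p + z) * v $ i)) (at z)"
  using has_derivative_compose[OF 1 holomorphic_Cn_on_has_derivative[OF assms]] .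
 show "pderivative i (%z. f (p + z)) z = pderivative i f (p + z)"
  by (rule pderivative_unique[OF d])
qed

lemma norm_le_polydisc: "z \<in> polydisc R ==> norm (z :: complex^'n::finite) \<le> CARD('n) * (R :: real)"
proof -
 assume "z \<in> polydisc R"
 then have "norm (z $ i) \<le> R" for i by (auto simp: polydisc_def less_imp_le)
 then have "(\<Sum>i\<in>UNIV. norm (z $ i)) \<le> CARD('n) * R" using sum_bounded_above[of UNIV "%i. norm (z $ i)" R] by simp
 moreover have "norm z \<le> (\<Sum>i\<in>UNIV. norm (z $ i))"
  by (simp add: norm_vec_def L2_set_le_sum)
 ultimately show ?thesis by linarith
qed

lemma polydisc_in_ball:
 assumes "0 < e"
 obtains R where "0 < R" "polydisc R \<subseteq> ball (0 :: complex^'n::finite) e"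
proof
 show "0 < e / (2 * CARD('n))" using assms by simp
 show "polydisc (e / (2 * CARD('n))) \<subseteq> ball (0 :: complex^'n) e"
 proof
  fix z :: "complex^'n" assume "z \<in> polydisc (e / (2 * CARD('n)))"
  from norm_le_polydisc[OF this] have "norm z \<le> CARD('n) * (e / (2 * CARD('n)))" .
  then show "z \<in> ball 0 e" using assms by simp
 qed
qed

text \<open>A function that is holomorphic near \<open>p\<close> is, after translation, of the kind that has been expanded
 into a power series.\<close>

lemma holomorphic_Cn_imp_sep_holo:
 fixes f :: "complex^'n::finite => complex"
 assumes "holomorphic_Cn_on f U" "open U" "p \<in> U"
 obtains R M where "0 < R" "0 \<le> M" "sep_holo R (%z. f (p + z))"
  "\<And>z. z \<in> polydisc R ==> norm (f (p + z)) \<le> M" "\<And>z. z \<in> polydisc R ==> p + z \<in> U"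
proof -
 obtain e where e: "0 < e" "cball p e \<subseteq> U" using assms open_contains_cball by blast
 obtain R where R: "0 < R" "polydisc R \<subseteq> ball (0 :: complex^'n) e" using polydisc_in_ball[OF e(1)] .
 have in_cb: "p + z \<in> cball p e" if "z \<in> polydisc R" for z using R that by (auto simp: dist_norm)
 have contf: "continuous_on U f"
  by (rule continuous_at_imp_continuous_on)
    (auto intro!: has_derivative_continuous holomorphic_Cn_on_has_derivative[OF assms(1)])
 have "compact (f ` cball p e)"
  by (rule compact_continuous_image[OF continuous_on_subset[OF contf e(2)]]) simp
 then obtain M where M: "\<And>z. z \<in> cball p e ==> norm (f z) \<le> M"
  by (meson bounded_iff compact_imp_bounded imageI)
 have "0 \<le> M" using M[of p] e by (meson centre_in_cball less_imp_le norm_ge_zero order_trans)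
 have "sep_holo R (%z. f (p + z))"
  unfolding sep_holo_def
 proof (intro conjI ballI allI)
  show "continuous_on (polydisc R) (%z. f (p + z))"
   by (rule continuous_on_compose2[OF contf]) (use in_cb e in \<open>auto intro!: continuous_intros\<close>)
  fix z :: "complex^'n" and i assume z: "z \<in> polydisc R"
  have "(%w. f (p + vupd z i w)) field_differentiable at w" if "w \<in> ball 0 R" for w
  proof -
   have "p + vupd z i w \<in> U" using in_cb[OF vupd_polydisc[OF z]] that e by auto
   then have "((%v. f (p + vupd (vupd z i w) i v)) has_field_derivative
     (\<Sum>l\<in>UNIV. pderivative l f (p + vupd z i w) * axis i 1 $ l)) (at (vupd z i w $ i))"
    by (intro holomorphic_Cn_derivative(1)[OF holomorphic_Cn_on_translate(1)[OF assms(1)]])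
      (auto simp: sum_distrib_left mult_ac)
   then show ?thesis by (auto simp: field_differentiable_def vupd_nth)
  qed
  then show "(%w. f (p + vupd z i w)) holomorphic_on ball 0 R"
   by (auto simp: holomorphic_on_def intro: field_differentiable_at_within)
 qed
 moreover have "p + z \<in> U" if "z \<in> polydisc R" for z using in_cb[OF that] e by auto
 ultimately show thesis using that R(1) \<open>0 \<le> M\<close> M in_cb by blast
qed

text \<open>Termwise differentiation.\<close>

lemma power_series_pderivative:
 fixes f :: "complex^'n::finite => complex"
 assumes C: "\<And>b. norm (C b) \<le> M / r ^ (\<Sum>i\<in>UNIV. b $ i)"
  and f: "\<And>z. z \<in> polydisc r ==> ((%b. C b * monomial_Cn b z) has_sum f z) UNIV"
  and z: "z \<in> polydisc r"
 shows "((%b. of_nat (b $ l) * C b * monomial_Cn (vupd b l (b $ l - 1)) z) has_sum pderivative l f z) UNIV"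
proof -
 have r: "0 < r" using z le_less_trans[OF norm_ge_zero, of "z $ l" r] by (simp add: polydisc_def)
 define \<rho> where "\<rho> = (r - norm (z $ l)) / 2"
 have \<rho>: "0 < \<rho>" using z by (simp add: \<rho>_def polydisc_def)
 have dom: "vupd z l w \<in> polydisc r" "norm w \<le> norm (z $ l) + \<rho>" if "w \<in> cball (z $ l) \<rho>" for w
 proof -
  have "norm w \<le> norm (z $ l) + \<rho>"
   using that norm_triangle_sub[of w "z $ l"] by (simp add: dist_norm norm_minus_commute)
  moreover have "norm (z $ l) + \<rho> < r" using \<rho> by (simp add: \<rho>_def field_simps)
  ultimately show "vupd z l w \<in> polydisc r" "norm w \<le> norm (z $ l) + \<rho>"
   by (auto intro!: vupd_polydisc z)
 qed
 define q where "q = (%i. if i = l then (norm (z $ l) + \<rho>) / r else norm (z $ i) / r)"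
 have q: "0 \<le> q i" "q i < 1" for i
  using z r \<rho> by (auto simp: q_def polydisc_def \<rho>_def field_simps)
 define P where "P = (%b::nat^'n. \<Prod>i\<in>UNIV - {l}. (z $ i) ^ (b $ i))"
 define t where "t = (%b w. C b * monomial_Cn b (vupd z l w))"
 define t' where "t' = (%b w. of_nat (b $ l) * w ^ (b $ l - 1) * (C b * P b))"
 have mono_eq: "monomial_Cn b (vupd z l w) = w ^ (b $ l) * P b" for b w
  using monomial_vupd[of b l "b $ l" z w] by (simp add: P_def)
 have t: "t b w = w ^ (b $ l) * (C b * P b)" for b w by (simp add: t_def mono_eq mult_ac)
 have der: "((%w. t b w) has_field_derivative t' b w) (at w)" for b w
  unfolding t t'_def by (auto intro!: derivative_eq_intros)
 have "uniform_limit (cball (z $ l) \<rho>) (%X w. \<Sum>b\<in>X. t b w) (%w. f (vupd z l w)) (finite_subsets_at_top UNIV)"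
 proof (rule Weierstrass_m_test_general')
  show "(%b::nat^'n. M * (\<Prod>i\<in>UNIV. q i ^ (b $ i))) summable_on UNIV"
   by (intro summable_on_cmult_right summable_on_geometric_multi q)
  fix w assume w: "w \<in> cball (z $ l) \<rho>"
  show "((%b. t b w) has_sum f (vupd z l w)) UNIV" unfolding t_def by (rule f[OF dom(1)[OF w]])
  fix b :: "nat^'n"
  have "norm (C b) \<ge> 0" by simp
  then have M: "0 \<le> M" using C[of 0] order_trans[OF norm_ge_zero C[of 0]] by simp
  have "norm (t b w) \<le> M * (\<Prod>i\<in>UNIV. (norm (vupd z l w $ i) / r) ^ (b $ i))"
   unfolding t_def by (rule norm_power_series_term_le[OF C])
  also have "\<dots> \<le> M * (\<Prod>i\<in>UNIV. q i ^ (b $ i))"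
   by (intro mult_left_mono prod_mono conjI power_mono)
     (use M r dom(2)[OF w] in \<open>auto simp: q_def vupd_nth divide_right_mono\<close>)
  finally show "norm (t b w) \<le> M * (\<Prod>i\<in>UNIV. q i ^ (b $ i))" .
 qed
 then obtain g' where g': "\<And>w. w \<in> ball (z $ l) \<rho> ==> ((%w. f (vupd z l w)) has_field_derivative g' w) (at w) \<and>
   ((%X. \<Sum>b\<in>X. t' b w) \<longlongrightarrow> g' w) (finite_subsets_at_top UNIV)"
 proof (rule has_complex_derivative_uniform_limit[rotated])
  show "\<forall>\<^sub>F X in finite_subsets_at_top UNIV. continuous_on (cball (z $ l) \<rho>) (%w. \<Sum>b\<in>X. t b w) \<and>
    (\<forall>w\<in>ball (z $ l) \<rho>. ((%w. \<Sum>b\<in>X. t b w) has_field_derivative (\<Sum>b\<in>X. t' b w)) (at w))"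
   by (intro always_eventually allI conjI ballI DERIV_sum der continuous_on_sum continuous_at_imp_continuous_on DERIV_isCont[OF der])
 qed (use \<rho> in auto)
 have "g' (z $ l) = pderivative l f z"
  unfolding pderivative_def using \<rho> by (intro DERIV_imp_deriv[symmetric] conjunct1[OF g']) simp
 then have "((%b. t' b (z $ l)) has_sum pderivative l f z) UNIV"
  using g'[of "z $ l"] \<rho> by (simp add: has_sum_def)
 moreover have "t' b (z $ l) = of_nat (b $ l) * C b * monomial_Cn (vupd b l (b $ l - 1)) z" for b
  using monomial_vupd[of b l "b $ l - 1" z "z $ l"] by (simp add: t'_def P_def mult_ac)
 ultimately show ?thesis by simp
qed

lemma power_series_zero_one:
 fixes a :: "nat => complex"
 assumes "0 < r" "\<And>w. norm w < r ==> ((%n. w ^ n * a n) has_sum 0) UNIV"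
 shows "a n = 0"
proof (rule ccontr)
 assume nz: "a n ~= 0"
 have s: "(%n. a n * (w - 0) ^ n) sums 0" if "norm (w - 0) < r" for w
  using has_sum_imp_sums[OF assms(2)[of w]] that by (simp add: mult.commute)
 show False
 proof (cases "n = 0")
  case True
  have "(%n. a n * 0 ^ n) sums a 0" by (rule powser_sums_zero)
  then show False using s[of 0] assms(1) nz True by (simp add: sums_unique2)
 next
  case False
  then obtain s' where "0 < s'" "\<And>z. z \<in> cball 0 s' - {0::complex} ==> (0::complex) ~= 0"
   using powser_0_nonzero[of r 0 a "%_. 0" n] s nz assms(1) by auto
  from this(2)[of "of_real s'"] this(1) show False by simp
 qed
qed

lemma power_series_unique:
 fixes C :: "nat^'n::finite => complex"
 assumes r: "0 < r" and C: "\<And>z. z \<in> polydisc r ==> ((%b. C b * monomial_Cn b z) has_sum 0) UNIV"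
 shows "C b = 0"
proof -
 have zero_on: "\<forall>b0. \<forall>z\<in>polydisc r. ((%b. C b * (\<Prod>i\<in>UNIV - S. (z $ i) ^ (b $ i))) has_sum 0) {b. \<forall>i\<in>S. b $ i = b0 $ i}"
  if "finite S" for S :: "'n set"
  using that
 proof (induction S)
  case empty
  then show ?case using C by (simp add: monomial_Cn_def)
 next
  case (insert i S)
  show ?case
  proof (intro allI ballI)
   fix b0 :: "nat^'n" and z :: "complex^'n" assume z: "z \<in> polydisc r"
   define B where "B = (%n. {b :: nat^'n. (\<forall>l\<in>S. b $ l = b0 $ l) \<and> b $ i = n})"
   define Q where "Q = (%b::nat^'n. C b * (\<Prod>l\<in>UNIV - insert i S. (z $ l) ^ (b $ l)))"
   have total: "((%(n, b). w ^ n * Q b) has_sum 0) (Sigma UNIV B)" if w: "norm w < r" for w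
   proof -
    have "((%b. C b * (\<Prod>l\<in>UNIV - S. (vupd z i w $ l) ^ (b $ l))) has_sum 0) {b. \<forall>l\<in>S. b $ l = b0 $ l}"
     using insert.IH vupd_polydisc[OF z w] by blast
    moreover have "(\<Prod>l\<in>UNIV - S. (vupd z i w $ l) ^ (b $ l)) = w ^ (b $ i) * (\<Prod>l\<in>UNIV - insert i S. (z $ l) ^ (b $ l))"
     for b :: "nat^'n"
    proof -
     have "UNIV - S - {i} = UNIV - insert i S" by auto
     then show ?thesis using insert.hyps
      by (subst prod.remove[of _ i]) (auto simp: vupd_nth intro!: prod.cong)
    qed
    ultimately have "((%b. w ^ (b $ i) * Q b) has_sum 0) {b. \<forall>l\<in>S. b $ l = b0 $ l}"
     by (simp add: Q_def mult_ac)
    moreover have "((%(n, b). w ^ n * Q b) has_sum 0) (Sigma UNIV B) \<longleftrightarrow>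
      ((%b. w ^ (b $ i) * Q b) has_sum 0) {b. \<forall>l\<in>S. b $ l = b0 $ l}"
     by (rule has_sum_reindex_bij_witness[where i = "%b. (b $ i, b)" and j = snd]) (auto simp: B_def)
    ultimately show ?thesis by simp
   qed
   have "\<exists>s. (Q has_sum s) (B n)" for n
   proof -
    define w where "w = (of_real (r / 2) :: complex)"
    have w: "norm w < r" "w ~= 0" using r by (auto simp: w_def)
    have "(%(n, b). w ^ n * Q b) summable_on (Sigma UNIV B)"
     using total[OF w(1)] by (auto simp: summable_on_def)
    then have "(%b. w ^ n * Q b) summable_on B n"
     using summable_on_SigmaD1[of "%n b. w ^ n * Q b" UNIV B n] by simp
    then have "(%b. inverse (w ^ n) * (w ^ n * Q b)) summable_on B n" by (rule summable_on_cmult_right)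
    then show ?thesis using w by (simp add: summable_on_def mult.assoc[symmetric])
   qed
   then obtain G where G: "\<And>n. (Q has_sum G n) (B n)" by metis
   have "((%n. w ^ n * G n) has_sum 0) UNIV" if "norm w < r" for w
    by (rule has_sum_SigmaD[OF total[OF that]]) (simp add: has_sum_cmult_right[OF G])
   then have "G (b0 $ i) = 0" by (rule power_series_zero_one[OF r])
   moreover have "B (b0 $ i) = {b. \<forall>l\<in>insert i S. b $ l = b0 $ l}" by (auto simp: B_def)
   ultimately show "((%b. C b * (\<Prod>l\<in>UNIV - insert i S. (z $ l) ^ (b $ l))) has_sum 0) {b. \<forall>l\<in>insert i S. b $ l = b0 $ l}"
    using G[of "b0 $ i"] by (simp add: Q_def)
  qed
 qed
 have "(0 :: complex^'n) \<in> polydisc r" using r by (simp add: polydisc_def)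
 from zero_on[OF finite_class.finite_UNIV, rule_format, OF this, of b]
 have "(C has_sum 0) {b'. \<forall>i. b' $ i = b $ i}" by simp
 also have "{b'. \<forall>i. b' $ i = b $ i} = {b}" by (auto simp: Finite_Cartesian_Product.vec_eq_iff)
 finally show ?thesis by (simp add: has_sum_finite_iff)
qed

lemma polydisc_nhds: "0 < r ==> \<forall>\<^sub>F z in nhds 0. z \<in> polydisc r"
 by (rule eventually_nhds_in_open[OF open_polydisc]) (simp add: polydisc_def)

lemma taylor_coeff_eqI:
 fixes C :: "nat^'n::finite => complex"
 assumes "0 < r" "\<And>z. z \<in> polydisc r ==> ((%b. C b * monomial_Cn b z) has_sum f z) UNIV"
 shows "taylor_coeff f = C"
 unfolding taylor_coeff_def
proof (rule the_equality)
 show "\<forall>\<^sub>F z in nhds 0. ((%b. C b * monomial_Cn b z) has_sum f z) UNIV"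
  using polydisc_nhds[OF assms(1)] by eventually_elim (rule assms(2))
 fix D :: "nat^'n => complex" assume "\<forall>\<^sub>F z in nhds 0. ((%b. D b * monomial_Cn b z) has_sum f z) UNIV"
 then obtain e where e: "e > 0" "\<And>z. dist z 0 < e ==> ((%b. D b * monomial_Cn b z) has_sum f z) UNIV"
  unfolding eventually_nhds_metric by blast
 obtain R where R: "0 < R" "polydisc R \<subseteq> ball (0 :: complex^'n) e" using polydisc_in_ball[OF e(1)] .
 have "D b - C b = 0" for b
 proof (rule power_series_unique[of "min r R"])
  fix z :: "complex^'n" assume "z \<in> polydisc (min r R)"
  then have "z \<in> polydisc r" "z \<in> polydisc R" by (auto simp: polydisc_def)
  then have D: "((%b. D b * monomial_Cn b z) has_sum f z) UNIV" and C: "((%b. C b * monomial_Cn b z) has_sum f z) UNIV"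
   using R by (auto intro!: e(2) assms(2) simp: dist_commute)
  have "((%b. D b * monomial_Cn b z + (- 1) * (C b * monomial_Cn b z)) has_sum (f z + (- 1) * f z)) UNIV"
   by (intro has_sum_add D has_sum_cmult_right C)
  then show "((%b. (D b - C b) * monomial_Cn b z) has_sum 0) UNIV" by (simp add: algebra_simps)
 qed (use assms R in auto)
 then show "D = C" by auto
qed

section \<open>Zero sets of functions with independent gradients\<close>

definition bilin :: "complex^'n => complex^'n => complex" where
 "bilin a u = (\<Sum>i\<in>UNIV. a $ i * u $ i)"

lemma bilin_simps [simp]:
 "bilin a (u + v) = bilin a u + bilin a v" "bilin a (u - v) = bilin a u - bilin a v"
 "bilin a (c *s u) = c * bilin a u" "bilin a 0 = 0" "bilin 0 u = 0"
 "bilin (a + b) u = bilin a u + bilin b u" "bilin (c *s a) u = c * bilin a u"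
 by (simp_all add: bilin_def algebra_simps sum.distrib sum_subtractf sum_distrib_left)

lemma bilin_sum: "bilin a (\<Sum>q\<in>Q. f q) = (\<Sum>q\<in>Q. bilin a (f q))"
 by (induction Q rule: infinite_finite_induct) simp_all

lemma bilin_sum_left: "bilin (\<Sum>q\<in>Q. f q) u = (\<Sum>q\<in>Q. bilin (f q) u)"
 by (induction Q rule: infinite_finite_induct) simp_all

lemma bilin_axis: "bilin a (axis i 1) = a $ i"
proof -
 have "bilin a (axis i 1) = (\<Sum>l\<in>UNIV. if l = i then a $ l else 0)"
  unfolding bilin_def by (rule sum.cong) (auto simp: axis_def)
 then show ?thesis by simp
qed

lemma bounded_linear_bilin: "bounded_linear (bilin a :: complex^'n::finite => complex)"
proof -
 have "r *\<^sub>R u = complex_of_real r *s u" for r and u :: "complex^'n"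
  by (simp add: Finite_Cartesian_Product.vec_eq_iff scaleR_conv_of_real[where 'a = complex])
 then show ?thesis
  unfolding linear_conv_bounded_linear[symmetric] by (simp add: linear_iff scaleR_conv_of_real[where 'a = complex])
qed

text \<open>Independent functionals on a finite-dimensional space are part of a dual basis.\<close>

lemma dual_vectors:
 fixes G :: "'q => complex^'n::finite"
 assumes Q: "finite Q" and indep: "\<And>c. (\<Sum>q\<in>Q. c q *s G q) = 0 ==> \<forall>q\<in>Q. c q = 0"
 obtains v where "\<And>q q'. q \<in> Q ==> q' \<in> Q ==> bilin (G q) (v q') = (if q = q' then 1 else 0)"
proof -
 have inj: "inj_on G Q"
 proof (rule inj_onI, rule ccontr)
  fix q q' assume q: "q \<in> Q" "q' \<in> Q" "G q = G q'" "q ~= q'"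
  have "(\<Sum>x\<in>Q. (if x = q then 1 else if x = q' then -1 else 0) *s G x)
    = (\<Sum>x\<in>Q. (if x = q then G q else 0) + (if x = q' then - G q' else 0))"
   using q(4) by (intro sum.cong) auto
  also have "\<dots> = 0" using q Q by (simp add: sum.distrib)
  finally have "\<forall>x\<in>Q. (if x = q then 1 else if x = q' then -1 else (0 :: complex)) = 0" by (rule indep)
  from bspec[OF this q(1)] show False by simp
 qed
 have ind: "vec.independent (G ` Q)"
 proof
  assume "vec.dependent (G ` Q)"
  then obtain u x where u: "x \<in> G ` Q" "u x ~= 0" "(\<Sum>v\<in>G ` Q. u v *s v) = 0"
   using vec.dependent_finite[of "G ` Q"] Q by auto
  then have "(\<Sum>q\<in>Q. u (G q) *s G q) = 0" by (simp add: sum.reindex[OF inj])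
  then show False using indep u by fastforce
 qed
 obtain i0 :: 'n where True by simp
 have "\<exists>v. \<forall>q\<in>Q. bilin (G q) v = (if q = q' then 1 else 0)" if q': "q' \<in> Q" for q'
 proof -
  obtain f :: "complex^'n => complex^'n" where f: "Vector_Spaces.linear (*s) (*s) f"
    "\<forall>x\<in>G ` Q. f x = (if x = G q' then axis i0 1 else 0)"
   using vec.linear_independent_extend[OF ind, of "%x. if x = G q' then axis i0 1 else 0"] by blast
  have fx: "f x $ i0 = bilin x (\<chi> i. f (axis i 1) $ i0)" for x
  proof -
   have "f x = f (\<Sum>i\<in>UNIV. x $ i *s axis i 1)" by (simp add: basis_expansion)
   also have "\<dots> = (\<Sum>i\<in>UNIV. x $ i *s f (axis i 1))"
    by (simp add: vec.linear_sum[OF f(1)] vec.linear_scale[OF f(1)])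
   finally show ?thesis by (simp add: bilin_def)
  qed
  show ?thesis
  proof (intro exI ballI)
   fix q assume q: "q \<in> Q"
   have "f (G q) = (if q = q' then axis i0 1 else 0)" using f(2) q q' inj by (auto simp: inj_on_eq_iff)
   then show "bilin (G q) (\<chi> i. f (axis i 1) $ i0) = (if q = q' then 1 else 0)"
    unfolding fx[symmetric] by (simp add: axis_def)
  qed
 qed
 then obtain v where "\<forall>q'\<in>Q. \<forall>q\<in>Q. bilin (G q) (v q') = (if q = q' then 1 else 0)" by metis
 then show thesis by (intro that[of v]) simp
qed

lemma holomorphic_Cn_derivative_gradient:
 assumes "holomorphic_Cn_on f U" "z \<in> U"
 shows "(f has_derivative bilin (gradient f z)) (at z)"
 using holomorphic_Cn_on_has_derivative[OF assms] by (simp add: bilin_def[abs_def] gradient_nth)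

lemma continuous_on_pderivative_Cn:
 fixes f :: "complex^'n::finite => complex"
 assumes f: "holomorphic_Cn_on f U" "open U"
 shows "continuous_on U (pderivative i f)"
proof (rule continuous_at_imp_continuous_on, rule ballI)
 fix p assume p: "p \<in> U"
 obtain R M where R: "0 < R" "sep_holo R (%z. f (p + z))" "\<And>z. z \<in> polydisc R ==> p + z \<in> U"
  using holomorphic_Cn_imp_sep_holo[OF f p] by metis
 have 0: "(0 :: complex^'n) \<in> polydisc R" using R by (simp add: polydisc_def)
 have "continuous_on (polydisc R) (%z. pderivative i f (p + z))"
  using continuous_on_pderivative[OF R(2)]
  by (rule continuous_on_eq) (simp add: holomorphic_Cn_on_translate(2)[OF f(1) R(3)])
 then have "isCont (%z. pderivative i f (p + z)) 0"
  using 0 by (simp add: continuous_on_eq_continuous_at[OF open_polydisc])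
 then show "isCont (pderivative i f) p"
  unfolding isCont_def by (subst LIM_offset_zero_iff) auto
qed

definition straighten :: "'q set => ('q => complex^'n => complex) => complex^'n => ('q => complex^'n) => complex^'n => complex^'n" where
 "straighten Q h p v z = z - p + (\<Sum>q\<in>Q. (h q z - bilin (gradient (h q) p) (z - p)) *s v q)"

text \<open>A common zero set of holomorphic functions \<open>h q\<close> with independent gradients is straightened by
 \<open>\<phi> z = z - p + (\<Sum>q\<in>Q. (h q z - bilin (gradient (h q) p) (z - p)) *s v q)\<close>, where the \<open>v q\<close> are dual
 to the gradients: its derivative at \<open>p\<close> is the identity, and the linear form given by the gradient of
 \<open>h q\<close> at \<open>p\<close> takes it to \<open>h q\<close>.\<close>

lemma straightening_chart:
 fixes h :: "'q => complex^'n::finite => complex"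
 assumes Q: "finite Q" and U: "open U" "p \<in> U"
  and h: "\<And>q. q \<in> Q ==> holomorphic_Cn_on (h q) U"
  and v: "\<And>q q'. q \<in> Q ==> q' \<in> Q ==> bilin (gradient (h q) p) (v q') = (if q = q' then 1 else 0)"
 defines "\<phi> \<equiv> straighten Q h p v"
 obtains U' V \<psi> where "open U'" "U' \<subseteq> U" "p \<in> U'" "open V" "\<phi> p \<in> V" "homeomorphism U' V \<phi> \<psi>"
  "\<And>i. holomorphic_Cn_on (%z. \<phi> z $ i) U'" "\<And>i. holomorphic_Cn_on (%w. \<psi> w $ i) V"
  "(\<psi> has_derivative (%u. u)) (at (\<phi> p))"
  "\<And>q z. q \<in> Q ==> bilin (gradient (h q) p) (\<phi> z) = h q z"
proof -
 define dphi where "dphi = (%z u. u + (\<Sum>q\<in>Q. (bilin (gradient (h q) z) u - bilin (gradient (h q) p) u) *s v q))"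
 have scale: "c *s (\<Sum>q\<in>Q. f q) = (\<Sum>q\<in>Q. c *s f q)" for c and f :: "'q => complex^'n"
  by (induction Q rule: infinite_finite_induct) (auto simp: vector_add_ldistrib)
 have blv: "bounded_linear (%c. c *s w)" for w :: "complex^'n"
  unfolding linear_conv_bounded_linear[symmetric]
  by (auto simp: linear_iff Finite_Cartesian_Product.vec_eq_iff algebra_simps)
 have bl: "bounded_linear (dphi z)" for z
  unfolding dphi_def
  by (intro bounded_linear_add bounded_linear_ident bounded_linear_sum
    bounded_linear_compose[OF blv] bounded_linear_sub bounded_linear_bilin)
 have Clin: "dphi z (c *s u) = c *s dphi z u" for z c u
  by (simp add: dphi_def scale vector_add_ldistrib right_diff_distrib[symmetric] vector_smult_assoc)
 have der: "(\<phi> has_derivative dphi z) (at z)" if z: "z \<in> U" for z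
 proof -
  have 1: "((%z. bilin (gradient (h q) p) (z - p)) has_derivative bilin (gradient (h q) p)) (at z)" for q
   by (rule has_derivative_eq_rhs, rule bounded_linear.has_derivative[OF bounded_linear_bilin])
     (auto intro!: derivative_eq_intros)
  have "((%z. (h q z - bilin (gradient (h q) p) (z - p)) *s v q) has_derivative
    (%u. (bilin (gradient (h q) z) u - bilin (gradient (h q) p) u) *s v q)) (at z)" if "q \<in> Q" for q
   by (rule bounded_linear.has_derivative[OF blv], rule has_derivative_diff[OF holomorphic_Cn_derivative_gradient 1])
     (use h that z in auto)
  then have "((%z. \<Sum>q\<in>Q. (h q z - bilin (gradient (h q) p) (z - p)) *s v q) has_derivative
    (%u. \<Sum>q\<in>Q. (bilin (gradient (h q) z) u - bilin (gradient (h q) p) u) *s v q)) (at z)"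
   by (rule has_derivative_sum)
  moreover have "((%z. z - p) has_derivative (%u. u)) (at z)" by (auto intro!: derivative_eq_intros)
  ultimately show ?thesis unfolding \<phi>_def straighten_def[abs_def] dphi_def by (rule has_derivative_add[rotated])
 qed
 have dphi_p: "dphi p = (%u. u)" by (simp add: dphi_def fun_eq_iff)
 have app: "blinfun_apply (Blinfun (dphi z)) = dphi z" for z
  by (rule bounded_linear_Blinfun_apply[OF bl])
 have cont: "continuous_on U (%z. Blinfun (dphi z))"
 proof (rule continuous_on_blinfun_componentwise)
  fix b :: "complex^'n"
  have cg: "continuous_on U (%z. bilin (gradient (h q) z) b)" if "q \<in> Q" for q
   unfolding bilin_def gradient_nth
   by (intro continuous_intros continuous_on_pderivative_Cn h that U)
  have "continuous_on U (%z. (bilin (gradient (h q) z) b - bilin (gradient (h q) p) b) *s v q)" if "q \<in> Q" for q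
   by (rule continuous_on_compose2[OF linear_continuous_on[OF blv, of UNIV]])
     (auto intro!: continuous_intros cg that)
  then show "continuous_on U (%z. blinfun_apply (Blinfun (dphi z)) b)"
   unfolding app unfolding dphi_def by (intro continuous_intros)
 qed
 obtain U' V \<psi> \<psi>' where UV: "open U'" "U' \<subseteq> U" "p \<in> U'" "open V" "\<phi> p \<in> V" "homeomorphism U' V \<phi> \<psi>"
  and d\<psi>: "\<And>y. y \<in> V ==> (\<psi> has_derivative (\<psi>' y)) (at y)"
  and \<psi>': "\<And>y. y \<in> V ==> \<psi>' y = inv_into UNIV (blinfun_apply (Blinfun (dphi (\<psi> y))))"
  and bij: "\<And>y. y \<in> V ==> bij (blinfun_apply (Blinfun (dphi (\<psi> y))))"
 proof (rule inverse_function_theorem[of U \<phi> "%z. Blinfun (dphi z)" p id_blinfun])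
  show "id_blinfun o\<^sub>L Blinfun (dphi p) = id_blinfun"
   using app[of p] by (intro blinfun_eqI) (simp add: dphi_p)
 qed (use U der cont in \<open>auto simp: app\<close>)
 have comp: "((%z. F z $ i) has_derivative (%u. F' u $ i)) (at z)" if "(F has_derivative F') (at z)"
  for F F' and z :: "complex^'n" and i :: 'n
  using bounded_linear.has_derivative[OF bounded_linear_vec_nth that] .
 have hol\<phi>: "holomorphic_Cn_on (%z. \<phi> z $ i) U'" for i
  unfolding holomorphic_Cn_on_def
 proof
  fix z assume "z \<in> U'"
  then have "((%z. \<phi> z $ i) has_derivative (%u. dphi z u $ i)) (at z)"
   using UV(2) by (intro comp der) auto
  then show "\<exists>f'. ((%z. \<phi> z $ i) has_derivative f') (at z) \<and> (\<forall>c v. f' (c *s v) = c * f' v)"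
   by (intro exI[of _ "%u. dphi z u $ i"]) (simp add: Clin)
 qed
 have hol\<psi>: "holomorphic_Cn_on (%w. \<psi> w $ i) V" for i
  unfolding holomorphic_Cn_on_def
 proof
  fix y assume y: "y \<in> V"
  have b: "bij (dphi (\<psi> y))" using bij[OF y] by (simp add: app)
  have "\<psi>' y (c *s u) = c *s \<psi>' y u" for c u
  proof -
   have "dphi (\<psi> y) (c *s \<psi>' y u) = c *s u"
    using b by (simp add: Clin \<psi>'[OF y] app bij_is_surj surj_f_inv_f)
   then show ?thesis using b by (metis \<psi>'[OF y] app bij_inv_eq_iff)
  qed
  then show "\<exists>f'. ((%w. \<psi> w $ i) has_derivative f') (at y) \<and> (\<forall>c v. f' (c *s v) = c * f' v)"
   by (intro exI[of _ "%u. \<psi>' y u $ i"]) (simp add: comp[OF d\<psi>[OF y]])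
 qed
 have "\<psi> (\<phi> p) = p" using UV(3,6) by (simp add: homeomorphism_apply1)
 then have "\<psi>' (\<phi> p) = inv_into UNIV (%u. u)" using \<psi>'[OF UV(5)] app[of p] by (simp add: dphi_p)
 then have "\<psi>' (\<phi> p) = (%u. u)" using inv_f_f[of "%u::complex^'n. u"] by (simp add: fun_eq_iff)
 then have \<psi>_id: "(\<psi> has_derivative (%u. u)) (at (\<phi> p))" using d\<psi>[OF UV(5)] by simp
 have bil: "bilin (gradient (h q) p) (\<phi> z) = h q z" if q: "q \<in> Q" for q z
 proof -
  have "bilin (gradient (h q) p) (\<phi> z) = bilin (gradient (h q) p) (z - p) +
    (\<Sum>q'\<in>Q. (h q' z - bilin (gradient (h q') p) (z - p)) * bilin (gradient (h q) p) (v q'))"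
   by (simp only: \<phi>_def straighten_def bilin_simps(1,3) bilin_sum)
  also have "(\<Sum>q'\<in>Q. (h q' z - bilin (gradient (h q') p) (z - p)) * bilin (gradient (h q) p) (v q'))
    = (\<Sum>q'\<in>Q. if q' = q then h q' z - bilin (gradient (h q') p) (z - p) else 0)"
   by (rule sum.cong) (use v q in auto)
  finally show ?thesis using q Q by simp
 qed
 show thesis by (rule that[of U' V \<psi>]) (fact UV hol\<phi> hol\<psi> \<psi>_id bil)+
qed

text \<open>In the straightening chart the zero set is the common kernel of the gradients.\<close>

lemma regular_zero_set:
 fixes h :: "'q => complex^'n::finite => complex"
 assumes Q: "finite Q" and U: "open U" "p \<in> U"
  and h: "\<And>q. q \<in> Q ==> holomorphic_Cn_on (h q) U"
  and X: "\<And>z. z \<in> U ==> z \<in> X \<longleftrightarrow> (\<forall>q\<in>Q. h q z = 0)" and p: "p \<in> X"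
  and indep: "\<And>c. (\<Sum>q\<in>Q. c q *s gradient (h q) p) = 0 ==> \<forall>q\<in>Q. c q = 0"
 shows "\<exists>d. submanifold_at X p d"
  and "tangent_space X p = {u. \<forall>q\<in>Q. bilin (gradient (h q) p) u = 0}"
proof -
 obtain v where v: "\<And>q q'. q \<in> Q ==> q' \<in> Q ==> bilin (gradient (h q) p) (v q') = (if q = q' then 1 else 0)"
  using dual_vectors[where G = "%q. gradient (h q) p", OF Q indep] by blast
 let ?\<phi> = "straighten Q h p v"
 define L where "L = {u. \<forall>q\<in>Q. bilin (gradient (h q) p) u = 0}"
 have h0: "h q p = 0" if "q \<in> Q" for q using X[OF U(2)] p that by blast
 then have \<phi>p: "?\<phi> p = 0" by (simp add: straighten_def)
 obtain U' V \<psi> where UV: "open U'" "U' \<subseteq> U" "p \<in> U'" "open V" "?\<phi> p \<in> V" "homeomorphism U' V ?\<phi> \<psi>"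
  "\<And>i. holomorphic_Cn_on (%z. ?\<phi> z $ i) U'" "\<And>i. holomorphic_Cn_on (%w. \<psi> w $ i) V"
  "(\<psi> has_derivative (%u. u)) (at (?\<phi> p))"
  and bil: "\<And>q z. q \<in> Q ==> bilin (gradient (h q) p) (?\<phi> z) = h q z"
  by (rule straightening_chart[OF Q U h v]) (assumption | rule that)+
 have XL: "z \<in> X \<longleftrightarrow> ?\<phi> z \<in> L" if "z \<in> U'" for z
  using X[of z] that UV(2) bil by (auto simp: L_def)
 have sub: "vec.subspace L" by (auto simp: vec.subspace_def L_def)
 have ret: "\<psi> w \<in> U'" "?\<phi> (\<psi> w) = w" if "w \<in> V" for w
  using homeomorphism_image2[OF UV(6)] homeomorphism_apply2[OF UV(6) that] that by blast+
 have img: "?\<phi> ` (X \<inter> U') = L \<inter> V"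
 proof (intro equalityI subsetI)
  fix w assume w: "w \<in> L \<inter> V"
  then have "\<psi> w \<in> X \<inter> U'" using XL[OF ret(1)] ret by simp
  then show "w \<in> ?\<phi> ` (X \<inter> U')" using ret(2) w by (metis IntD2 imageI)
 next
  fix w assume "w \<in> ?\<phi> ` (X \<inter> U')"
  then show "w \<in> L \<inter> V" using homeomorphism_image1[OF UV(6)] XL by blast
 qed
 show "\<exists>d. submanifold_at X p d"
  unfolding submanifold_at_def
  by (rule exI[of _ "vec.dim L"], rule conjI[OF p], rule exI[of _ U'], rule exI[of _ V],
    rule exI[of _ "?\<phi>"], rule exI[of _ \<psi>], rule exI[of _ L]) (intro conjI allI UV img sub refl)
 show "tangent_space X p = {u. \<forall>q\<in>Q. bilin (gradient (h q) p) u = 0}"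
  unfolding L_def[symmetric]
 proof (intro equalityI subsetI)
  fix u assume "u \<in> tangent_space X p"
  then have "\<exists>\<gamma> :: real => complex^'n. \<gamma> 0 = p \<and> (\<forall>\<tau>. \<gamma> \<tau> \<in> X) \<and> (\<gamma> has_vector_derivative u) (at 0)"
   unfolding tangent_space_def by (rule CollectD)
  then obtain \<gamma> :: "real => complex^'n" where \<gamma>: "\<gamma> 0 = p" "\<And>\<tau>. \<gamma> \<tau> \<in> X" "(\<gamma> has_vector_derivative u) (at 0)"
   by blast
  have "isCont \<gamma> 0" using \<gamma>(3) by (rule has_vector_derivative_continuous)
  then have "(\<gamma> \<longlongrightarrow> \<gamma> 0) (nhds 0)" by (simp only: isCont_def tendsto_at_iff_tendsto_nhds)
  then have "(\<gamma> \<longlongrightarrow> p) (nhds 0)" by (simp only: \<gamma>(1))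
  then have ev: "\<forall>\<^sub>F \<tau> in nhds 0. \<gamma> \<tau> \<in> U"
   by (rule topological_tendstoD) (rule U)+
  have "bilin (gradient (h q) p) u = 0" if q: "q \<in> Q" for q
  proof -
   have "((%\<tau>. h q (\<gamma> \<tau>)) has_derivative (%s. bilin (gradient (h q) p) (s *\<^sub>R u))) (at 0)"
    using \<gamma>(3) holomorphic_Cn_derivative_gradient[OF h[OF q] U(2)]
    unfolding has_vector_derivative_def \<gamma>(1)[symmetric]
    by (rule has_derivative_compose)
   moreover have "((%\<tau>. h q (\<gamma> \<tau>)) has_derivative (%s. 0)) (at 0)"
   proof (rule has_derivative_transform_eventually[OF has_derivative_const])
    show "\<forall>\<^sub>F \<tau> in at 0. 0 = h q (\<gamma> \<tau>)"
     using ev X \<gamma>(2) q by (auto simp: eventually_at_filter elim!: eventually_mono)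
    show "0 = h q (\<gamma> 0)" using h0[OF q] \<gamma>(1) by simp
   qed auto
   ultimately have "(%s. bilin (gradient (h q) p) (s *\<^sub>R u)) = (%s. 0)"
    by (rule has_derivative_unique)
   from fun_cong[OF this, of 1] show ?thesis by simp
  qed
  then show "u \<in> L" by (simp add: L_def)
 next
  fix u assume u: "u \<in> L"
  obtain e where e: "e > 0" "ball 0 e \<subseteq> V" using UV(4,5) \<phi>p open_contains_ball by metis
  define w where "w = (%\<tau>::real. if norm (\<tau> *\<^sub>R u) < e then \<tau> *\<^sub>R u else 0)"
  have "r *\<^sub>R x = complex_of_real r *s x" for r and x :: "complex^'n"
   by (simp add: Finite_Cartesian_Product.vec_eq_iff scaleR_conv_of_real[where 'a = complex])
  then have "\<tau> *\<^sub>R u \<in> L" for \<tau> using sub u by (simp add: vec.subspace_scale)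
  then have w: "w \<tau> \<in> L \<inter> V" for \<tau>
   using e sub vec.subspace_0[OF sub] UV(5) \<phi>p by (auto simp: w_def subset_iff)
  have inX: "\<psi> (w \<tau>) \<in> X" for \<tau>
   using XL[OF ret(1)] ret(2) w[of \<tau>] by simp
  have "\<psi> (w 0) = p" using UV(3,6) \<phi>p e by (metis homeomorphism_apply1 scaleR_zero_left w_def)
  moreover have "((%\<tau>. \<psi> (w \<tau>)) has_vector_derivative u) (at 0)"
   unfolding has_vector_derivative_def
  proof (rule has_derivative_transform_eventually)
   have "((%\<tau>::real. \<tau> *\<^sub>R u) has_derivative (%s. s *\<^sub>R u)) (at 0)" by (auto intro!: derivative_eq_intros)
   moreover have "(\<psi> has_derivative (%u. u)) (at (0 *\<^sub>R u))" using UV(9) \<phi>p by simp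
   ultimately show "((%\<tau>. \<psi> (\<tau> *\<^sub>R u)) has_derivative (%s. s *\<^sub>R u)) (at 0)"
    by (rule has_derivative_compose)
   have "((%\<tau>::real. norm (\<tau> *\<^sub>R u)) \<longlongrightarrow> norm (0 *\<^sub>R u)) (at 0)" by (intro tendsto_intros)
   then have "\<forall>\<^sub>F \<tau> in at (0::real). norm (\<tau> *\<^sub>R u) < e" using e by (intro order_tendstoD) auto
   then show "\<forall>\<^sub>F \<tau> in at 0. \<psi> (\<tau> *\<^sub>R u) = \<psi> (w \<tau>)" by eventually_elim (simp add: w_def)
  qed (use e in \<open>auto simp: w_def\<close>)
  ultimately show "u \<in> tangent_space X p"
   unfolding tangent_space_def using inX by (intro CollectI exI[of _ "%\<tau>. \<psi> (w \<tau>)"]) auto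
 qed
qed

section \<open>Minors and matrices of low rank\<close>

definition minor :: "nat set => nat set => (nat => nat => complex) => complex" where
 "minor I J M = Determinant.det (Matrix.mat (card I) (card J) (%(a, b). M (pick I a) (pick J b)))"

definition minor_cofactor :: "nat set => nat set => (nat => nat => complex) => nat => nat => complex" where
 "minor_cofactor I J M i j = (\<Sum>p | p permutes {0..<card I}. of_int (sign p) *
   (\<Sum>a\<in>{0..<card I}. (if pick I a = i \<and> pick J (p a) = j then 1 else 0) *
    (\<Prod>a'\<in>{0..<card I} - {a}. M (pick I a') (pick J (p a')))))"

text \<open>Rank at most \<open>r\<close> as a factorisation, for matrices given as functions; this form is
 stable under limits and row and column operations without reference to a matrix type.\<close>

definition low_rank :: "nat => nat => nat => (nat => nat => complex) => bool" where
 "low_rank r n k M \<longleftrightarrow> (\<exists>(L :: nat set) u v. finite L \<and> card L \<le> r \<and>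
   (\<forall>i<n. \<forall>j<k. M i j = (\<Sum>l\<in>L. u l i * v l j)))"

lemma bij_betw_pick:
 assumes "finite I"
 shows "bij_betw (pick I) {0..<card I} I"
proof (rule bij_betwI')
 show "pick I x = pick I y \<longleftrightarrow> x = y" if "x \<in> {0..<card I}" "y \<in> {0..<card I}" for x y
  using that pick_mono_le[of x I y] pick_mono_le[of y I x] by (metis atLeastLessThan_iff less_irrefl linorder_neqE_nat)
 show "pick I x \<in> I" if "x \<in> {0..<card I}" for x using that by (simp add: pick_in_set_le)
 show "\<exists>x\<in>{0..<card I}. y = pick I x" if y: "y \<in> I" for y
 proof (intro bexI)
  show "y = pick I (card {a \<in> I. a < y})" using pick_card_in_set[OF y] by simp
  have "{a \<in> I. a < y} \<subset> I" using y by auto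
  then show "card {a \<in> I. a < y} \<in> {0..<card I}" by (simp add: assms psubset_card_mono)
 qed
qed

lemma minor_cong:
 assumes "finite I" "finite J" "\<And>i j. i \<in> I ==> j \<in> J ==> M i j = M' i j"
 shows "minor I J M = minor I J M'"
proof -
 have "Matrix.mat (card I) (card J) (%(a, b). M (pick I a) (pick J b)) = Matrix.mat (card I) (card J) (%(a, b). M' (pick I a) (pick J b))"
  by (rule eq_matI) (auto simp: pick_in_set_le intro!: assms)
 then show ?thesis by (simp add: minor_def)
qed

lemma det_submatrix_eq_minor:
 assumes "A \<in> carrier_mat n k" "I \<subseteq> {..<n}" "J \<subseteq> {..<k}"
 shows "Determinant.det (submatrix A I J) = minor I J (%i j. A $$ (i, j))"
proof -
 have "{i. i < n \<and> i \<in> I} = I" "{j. j < k \<and> j \<in> J} = J" using assms by auto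
 then show ?thesis using assms by (simp add: submatrix_def minor_def)
qed

lemma minor_expand:
 assumes "card I = card J"
 shows "minor I J M = (\<Sum>p | p permutes {0..<card I}. of_int (sign p) *
   (\<Prod>a\<in>{0..<card I}. M (pick I a) (pick J (p a))))"
proof -
 have "Matrix.mat (card I) (card J) (%(a, b). M (pick I a) (pick J b)) \<in> carrier_mat (card I) (card I)"
  using assms by simp
 then have "minor I J M = (\<Sum>p | p permutes {0..<card I}. of_int (sign p) *
   (\<Prod>a = 0..<card I. Matrix.mat (card I) (card J) (%(a, b). M (pick I a) (pick J b)) $$ (a, p a)))"
  unfolding minor_def by (rule det_def')
 also have "\<dots> = (\<Sum>p | p permutes {0..<card I}. of_int (sign p) *
   (\<Prod>a\<in>{0..<card I}. M (pick I a) (pick J (p a))))"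
  using assms by (intro sum.cong refl arg_cong2[where f = "(*)"] prod.cong)
   (auto dest: permutes_in_image[THEN iffD2])
 finally show ?thesis .
qed

lemma has_derivative_minor:
 fixes Mx :: "'a::real_normed_vector => nat => nat => complex"
 assumes fin: "finite I" "finite J" and card: "card I = card J"
  and D: "\<And>i j. i \<in> I ==> j \<in> J ==> ((%x. Mx x i j) has_derivative D i j) (at x0)"
 shows "((%x. minor I J (Mx x)) has_derivative (%v. \<Sum>i\<in>I. \<Sum>j\<in>J. minor_cofactor I J (Mx x0) i j * D i j v)) (at x0)"
proof -
 define P where "P = (%p a. \<Prod>a'\<in>{0..<card I} - {a}. Mx x0 (pick I a') (pick J (p a')))"
 have inI: "pick I a \<in> I" if "a \<in> {0..<card I}" for a using that by (simp add: pick_in_set_le)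
 have inJ: "pick J (p a) \<in> J" if "p permutes {0..<card I}" "a \<in> {0..<card I}" for p a
  using that card permutes_in_image[OF that(1), of a] by (simp add: pick_in_set_le)
 have "((%x. \<Sum>p | p permutes {0..<card I}. of_int (sign p) * (\<Prod>a\<in>{0..<card I}. Mx x (pick I a) (pick J (p a))))
   has_derivative (%v. \<Sum>p | p permutes {0..<card I}. of_int (sign p) * (\<Sum>a\<in>{0..<card I}. D (pick I a) (pick J (p a)) v * P p a))) (at x0)"
  unfolding P_def by (intro has_derivative_sum has_derivative_mult_right has_derivative_prod D inI inJ) auto
 moreover have "(\<Sum>p | p permutes {0..<card I}. of_int (sign p) * (\<Sum>a\<in>{0..<card I}. D (pick I a) (pick J (p a)) v * P p a))
   = (\<Sum>i\<in>I. \<Sum>j\<in>J. minor_cofactor I J (Mx x0) i j * D i j v)" for v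
 proof -
  have pt: "D (pick I a) (pick J (p a)) v = (\<Sum>i\<in>I. \<Sum>j\<in>J. (if pick I a = i \<and> pick J (p a) = j then 1 else 0) * D i j v)"
   if "p permutes {0..<card I}" "a \<in> {0..<card I}" for p a
  proof -
   have "(\<Sum>i\<in>I. \<Sum>j\<in>J. (if pick I a = i \<and> pick J (p a) = j then 1 else 0) * D i j v)
     = (\<Sum>i\<in>I. if pick I a = i then (\<Sum>j\<in>J. if pick J (p a) = j then D i j v else 0) else 0)"
    by (intro sum.cong refl) (auto intro!: sum.cong)
   then show ?thesis using inI[OF that(2)] inJ[OF that] fin by simp
  qed
  have "(\<Sum>p | p permutes {0..<card I}. of_int (sign p) * (\<Sum>a\<in>{0..<card I}. D (pick I a) (pick J (p a)) v * P p a))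
   = (\<Sum>p | p permutes {0..<card I}. of_int (sign p) * (\<Sum>a\<in>{0..<card I}.
     (\<Sum>i\<in>I. \<Sum>j\<in>J. (if pick I a = i \<and> pick J (p a) = j then 1 else 0) * D i j v) * P p a))"
   by (intro sum.cong refl arg_cong2[where f = "(*)"] pt) auto
  also have "\<dots> = (\<Sum>p | p permutes {0..<card I}. \<Sum>a\<in>{0..<card I}. \<Sum>i\<in>I. \<Sum>j\<in>J.
     of_int (sign p) * ((if pick I a = i \<and> pick J (p a) = j then 1 else 0) * P p a) * D i j v)"
   by (simp add: sum_distrib_left sum_distrib_right mult_ac)
  also have "\<dots> = (\<Sum>p | p permutes {0..<card I}. \<Sum>i\<in>I. \<Sum>j\<in>J. \<Sum>a\<in>{0..<card I}.
     of_int (sign p) * ((if pick I a = i \<and> pick J (p a) = j then 1 else 0) * P p a) * D i j v)"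
   by (rule sum.cong[OF refl]) (subst sum.swap, rule sum.cong[OF refl], rule sum.swap)
  also have "\<dots> = (\<Sum>i\<in>I. \<Sum>j\<in>J. \<Sum>p | p permutes {0..<card I}. \<Sum>a\<in>{0..<card I}.
     of_int (sign p) * ((if pick I a = i \<and> pick J (p a) = j then 1 else 0) * P p a) * D i j v)"
   by (subst sum.swap, rule sum.cong[OF refl], rule sum.swap)
  also have "\<dots> = (\<Sum>i\<in>I. \<Sum>j\<in>J. minor_cofactor I J (Mx x0) i j * D i j v)"
   by (intro sum.cong refl) (simp add: minor_cofactor_def P_def sum_distrib_left sum_distrib_right)
  finally show ?thesis .
 qed
 ultimately show ?thesis by (simp add: minor_expand[OF card])
qed

lemma minor_eq_0_iff:
 assumes fin: "finite I" "finite J" and card: "card I = card J"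
 shows "minor I J M = 0 \<longleftrightarrow> (\<exists>c. (\<exists>j\<in>J. c j ~= 0) \<and> (\<forall>i\<in>I. (\<Sum>j\<in>J. M i j * c j) = 0))"
proof -
 let ?s = "card I"
 define A where "A = Matrix.mat ?s (card J) (%(a, b). M (pick I a) (pick J b))"
 have A: "A \<in> carrier_mat ?s ?s" using card by (simp add: A_def)
 have bI: "bij_betw (pick I) {0..<?s} I" and bJ: "bij_betw (pick J) {0..<?s} J"
  using bij_betw_pick fin card by metis+
 have Av: "vec_index (A *\<^sub>v v) a = (\<Sum>j\<in>J. M (pick I a) j * vec_index v (the_inv_into {0..<?s} (pick J) j))"
  if "v \<in> carrier_vec ?s" "a < ?s" for v a
 proof -
  have "vec_index (A *\<^sub>v v) a = (\<Sum>b\<in>{0..<?s}. M (pick I a) (pick J b) * vec_index v b)"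
   using that A card by (simp add: scalar_prod_def A_def)
  also have "\<dots> = (\<Sum>b\<in>{0..<?s}. M (pick I a) (pick J b) * vec_index v (the_inv_into {0..<?s} (pick J) (pick J b)))"
   using bJ by (intro sum.cong refl) (simp add: bij_betw_def the_inv_into_f_f)
  finally show ?thesis by (simp add: sum.reindex_bij_betw[OF bJ, of "%j. M (pick I a) j * vec_index v (the_inv_into {0..<?s} (pick J) j)"])
 qed
 have "minor I J M = 0 \<longleftrightarrow> (\<exists>v. v \<in> carrier_vec ?s \<and> v ~= 0\<^sub>v ?s \<and> A *\<^sub>v v = 0\<^sub>v ?s)"
  unfolding minor_def A_def[symmetric] by (rule det_0_iff_vec_prod_zero_field[OF A])
 also have "\<dots> \<longleftrightarrow> (\<exists>c. (\<exists>j\<in>J. c j ~= 0) \<and> (\<forall>i\<in>I. (\<Sum>j\<in>J. M i j * c j) = 0))"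
 proof
  assume "\<exists>v. v \<in> carrier_vec ?s \<and> v ~= 0\<^sub>v ?s \<and> A *\<^sub>v v = 0\<^sub>v ?s"
  then obtain v where v: "v \<in> carrier_vec ?s" "v ~= 0\<^sub>v ?s" "A *\<^sub>v v = 0\<^sub>v ?s" by blast
  obtain b where b: "b < ?s" "vec_index v b ~= 0"
   using v(1,2) by (metis carrier_vecD eq_vecI index_zero_vec)
  show "\<exists>c. (\<exists>j\<in>J. c j ~= 0) \<and> (\<forall>i\<in>I. (\<Sum>j\<in>J. M i j * c j) = 0)"
  proof (intro exI conjI ballI)
   show "\<exists>j\<in>J. vec_index v (the_inv_into {0..<?s} (pick J) j) ~= 0"
    using b bJ by (intro bexI[of _ "pick J b"]) (auto simp: bij_betw_def the_inv_into_f_f)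
   fix i assume "i \<in> I"
   then have "i \<in> pick I ` {0..<?s}" using bij_betw_imp_surj_on[OF bI] by simp
   then obtain a where a: "a < ?s" "i = pick I a" by auto
   then show "(\<Sum>j\<in>J. M i j * vec_index v (the_inv_into {0..<?s} (pick J) j)) = 0"
    using Av[OF v(1) a(1)] v(3) by simp
  qed
 next
  assume "\<exists>c. (\<exists>j\<in>J. c j ~= 0) \<and> (\<forall>i\<in>I. (\<Sum>j\<in>J. M i j * c j) = 0)"
  then obtain c j0 where c: "j0 \<in> J" "c j0 ~= 0" "\<And>i. i \<in> I ==> (\<Sum>j\<in>J. M i j * c j) = 0" by blast
  define v where "v = Matrix.vec ?s (%b. c (pick J b))"
  have v: "v \<in> carrier_vec ?s" by (simp add: v_def)
  have "j0 \<in> pick J ` {0..<?s}" using bij_betw_imp_surj_on[OF bJ] c(1) by simp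
  then obtain b0 where b0: "b0 < ?s" "j0 = pick J b0" by auto
  have "v ~= 0\<^sub>v ?s"
  proof
   assume "v = 0\<^sub>v ?s"
   then have "vec_index v b0 = 0" using b0 by simp
   then show False using b0 c by (simp add: v_def)
  qed
  moreover have "A *\<^sub>v v = 0\<^sub>v ?s"
  proof (rule eq_vecI)
   fix a assume "a < dim_vec (0\<^sub>v ?s :: complex Matrix.vec)"
   then have a: "a < ?s" by simp
   have "(\<Sum>j\<in>J. M (pick I a) j * vec_index v (the_inv_into {0..<?s} (pick J) j)) = (\<Sum>j\<in>J. M (pick I a) j * c j)"
   proof (rule sum.cong[OF refl])
    fix j assume "j \<in> J"
    then have "j \<in> pick J ` {0..<?s}" using bij_betw_imp_surj_on[OF bJ] by simp
    then obtain b where "b < ?s" "j = pick J b" by auto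
    then show "M (pick I a) j * vec_index v (the_inv_into {0..<?s} (pick J) j) = M (pick I a) j * c j"
     using bJ by (simp add: v_def bij_betw_def the_inv_into_f_f)
   qed
   also have "\<dots> = 0" using c(3) a by (simp add: pick_in_set_le)
   finally show "vec_index (A *\<^sub>v v) a = vec_index (0\<^sub>v ?s) a" using Av[OF v a] a by simp
  qed (use A in simp)
  ultimately show "\<exists>v. v \<in> carrier_vec ?s \<and> v ~= 0\<^sub>v ?s \<and> A *\<^sub>v v = 0\<^sub>v ?s" using v by blast
 qed
 finally show ?thesis .
qed

lemma minor_inverse:
 assumes fin: "finite I" "finite J" and card: "card I = card J" and nz: "minor I J M ~= 0"
 obtains N where "\<And>i i'. i \<in> I ==> i' \<in> I ==> (\<Sum>j\<in>J. M i j * N j i') = (if i = i' then 1 else 0)"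
  "\<And>j j'. j \<in> J ==> j' \<in> J ==> (\<Sum>i\<in>I. N j i * M i j') = (if j = j' then 1 else 0)"
proof -
 let ?s = "card I"
 define A where "A = Matrix.mat ?s (card J) (%(a, b). M (pick I a) (pick J b))"
 have A: "A \<in> carrier_mat ?s ?s" using card by (simp add: A_def)
 define d where "d = Determinant.det A"
 have d: "d ~= 0" using nz by (simp add: d_def A_def minor_def)
 define B where "B = adj_mat A"
 have B: "B \<in> carrier_mat ?s ?s" "A * B = d \<cdot>\<^sub>m 1\<^sub>m ?s" "B * A = d \<cdot>\<^sub>m 1\<^sub>m ?s"
  using adj_mat[OF A] by (auto simp: B_def d_def)
 have bI: "bij_betw (pick I) {0..<?s} I" and bJ: "bij_betw (pick J) {0..<?s} J"
  using bij_betw_pick fin card by metis+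
 define iI where "iI = the_inv_into {0..<?s} (pick I)"
 define iJ where "iJ = the_inv_into {0..<?s} (pick J)"
 have iI: "iI (pick I a) = a" and iJ: "iJ (pick J a) = a" if "a \<in> {0..<?s}" for a
  using bI bJ that by (simp_all add: iI_def iJ_def bij_betw_def the_inv_into_f_f)
 define N where "N = (%j i. B $$ (iJ j, iI i) / d)"
 show thesis
 proof (rule that[of N])
  fix i i' assume "i \<in> I" "i' \<in> I"
  then have "i \<in> pick I ` {0..<?s}" "i' \<in> pick I ` {0..<?s}" using bij_betw_imp_surj_on[OF bI] by auto
  then obtain a a' where a: "a < ?s" "i = pick I a" "a' < ?s" "i' = pick I a'" by auto
  have "(\<Sum>j\<in>J. M i j * N j i') = (\<Sum>b\<in>{0..<?s}. M i (pick J b) * N (pick J b) i')"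
   by (rule sum.reindex_bij_betw[OF bJ, symmetric])
  also have "\<dots> = (\<Sum>b\<in>{0..<?s}. A $$ (a, b) * B $$ (b, a')) / d"
   unfolding sum_divide_distrib
   using a card by (intro sum.cong refl) (simp add: N_def A_def iI iJ)
  also have "(\<Sum>b\<in>{0..<?s}. A $$ (a, b) * B $$ (b, a')) = (A * B) $$ (a, a')"
   using a A B(1) by (simp add: scalar_prod_def)
  also have "\<dots> / d = (if a = a' then 1 else 0)" using a d by (simp add: B(2))
  also have "\<dots> = (if i = i' then 1 else 0)" using a bI by (auto simp: bij_betw_def inj_on_def)
  finally show "(\<Sum>j\<in>J. M i j * N j i') = (if i = i' then 1 else 0)" .
 next
  fix j j' assume "j \<in> J" "j' \<in> J"
  then have "j \<in> pick J ` {0..<?s}" "j' \<in> pick J ` {0..<?s}" using bij_betw_imp_surj_on[OF bJ] by auto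
  then obtain b b' where b: "b < ?s" "j = pick J b" "b' < ?s" "j' = pick J b'" by auto
  have "(\<Sum>i\<in>I. N j i * M i j') = (\<Sum>a\<in>{0..<?s}. N j (pick I a) * M (pick I a) j')"
   by (rule sum.reindex_bij_betw[OF bI, symmetric])
  also have "\<dots> = (\<Sum>a\<in>{0..<?s}. B $$ (b, a) * A $$ (a, b')) / d"
   unfolding sum_divide_distrib
   using b card by (intro sum.cong refl) (simp add: N_def A_def iI iJ)
  also have "(\<Sum>a\<in>{0..<?s}. B $$ (b, a) * A $$ (a, b')) = (B * A) $$ (b, b')"
   using b A B(1) by (simp add: scalar_prod_def)
  also have "\<dots> / d = (if b = b' then 1 else 0)" using b d by (simp add: B(3))
  also have "\<dots> = (if j = j' then 1 else 0)" using b bJ by (auto simp: bij_betw_def inj_on_def)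
  finally show "(\<Sum>i\<in>I. N j i * M i j') = (if j = j' then 1 else 0)" .
 qed
qed

lemma low_rank_imp_rank_le:
 assumes "low_rank r n k M"
 shows "vec_space.rank n (Matrix.mat n k (%(i, j). M i j)) \<le> r"
proof -
 obtain L :: "nat set" and u v where L: "finite L" "card L \<le> r"
  "\<And>i j. i < n ==> j < k ==> M i j = (\<Sum>l\<in>L. u l i * v l j)"
  using assms by (auto simp: low_rank_def)
 have "vec_space.rank n (Matrix.mat n k (%(i, j). \<Sum>l\<in>L. u l i * v l j)) \<le> card L"
  using L(1)
 proof (induction L)
  case empty
  have "Matrix.mat n k (%(i, j). \<Sum>l\<in>{}. u l i * v l j) = 0\<^sub>m n k" by (rule eq_matI) auto
  then show ?case by (simp only: vec_space.rank_0I card.empty order_refl)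
 next
  case (insert l L)
  let ?A = "Matrix.mat n k (%(i, j). u l i * v l j)"
  let ?B = "Matrix.mat n k (%(i, j). \<Sum>l\<in>L. u l i * v l j)"
  have "Matrix.mat n k (%(i, j). \<Sum>l\<in>insert l L. u l i * v l j) = ?A + ?B"
   using insert by (intro eq_matI) auto
  moreover have "vec_space.rank n (?A + ?B) \<le> vec_space.rank n ?A + vec_space.rank n ?B"
   by (rule vec_space.rank_subadditive) auto
  moreover have "vec_space.rank n ?A \<le> 1"
   by (rule vec_space.rank_le_1_product_entries[where f = "u l" and g = "v l" and nc = k]) auto
  ultimately show ?case using insert by simp
 qed
 moreover have "Matrix.mat n k (%(i, j). \<Sum>l\<in>L. u l i * v l j) = Matrix.mat n k (%(i, j). M i j)"
  using L(3) by (intro eq_matI) auto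
 ultimately show ?thesis using L(2) by simp
qed

lemma rank_less_imp_minor_zero:
 assumes "A \<in> carrier_mat n k" "vec_space.rank n A < card J" "I \<subseteq> {..<n}" "J \<subseteq> {..<k}"
 shows "minor I J (%i j. A $$ (i, j)) = 0"
proof (rule ccontr)
 assume "minor I J (%i j. A $$ (i, j)) ~= 0"
 then have "card {j. j < k \<and> j \<in> J} \<le> vec_space.rank n A"
  using det_submatrix_eq_minor[OF assms(1,3,4)] by (intro vec_space.rank_gt_minor[OF assms(1), of I J]) simp
 moreover have "{j. j < k \<and> j \<in> J} = J" using assms by auto
 ultimately show False using assms(2) by simp
qed

lemma low_rank_imp_minor_zero:
 assumes "low_rank r n k M" "r < card J" "I \<subseteq> {..<n}" "J \<subseteq> {..<k}"
 shows "minor I J M = 0"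
proof -
 have "minor I J (%i j. Matrix.mat n k (%(i, j). M i j) $$ (i, j)) = 0"
  by (rule rank_less_imp_minor_zero[of _ n k]) (use low_rank_imp_rank_le[OF assms(1)] assms in auto)
 also have "minor I J (%i j. Matrix.mat n k (%(i, j). M i j) $$ (i, j)) = minor I J M"
  using assms(3,4) finite_subset[OF assms(3)] finite_subset[OF assms(4)] by (intro minor_cong) (auto simp: subset_eq)
 finally show ?thesis .
qed

text \<open>If \<open>M\<close> is invertible on \<open>I0 \<times> J0\<close> and all minors bordering \<open>I0 \<times> J0\<close> vanish, then the columns
 in \<open>J0\<close> span all columns.\<close>

lemma bordered_minors_zero_imp_low_rank:
 assumes I0: "I0 \<subseteq> {..<n}" and J0: "J0 \<subseteq> {..<k}" and card: "card I0 = card J0" and nz: "minor I0 J0 M ~= 0"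
  and bord: "\<And>i j. i < n ==> i \<notin> I0 ==> j < k ==> j \<notin> J0 ==> minor (insert i I0) (insert j J0) M = 0"
 shows "low_rank (card I0) n k M"
proof -
 have fin: "finite I0" "finite J0" using I0 J0 by (auto intro: finite_subset)
 obtain N where N: "\<And>i i'. i \<in> I0 ==> i' \<in> I0 ==> (\<Sum>j\<in>J0. M i j * N j i') = (if i = i' then 1 else 0)"
  "\<And>j j'. j \<in> J0 ==> j' \<in> J0 ==> (\<Sum>i\<in>I0. N j i * M i j') = (if j = j' then 1 else 0)"
  using minor_inverse[OF fin card nz] by blast
 define c where "c = (%j' j. \<Sum>i'\<in>I0. N j' i' * M i' j)"
 have onI0: "M i j = (\<Sum>j'\<in>J0. M i j' * c j' j)" if "i \<in> I0" for i j
 proof -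
  have "(\<Sum>j'\<in>J0. M i j' * c j' j) = (\<Sum>i'\<in>I0. (\<Sum>j'\<in>J0. M i j' * N j' i') * M i' j)"
   unfolding c_def by (subst sum.swap[of _ I0 J0, symmetric] | simp add: sum_distrib_left sum_distrib_right mult.assoc sum.swap[of _ I0 J0])+
  also have "\<dots> = (\<Sum>i'\<in>I0. if i = i' then M i' j else 0)"
   using that by (intro sum.cong refl) (simp add: N(1))
  finally show ?thesis using that fin by simp
 qed
 have "M i j = (\<Sum>j'\<in>J0. M i j' * c j' j)" if ij: "i < n" "j < k" for i j
 proof (cases "i \<in> I0 \<or> j \<in> J0")
  case True
  moreover have "M i j = (\<Sum>j'\<in>J0. M i j' * c j' j)" if "j \<in> J0"
  proof -
   have "(\<Sum>j'\<in>J0. M i j' * c j' j) = (\<Sum>j'\<in>J0. if j' = j then M i j' else 0)"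
    unfolding c_def using that by (intro sum.cong refl) (simp add: N(2))
   then show ?thesis using that fin by simp
  qed
  ultimately show ?thesis using onI0 by blast
 next
  case False
  have fin': "finite (insert i I0)" "finite (insert j J0)" "card (insert i I0) = card (insert j J0)"
   using fin card False by auto
  obtain e where e: "\<exists>j'\<in>insert j J0. e j' ~= 0" "\<And>i'. i' \<in> insert i I0 ==> (\<Sum>j'\<in>insert j J0. M i' j' * e j') = 0"
   using bord[of i j] ij False minor_eq_0_iff[OF fin'] by auto
  have e': "M i' j * e j + (\<Sum>j'\<in>J0. M i' j' * e j') = 0" if "i' \<in> insert i I0" for i'
   using e(2)[OF that] fin False by simp
  have ej: "e j ~= 0"
  proof
   assume "e j = 0"
   then have "\<exists>j'\<in>J0. e j' ~= 0" "\<And>i'. i' \<in> I0 ==> (\<Sum>j'\<in>J0. M i' j' * e j') = 0"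
    using e e' by auto
   then have "minor I0 J0 M = 0" using minor_eq_0_iff[OF fin card] by blast
   then show False using nz by simp
  qed
  have cj: "e j' = - e j * c j' j" if "j' \<in> J0" for j'
  proof -
   have "(\<Sum>i'\<in>I0. N j' i' * (M i' j * e j + (\<Sum>j''\<in>J0. M i' j'' * e j''))) = 0"
    using e' by simp
   moreover have "(\<Sum>i'\<in>I0. N j' i' * (M i' j * e j + (\<Sum>j''\<in>J0. M i' j'' * e j'')))
    = e j * c j' j + (\<Sum>j''\<in>J0. (\<Sum>i'\<in>I0. N j' i' * M i' j'') * e j'')"
    unfolding c_def distrib_left sum.distrib sum_distrib_left sum_distrib_right
    by (subst sum.swap[of _ J0 I0]) (simp add: mult_ac)
   moreover have "(\<Sum>j''\<in>J0. (\<Sum>i'\<in>I0. N j' i' * M i' j'') * e j'') = (\<Sum>j''\<in>J0. if j' = j'' then e j'' else 0)"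
    using that by (intro sum.cong refl) (simp add: N(2))
   ultimately show ?thesis using that fin by (simp add: add_eq_0_iff)
  qed
  have "M i j * e j + (\<Sum>j'\<in>J0. M i j' * (- e j * c j' j)) = 0"
   using e'[of i] cj by simp
  then have "e j * (M i j - (\<Sum>j'\<in>J0. M i j' * c j' j)) = 0"
   by (simp add: algebra_simps sum_distrib_left sum_negf)
  then show ?thesis using ej by simp
 qed
 then show ?thesis
  unfolding low_rank_def using fin card
  by (intro exI[of _ J0] exI[of _ "%j' i. M i j'"] exI[of _ c]) auto
qed

lemma minor_empty [simp]: "minor {} {} M = 1"
 by (simp add: minor_def)

lemma low_rank_mono: "low_rank r n k M ==> r \<le> r' ==> low_rank r' n k M"
 unfolding low_rank_def by (meson order_trans)

lemma minors_zero_imp_low_rank: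
 assumes "\<And>I J. I \<subseteq> {..<n} ==> J \<subseteq> {..<k} ==> card I = Suc r ==> card J = Suc r ==> minor I J M = 0"
 shows "low_rank r n k M"
 using assms
proof (induction r)
 case 0
 show ?case
  using bordered_minors_zero_imp_low_rank[of "{}" n "{}" k M] 0 by simp
next
 case (Suc r)
 show ?case
 proof (cases "\<exists>I J. I \<subseteq> {..<n} \<and> J \<subseteq> {..<k} \<and> card I = Suc r \<and> card J = Suc r \<and> minor I J M ~= 0")
  case True
  then obtain I J where IJ: "I \<subseteq> {..<n}" "J \<subseteq> {..<k}" "card I = Suc r" "card J = Suc r" "minor I J M ~= 0" by blast
  have "finite I" "finite J" using IJ by (auto intro: finite_subset)
  then have "low_rank (card I) n k M"
   using IJ by (intro bordered_minors_zero_imp_low_rank[of I n J k M] Suc.prems) auto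
  then show ?thesis using IJ by simp
 next
  case False
  then have "low_rank r n k M" by (intro Suc.IH) blast
  then show ?thesis by (rule low_rank_mono) simp
 qed
qed

lemma rank_less_iff_low_rank:
 assumes A: "A \<in> carrier_mat n k" and s: "0 < s"
 shows "vec_space.rank n A < s \<longleftrightarrow> low_rank (s - 1) n k (%i j. A $$ (i, j))"
proof
 assume "vec_space.rank n A < s"
 then show "low_rank (s - 1) n k (%i j. A $$ (i, j))"
  using s by (intro minors_zero_imp_low_rank rank_less_imp_minor_zero[OF A]) auto
next
 assume "low_rank (s - 1) n k (%i j. A $$ (i, j))"
 from low_rank_imp_rank_le[OF this] have "vec_space.rank n (Matrix.mat n k (%(i, j). A $$ (i, j))) \<le> s - 1" .
 moreover have "Matrix.mat n k (%(i, j). A $$ (i, j)) = A" using A by (intro eq_matI) auto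
 ultimately show "vec_space.rank n A < s" using s by simp
qed

section \<open>Conormal spaces and transversality\<close>

text \<open>The annihilator, under the pairing \<open>(\<Phi>, H) \<mapsto> (\<Sum>i j. \<Phi> i j * H i j)\<close>, of the directions \<open>M B + C M\<close>
 that are tangent to the matrices of the rank of \<open>M\<close>.\<close>

definition conormal :: "nat => nat => (nat => nat => complex) => (nat => nat => complex) set" where
 "conormal n k M = {\<Phi>. (\<forall>i<n. \<forall>i'<n. (\<Sum>j<k. \<Phi> i j * M i' j) = 0) \<and> (\<forall>j<k. \<forall>j'<k. (\<Sum>i<n. \<Phi> i j * M i j') = 0)}"

definition pull_back :: "nat => nat => (nat => nat => complex^'m) => (nat => nat => complex) => complex^'m" where
 "pull_back n k a \<Phi> = (\<Sum>i<n. \<Sum>j<k. \<Phi> i j *s a i j)"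

text \<open>Transversality of \<open>x \<mapsto> A x\<close> to the matrices of rank \<open>s - 1\<close>, where \<open>M\<close> is the matrix and \<open>a i j\<close> the
 gradient of the entry \<open>(i, j)\<close> at the point.\<close>

definition transversal :: "nat => nat => nat => (nat => nat => complex) => (nat => nat => complex^'m) => bool" where
 "transversal n k s M a \<longleftrightarrow>
   (\<exists>I J. I \<subseteq> {..<n} \<and> J \<subseteq> {..<k} \<and> card I = s - 1 \<and> card J = s - 1 \<and> minor I J M ~= 0) \<and>
   (\<forall>\<Phi>\<in>conormal n k M. pull_back n k a \<Phi> = 0 \<longrightarrow> (\<forall>i<n. \<forall>j<k. \<Phi> i j = 0))"

lemma minor_cofactor_outside: "i \<notin> I \<or> j \<notin> J ==> card I = card J ==> minor_cofactor I J M i j = 0"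
proof -
 assume ij: "i \<notin> I \<or> j \<notin> J" and card: "card I = card J"
 have no: "\<not> (pick I a = i \<and> pick J (p a) = j)" if "p permutes {0..<card I}" "a \<in> {0..<card I}" for p a
 proof -
  have "p a \<in> {0..<card I}" using that permutes_in_image[OF that(1)] by simp
  then have "pick I a \<in> I" "pick J (p a) \<in> J" using that card by (simp_all add: pick_in_set_le)
  then show ?thesis using ij by auto
 qed
 have "(\<Sum>a\<in>{0..<card I}. (if pick I a = i \<and> pick J (p a) = j then 1 else 0) *
    (\<Prod>a'\<in>{0..<card I} - {a}. M (pick I a') (pick J (p a')))) = 0" if "p permutes {0..<card I}" for p
  by (rule sum.neutral, rule ballI) (simp only: no[OF that] if_False mult_zero_left)
 then show ?thesis
  unfolding minor_cofactor_def by (intro sum.neutral) simp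
qed

text \<open>The cofactor does not involve the row \<open>i\<close>.\<close>

lemma minor_cofactor_row_cong:
 assumes "finite I" "finite J" "card I = card J" "\<And>i' j'. i' \<in> I ==> i' ~= i ==> M i' j' = M' i' j'"
 shows "minor_cofactor I J M i j = minor_cofactor I J M' i j"
proof -
 have inj: "inj_on (pick I) {0..<card I}" using bij_betw_pick[OF assms(1)] by (rule bij_betw_imp_inj_on)
 have eq: "(if pick I a = i \<and> pick J (p a) = j then 1 else 0) * (\<Prod>a'\<in>{0..<card I} - {a}. M (pick I a') (pick J (p a')))
   = (if pick I a = i \<and> pick J (p a) = j then 1 else 0) * (\<Prod>a'\<in>{0..<card I} - {a}. M' (pick I a') (pick J (p a')))"
  if a: "a \<in> {0..<card I}" for p a
 proof (cases "pick I a = i")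
  case True
  have "pick I a' ~= i" "pick I a' \<in> I" if "a' \<in> {0..<card I} - {a}" for a'
   using inj_onD[OF inj, of a' a] that a True by (auto simp: pick_in_set_le)
  then have "(\<Prod>a'\<in>{0..<card I} - {a}. M (pick I a') (pick J (p a'))) = (\<Prod>a'\<in>{0..<card I} - {a}. M' (pick I a') (pick J (p a')))"
   by (intro prod.cong refl assms(4)) auto
  then show ?thesis by simp
 qed auto
 show ?thesis
  unfolding minor_cofactor_def by (intro sum.cong refl arg_cong2[where f = "(*)"] eq)
qed

lemma has_field_derivative_minor:
 assumes "finite I" "finite J" "card I = card J"
 shows "((%\<tau>. minor I J (%i j. M i j + \<tau> * H i j)) has_field_derivative
   (\<Sum>i\<in>I. \<Sum>j\<in>J. minor_cofactor I J (%i j. M i j + \<tau> * H i j) i j * H i j)) (at \<tau>)"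
proof -
 have "((%\<tau>. minor I J (%i j. M i j + \<tau> * H i j)) has_derivative
   (%v. \<Sum>i\<in>I. \<Sum>j\<in>J. minor_cofactor I J (%i j. M i j + \<tau> * H i j) i j * (v * H i j))) (at \<tau>)"
  by (rule has_derivative_minor[OF assms]) (auto intro!: derivative_eq_intros)
 moreover have "(%v. \<Sum>i\<in>I. \<Sum>j\<in>J. minor_cofactor I J (%i j. M i j + \<tau> * H i j) i j * (v * H i j)) =
   (*) (\<Sum>i\<in>I. \<Sum>j\<in>J. minor_cofactor I J (%i j. M i j + \<tau> * H i j) i j * H i j)"
  by (rule ext) (simp add: sum_distrib_left mult_ac)
 ultimately show ?thesis unfolding has_field_derivative_def by (rule subst[rotated])
qed

lemma minor_affine:
 assumes fin: "finite I" "finite J" and card: "card I = card J"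
 shows "minor I J (%i' j'. M i' j' + \<tau> * (if i' = i \<and> j' = j then 1 else 0)) = minor I J M + \<tau> * minor_cofactor I J M i j"
proof -
 let ?M = "%\<tau> i' j'. M i' j' + \<tau> * (if i' = i \<and> j' = j then 1 else 0)"
 have d: "((%\<tau>. minor I J (?M \<tau>)) has_field_derivative minor_cofactor I J M i j) (at \<tau>)" for \<tau>
 proof -
  have "(\<Sum>i'\<in>I. \<Sum>j'\<in>J. minor_cofactor I J (?M \<tau>) i' j' * (if i' = i \<and> j' = j then 1 else 0))
   = (\<Sum>i'\<in>I. if i' = i then (\<Sum>j'\<in>J. if j' = j then minor_cofactor I J (?M \<tau>) i j else 0) else 0)"
   by (intro sum.cong refl) (auto intro!: sum.cong)
  also have "\<dots> = minor_cofactor I J (?M \<tau>) i j"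
   using fin minor_cofactor_outside[of i I j J "?M \<tau>"] card by auto
  also have "\<dots> = minor_cofactor I J M i j"
   by (rule minor_cofactor_row_cong[OF fin card]) simp
  finally show ?thesis using has_field_derivative_minor[OF fin card, of M "%i' j'. if i' = i \<and> j' = j then 1 else 0" \<tau>] by simp
 qed
 have "\<exists>c. \<forall>\<tau>\<in>UNIV. minor I J (?M \<tau>) - \<tau> * minor_cofactor I J M i j = c"
 proof (rule has_field_derivative_zero_constant[OF convex_UNIV])
  fix \<tau> :: complex
  have "((%\<tau>. minor I J (?M \<tau>) - \<tau> * minor_cofactor I J M i j) has_field_derivative
    minor_cofactor I J M i j - 1 * minor_cofactor I J M i j) (at \<tau>)"
   by (intro DERIV_diff d DERIV_cmult_right DERIV_ident)
  then show "((%\<tau>. minor I J (?M \<tau>) - \<tau> * minor_cofactor I J M i j) has_field_derivative 0) (at \<tau> within UNIV)"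
   by simp
 qed
 then obtain c where c: "\<forall>\<tau>\<in>UNIV. minor I J (?M \<tau>) - \<tau> * minor_cofactor I J M i j = c" ..
 have "minor I J (?M \<tau>) - \<tau> * minor_cofactor I J M i j = minor I J (?M 0) - 0 * minor_cofactor I J M i j"
  by (rule trans[OF bspec[OF c UNIV_I] bspec[OF c UNIV_I, symmetric]])
 then show ?thesis by (simp add: diff_eq_eq)
qed

lemma low_rank_add_row_multiple:
 assumes "low_rank r n k M" "i' < n"
 shows "low_rank r n k (%i'' j. M i'' j + \<tau> * (if i'' = i then M i' j else 0))"
proof -
 obtain L :: "nat set" and u v where L: "finite L" "card L \<le> r"
  "\<And>i j. i < n ==> j < k ==> M i j = (\<Sum>l\<in>L. u l i * v l j)"
  using assms(1) by (auto simp: low_rank_def)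
 have h: "M i'' j + \<tau> * (if i'' = i then M i' j else 0) = (\<Sum>l\<in>L. (u l i'' + \<tau> * (if i'' = i then u l i' else 0)) * v l j)"
  if "i'' < n" "j < k" for i'' j
  using that L(3) assms(2) by (simp add: algebra_simps sum.distrib sum_distrib_left)
 show ?thesis unfolding low_rank_def
  by (rule exI[of _ L], rule exI[of _ "%l i''. u l i'' + \<tau> * (if i'' = i then u l i' else 0)"], rule exI[of _ v])
    (intro conjI allI impI L(1,2) h)
qed

lemma low_rank_add_column_multiple:
 assumes "low_rank r n k M" "j' < k"
 shows "low_rank r n k (%i j''. M i j'' + \<tau> * (if j'' = j then M i j' else 0))"
proof -
 obtain L :: "nat set" and u v where L: "finite L" "card L \<le> r"
  "\<And>i j. i < n ==> j < k ==> M i j = (\<Sum>l\<in>L. u l i * v l j)"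
  using assms(1) by (auto simp: low_rank_def)
 have h: "M i j'' + \<tau> * (if j'' = j then M i j' else 0) = (\<Sum>l\<in>L. u l i * (v l j'' + \<tau> * (if j'' = j then v l j' else 0)))"
  if "i < n" "j'' < k" for i j''
  using that L(3) assms(2) by (simp add: algebra_simps sum.distrib sum_distrib_left)
 show ?thesis unfolding low_rank_def
  by (rule exI[of _ L], rule exI[of _ u], rule exI[of _ "%l j''. v l j'' + \<tau> * (if j'' = j then v l j' else 0)"])
    (intro conjI allI impI L(1,2) h)
qed

lemma low_rank_add_unit:
 assumes "low_rank r n k M"
 shows "low_rank (Suc r) n k (%i' j'. M i' j' + \<tau> * (if i' = i \<and> j' = j then 1 else 0))"
proof -
 obtain L :: "nat set" and u v where L: "finite L" "card L \<le> r"
  "\<And>i j. i < n ==> j < k ==> M i j = (\<Sum>l\<in>L. u l i * v l j)"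
  using assms(1) by (auto simp: low_rank_def)
 obtain l0 where l0: "l0 \<notin> L" using L(1) ex_new_if_finite infinite_UNIV_nat by blast
 define u' where "u' = (%l i'. if l = l0 then (if i' = i then \<tau> else 0) else u l i')"
 define v' where "v' = (%l j'. if l = l0 then (if j' = j then 1 else 0) else v l j')"
 have "M i' j' + \<tau> * (if i' = i \<and> j' = j then 1 else 0) = (\<Sum>l\<in>insert l0 L. u' l i' * v' l j')" if "i' < n" "j' < k" for i' j'
 proof -
  have "(\<Sum>l\<in>L. u' l i' * v' l j') = (\<Sum>l\<in>L. u l i' * v l j')"
   using l0 by (intro sum.cong) (auto simp: u'_def v'_def)
  then show ?thesis using l0 L that by (simp add: u'_def v'_def)
 qed
 then show ?thesis unfolding low_rank_def using L(1,2) l0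
  by (intro exI[of _ "insert l0 L"] exI[of _ u'] exI[of _ v']) auto
qed

text \<open>As all minors of \<open>M + \<tau> (M B + C M)\<close> of the size in question vanish, so do their derivatives.\<close>

lemma minor_cofactor_conormal:
 assumes lr: "low_rank r n k M" and I: "I \<subseteq> {..<n}" "J \<subseteq> {..<k}" and card: "card I = Suc r" "card J = Suc r"
 shows "minor_cofactor I J M \<in> conormal n k M"
proof -
 have fin: "finite I" "finite J" using I by (auto intro: finite_subset)
 have cd: "card I = card J" using card by simp
 have zero: "(\<Sum>i\<in>I. \<Sum>j\<in>J. minor_cofactor I J M i j * H i j) = 0"
  if "\<And>\<tau>. low_rank r n k (%i j. M i j + \<tau> * H i j)" for H
 proof -
  have "(%\<tau>. minor I J (%i j. M i j + \<tau> * H i j)) = (%\<tau>. 0)"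
   using low_rank_imp_minor_zero[OF that _ I] card by auto
  then have "((%\<tau>::complex. 0) has_field_derivative (\<Sum>i\<in>I. \<Sum>j\<in>J. minor_cofactor I J M i j * H i j)) (at 0)"
   using has_field_derivative_minor[OF fin cd, of M H 0] by simp
  then show ?thesis using DERIV_unique DERIV_const by blast
 qed
 show ?thesis
  unfolding conormal_def
 proof (intro CollectI conjI allI impI)
  fix i i' assume ii: "i < n" "i' < n"
  have "(\<Sum>i''\<in>I. \<Sum>j\<in>J. minor_cofactor I J M i'' j * (if i'' = i then M i' j else 0)) = 0"
   by (rule zero) (rule low_rank_add_row_multiple[OF lr ii(2)])
  moreover have "(\<Sum>i''\<in>I. \<Sum>j\<in>J. minor_cofactor I J M i'' j * (if i'' = i then M i' j else 0))
    = (\<Sum>i''\<in>I. if i'' = i then \<Sum>j\<in>J. minor_cofactor I J M i j * M i' j else 0)"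
   by (intro sum.cong) auto
  ultimately have "(if i \<in> I then \<Sum>j\<in>J. minor_cofactor I J M i j * M i' j else 0) = 0"
   using fin by simp
  moreover have "(\<Sum>j<k. minor_cofactor I J M i j * M i' j) = (\<Sum>j\<in>J. minor_cofactor I J M i j * M i' j)"
   using I by (intro sum.mono_neutral_right) (auto simp: minor_cofactor_outside[OF _ cd])
  ultimately show "(\<Sum>j<k. minor_cofactor I J M i j * M i' j) = 0"
   by (cases "i \<in> I") (auto simp: minor_cofactor_outside[OF _ cd])
 next
  fix j j' assume jj: "j < k" "j' < k"
  have "(\<Sum>i\<in>I. \<Sum>j''\<in>J. minor_cofactor I J M i j'' * (if j'' = j then M i j' else 0)) = 0"
   by (rule zero) (rule low_rank_add_column_multiple[OF lr jj(2)])
  moreover have "(\<Sum>i\<in>I. \<Sum>j''\<in>J. minor_cofactor I J M i j'' * (if j'' = j then M i j' else 0))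
    = (\<Sum>i\<in>I. \<Sum>j''\<in>J. if j'' = j then minor_cofactor I J M i j * M i j' else 0)"
   by (intro sum.cong refl) auto
  ultimately have "(\<Sum>i\<in>I. if j \<in> J then minor_cofactor I J M i j * M i j' else 0) = 0"
   using fin by simp
  moreover have "(\<Sum>i<n. minor_cofactor I J M i j * M i j') = (\<Sum>i\<in>I. minor_cofactor I J M i j * M i j')"
   using I by (intro sum.mono_neutral_right) (auto simp: minor_cofactor_outside[OF _ cd])
  ultimately show "(\<Sum>i<n. minor_cofactor I J M i j * M i j') = 0"
   by (cases "j \<in> J") (auto simp: minor_cofactor_outside[OF _ cd])
 qed
qed

lemma bordered_cofactor_nonzero:
 assumes I0: "I0 \<subseteq> {..<n}" and J0: "J0 \<subseteq> {..<k}" and card: "card I0 = r" "card J0 = r" and nz: "minor I0 J0 M ~= 0"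
  and lr: "low_rank r n k M" and ij: "i < n" "i \<notin> I0" "j < k" "j \<notin> J0"
 shows "minor_cofactor (insert i I0) (insert j J0) M i j ~= 0"
proof
 assume z: "minor_cofactor (insert i I0) (insert j J0) M i j = 0"
 have fin: "finite I0" "finite J0" using I0 J0 by (auto intro: finite_subset)
 let ?I = "insert i I0" and ?J = "insert j J0"
 let ?M = "%i' j'. M i' j' + 1 * (if i' = i \<and> j' = j then 1 else 0)"
 have fin': "finite ?I" "finite ?J" "card ?I = card ?J" using fin card ij by auto
 have m0: "minor ?I ?J M = 0" by (rule low_rank_imp_minor_zero[OF lr]) (use I0 J0 ij card fin in auto)
 then have m1: "minor ?I ?J ?M = 0" using minor_affine[OF fin', of M 1 i j] z by simp
 obtain c where c: "\<exists>j'\<in>?J. c j' ~= 0" "\<And>i'. i' \<in> ?I ==> (\<Sum>j'\<in>?J. M i' j' * c j') = 0"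
  using m0 minor_eq_0_iff[OF fin'] by blast
 obtain e where e: "\<exists>j'\<in>?J. e j' ~= 0" "\<And>i'. i' \<in> ?I ==> (\<Sum>j'\<in>?J. ?M i' j' * e j') = 0"
  using m1 minor_eq_0_iff[OF fin', of ?M] by blast
 have inj: "\<forall>j'\<in>J0. d j' = 0" if "\<And>i'. i' \<in> I0 ==> (\<Sum>j'\<in>J0. M i' j' * d j') = 0" for d
  using minor_eq_0_iff[of I0 J0 M] fin card nz that by metis
 have c': "M i' j * c j + (\<Sum>j'\<in>J0. M i' j' * c j') = 0" if "i' \<in> ?I" for i'
  using c(2)[OF that] fin ij by simp
 have e': "M i' j * e j + (\<Sum>j'\<in>J0. M i' j' * e j') = 0" if "i' \<in> I0" for i'
 proof -
  have "i' ~= i" using that ij by auto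
  then show ?thesis using e(2)[of i'] that fin ij by simp
 qed
 have ei: "M i j * e j + e j + (\<Sum>j'\<in>J0. M i j' * e j') = 0"
 proof -
  have "(\<Sum>j'\<in>J0. ?M i j' * e j') = (\<Sum>j'\<in>J0. M i j' * e j')"
   using ij by (intro sum.cong) auto
  then show ?thesis using e(2)[of i] fin ij by (simp add: algebra_simps)
 qed
 have cj: "c j ~= 0"
 proof
  assume c0: "c j = 0"
  have "\<forall>j'\<in>J0. c j' = 0"
  proof (rule inj)
   fix i' assume "i' \<in> I0"
   then have "M i' j * c j + (\<Sum>j'\<in>J0. M i' j' * c j') = 0" by (intro c') simp
   then show "(\<Sum>j'\<in>J0. M i' j' * c j') = 0" by (simp add: c0)
  qed
  then show False using c(1) c0 by blast
 qed
 have "\<forall>j'\<in>J0. c j * e j' - e j * c j' = 0"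
 proof (rule inj)
  fix i' assume i': "i' \<in> I0"
  have "(\<Sum>j'\<in>J0. M i' j' * (c j * e j' - e j * c j')) = c j * (\<Sum>j'\<in>J0. M i' j' * e j') - e j * (\<Sum>j'\<in>J0. M i' j' * c j')"
   by (simp add: algebra_simps sum_subtractf sum_distrib_left)
  also have "\<dots> = c j * (- (M i' j * e j)) - e j * (- (M i' j * c j))"
   using e'[OF i'] c'[of i'] i' by (simp add: add_eq_0_iff)
  finally show "(\<Sum>j'\<in>J0. M i' j' * (c j * e j' - e j * c j')) = 0" by simp
 qed
 then have "(\<Sum>j'\<in>J0. M i j' * (c j * e j')) = (\<Sum>j'\<in>J0. M i j' * (e j * c j'))"
  by (intro sum.cong) auto
 then have "c j * (\<Sum>j'\<in>J0. M i j' * e j') = e j * (\<Sum>j'\<in>J0. M i j' * c j')"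
  by (simp add: sum_distrib_left mult_ac)
 moreover have "(\<Sum>j'\<in>J0. M i j' * c j') = - (M i j * c j)" using c'[of i] by (simp add: add_eq_0_iff)
 moreover have "(\<Sum>j'\<in>J0. M i j' * e j') = - (M i j * e j + e j)" using ei by (simp only: add_eq_0_iff)
 ultimately have "c j * (- (M i j * e j + e j)) = e j * (- (M i j * c j))" by (simp only:)
 then have "c j * e j = 0" by (simp add: algebra_simps)
 then have ej: "e j = 0" using cj by simp
 have "\<forall>j'\<in>J0. e j' = 0"
 proof (rule inj)
  fix i' assume "i' \<in> I0"
  then have "M i' j * e j + (\<Sum>j'\<in>J0. M i' j' * e j') = 0" by (rule e')
  then show "(\<Sum>j'\<in>J0. M i' j' * e j') = 0" by (simp add: ej)
 qed
 then show False using e(1) ej by blast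
qed

lemma conormal_eq_zero:
 assumes I0: "I0 \<subseteq> {..<n}" and J0: "J0 \<subseteq> {..<k}" and card: "card I0 = card J0" and nz: "minor I0 J0 M ~= 0"
  and \<Phi>: "\<Phi> \<in> conormal n k M" and zero: "\<And>i j. i < n ==> i \<notin> I0 ==> j < k ==> j \<notin> J0 ==> \<Phi> i j = 0"
  and ij: "i < n" "j < k"
 shows "\<Phi> i j = 0"
proof -
 have fin: "finite I0" "finite J0" using I0 J0 by (auto intro: finite_subset)
 obtain N where N: "\<And>i i'. i \<in> I0 ==> i' \<in> I0 ==> (\<Sum>j\<in>J0. M i j * N j i') = (if i = i' then 1 else 0)"
  "\<And>j j'. j \<in> J0 ==> j' \<in> J0 ==> (\<Sum>i\<in>I0. N j i * M i j') = (if j = j' then 1 else 0)"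
  using minor_inverse[OF fin card nz] by blast
 have col: "\<Phi> i j = 0" if "i < n" "j < k" "j \<notin> J0" for i j
 proof (cases "i \<in> I0")
  case True
  have s: "(\<Sum>i'\<in>I0. \<Phi> i' j * M i' j') = 0" if "j' \<in> J0" for j'
  proof -
   have "(\<Sum>i'<n. \<Phi> i' j * M i' j') = 0" using \<Phi> \<open>j < k\<close> that J0 by (auto simp: conormal_def)
   moreover have "(\<Sum>i'<n. \<Phi> i' j * M i' j') = (\<Sum>i'\<in>I0. \<Phi> i' j * M i' j')"
    using I0 zero \<open>j < k\<close> \<open>j \<notin> J0\<close> by (intro sum.mono_neutral_right) auto
   ultimately show ?thesis by simp
  qed
  have "0 = (\<Sum>j'\<in>J0. (\<Sum>i'\<in>I0. \<Phi> i' j * M i' j') * N j' i)" using s by simp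
  also have "\<dots> = (\<Sum>i'\<in>I0. \<Phi> i' j * (\<Sum>j'\<in>J0. M i' j' * N j' i))"
   unfolding sum_distrib_left sum_distrib_right by (subst sum.swap) (simp add: mult_ac)
  also have "\<dots> = (\<Sum>i'\<in>I0. if i' = i then \<Phi> i' j else 0)"
   using True by (intro sum.cong refl) (simp add: N(1))
  finally show ?thesis using True fin by simp
 qed (use zero that in auto)
 show ?thesis
 proof (cases "j \<in> J0")
  case True
  have s: "(\<Sum>j'\<in>J0. \<Phi> i j' * M i' j') = 0" if "i' \<in> I0" for i'
  proof -
   have "(\<Sum>j'<k. \<Phi> i j' * M i' j') = 0" using \<Phi> ij that I0 by (auto simp: conormal_def)
   moreover have "(\<Sum>j'<k. \<Phi> i j' * M i' j') = (\<Sum>j'\<in>J0. \<Phi> i j' * M i' j')"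
    using J0 col ij by (intro sum.mono_neutral_right) auto
   ultimately show ?thesis by simp
  qed
  have "0 = (\<Sum>i'\<in>I0. (\<Sum>j'\<in>J0. \<Phi> i j' * M i' j') * N j i')" using s by simp
  also have "\<dots> = (\<Sum>j'\<in>J0. \<Phi> i j' * (\<Sum>i'\<in>I0. N j i' * M i' j'))"
   unfolding sum_distrib_left sum_distrib_right by (subst sum.swap) (simp add: mult_ac)
  also have "\<dots> = (\<Sum>j'\<in>J0. if j = j' then \<Phi> i j' else 0)"
   using True by (intro sum.cong refl) (simp add: N(2))
  finally show ?thesis using True fin by simp
 qed (use col ij in auto)
qed


lemma conormal_diff_sum:
 assumes "\<Phi> \<in> conormal n k M" "\<And>q. q \<in> Q ==> \<Psi> q \<in> conormal n k M"
 shows "(%i j. \<Phi> i j - (\<Sum>q\<in>Q. c q * \<Psi> q i j)) \<in> conormal n k M"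
proof -
 have "(\<Sum>j<k. (\<Phi> i j - (\<Sum>q\<in>Q. c q * \<Psi> q i j)) * M i' j)
   = (\<Sum>j<k. \<Phi> i j * M i' j) - (\<Sum>q\<in>Q. c q * (\<Sum>j<k. \<Psi> q i j * M i' j))" for i i'
 proof -
  have "(\<Sum>j<k. (\<Sum>q\<in>Q. c q * \<Psi> q i j) * M i' j) = (\<Sum>q\<in>Q. c q * (\<Sum>j<k. \<Psi> q i j * M i' j))"
   unfolding sum_distrib_left sum_distrib_right by (subst sum.swap) (simp add: mult_ac)
  then show ?thesis by (simp add: left_diff_distrib sum_subtractf)
 qed
 moreover have "(\<Sum>i<n. (\<Phi> i j - (\<Sum>q\<in>Q. c q * \<Psi> q i j)) * M i j')
   = (\<Sum>i<n. \<Phi> i j * M i j') - (\<Sum>q\<in>Q. c q * (\<Sum>i<n. \<Psi> q i j * M i j'))" for j j'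
 proof -
  have "(\<Sum>i<n. (\<Sum>q\<in>Q. c q * \<Psi> q i j) * M i j') = (\<Sum>q\<in>Q. c q * (\<Sum>i<n. \<Psi> q i j * M i j'))"
   unfolding sum_distrib_left sum_distrib_right by (subst sum.swap) (simp add: mult_ac)
  then show ?thesis by (simp add: left_diff_distrib sum_subtractf)
 qed
 ultimately show ?thesis using assms by (simp add: conormal_def)
qed

lemma pull_back_sum: "pull_back n k a (%i j. \<Sum>q\<in>Q. c q * \<Psi> q i j) = (\<Sum>q\<in>Q. c q *s pull_back n k a (\<Psi> q))"
proof -
 have "pull_back n k a (%i j. \<Sum>q\<in>Q. c q * \<Psi> q i j) $ l = (\<Sum>q\<in>Q. c q *s pull_back n k a (\<Psi> q)) $ l" for l
 proof -
  have "pull_back n k a (%i j. \<Sum>q\<in>Q. c q * \<Psi> q i j) $ l = (\<Sum>i<n. \<Sum>j<k. \<Sum>q\<in>Q. c q * (\<Psi> q i j * a i j $ l))"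
   by (simp add: pull_back_def sum_distrib_right mult.assoc)
  also have "\<dots> = (\<Sum>i<n. \<Sum>q\<in>Q. \<Sum>j<k. c q * (\<Psi> q i j * a i j $ l))"
   by (intro sum.cong refl sum.swap)
  also have "\<dots> = (\<Sum>q\<in>Q. \<Sum>i<n. \<Sum>j<k. c q * (\<Psi> q i j * a i j $ l))"
   by (rule sum.swap)
  also have "\<dots> = (\<Sum>q\<in>Q. c q *s pull_back n k a (\<Psi> q)) $ l"
   by (simp add: pull_back_def sum_distrib_left)
  finally show ?thesis .
 qed
 then show ?thesis by (simp add: Finite_Cartesian_Product.vec_eq_iff)
qed

context
 fixes n k s :: nat and M :: "nat => nat => complex" and I0 J0 :: "nat set"
 assumes s: "0 < s" "s \<le> n" "s \<le> k" and lr: "low_rank (s - 1) n k M"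
  and I0: "I0 \<subseteq> {..<n}" "card I0 = s - 1" and J0: "J0 \<subseteq> {..<k}" "card J0 = s - 1"
  and nz: "minor I0 J0 M ~= 0"
begin

text \<open>The positions outside a nonzero minor of size \<open>s - 1\<close>: as many as the codimension of
 the rank stratum.\<close>

definition border :: "(nat \<times> nat) set" where
 "border = ({..<n} - I0) \<times> ({..<k} - J0)"

definition border_cofactor :: "nat \<times> nat => nat => nat => complex" where
 "border_cofactor q = minor_cofactor (insert (fst q) I0) (insert (snd q) J0) M"

lemma finite_border: "finite border" by (simp add: border_def)

lemma card_border: "card border = det_codim n k s"
proof -
 have "finite I0" "finite J0" using I0 J0 by (auto intro: finite_subset)
 then have "card ({..<n} - I0) = n - (s - 1)" "card ({..<k} - J0) = k - (s - 1)"
  using I0 J0 by (simp_all add: card_Diff_subset)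
 moreover have "n - (s - 1) = n - s + 1" "k - (s - 1) = k - s + 1" using s by auto
 ultimately show ?thesis by (simp only: border_def det_codim_def card_cartesian_product)
qed

lemma border_sets:
 assumes "q \<in> border"
 shows "insert (fst q) I0 \<subseteq> {..<n}" "insert (snd q) J0 \<subseteq> {..<k}" "card (insert (fst q) I0) = s" "card (insert (snd q) J0) = s"
proof -
 have "finite I0" "finite J0" using I0 J0 by (auto intro: finite_subset)
 then show "insert (fst q) I0 \<subseteq> {..<n}" "insert (snd q) J0 \<subseteq> {..<k}" "card (insert (fst q) I0) = s" "card (insert (snd q) J0) = s"
  using assms I0 J0 s by (auto simp: border_def)
qed

lemma border_cofactor_conormal: "q \<in> border ==> border_cofactor q \<in> conormal n k M"
 unfolding border_cofactor_def using border_sets[of q] s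
 by (intro minor_cofactor_conormal[OF lr]) auto

lemma border_cofactor_diag: "q \<in> border ==> border_cofactor q (fst q) (snd q) ~= 0"
 unfolding border_cofactor_def
 by (rule bordered_cofactor_nonzero[OF I0(1) J0(1) I0(2) J0(2) nz lr]) (auto simp: border_def)

lemma border_cofactor_off_diag:
 assumes "q \<in> border" "q' \<in> border" "q ~= q'"
 shows "border_cofactor q (fst q') (snd q') = 0"
 unfolding border_cofactor_def
 by (rule minor_cofactor_outside) (use assms border_sets[OF assms(1)] in \<open>auto simp: border_def prod_eq_iff\<close>)

text \<open>The cofactors of the bordered minors form a basis of the conormal space.\<close>

lemma conormal_expand:
 assumes \<Phi>: "\<Phi> \<in> conormal n k M" and ij: "i < n" "j < k"
 shows "\<Phi> i j = (\<Sum>q\<in>border. \<Phi> (fst q) (snd q) / border_cofactor q (fst q) (snd q) * border_cofactor q i j)"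
proof -
 let ?\<Psi> = "%i j. \<Phi> i j - (\<Sum>q\<in>border. \<Phi> (fst q) (snd q) / border_cofactor q (fst q) (snd q) * border_cofactor q i j)"
 have "?\<Psi> i j = 0"
 proof (rule conormal_eq_zero[OF I0(1) J0(1) _ nz _ _ ij])
  show "?\<Psi> \<in> conormal n k M"
   by (rule conormal_diff_sum[OF \<Phi> border_cofactor_conormal])
  fix i j assume b: "i < n" "i \<notin> I0" "j < k" "j \<notin> J0"
  then have ij: "(i, j) \<in> border" by (simp add: border_def)
  have "(\<Sum>q\<in>border. \<Phi> (fst q) (snd q) / border_cofactor q (fst q) (snd q) * border_cofactor q i j)
    = (\<Sum>q\<in>border. if q = (i, j) then \<Phi> i j else 0)"
  proof (rule sum.cong[OF refl])
   fix q assume q: "q \<in> border"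
   show "\<Phi> (fst q) (snd q) / border_cofactor q (fst q) (snd q) * border_cofactor q i j = (if q = (i, j) then \<Phi> i j else 0)"
    using border_cofactor_diag[OF q] border_cofactor_off_diag[OF q ij] by auto
  qed
  then show "?\<Psi> i j = 0" using ij finite_border by simp
 qed (use I0 J0 in auto)
 then show ?thesis by simp
qed

lemma pull_back_border_independent:
 assumes inj: "\<forall>\<Phi>\<in>conormal n k M. pull_back n k a \<Phi> = 0 \<longrightarrow> (\<forall>i<n. \<forall>j<k. \<Phi> i j = 0)"
  and z: "(\<Sum>q\<in>border. c q *s pull_back n k a (border_cofactor q)) = 0"
 shows "\<forall>q\<in>border. c q = 0"
proof
 fix q assume q: "q \<in> border"
 let ?\<Psi> = "%i j. \<Sum>q\<in>border. c q * border_cofactor q i j"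
 have "(%i j. 0 - (\<Sum>q\<in>border. (- c q) * border_cofactor q i j)) \<in> conormal n k M"
  by (rule conormal_diff_sum[OF _ border_cofactor_conormal]) (simp_all add: conormal_def)
 then have "?\<Psi> \<in> conormal n k M" by (simp add: sum_negf)
 moreover have "pull_back n k a ?\<Psi> = 0" using z by (simp add: pull_back_sum)
 moreover have "fst q < n" "snd q < k" using q by (auto simp: border_def)
 ultimately have "?\<Psi> (fst q) (snd q) = 0" using inj by blast
 also have "?\<Psi> (fst q) (snd q) = (\<Sum>q'\<in>border. if q' = q then c q * border_cofactor q (fst q) (snd q) else 0)"
  using q by (intro sum.cong refl) (auto simp: border_cofactor_off_diag)
 finally show "c q = 0" using q finite_border border_cofactor_diag[OF q] by simp
qed

lemma pull_back_injective:
 assumes dim: "det_codim n k s \<le> vec.dim S"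
  and S: "\<And>x. x \<in> S ==> \<exists>\<Psi>\<in>conormal n k M. x = pull_back n k a \<Psi>"
  and \<Phi>: "\<Phi> \<in> conormal n k M" "pull_back n k a \<Phi> = 0" and ij: "i < n" "j < k"
 shows "\<Phi> i j = 0"
proof (rule ccontr)
 assume nz': "\<Phi> i j ~= 0"
 define g where "g = (%q. pull_back n k a (border_cofactor q))"
 have expand: "pull_back n k a \<Psi> = (\<Sum>q\<in>border. (\<Psi> (fst q) (snd q) / border_cofactor q (fst q) (snd q)) *s g q)"
  if "\<Psi> \<in> conormal n k M" for \<Psi>
 proof -
  have "pull_back n k a \<Psi> = pull_back n k a (%i j. \<Sum>q\<in>border. \<Psi> (fst q) (snd q) / border_cofactor q (fst q) (snd q) * border_cofactor q i j)"
   unfolding pull_back_def by (intro sum.cong refl arg_cong2[where f = "(*s)"] conormal_expand[OF that]) auto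
  then show ?thesis by (simp only: pull_back_sum g_def)
 qed
 obtain q0 where q0: "q0 \<in> border" "\<Phi> (fst q0) (snd q0) ~= 0"
 proof (rule ccontr)
  assume "\<not> thesis"
  then have "\<forall>q\<in>border. \<Phi> (fst q) (snd q) = 0" using that by blast
  then have "\<Phi> i j = 0" by (subst conormal_expand[OF \<Phi>(1) ij]) simp
  then show False using nz' by simp
 qed
 define c where "c = (%q. \<Phi> (fst q) (snd q) / border_cofactor q (fst q) (snd q))"
 have c0: "c q0 ~= 0" using q0 border_cofactor_diag by (simp add: c_def)
 have "c q0 *s g q0 + (\<Sum>q\<in>border - {q0}. c q *s g q) = 0"
  using expand[OF \<Phi>(1)] \<Phi>(2) q0(1) finite_border by (simp add: c_def sum.remove)
 then have "c q0 *s g q0 = - (\<Sum>q\<in>border - {q0}. c q *s g q)" by (simp add: add_eq_0_iff2)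
 also have "\<dots> \<in> vec.span (g ` (border - {q0}))"
  by (intro vec.span_neg vec.span_sum vec.span_scale vec.span_base) auto
 finally have "inverse (c q0) *s (c q0 *s g q0) \<in> vec.span (g ` (border - {q0}))" by (rule vec.span_scale)
 then have g0: "g q0 \<in> vec.span (g ` (border - {q0}))" using c0 by (simp add: vector_smult_assoc)
 have gq: "g q \<in> vec.span (g ` (border - {q0}))" if "q \<in> border" for q
  using that g0 by (cases "q = q0") (auto intro: vec.span_base)
 have "S \<subseteq> vec.span (g ` (border - {q0}))"
 proof
  fix x assume "x \<in> S"
  then obtain \<Psi> where "\<Psi> \<in> conormal n k M" "x = pull_back n k a \<Psi>" using S by blast
  then show "x \<in> vec.span (g ` (border - {q0}))"
   using expand by (auto intro!: vec.span_sum vec.span_scale gq)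
 qed
 then have "vec.dim S \<le> card (g ` (border - {q0}))" by (rule vec.dim_le_card) (simp add: finite_border)
 also have "\<dots> \<le> card (border - {q0})" by (rule card_image_le) (simp add: finite_border)
 also have "\<dots> < card border" using q0(1) finite_border by (intro psubset_card_mono) auto
 finally show False using dim card_border by simp
qed

lemma dim_ge_det_codim:
 assumes inj: "\<forall>\<Phi>\<in>conormal n k M. pull_back n k a \<Phi> = 0 \<longrightarrow> (\<forall>i<n. \<forall>j<k. \<Phi> i j = 0)"
  and S: "\<And>q. q \<in> border ==> pull_back n k a (border_cofactor q) \<in> S"
 shows "det_codim n k s \<le> vec.dim S"
proof -
 define g where "g = (%q. pull_back n k a (border_cofactor q))"
 have ind: "\<forall>q\<in>border. c q = 0" if "(\<Sum>q\<in>border. c q *s g q) = 0" for c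
  using pull_back_border_independent[OF inj] that by (simp add: g_def)
 obtain v where v: "\<And>q q'. q \<in> border ==> q' \<in> border ==> bilin (g q) (v q') = (if q = q' then 1 else 0)"
  using dual_vectors[where G = g, OF finite_border ind] by blast
 have inj: "inj_on g border"
 proof (rule inj_onI, rule ccontr)
  fix q q' assume "q \<in> border" "q' \<in> border" "g q = g q'" "q ~= q'"
  then show False using v[of q q] v[of q' q] by simp
 qed
 have "vec.independent (g ` border)"
 proof
  assume "vec.dependent (g ` border)"
  then obtain u x where u: "x \<in> g ` border" "u x ~= 0" "(\<Sum>y\<in>g ` border. u y *s y) = 0"
   using vec.dependent_finite[of "g ` border"] finite_border by auto
  then have "(\<Sum>q\<in>border. u (g q) *s g q) = 0" by (simp add: sum.reindex[OF inj])
  from ind[OF this] show False using u by blast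
 qed
 then have "card (g ` border) \<le> vec.dim S" using S by (intro vec.independent_card_le_dim) (auto simp: g_def)
 then show ?thesis by (simp add: card_image[OF inj] card_border)
qed

end

definition minor_gradients :: "nat => nat => nat => (nat => nat => complex) => (nat => nat => complex^'m) => (complex^'m) set" where
 "minor_gradients n k s M a = {pull_back n k a (minor_cofactor I J M) | I J.
   I \<subseteq> {..<n} \<and> J \<subseteq> {..<k} \<and> card I = s \<and> card J = s}"

text \<open>The Jacobian criterion means transversality.\<close>

lemma transversal_iff_dim:
 assumes s: "0 < s" "s \<le> n" "s \<le> k" and lr: "low_rank (s - 1) n k M"
 shows "transversal n k s M a \<longleftrightarrow> det_codim n k s \<le> vec.dim (minor_gradients n k s M a)"
proof
 assume "transversal n k s M a"
 then obtain I J where IJ: "I \<subseteq> {..<n}" "card I = s - 1" "J \<subseteq> {..<k}" "card J = s - 1" "minor I J M ~= 0"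
  unfolding transversal_def by (elim conjE exE)
 have inj: "\<forall>\<Phi>\<in>conormal n k M. pull_back n k a \<Phi> = 0 \<longrightarrow> (\<forall>i<n. \<forall>j<k. \<Phi> i j = 0)"
  using \<open>transversal n k s M a\<close> unfolding transversal_def by (rule conjunct2)
 note ctx = s lr IJ
 show "det_codim n k s \<le> vec.dim (minor_gradients n k s M a)"
 proof (rule dim_ge_det_codim[OF ctx inj])
  fix q assume "q \<in> border n k I J"
  from border_sets[OF ctx this] show "pull_back n k a (border_cofactor M I J q) \<in> minor_gradients n k s M a"
   unfolding minor_gradients_def border_cofactor_def[OF ctx] by blast
 qed
next
 assume dim: "det_codim n k s \<le> vec.dim (minor_gradients n k s M a)"
 have "\<exists>I J. I \<subseteq> {..<n} \<and> J \<subseteq> {..<k} \<and> card I = s - 1 \<and> card J = s - 1 \<and> minor I J M ~= 0"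
 proof (rule ccontr)
  assume no: "\<not> (\<exists>I J. I \<subseteq> {..<n} \<and> J \<subseteq> {..<k} \<and> card I = s - 1 \<and> card J = s - 1 \<and> minor I J M ~= 0)"
  have "s ~= 1"
  proof
   assume "s = 1"
   then show False using no by (auto dest!: spec[of _ "{}"])
  qed
  then obtain r where r: "s = Suc (Suc r)" using s(1) by (metis One_nat_def gr0_implies_Suc not0_implies_Suc)
  then have "low_rank r n k M" using no by (intro minors_zero_imp_low_rank) auto
  then have lr': "low_rank (Suc r) n k (%i' j'. M i' j' + 1 * (if i' = i \<and> j' = j then 1 else 0))" for i j
   by (rule low_rank_add_unit)
  have "minor_cofactor I J M i j = 0"
   if IJ: "I \<subseteq> {..<n}" "J \<subseteq> {..<k}" "card I = s" "card J = s" for I J i j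
  proof -
   have "minor I J (%i' j'. M i' j' + 1 * (if i' = i \<and> j' = j then 1 else 0)) = 0"
    by (rule low_rank_imp_minor_zero[OF lr']) (use IJ r in simp_all)
   moreover have "minor I J M = 0" by (rule low_rank_imp_minor_zero[OF lr]) (use IJ r in simp_all)
   moreover have "minor I J (%i' j'. M i' j' + 1 * (if i' = i \<and> j' = j then 1 else 0)) = minor I J M + 1 * minor_cofactor I J M i j"
    by (rule minor_affine) (use IJ in \<open>auto intro: finite_subset\<close>)
   ultimately show ?thesis by simp
  qed
  then have "minor_gradients n k s M a \<subseteq> {0}"
   by (auto simp: minor_gradients_def pull_back_def)
  then have "minor_gradients n k s M a \<subseteq> vec.span {}" by simp
  then have "vec.dim (minor_gradients n k s M a) \<le> card ({} :: (complex^'a) set)"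
   by (rule vec.dim_le_card) simp
  from le_trans[OF dim this] show False by (simp add: det_codim_def)
 qed
 then obtain I J where IJ: "I \<subseteq> {..<n}" "card I = s - 1" "J \<subseteq> {..<k}" "card J = s - 1" "minor I J M ~= 0"
  by blast
 note ctx = s lr IJ
 have "\<Phi> i j = 0" if "\<Phi> \<in> conormal n k M" "pull_back n k a \<Phi> = 0" "i < n" "j < k" for \<Phi> i j
 proof (rule pull_back_injective[OF ctx dim _ that])
  fix x assume "x \<in> minor_gradients n k s M a"
  then obtain I' J' where IJ': "I' \<subseteq> {..<n}" "J' \<subseteq> {..<k}" "card I' = s" "card J' = s"
   and x: "x = pull_back n k a (minor_cofactor I' J' M)"
   by (auto simp: minor_gradients_def)
  have "minor_cofactor I' J' M \<in> conormal n k M"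
   by (rule minor_cofactor_conormal[OF lr]) (use IJ' s in auto)
  then show "\<exists>\<Psi>\<in>conormal n k M. x = pull_back n k a \<Psi>" using x by blast
 qed
 then have "\<forall>\<Phi>\<in>conormal n k M. pull_back n k a \<Phi> = 0 \<longrightarrow> (\<forall>i<n. \<forall>j<k. \<Phi> i j = 0)" by simp
 moreover have "\<exists>I J. I \<subseteq> {..<n} \<and> J \<subseteq> {..<k} \<and> card I = s - 1 \<and> card J = s - 1 \<and> minor I J M ~= 0"
  by (rule exI[of _ I], rule exI[of _ J]) (intro conjI IJ)
 ultimately show "transversal n k s M a" unfolding transversal_def by (rule conjI[rotated])
qed

section \<open>Monomials along sequences in the torus\<close>

no_notation scalar_prod (infix "\<bullet>" 70)

lemma common_subsequence:
 fixes S :: "'s set"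
 assumes "finite S"
  and ex: "\<And>s r. s \<in> S ==> strict_mono (r :: nat => nat) ==> \<exists>r'. strict_mono (r' :: nat => nat) \<and> Q s (r \<circ> r')"
  and sub: "\<And>s r r'. s \<in> S ==> Q s r ==> strict_mono (r' :: nat => nat) ==> Q s (r \<circ> r')"
  and r0: "strict_mono r0"
 obtains r' where "strict_mono (r' :: nat => nat)" "\<And>s. s \<in> S ==> Q s (r0 \<circ> r')"
proof -
 have "\<exists>r'. strict_mono (r' :: nat => nat) \<and> (\<forall>s\<in>S. Q s (r0 \<circ> r'))"
  using assms(1) ex sub
 proof (induction S)
  case empty
  show ?case by (rule exI[of _ id]) (simp add: strict_mono_def)
 next
  case (insert s S)
  have "\<exists>r'. strict_mono r' \<and> (\<forall>s\<in>S. Q s (r0 \<circ> r'))"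
   by (rule insert.IH) (rule insert.prems; assumption?; simp)+
  then obtain r1 where r1: "strict_mono r1" "\<forall>s\<in>S. Q s (r0 \<circ> r1)" by (elim exE conjE)
  have "strict_mono (r0 \<circ> r1)" using r0 r1(1) by (rule strict_mono_o)
  then obtain r2 where r2: "strict_mono r2" "Q s ((r0 \<circ> r1) \<circ> r2)" using insert.prems(1)[of s "r0 \<circ> r1"] by blast
  show ?case
  proof (rule exI[of _ "r1 \<circ> r2"], intro conjI ballI)
   show "strict_mono (r1 \<circ> r2)" using r1(1) r2(1) by (rule strict_mono_o)
   fix t assume "t \<in> insert s S"
   then have "Q t ((r0 \<circ> r1) \<circ> r2)"
    using r1(2) r2 insert.prems(2)[of t "r0 \<circ> r1" r2] by blast
   then show "Q t (r0 \<circ> (r1 \<circ> r2))" by (simp only: o_assoc)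
  qed
 qed
 then show thesis using that by blast
qed

lemma monomial_nonzero: "x \<in> complex_torus ==> monomial_Cn a x ~= 0"
 by (simp add: monomial_Cn_def complex_torus_def)

definition log_abs :: "complex^'m => real^'m" where
 "log_abs x = (\<chi> i. ln (norm (x $ i)))"

lemma inner_lattice: "(w :: real^'m::finite) \<bullet> lattice_point a = (\<Sum>i\<in>UNIV. w $ i * real (a $ i))"
 by (simp add: inner_vec_def lattice_point_def)

definition phase :: "complex^'m => complex^'m" where
 "phase x = (\<chi> i. x $ i / of_real (norm (x $ i)))"

lemma polar_form:
 assumes "x \<in> complex_torus"
 shows "x $ i = of_real (exp (log_abs x $ i)) * phase x $ i" "norm (phase x $ i) = 1"
 using assms by (auto simp: complex_torus_def log_abs_def phase_def norm_divide)

lemma monomial_polar: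
 assumes "\<And>i. x $ i = of_real (exp (u $ i)) * e $ i"
 shows "monomial_Cn a x = of_real (exp (u \<bullet> lattice_point a)) * monomial_Cn a e"
proof -
 have "monomial_Cn a x = of_real (\<Prod>i\<in>UNIV. exp (u $ i * real (a $ i))) * monomial_Cn a e"
  by (simp add: monomial_Cn_def assms power_mult_distrib prod.distrib exp_of_nat2_mult)
 then show ?thesis by (simp add: inner_lattice exp_sum)
qed

lemma convergent_inner_span:
 fixes u :: "nat => 'a::euclidean_space"
 assumes E: "\<And>e. e \<in> E ==> convergent (%\<nu>. e \<bullet> u \<nu>)" and e: "e \<in> Real_Vector_Spaces.span E"
 shows "convergent (%\<nu>. e \<bullet> u \<nu>)"
 using e
proof (induction rule: Real_Vector_Spaces.span_induct_alt)
 case base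
 show ?case by (simp add: convergent_const)
next
 case (step c x y)
 have "convergent (%\<nu>. c * (x \<bullet> u \<nu>) + y \<bullet> u \<nu>)"
  by (intro convergent_add convergent_mult convergent_const E step)
 then show ?case by (simp add: inner_add_left)
qed

text \<open>A theorem of the alternative, by separation of the compact convex hull of \<open>K\<close> from the span of \<open>E\<close>:
 if the functionals \<open>u \<nu>\<close> stay bounded on \<open>E\<close> and tend to \<open>-\<infinity>\<close> on \<open>K\<close>, then a single functional
 vanishes on \<open>E\<close> and is positive on \<open>K\<close>.\<close>

lemma separating_weight:
 fixes u :: "nat => 'a::euclidean_space"
 assumes K: "finite K" "K ~= {}" and Kdiv: "\<And>c. c \<in> K ==> filterlim (%\<nu>. c \<bullet> u \<nu>) at_bot sequentially"
  and E: "\<And>e. e \<in> E ==> convergent (%\<nu>. e \<bullet> u \<nu>)"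
 obtains w where "\<And>c. c \<in> K ==> 0 < w \<bullet> c" "\<And>e. e \<in> E ==> w \<bullet> e = 0"
proof -
 let ?E = "Real_Vector_Spaces.span E"
 have conv: "convergent (%\<nu>. e \<bullet> u \<nu>)" if "e \<in> ?E" for e
  by (rule convergent_inner_span[of E u]) (use E that in auto)
 have "K \<subseteq> {c. filterlim (%\<nu>. c \<bullet> u \<nu>) at_bot sequentially}" using Kdiv by blast
 moreover have "convex {c. filterlim (%\<nu>. c \<bullet> u \<nu>) at_bot sequentially}"
  unfolding convex_def
 proof (intro ballI allI impI CollectI)
  fix x y and s t :: real
  assume xy: "x \<in> {c. filterlim (%\<nu>. c \<bullet> u \<nu>) at_bot sequentially}" "y \<in> {c. filterlim (%\<nu>. c \<bullet> u \<nu>) at_bot sequentially}"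
   and st: "0 \<le> s" "0 \<le> t" "s + t = 1"
  show "filterlim (%\<nu>. (s *\<^sub>R x + t *\<^sub>R y) \<bullet> u \<nu>) at_bot sequentially"
   unfolding filterlim_at_bot
  proof
   fix Z :: real
   have "\<forall>\<^sub>F \<nu> in sequentially. x \<bullet> u \<nu> \<le> Z" "\<forall>\<^sub>F \<nu> in sequentially. y \<bullet> u \<nu> \<le> Z"
    using xy by (auto simp: filterlim_at_bot)
   then show "\<forall>\<^sub>F \<nu> in sequentially. (s *\<^sub>R x + t *\<^sub>R y) \<bullet> u \<nu> \<le> Z"
   proof eventually_elim
    case (elim \<nu>)
    have "s * (x \<bullet> u \<nu>) + t * (y \<bullet> u \<nu>) \<le> s * Z + t * Z"
     using elim st by (intro add_mono mult_left_mono) auto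
    also have "\<dots> = Z" using st by (metis distrib_right mult_1)
    finally show ?case by (simp add: inner_add_left)
   qed
  qed
 qed
 ultimately have hull: "convex hull K \<subseteq> {c. filterlim (%\<nu>. c \<bullet> u \<nu>) at_bot sequentially}"
  by (rule hull_minimal)
 have "?E \<inter> convex hull K = {}"
 proof (rule ccontr)
  assume "?E \<inter> convex hull K ~= {}"
  then obtain c where c: "c \<in> ?E" "c \<in> convex hull K" by blast
  from conv[OF c(1)] obtain l where "(%\<nu>. c \<bullet> u \<nu>) \<longlonglongrightarrow> l" by (auto simp: convergent_def)
  then have "\<forall>\<^sub>F \<nu> in sequentially. l - 1 < c \<bullet> u \<nu>" by (rule order_tendstoD) simp
  moreover have "\<forall>\<^sub>F \<nu> in sequentially. c \<bullet> u \<nu> \<le> l - 1"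
   using hull c(2) by (auto simp: filterlim_at_bot)
  ultimately have "\<forall>\<^sub>F \<nu> in sequentially. False" by eventually_elim linarith
  then show False by simp
 qed
 then obtain w b where w: "\<forall>x\<in>?E. w \<bullet> x < b" "\<forall>x\<in>convex hull K. w \<bullet> x > b"
  using separating_hyperplane_closed_compact[of ?E "convex hull K"] K
  by (auto simp: closed_span subspace_imp_convex finite_imp_compact_convex_hull)
 have b: "0 < b" using w(1)[rule_format, OF Real_Vector_Spaces.span_zero] by simp
 show thesis
 proof
  show "0 < w \<bullet> c" if "c \<in> K" for c
   using w(2)[rule_format, OF hull_inc[OF that]] b by linarith
  fix e assume e: "e \<in> E"
  show "w \<bullet> e = 0"
  proof (rule ccontr)
   assume nz: "w \<bullet> e ~= 0"
   have "(b / (w \<bullet> e)) *\<^sub>R e \<in> ?E" by (intro Real_Vector_Spaces.span_scale Real_Vector_Spaces.span_base e)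
   from w(1)[rule_format, OF this] nz show False by simp
  qed
 qed
qed

text \<open>Values that converge on a set \<open>E\<close> of vectors are taken in the limit by one functional.\<close>

lemma limit_functional:
 fixes u :: "nat => 'a::euclidean_space"
 assumes E: "\<And>e. e \<in> E ==> convergent (%\<nu>. e \<bullet> u \<nu>)"
 obtains p where "\<And>e. e \<in> E ==> (%\<nu>. e \<bullet> u \<nu>) \<longlonglongrightarrow> e \<bullet> p"
proof -
 let ?E = "Real_Vector_Spaces.span E"
 have conv: "convergent (%\<nu>. e \<bullet> u \<nu>)" if "e \<in> ?E" for e
  by (rule convergent_inner_span[of E u]) (use E that in auto)
 obtain B where B: "B \<subseteq> ?E" "pairwise real_inner_class.orthogonal B" "\<And>x. x \<in> B ==> norm x = 1"
  "Real_Vector_Spaces.span B = ?E" "finite B"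
  using orthonormal_basis_subspace[of ?E] independent_imp_finite by (metis Real_Vector_Spaces.subspace_span)
 define p where "p = (\<Sum>b\<in>B. lim (%\<nu>. b \<bullet> u \<nu>) *\<^sub>R b)"
 show thesis
 proof
  fix e assume "e \<in> E"
  then have e: "e \<in> Real_Vector_Spaces.span B" using B(4) by (simp add: Real_Vector_Spaces.span_base)
  have e_eq: "e = (\<Sum>b\<in>B. (b \<bullet> e) *\<^sub>R b)"
   using orthonormal_basis_expand[OF B(2,3) e B(5)] by (simp add: inner_commute)
  have lim: "(%\<nu>. b \<bullet> u \<nu>) \<longlonglongrightarrow> lim (%\<nu>. b \<bullet> u \<nu>)" if "b \<in> B" for b
   using conv[of b] that B(1) by (auto simp: convergent_LIMSEQ_iff)
  have "(%\<nu>. \<Sum>b\<in>B. (b \<bullet> e) * (b \<bullet> u \<nu>)) \<longlonglongrightarrow> (\<Sum>b\<in>B. (b \<bullet> e) * lim (%\<nu>. b \<bullet> u \<nu>))"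
   by (intro tendsto_intros lim)
  moreover have "(\<Sum>b\<in>B. (b \<bullet> e) * (b \<bullet> u \<nu>)) = e \<bullet> u \<nu>" for \<nu>
   by (subst (2) e_eq) (simp add: inner_sum_left)
  moreover have "(\<Sum>b\<in>B. (b \<bullet> e) * lim (%\<nu>. b \<bullet> u \<nu>)) = e \<bullet> p"
   by (simp add: p_def inner_sum_right inner_commute mult.commute)
  ultimately show "(%\<nu>. e \<bullet> u \<nu>) \<longlonglongrightarrow> e \<bullet> p" by simp
 qed
qed


lemma constant_maximizer:
 fixes f :: "'b => nat => real"
 assumes "finite P" "P ~= {}"
 obtains r a where "strict_mono (r :: nat => nat)" "a \<in> P" "\<And>\<nu> b. b \<in> P ==> f b (r \<nu>) \<le> f a (r \<nu>)"
proof -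
 have "\<exists>a\<in>P. \<forall>b\<in>P. f b \<nu> \<le> f a \<nu>" for \<nu>
 proof -
  have "Max ((%b. f b \<nu>) ` P) \<in> (%b. f b \<nu>) ` P" using assms by (intro Max_in) auto
  then obtain a where "a \<in> P" "Max ((%b. f b \<nu>) ` P) = f a \<nu>" by auto
  then show ?thesis using assms by (metis Max_ge finite_imageI imageI)
 qed
 then obtain g where g: "\<And>\<nu>. g \<nu> \<in> P" "\<And>\<nu> b. b \<in> P ==> f b \<nu> \<le> f (g \<nu>) \<nu>" by metis
 have "finite (range g)" using g(1) assms(1) by (meson finite_subset image_subsetI)
 then obtain \<nu>0 where "infinite {\<nu> \<in> UNIV. g \<nu> = g \<nu>0}"
  using pigeonhole_infinite[OF infinite_UNIV_nat] by blast
 from infinite_enumerate[OF this] obtain r :: "nat => nat" where r: "strict_mono r" "\<And>\<nu>. g (r \<nu>) = g \<nu>0"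
  by blast
 have "f b (r \<nu>) \<le> f (g \<nu>0) (r \<nu>)" if "b \<in> P" for b \<nu>
  using g(2)[OF that, of "r \<nu>"] by (simp only: r(2))
 then show thesis by (rule that[OF r(1) g(1)[of \<nu>0]])
qed

lemma continuous_monomial: "continuous_on UNIV (monomial_Cn a)"
 unfolding monomial_Cn_def by (intro continuous_intros)

text \<open>The logarithms of quotients of monomials converge or tend to \<open>-\<infinity>\<close> along a
 subsequence; the weight separates the two kinds, and the point \<open>y\<close> realises the finite limits and
 the limits of the phases.\<close>

lemma torus_limit:
 fixes P :: "nat => (nat^'m::finite) set" and x :: "nat => complex^'m"
 assumes P: "\<And>j. j < k ==> finite (P j)" "\<And>j. j < k ==> P j ~= {}"
  and x: "\<And>\<nu>. x \<nu> \<in> complex_torus" "x \<longlonglongrightarrow> 0"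
 obtains r w y a where "strict_mono (r :: nat => nat)" "\<And>i. 0 < w $ i" "y \<in> complex_torus"
  "\<And>j. j < k ==> a j \<in> P j" "\<And>j b. j < k ==> b \<in> P j ==> w \<bullet> lattice_point (a j) \<le> w \<bullet> lattice_point b"
  "\<And>j b \<nu>. j < k ==> b \<in> P j ==> norm (monomial_Cn b (x (r \<nu>))) \<le> norm (monomial_Cn (a j) (x (r \<nu>)))"
  "\<And>j b. j < k ==> b \<in> P j ==> (%\<nu>. monomial_Cn b (x (r \<nu>)) / monomial_Cn (a j) (x (r \<nu>))) \<longlonglongrightarrow>
    (if w \<bullet> lattice_point b = w \<bullet> lattice_point (a j) then monomial_Cn b y / monomial_Cn (a j) y else 0)"
  "\<And>j b. j < k ==> b \<in> P j ==> w \<bullet> lattice_point b = w \<bullet> lattice_point (a j) ==>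
    convergent (%\<nu>. (lattice_point b - lattice_point (a j)) \<bullet> log_abs (x (r \<nu>)))"
proof -
 let ?m = "%b \<nu>. monomial_Cn b (x \<nu>)"
 have mnz: "?m b \<nu> ~= 0" for b \<nu> by (rule monomial_nonzero[OF x(1)])
 obtain r1 :: "nat => nat" where r1: "strict_mono r1"
  "\<And>j. j \<in> {..<k} ==> \<exists>a\<in>P j. \<forall>\<nu>. \<forall>b\<in>P j. norm (?m b ((id \<circ> r1) \<nu>)) \<le> norm (?m a ((id \<circ> r1) \<nu>))"
 proof (rule common_subsequence[of "{..<k}" "%j r. \<exists>a\<in>P j. \<forall>\<nu>. \<forall>b\<in>P j. norm (?m b (r \<nu>)) \<le> norm (?m a (r \<nu>))" id])
  fix j and r :: "nat => nat" assume "j \<in> {..<k}"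
  then have "finite (P j)" "P j ~= {}" using P by auto
  from constant_maximizer[OF this, of "%b \<nu>. norm (?m b (r \<nu>))"]
  obtain r' a where R: "strict_mono (r' :: nat => nat)" "a \<in> P j"
   "\<And>\<nu> b. b \<in> P j ==> norm (?m b (r (r' \<nu>))) \<le> norm (?m a (r (r' \<nu>)))" by blast
  show "\<exists>r' :: nat => nat. strict_mono r' \<and> (\<exists>a\<in>P j. \<forall>\<nu>. \<forall>b\<in>P j. norm (?m b ((r \<circ> r') \<nu>)) \<le> norm (?m a ((r \<circ> r') \<nu>)))"
   by (rule exI[of _ r'], rule conjI[OF R(1)], rule bexI[OF _ R(2)]) (simp add: R(3))
 next
  fix j and r r' :: "nat => nat"
  assume "\<exists>a\<in>P j. \<forall>\<nu>. \<forall>b\<in>P j. norm (?m b (r \<nu>)) \<le> norm (?m a (r \<nu>))"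
  then show "\<exists>a\<in>P j. \<forall>\<nu>. \<forall>b\<in>P j. norm (?m b ((r \<circ> r') \<nu>)) \<le> norm (?m a ((r \<circ> r') \<nu>))"
   unfolding o_def by (elim bexE) (rule bexI, rule allI, erule spec)
 qed (auto simp: strict_mono_def)
 have "\<forall>j\<in>{..<k}. \<exists>a. a \<in> P j \<and> (\<forall>\<nu>. \<forall>b\<in>P j. norm (?m b (r1 \<nu>)) \<le> norm (?m a (r1 \<nu>)))"
  using r1(2) unfolding o_def id_def by (intro ballI) (simp only: Bex_def)
 from bchoice[OF this] obtain a where a0: "\<forall>j\<in>{..<k}. a j \<in> P j \<and> (\<forall>\<nu>. \<forall>b\<in>P j. norm (?m b (r1 \<nu>)) \<le> norm (?m (a j) (r1 \<nu>)))" ..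
 have a: "a j \<in> P j" "b \<in> P j ==> norm (?m b (r1 \<nu>)) \<le> norm (?m (a j) (r1 \<nu>))" if "j < k" for j b \<nu>
  using bspec[OF a0, of j] that by simp_all
 let ?q = "%j b \<nu>. ?m b \<nu> / ?m (a j) \<nu>"
 have q1: "norm (?q j b (r1 \<nu>)) \<le> 1" if "j < k" "b \<in> P j" for j b \<nu>
  using a(2)[OF that, of \<nu>] mnz[of "a j" "r1 \<nu>"] by (simp add: norm_divide)
 obtain r2 :: "nat => nat" where r2: "strict_mono r2"
  "\<And>p. p \<in> Sigma {..<k} P ==> convergent (%\<nu>. ?q (fst p) (snd p) (r1 ((id \<circ> r2) \<nu>)))"
 proof (rule common_subsequence[of "Sigma {..<k} P" "%p r. convergent (%\<nu>. ?q (fst p) (snd p) (r1 (r \<nu>)))" id])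
  show "finite (Sigma {..<k} P)" using P by auto
  fix p and r :: "nat => nat" assume "p \<in> Sigma {..<k} P"
  then have "\<forall>\<nu>. ?q (fst p) (snd p) (r1 (r \<nu>)) \<in> cball 0 1" using q1 by auto
  then obtain l r' where "strict_mono (r' :: nat => nat)" "((%\<nu>. ?q (fst p) (snd p) (r1 (r \<nu>))) \<circ> r') \<longlonglongrightarrow> l"
   using compact_imp_seq_compact[OF compact_cball[of "0::complex" 1]] by (meson seq_compactE)
  then show "\<exists>r' :: nat => nat. strict_mono r' \<and> convergent (%\<nu>. ?q (fst p) (snd p) (r1 ((r \<circ> r') \<nu>)))"
   by (intro exI[of _ r']) (auto simp: convergent_def o_def)
 next
  fix p and r r' :: "nat => nat"
  assume "convergent (%\<nu>. ?q (fst p) (snd p) (r1 (r \<nu>)))" "strict_mono r'"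
  from convergent_subseq_convergent[OF this]
  show "convergent (%\<nu>. ?q (fst p) (snd p) (r1 ((r \<circ> r') \<nu>)))" by (simp add: o_def)
 qed (auto simp: strict_mono_def)
 have phase_bd: "phase (x (r1 (r2 \<nu>))) \<in> cball 0 (CARD('m) * 1)" for \<nu>
 proof -
  have "norm (phase (x (r1 (r2 \<nu>)))) \<le> (\<Sum>i\<in>UNIV. norm (phase (x (r1 (r2 \<nu>))) $ i))"
   by (simp add: norm_vec_def L2_set_le_sum)
  then show ?thesis using polar_form(2)[OF x(1)] by simp
 qed
 obtain \<epsilon> r3 where r3: "strict_mono (r3 :: nat => nat)" "((%\<nu>. phase (x (r1 (r2 \<nu>)))) \<circ> r3) \<longlonglongrightarrow> \<epsilon>"
  using compact_imp_seq_compact[OF compact_cball[of "0::complex^'m" "CARD('m) * 1"]] phase_bd by (meson seq_compactE)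
 define r where "r = r1 \<circ> r2 \<circ> r3"
 have r: "strict_mono r" unfolding r_def by (intro strict_mono_o r1 r2 r3)
 define X where "X = (%\<nu>. x (r \<nu>))"
 have X: "X \<nu> \<in> complex_torus" for \<nu> using x by (simp add: X_def)
 have Xlim: "X \<longlonglongrightarrow> 0" using LIMSEQ_subseq_LIMSEQ[OF x(2) r] by (simp add: X_def o_def)
 have elim: "(%\<nu>. phase (X \<nu>)) \<longlonglongrightarrow> \<epsilon>" using r3(2) by (simp add: X_def r_def o_def)
 let ?Q = "%j b \<nu>. monomial_Cn b (X \<nu>) / monomial_Cn (a j) (X \<nu>)"
 have conv: "convergent (?Q j b)" if "j < k" "b \<in> P j" for j b
 proof -
  have "convergent (%\<nu>. ?q j b (r1 (r2 \<nu>)))" using r2(2)[of "(j, b)"] that by simp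
  from convergent_subseq_convergent[OF this r3(1)] show ?thesis by (simp add: X_def r_def o_def)
 qed
 define \<zeta> where "\<zeta> = (%j b. lim (?Q j b))"
 have \<zeta>: "?Q j b \<longlonglongrightarrow> \<zeta> j b" if "j < k" "b \<in> P j" for j b
  using conv[OF that] by (simp add: \<zeta>_def convergent_LIMSEQ_iff)
 define u where "u = (%\<nu>. log_abs (X \<nu>))"
 let ?d = "%j b. lattice_point b - lattice_point (a j)"
 have pol: "monomial_Cn b (X \<nu>) = of_real (exp (u \<nu> \<bullet> lattice_point b)) * monomial_Cn b (phase (X \<nu>))" for b \<nu>
  unfolding u_def by (rule monomial_polar) (rule polar_form(1)[OF X])
 have norm_ph: "norm (monomial_Cn b (phase (X \<nu>))) = 1" for b \<nu>
  by (simp add: norm_monomial polar_form(2)[OF X])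
 have Qpol: "?Q j b \<nu> = of_real (exp (?d j b \<bullet> u \<nu>)) * (monomial_Cn b (phase (X \<nu>)) / monomial_Cn (a j) (phase (X \<nu>)))" for j b \<nu>
  by (simp only: pol inner_commute[of "?d j b" "u \<nu>"] inner_diff_right exp_diff of_real_divide times_divide_times_eq)
 have normQ: "norm (?Q j b \<nu>) = exp (?d j b \<bullet> u \<nu>)" for j b \<nu>
  by (simp only: Qpol norm_mult norm_divide norm_ph) simp
 have dln: "?d j b \<bullet> u \<nu> = ln (norm (?Q j b \<nu>))" for j b \<nu> by (simp only: normQ ln_exp)
 define K where "K = (%(j, b). ?d j b) ` {p \<in> Sigma {..<k} P. \<zeta> (fst p) (snd p) = 0} \<union> range (%i. axis i 1)"
 define E where "E = {?d j b | j b. j < k \<and> b \<in> P j \<and> \<zeta> j b ~= 0}"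
 have "finite (Sigma {..<k} P)" using P by auto
 then have finK: "finite K" "K ~= {}" by (auto simp: K_def)
 have Kdiv: "filterlim (%\<nu>. c \<bullet> u \<nu>) at_bot sequentially" if cK: "c \<in> K" for c
 proof -
  have ln_bot: "filterlim (%\<nu>. ln (f \<nu>)) at_bot sequentially" if "f \<longlonglongrightarrow> 0" "\<And>\<nu>. 0 < f \<nu>" for f :: "nat => real"
   by (rule filterlim_compose[OF ln_at_0 tendsto_imp_filterlim_at_right[OF that(1)]]) (simp add: that(2))
  consider (1) j b where "j < k" "b \<in> P j" "\<zeta> j b = 0" "c = ?d j b" | (2) i where "c = axis i 1"
   using cK by (auto simp: K_def)
  then show ?thesis
  proof cases
   case 1
   have "(%\<nu>. norm (?Q j b \<nu>)) \<longlonglongrightarrow> 0" using tendsto_norm[OF \<zeta>[OF 1(1,2)]] 1(3) by simp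
   then have "filterlim (%\<nu>. ln (norm (?Q j b \<nu>))) at_bot sequentially"
    by (rule ln_bot) (simp only: normQ exp_gt_zero)
   then show ?thesis by (simp only: 1(4) dln)
  next
   case 2
   have "(%\<nu>. norm (X \<nu> $ i)) \<longlonglongrightarrow> norm ((0 :: complex^'m) $ i)" by (intro tendsto_intros Xlim)
   then have "filterlim (%\<nu>. ln (norm (X \<nu> $ i))) at_bot sequentially"
    using X by (intro ln_bot) (auto simp: complex_torus_def)
   then show ?thesis by (simp add: 2 u_def log_abs_def inner_axis')
  qed
 qed
 have Econv: "convergent (%\<nu>. e \<bullet> u \<nu>)" if eE: "e \<in> E" for e
 proof -
  obtain j b where jb: "j < k" "b \<in> P j" "\<zeta> j b ~= 0" "e = ?d j b" using eE by (auto simp: E_def)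
  have "(%\<nu>. ln (norm (?Q j b \<nu>))) \<longlonglongrightarrow> ln (norm (\<zeta> j b))"
   using jb by (intro tendsto_ln tendsto_norm \<zeta>) auto
  then show ?thesis unfolding jb(4) dln convergent_def by blast
 qed
 obtain w where w: "\<And>c. c \<in> K ==> 0 < w \<bullet> c" "\<And>e. e \<in> E ==> w \<bullet> e = 0"
  using separating_weight[OF finK Kdiv Econv] by blast
 obtain p where p: "\<And>e. e \<in> E ==> (%\<nu>. e \<bullet> u \<nu>) \<longlonglongrightarrow> e \<bullet> p"
  using limit_functional[OF Econv] by blast
 have norm\<epsilon>: "norm (\<epsilon> $ i) = 1" for i
 proof -
  have "(%\<nu>. norm (phase (X \<nu>) $ i)) \<longlonglongrightarrow> norm (\<epsilon> $ i)" by (intro tendsto_intros elim)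
  then show ?thesis using polar_form(2)[OF X] LIMSEQ_unique[of "%\<nu>. 1" "norm (\<epsilon> $ i)" 1] by simp
 qed
 then have \<epsilon>nz: "\<epsilon> $ i ~= 0" for i using norm_zero by (metis zero_neq_one)
 define y where "y = (\<chi> i. of_real (exp (p $ i)) * \<epsilon> $ i)"
 have ypol: "monomial_Cn b y = of_real (exp (p \<bullet> lattice_point b)) * monomial_Cn b \<epsilon>" for b
  by (rule monomial_polar) (simp add: y_def)
 have w_cases: "w \<bullet> lattice_point b = w \<bullet> lattice_point (a j) \<longleftrightarrow> \<zeta> j b ~= 0" "w \<bullet> lattice_point (a j) \<le> w \<bullet> lattice_point b"
  if jb: "j < k" "b \<in> P j" for j b
 proof -
  have "0 < w \<bullet> ?d j b" if "\<zeta> j b = 0"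
  proof (rule w(1))
   have "(j, b) \<in> {p \<in> Sigma {..<k} P. \<zeta> (fst p) (snd p) = 0}" using jb that by simp
   then show "?d j b \<in> K" unfolding K_def by (intro UnI1 image_eqI[of _ _ "(j, b)"]) auto
  qed
  moreover have "w \<bullet> ?d j b = 0" if "\<zeta> j b ~= 0"
   by (rule w(2)) (use jb that in \<open>auto simp: E_def\<close>)
  ultimately show "w \<bullet> lattice_point b = w \<bullet> lattice_point (a j) \<longleftrightarrow> \<zeta> j b ~= 0" "w \<bullet> lattice_point (a j) \<le> w \<bullet> lattice_point b"
   by (cases "\<zeta> j b = 0"; simp add: inner_diff_right)+
 qed
 have lim: "?Q j b \<longlonglongrightarrow> (if w \<bullet> lattice_point b = w \<bullet> lattice_point (a j) then monomial_Cn b y / monomial_Cn (a j) y else 0)"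
  if jb: "j < k" "b \<in> P j" for j b
 proof (cases "\<zeta> j b = 0")
  case True
  then show ?thesis using \<zeta>[OF jb] w_cases(1)[OF jb] by simp
 next
  case False
  have mlim: "(%\<nu>. monomial_Cn b (phase (X \<nu>))) \<longlonglongrightarrow> monomial_Cn b \<epsilon>" for b
   using continuous_on_tendsto_compose[OF continuous_monomial elim] by simp
  have \<epsilon>m: "monomial_Cn (a j) \<epsilon> ~= 0" by (rule monomial_nonzero) (simp add: complex_torus_def \<epsilon>nz)
  have dl: "(%\<nu>. ?d j b \<bullet> u \<nu>) \<longlonglongrightarrow> ?d j b \<bullet> p" by (rule p) (use jb False in \<open>auto simp: E_def\<close>)
  have "?Q j b \<longlonglongrightarrow> of_real (exp (?d j b \<bullet> p)) * (monomial_Cn b \<epsilon> / monomial_Cn (a j) \<epsilon>)"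
   unfolding Qpol by (intro tendsto_mult tendsto_divide tendsto_of_real tendsto_exp dl mlim \<epsilon>m)
  moreover have "of_real (exp (?d j b \<bullet> p)) * (monomial_Cn b \<epsilon> / monomial_Cn (a j) \<epsilon>) = monomial_Cn b y / monomial_Cn (a j) y"
   by (simp only: ypol inner_commute[of "?d j b" p] inner_diff_right exp_diff of_real_divide times_divide_times_eq)
  ultimately show ?thesis using w_cases(1)[OF jb] False by simp
 qed
 show thesis
 proof (rule that[of r w y a])
  show "0 < w $ i" for i using w(1)[of "axis i 1"] by (simp add: K_def inner_axis)
  show "y \<in> complex_torus" by (simp add: complex_torus_def y_def \<epsilon>nz)
  fix j b assume jb: "j < k" "b \<in> P j"
  show "norm (monomial_Cn b (x (r \<nu>))) \<le> norm (monomial_Cn (a j) (x (r \<nu>)))" for \<nu>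
   using a(2)[OF jb] by (simp add: r_def)
  show "(%\<nu>. monomial_Cn b (x (r \<nu>)) / monomial_Cn (a j) (x (r \<nu>))) \<longlonglongrightarrow>
    (if w \<bullet> lattice_point b = w \<bullet> lattice_point (a j) then monomial_Cn b y / monomial_Cn (a j) y else 0)"
   using lim[OF jb] by (simp add: X_def)
  assume "w \<bullet> lattice_point b = w \<bullet> lattice_point (a j)"
  then have "?d j b \<in> E" using w_cases(1)[OF jb] jb by (auto simp: E_def)
  from Econv[OF this] show "convergent (%\<nu>. (lattice_point b - lattice_point (a j)) \<bullet> log_abs (x (r \<nu>)))"
   by (simp add: u_def X_def)
 qed (use r a(1) w_cases(2) in auto)
qed

section \<open>Newton polyhedra along sequences\<close>

text \<open>The shape of a Newton polyhedron, detached from a function.\<close>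

definition newton_set :: "(real^'m) set => bool" where
 "newton_set \<Delta> \<longleftrightarrow> (\<exists>S. \<Delta> = convex hull {lattice_point a + v | a v. a \<in> S \<and> (\<forall>i. 0 \<le> v $ i)})"

definition lattice_points :: "(real^'m) set => (nat^'m) set" where
 "lattice_points \<Delta> = {a. lattice_point a \<in> \<Delta>}"

lemma newton_set_add:
 assumes "newton_set \<Delta>" "v \<in> \<Delta>" "\<And>i. 0 \<le> v' $ i"
 shows "v + v' \<in> \<Delta>"
proof -
 obtain S where S: "\<Delta> = convex hull {lattice_point a + v | a v. a \<in> S \<and> (\<forall>i. 0 \<le> v $ i)}"
  using assms(1) by (auto simp: newton_set_def)
 let ?G = "{lattice_point a + v | a v. a \<in> S \<and> (\<forall>i. 0 \<le> v $ i)}"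
 have "(+) v' ` ?G \<subseteq> ?G"
 proof
  fix z assume "z \<in> (+) v' ` ?G"
  then obtain a v where "a \<in> S" "\<forall>i. 0 \<le> v $ i" "z = v' + (lattice_point a + v)" by blast
  then show "z \<in> ?G" using assms(3) by (intro CollectI exI[of _ a] exI[of _ "v' + v"]) (auto simp: add_ac)
 qed
 then have "convex hull ((+) v' ` ?G) \<subseteq> \<Delta>" unfolding S by (rule hull_mono)
 moreover have "v' + v \<in> convex hull ((+) v' ` ?G)"
  unfolding convex_hull_translation using assms(2) unfolding S by (rule imageI)
 ultimately have "v' + v \<in> \<Delta>" by (rule subsetD)
 then show ?thesis by (simp only: add.commute)
qed

lemma newton_set_halfspace:
 assumes "newton_set \<Delta>" and w: "\<And>i. 0 \<le> w $ i" and b: "\<And>a. a \<in> lattice_points \<Delta> ==> c \<le> w \<bullet> lattice_point a"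
  and v: "v \<in> \<Delta>"
 shows "c \<le> (w :: real^'m::finite) \<bullet> v"
proof -
 obtain S where S: "\<Delta> = convex hull {lattice_point a + v | a v. a \<in> S \<and> (\<forall>i. 0 \<le> v $ i)}"
  using assms(1) by (auto simp: newton_set_def)
 have "{lattice_point a + v | a v. a \<in> S \<and> (\<forall>i. 0 \<le> v $ i)} \<subseteq> {v. w \<bullet> v \<ge> c}"
 proof
  fix z assume "z \<in> {lattice_point a + v | a v. a \<in> S \<and> (\<forall>i. 0 \<le> v $ i)}"
  then obtain a v where z: "a \<in> S" "\<forall>i. 0 \<le> v $ i" "z = lattice_point a + v" by blast
  have "lattice_point a + 0 \<in> {lattice_point a + v | a v. a \<in> S \<and> (\<forall>i. 0 \<le> v $ i)}"
   using z(1) by (intro CollectI exI[of _ a] exI[of _ 0]) auto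
  then have "a \<in> lattice_points \<Delta>" unfolding S lattice_points_def by (auto intro: hull_inc)
  then have "c \<le> w \<bullet> lattice_point a" by (rule b)
  moreover have "0 \<le> w \<bullet> v" using w z(2) by (auto simp: inner_vec_def intro!: sum_nonneg)
  ultimately show "z \<in> {v. w \<bullet> v \<ge> c}" by (simp add: z(3) inner_add_right)
 qed
 then have "\<Delta> \<subseteq> {v. w \<bullet> v \<ge> c}" unfolding S by (rule hull_minimal) (rule convex_halfspace_ge)
 then show ?thesis using v by blast
qed

lemma newton_set_nonneg:
 assumes "newton_set \<Delta>" "v \<in> \<Delta>"
 shows "0 \<le> (v :: real^'m::finite) $ i"
proof -
 have "0 \<le> axis i 1 \<bullet> v"
 proof (rule newton_set_halfspace[OF assms(1) _ _ assms(2)])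
  show "0 \<le> axis i (1::real) $ l" for l by (simp add: axis_def)
  show "0 \<le> axis i 1 \<bullet> lattice_point a" for a by (simp add: inner_axis' lattice_point_def)
 qed
 then show ?thesis by (simp add: inner_axis')
qed

lemma newton_set_convex: "newton_set \<Delta> ==> convex \<Delta>"
 by (auto simp: newton_set_def convex_convex_hull)

text \<open>A convenient Newton polyhedron contains a point \<open>N e\<^sub>i\<close> on each axis, so every lattice point in it
 dominates one with entries at most \<open>N\<close>.\<close>

lemma convenient_generators:
 fixes \<Delta> :: "(real^'m::finite) set"
 assumes \<Delta>: "newton_set \<Delta>" and conv: "convenient \<Delta>"
 obtains N where "\<And>i. axis i N \<in> lattice_points \<Delta>"
  "\<And>a. a \<in> lattice_points \<Delta> ==> \<exists>p\<in>lattice_points \<Delta>. (\<forall>i. p $ i \<le> N) \<and> (\<forall>i. p $ i \<le> a $ i)"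
proof -
 obtain c where c: "\<And>i. c i *\<^sub>R axis i 1 \<in> \<Delta>" using conv by (auto simp: convenient_def) metis
 define N where "N = Max (range (%i. nat \<lceil>c i\<rceil>))"
 have cN: "c i \<le> real N" for i
 proof -
  have "nat \<lceil>c i\<rceil> \<le> N" unfolding N_def by (rule Max_ge) auto
  then show ?thesis by linarith
 qed
 have ax: "axis i n \<in> lattice_points \<Delta>" if "N \<le> n" for i n
 proof -
  have "c i *\<^sub>R axis i 1 + (real n - c i) *\<^sub>R axis i 1 \<in> \<Delta>"
   using cN[of i] that by (intro newton_set_add[OF \<Delta> c]) (auto simp: axis_def intro: order_trans)
  moreover have "c i *\<^sub>R axis i 1 + (real n - c i) *\<^sub>R axis i 1 = lattice_point (axis i n :: nat^'m)"
   by (auto simp: Finite_Cartesian_Product.vec_eq_iff lattice_point_def axis_def algebra_simps)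
  ultimately show ?thesis by (simp add: lattice_points_def)
 qed
 show thesis
 proof
  show "axis i N \<in> lattice_points \<Delta>" for i by (rule ax) simp
  fix a assume a: "a \<in> lattice_points \<Delta>"
  show "\<exists>p\<in>lattice_points \<Delta>. (\<forall>i. p $ i \<le> N) \<and> (\<forall>i. p $ i \<le> a $ i)"
  proof (cases "\<forall>i. a $ i \<le> N")
   case False
   then obtain i where "N < a $ i" by (auto simp: not_le)
   then show ?thesis by (intro bexI[OF _ ax[of N i]]) (auto simp: axis_def)
  qed (use a in auto)
 qed
qed

lemma finite_bounded_vec: "finite {a :: nat^'m::finite. \<forall>i. a $ i \<le> N}"
proof (rule finite_subset)
 show "{a :: nat^'m. \<forall>i. a $ i \<le> N} \<subseteq> vec_lambda ` (PiE UNIV (%_. {..N}))"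
 proof
  fix a :: "nat^'m" assume "a \<in> {a. \<forall>i. a $ i \<le> N}"
  then show "a \<in> vec_lambda ` (PiE UNIV (%_. {..N}))" by (intro image_eqI[of _ _ "vec_nth a"]) auto
 qed
qed (intro finite_imageI finite_PiE; simp)

lemma monomial_split: "(\<And>i. p $ i \<le> a $ i) ==> monomial_Cn a x = monomial_Cn p x * monomial_Cn (a - p) x"
 by (auto simp: monomial_Cn_def prod.distrib[symmetric] power_add[symmetric] intro!: prod.cong)

text \<open>A sequence with some coordinates \<open>0\<close> is replaced by one in the torus whose new coordinates are so
 small that no limit of quotients of monomials changes.\<close>

lemma torus_replacement:
 fixes x :: "nat => complex^'m::finite"
 assumes x: "x \<longlonglongrightarrow> 0"
 obtains x' where "\<And>\<nu>. x' \<nu> \<in> complex_torus" "x' \<longlonglongrightarrow> 0" "\<And>\<nu> i. x \<nu> $ i ~= 0 ==> x' \<nu> $ i = x \<nu> $ i"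
  "\<And>\<nu> i l. x \<nu> $ i = 0 ==> x \<nu> $ l ~= 0 ==> norm (x' \<nu> $ i) \<le> norm (x \<nu> $ l) ^ (N + 1) * (1/2) ^ \<nu>"
proof -
 define m where "m = (%\<nu>. Min (insert (1/2) ((%i. norm (x \<nu> $ i)) ` {i. x \<nu> $ i ~= 0})))"
 have m: "0 < m \<nu>" for \<nu>
  unfolding m_def by (subst Min_gr_iff) auto
 have m2: "m \<nu> \<le> 1/2" for \<nu>
  unfolding m_def by (rule Min_le) auto
 have ml: "m \<nu> \<le> norm (x \<nu> $ l)" if "x \<nu> $ l ~= 0" for \<nu> l
  unfolding m_def by (rule Min_le) (use that in auto)
 define x' where "x' = (%\<nu>. \<chi> i. if x \<nu> $ i = 0 then of_real (m \<nu> ^ (N + 1) * (1/2) ^ \<nu>) else x \<nu> $ i)"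
 have tiny: "m \<nu> ^ (N + 1) * (1/2) ^ \<nu> \<le> (1/2) ^ \<nu>" for \<nu>
  using m[of \<nu>] m2[of \<nu>] by (intro mult_left_le_one_le power_le_one) auto
 show thesis
 proof
  show "x' \<nu> \<in> complex_torus" for \<nu> using m[of \<nu>] by (auto simp: x'_def complex_torus_def)
  show "x' \<longlonglongrightarrow> 0"
  proof (rule vec_tendstoI)
   fix i
   have "(%\<nu>. norm (x \<nu> $ i) + (1/2) ^ \<nu>) \<longlonglongrightarrow> norm ((0 :: complex^'m) $ i) + 0"
    by (intro tendsto_intros x LIMSEQ_power_zero) auto
   then have lim: "(%\<nu>. norm (x \<nu> $ i) + (1/2) ^ \<nu>) \<longlonglongrightarrow> 0" by simp
   have "norm (x' \<nu> $ i) \<le> norm (x \<nu> $ i) + (1/2) ^ \<nu>" for \<nu>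
    using tiny[of \<nu>] m[of \<nu>] by (auto simp: x'_def norm_mult norm_power)
   then have "(%\<nu>. x' \<nu> $ i) \<longlonglongrightarrow> 0" by (intro Lim_null_comparison[OF _ lim] always_eventually allI)
   then show "(%\<nu>. x' \<nu> $ i) \<longlonglongrightarrow> 0 $ i" by simp
  qed
  show "x' \<nu> $ i = x \<nu> $ i" if "x \<nu> $ i ~= 0" for \<nu> i using that by (simp add: x'_def)
  fix \<nu> i l assume "x \<nu> $ i = 0" "x \<nu> $ l ~= 0"
  moreover from this have "m \<nu> ^ (N + 1) \<le> norm (x \<nu> $ l) ^ (N + 1)"
   using ml[of \<nu> l] m[of \<nu>] by (intro power_mono) auto
  then have "m \<nu> ^ (N + 1) * (1/2) ^ \<nu> \<le> norm (x \<nu> $ l) ^ (N + 1) * (1/2) ^ \<nu>"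
   by (rule mult_right_mono) simp
  moreover have "norm (complex_of_real (m \<nu> ^ (N + 1) * (1/2) ^ \<nu>)) = m \<nu> ^ (N + 1) * (1/2) ^ \<nu>"
   using m[of \<nu>] by (simp only: norm_of_real) simp
  ultimately show "norm (x' \<nu> $ i) \<le> norm (x \<nu> $ l) ^ (N + 1) * (1/2) ^ \<nu>"
   unfolding x'_def by simp
 qed
qed


text \<open>The limits of a sequence in \<open>\<complex>\<^sup>m - {0}\<close> that tends to \<open>0\<close>: along a subsequence all monomials
 with exponents in the polyhedra \<open>\<Delta> j\<close>, scaled by \<open>\<sigma> j\<close>, tend to their values at a point \<open>y\<close> of the torus,
 or to \<open>0\<close> off the faces on which a positive weight \<open>w\<close> is minimal.  The last conclusion is what remains
 of Euler's relation in the limit.\<close>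

lemma newton_limit:
 fixes \<Delta> :: "nat => (real^'m::finite) set" and x :: "nat => complex^'m"
 assumes \<Delta>: "\<And>j. j < k ==> newton_set (\<Delta> j)" "\<And>j. j < k ==> convenient (\<Delta> j)"
  and x: "x \<longlonglongrightarrow> 0" "\<And>\<nu>. x \<nu> ~= 0"
 obtains r w y \<sigma> \<mu> N e where "strict_mono (r :: nat => nat)" "\<And>i. 0 < w $ i" "y \<in> complex_torus"
  "\<And>j \<nu>. \<sigma> j \<nu> ~= (0 :: complex)"
  "\<And>j. j < k ==> \<exists>a\<in>lattice_points (\<Delta> j). w \<bullet> lattice_point a = \<mu> j"
  "\<And>j v. j < k ==> v \<in> \<Delta> j ==> \<mu> j \<le> w \<bullet> v"
  "\<And>j a. j < k ==> a \<in> lattice_points (\<Delta> j) ==> (%\<nu>. monomial_Cn a (x (r \<nu>)) / \<sigma> j \<nu>) \<longlonglongrightarrow>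
    (if w \<bullet> lattice_point a = \<mu> j then monomial_Cn a y else 0)"
  "\<And>j a. j < k ==> a \<in> lattice_points (\<Delta> j) ==> \<exists>p. (\<forall>i. p $ i \<le> N) \<and> (\<forall>i. p $ i \<le> a $ i) \<and>
    (\<forall>\<nu>. norm (monomial_Cn p (x (r \<nu>)) / \<sigma> j \<nu>) \<le> real N)"
  "(%\<nu>. x (r \<nu>) /\<^sub>R norm (x (r \<nu>))) \<longlonglongrightarrow> e"
  "\<And>q :: nat => nat^'m => complex. (\<And>j. j < k ==> (\<Sum>a | a \<in> lattice_points (\<Delta> j) \<and> w \<bullet> lattice_point a = \<mu> j. q j a) = 0) ==>
    (\<And>i. e $ i = 0 ==> (\<Sum>j<k. \<Sum>a | a \<in> lattice_points (\<Delta> j) \<and> w \<bullet> lattice_point a = \<mu> j. q j a * of_nat (a $ i)) = 0) ==>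
    (\<Sum>i\<in>UNIV. \<Sum>j<k. \<Sum>a | a \<in> lattice_points (\<Delta> j) \<and> w \<bullet> lattice_point a = \<mu> j. q j a * of_nat (a $ i)) = 0"
proof -
 let ?L = "%j. lattice_points (\<Delta> j)"
 have "\<forall>j\<in>{..<k}. \<exists>N. (\<forall>i. axis i N \<in> ?L j) \<and> (\<forall>a\<in>?L j. \<exists>p\<in>?L j. (\<forall>i. p $ i \<le> N) \<and> (\<forall>i. p $ i \<le> a $ i))"
 proof
  fix j assume "j \<in> {..<k}"
  then have j: "j < k" by simp
  show "\<exists>N. (\<forall>i. axis i N \<in> ?L j) \<and> (\<forall>a\<in>?L j. \<exists>p\<in>?L j. (\<forall>i. p $ i \<le> N) \<and> (\<forall>i. p $ i \<le> a $ i))"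
  proof (rule convenient_generators[OF \<Delta>(1)[OF j] \<Delta>(2)[OF j]])
   fix N assume h: "\<And>i. axis i N \<in> ?L j"
    "\<And>a. a \<in> ?L j ==> \<exists>p\<in>?L j. (\<forall>i. p $ i \<le> N) \<and> (\<forall>i. p $ i \<le> a $ i)"
   show ?thesis by (rule exI[of _ N], intro conjI allI ballI h)
  qed
 qed
 from bchoice[OF this] obtain Nj where Nj0: "\<forall>j\<in>{..<k}. (\<forall>i. axis i (Nj j) \<in> ?L j) \<and>
   (\<forall>a\<in>?L j. \<exists>p\<in>?L j. (\<forall>i. p $ i \<le> Nj j) \<and> (\<forall>i. p $ i \<le> a $ i))" ..
 have Nj: "axis i (Nj j) \<in> ?L j" "a \<in> ?L j ==> \<exists>p\<in>?L j. (\<forall>i. p $ i \<le> Nj j) \<and> (\<forall>i. p $ i \<le> a $ i)" if "j < k" for j i a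
  using bspec[OF Nj0, of j] that by simp_all
 define N0 where "N0 = Max (insert 0 (Nj ` {..<k}))"
 have N0: "Nj j \<le> N0" if "j < k" for j unfolding N0_def by (rule Max_ge) (use that in auto)
 define P where "P = (%j. {p \<in> ?L j. \<forall>i. p $ i \<le> N0})"
 have P: "finite (P j)" "P j ~= {}" "axis i (Nj j) \<in> P j" if "j < k" for j i
 proof -
  show "finite (P j)" unfolding P_def by (rule finite_subset[OF _ finite_bounded_vec[of N0]]) auto
  show ax: "axis i (Nj j) \<in> P j" for i using Nj(1)[OF that] N0[OF that] by (auto simp: P_def axis_def)
  show "P j ~= {}" using ax by blast
 qed
 have gen: "\<exists>p\<in>P j. \<forall>i. p $ i \<le> a $ i" if ja: "j < k" "a \<in> ?L j" for j a
 proof -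
  from Nj(2)[OF ja] obtain p where p: "p \<in> ?L j" "\<forall>i. p $ i \<le> Nj j" "\<forall>i. p $ i \<le> a $ i" by (elim bexE conjE)
  have "p $ i \<le> N0" for i using p(2)[rule_format, of i] N0[OF ja(1)] by (rule order_trans)
  then have "p \<in> P j" using p(1) by (simp add: P_def)
  then show ?thesis using p(3) by (rule bexI[rotated])
 qed
 obtain r0 e where r0: "strict_mono (r0 :: nat => nat)" "((%\<nu>. x \<nu> /\<^sub>R norm (x \<nu>)) \<circ> r0) \<longlonglongrightarrow> e"
 proof -
  have "\<forall>\<nu>. x \<nu> /\<^sub>R norm (x \<nu>) \<in> cball 0 1" using x(2) by simp
  then show thesis
   using compact_imp_seq_compact[OF compact_cball[of "0::complex^'m" 1]] that by (meson seq_compactE)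
 qed
 define X0 where "X0 = (%\<nu>. x (r0 \<nu>))"
 have X0: "X0 \<longlonglongrightarrow> 0" using LIMSEQ_subseq_LIMSEQ[OF x(1) r0(1)] by (simp add: X0_def o_def)
 obtain x' where x': "\<And>\<nu>. x' \<nu> \<in> complex_torus" "x' \<longlonglongrightarrow> 0" "\<And>\<nu> i. X0 \<nu> $ i ~= 0 ==> x' \<nu> $ i = X0 \<nu> $ i"
  "\<And>\<nu> i l. X0 \<nu> $ i = 0 ==> X0 \<nu> $ l ~= 0 ==> norm (x' \<nu> $ i) \<le> norm (X0 \<nu> $ l) ^ (N0 + 1) * (1/2) ^ \<nu>"
  by (rule torus_replacement[OF X0, of N0]) (assumption | rule that)+
 obtain r1 w y a where r1: "strict_mono (r1 :: nat => nat)" and w: "\<And>i. 0 < w $ i" and y: "y \<in> complex_torus"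
  and a: "\<And>j. j < k ==> a j \<in> P j" "\<And>j b. j < k ==> b \<in> P j ==> w \<bullet> lattice_point (a j) \<le> w \<bullet> lattice_point b"
  and dom: "\<And>j b \<nu>. j < k ==> b \<in> P j ==> norm (monomial_Cn b (x' (r1 \<nu>))) \<le> norm (monomial_Cn (a j) (x' (r1 \<nu>)))"
  and lim: "\<And>j b. j < k ==> b \<in> P j ==> (%\<nu>. monomial_Cn b (x' (r1 \<nu>)) / monomial_Cn (a j) (x' (r1 \<nu>))) \<longlonglongrightarrow>
    (if w \<bullet> lattice_point b = w \<bullet> lattice_point (a j) then monomial_Cn b y / monomial_Cn (a j) y else 0)"
  and cv: "\<And>j b. j < k ==> b \<in> P j ==> w \<bullet> lattice_point b = w \<bullet> lattice_point (a j) ==>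
    convergent (%\<nu>. (lattice_point b - lattice_point (a j)) \<bullet> log_abs (x' (r1 \<nu>)))"
  by (rule torus_limit[of k P x', OF P(1,2) x'(1,2)]) (assumption | rule that)+
 define r where "r = r0 \<circ> r1"
 have r: "strict_mono r" unfolding r_def by (rule strict_mono_o[OF r0(1) r1])
 define X where "X = (%\<nu>. X0 (r1 \<nu>))"
 define X' where "X' = (%\<nu>. x' (r1 \<nu>))"
 have Xr: "X \<nu> = x (r \<nu>)" for \<nu> by (simp add: X_def X0_def r_def)
 have Xlim: "X \<longlonglongrightarrow> 0" using LIMSEQ_subseq_LIMSEQ[OF X0 r1] by (simp add: X_def o_def)
 have X'lim: "X' \<longlonglongrightarrow> 0" using LIMSEQ_subseq_LIMSEQ[OF x'(2) r1] by (simp add: X'_def o_def)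
 have X't: "X' \<nu> \<in> complex_torus" for \<nu> using x'(1) by (simp add: X'_def)
 have X'X: "X' \<nu> $ i = X \<nu> $ i" if "X \<nu> $ i ~= 0" for \<nu> i using x'(3) that by (simp add: X_def X'_def)
 have r1_ge: "\<nu> \<le> r1 \<nu>" for \<nu> using r1 by (rule strict_mono_imp_increasing)
 have tiny: "norm (X' \<nu> $ i) \<le> norm (X \<nu> $ l) ^ (N0 + 1) * (1/2) ^ \<nu>" if "X \<nu> $ i = 0" "X \<nu> $ l ~= 0" for \<nu> i l
 proof -
  have "norm (X' \<nu> $ i) \<le> norm (X \<nu> $ l) ^ (N0 + 1) * (1/2) ^ r1 \<nu>"
   using x'(4) that by (simp add: X_def X'_def)
  also have "\<dots> \<le> norm (X \<nu> $ l) ^ (N0 + 1) * (1/2) ^ \<nu>"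
   by (intro mult_left_mono power_decreasing r1_ge) auto
  finally show ?thesis .
 qed
 have X_le: "norm (X \<nu> $ i) \<le> norm (X' \<nu> $ i)" for \<nu> i by (cases "X \<nu> $ i = 0") (auto simp: X'X)
 have m_le: "norm (monomial_Cn b (X \<nu>)) \<le> norm (monomial_Cn b (X' \<nu>))" for b \<nu>
  unfolding norm_monomial by (intro prod_mono conjI power_mono X_le) auto
 have small: "\<forall>\<^sub>F \<nu> in sequentially. \<forall>i. norm (X' \<nu> $ i) \<le> 1"
 proof -
  have "\<forall>\<^sub>F \<nu> in sequentially. norm (X' \<nu>) < 1"
   using tendsto_norm[OF X'lim] by (intro order_tendstoD) auto
  then show ?thesis by eventually_elim (intro allI, rule order_trans[OF Finite_Cartesian_Product.norm_nth_le less_imp_le])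
 qed
 define \<mu> where "\<mu> = (%j. w \<bullet> lattice_point (a j))"
 define \<sigma> where "\<sigma> = (%j \<nu>. monomial_Cn (a j) (X' \<nu>) / monomial_Cn (a j) y)"
 have ynz: "monomial_Cn b y ~= 0" for b by (rule monomial_nonzero[OF y])
 have \<sigma>nz: "\<sigma> j \<nu> ~= 0" for j \<nu> using ynz monomial_nonzero[OF X't] by (simp add: \<sigma>_def)
 have \<mu>min: "\<mu> j \<le> w \<bullet> lattice_point b" if jb: "j < k" "b \<in> ?L j" for j b
 proof -
  obtain p where p: "p \<in> P j" "\<And>i. p $ i \<le> b $ i" using gen[OF jb] by blast
  have "\<mu> j \<le> w \<bullet> lattice_point p" using a(2)[OF jb(1) p(1)] by (simp add: \<mu>_def)
  also have "\<dots> \<le> w \<bullet> lattice_point b"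
   unfolding inner_lattice by (intro sum_mono mult_left_mono) (use p w in \<open>auto intro: less_imp_le\<close>)
  finally show ?thesis .
 qed
 have face_in_P: "b \<in> P j" if jb: "j < k" "b \<in> ?L j" "w \<bullet> lattice_point b = \<mu> j" for j b
 proof -
  obtain p where p: "p \<in> P j" "\<And>i. p $ i \<le> b $ i" using gen[OF jb(1,2)] by blast
  have "p $ i = b $ i" for i
  proof (rule ccontr)
   assume "p $ i ~= b $ i"
   then have "p $ i < b $ i" using p(2)[of i] by simp
   then have "w \<bullet> lattice_point p < w \<bullet> lattice_point b"
    unfolding inner_lattice using p w by (intro sum_strict_mono_ex1) (auto intro!: exI[of _ i] less_imp_le mult_left_mono)
   then show False using \<mu>min[OF jb(1), of p] p(1) jb(3) by (simp add: P_def)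
  qed
  then have "p = b" by (simp add: Finite_Cartesian_Product.vec_eq_iff)
  then show ?thesis using p by simp
 qed
 have limX': "(%\<nu>. monomial_Cn b (X' \<nu>) / \<sigma> j \<nu>) \<longlonglongrightarrow> (if w \<bullet> lattice_point b = \<mu> j then monomial_Cn b y else 0)"
  if jb: "j < k" "b \<in> P j" for j b
 proof -
  have "(%\<nu>. monomial_Cn b (X' \<nu>) / monomial_Cn (a j) (X' \<nu>) * monomial_Cn (a j) y) \<longlonglongrightarrow>
    (if w \<bullet> lattice_point b = w \<bullet> lattice_point (a j) then monomial_Cn b y / monomial_Cn (a j) y else 0) * monomial_Cn (a j) y"
   unfolding X'_def by (intro tendsto_mult_right lim jb)
  moreover have "(if w \<bullet> lattice_point b = w \<bullet> lattice_point (a j) then monomial_Cn b y / monomial_Cn (a j) y else 0) * monomial_Cn (a j) y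
    = (if w \<bullet> lattice_point b = \<mu> j then monomial_Cn b y else 0)"
   using ynz by (simp add: \<mu>_def)
  moreover have "monomial_Cn b (X' \<nu>) / monomial_Cn (a j) (X' \<nu>) * monomial_Cn (a j) y = monomial_Cn b (X' \<nu>) / \<sigma> j \<nu>" for \<nu>
   by (simp add: \<sigma>_def)
  ultimately show ?thesis by simp
 qed
 have bdX': "norm (monomial_Cn b (X' \<nu>) / \<sigma> j \<nu>) \<le> norm (monomial_Cn (a j) y)" if jb: "j < k" "b \<in> P j" for j b \<nu>
 proof -
  have "norm (monomial_Cn b (X' \<nu>)) / norm (monomial_Cn (a j) (X' \<nu>)) \<le> 1"
   using dom[OF jb, of \<nu>] monomial_nonzero[OF X't] by (simp add: X'_def)
  then have "norm (monomial_Cn b (X' \<nu>)) / norm (monomial_Cn (a j) (X' \<nu>)) * norm (monomial_Cn (a j) y) \<le> 1 * norm (monomial_Cn (a j) y)"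
   by (intro mult_right_mono) auto
  then show ?thesis by (simp add: \<sigma>_def norm_divide norm_mult)
 qed
 \<comment> \<open>a monomial that vanishes at \<open>X \<nu>\<close> is negligible at \<open>X' \<nu>\<close>\<close>
 have negl: "\<forall>\<^sub>F \<nu> in sequentially. norm (monomial_Cn b (X \<nu>) / \<sigma> j \<nu> - monomial_Cn b (X' \<nu>) / \<sigma> j \<nu>) \<le> norm (monomial_Cn (a j) y) * (1/2) ^ \<nu>"
  if jb: "j < k" "b \<in> P j" for j b
  using small
 proof eventually_elim
  case (elim \<nu>)
  show ?case
  proof (cases "\<exists>i. X \<nu> $ i = 0 \<and> 0 < b $ i")
   case False
   then have "monomial_Cn b (X \<nu>) = monomial_Cn b (X' \<nu>)"
    unfolding monomial_Cn_def by (intro prod.cong refl) (metis X'X gr0I power_0)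
   then show ?thesis by simp
  next
   case True
   then obtain i where i: "X \<nu> $ i = 0" "0 < b $ i" by blast
   have "X \<nu> ~= 0" using x(2) by (simp add: Xr)
   then obtain l where l: "X \<nu> $ l ~= 0" by (auto simp: Finite_Cartesian_Product.vec_eq_iff)
   have "monomial_Cn b (X \<nu>) = 0" using i by (auto simp: monomial_Cn_def)
   moreover have "norm (monomial_Cn b (X' \<nu>)) \<le> norm (X' \<nu> $ i)"
   proof -
    have "norm (monomial_Cn b (X' \<nu>)) = norm (X' \<nu> $ i) ^ (b $ i) * (\<Prod>i\<in>UNIV - {i}. norm (X' \<nu> $ i) ^ (b $ i))"
     unfolding norm_monomial by (rule prod.remove) auto
    also have "\<dots> \<le> norm (X' \<nu> $ i) ^ (b $ i) * 1"
     using elim by (intro mult_left_mono prod_le_1) (auto intro: power_le_one)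
    also have "\<dots> \<le> norm (X' \<nu> $ i) ^ 1 * 1"
     using elim i by (intro mult_right_mono power_decreasing) auto
    finally show ?thesis by simp
   qed
   moreover have "norm (X' \<nu> $ i) \<le> norm (monomial_Cn (axis l (Nj j)) (X' \<nu>)) * (1/2) ^ \<nu>"
   proof -
    have "norm (monomial_Cn (axis l (Nj j)) (X' \<nu>)) = norm (X' \<nu> $ l) ^ Nj j"
    proof -
     have "monomial_Cn (axis l (Nj j)) (X' \<nu>) = (\<Prod>i\<in>UNIV. if i = l then (X' \<nu> $ l) ^ Nj j else 1)"
      unfolding monomial_Cn_def by (rule prod.cong) (auto simp: axis_def)
     then show ?thesis by (simp add: norm_power)
    qed
    moreover have "norm (X \<nu> $ l) ^ (N0 + 1) \<le> norm (X' \<nu> $ l) ^ Nj j"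
     unfolding X'X[OF l] using elim[rule_format, of l] X'X[OF l] N0[OF jb(1)] by (intro power_decreasing) auto
    ultimately have "norm (X \<nu> $ l) ^ (N0 + 1) \<le> norm (monomial_Cn (axis l (Nj j)) (X' \<nu>))" by (simp only:)
    then have "norm (X \<nu> $ l) ^ (N0 + 1) * (1/2) ^ \<nu> \<le> norm (monomial_Cn (axis l (Nj j)) (X' \<nu>)) * (1/2) ^ \<nu>"
     by (rule mult_right_mono) simp
    with tiny[OF i(1) l] show ?thesis by (rule order_trans)
   qed
   ultimately have "norm (monomial_Cn b (X \<nu>) - monomial_Cn b (X' \<nu>)) \<le> norm (monomial_Cn (axis l (Nj j)) (X' \<nu>)) * (1/2) ^ \<nu>"
    by simp
   then have "norm (monomial_Cn b (X \<nu>) - monomial_Cn b (X' \<nu>)) / norm (\<sigma> j \<nu>) \<le> norm (monomial_Cn (axis l (Nj j)) (X' \<nu>)) * (1/2) ^ \<nu> / norm (\<sigma> j \<nu>)"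
    by (rule divide_right_mono) simp
   also have "\<dots> = norm (monomial_Cn (axis l (Nj j)) (X' \<nu>) / \<sigma> j \<nu>) * (1/2) ^ \<nu>" by (simp add: norm_divide)
   also have "\<dots> \<le> norm (monomial_Cn (a j) y) * (1/2) ^ \<nu>"
    by (intro mult_right_mono bdX' jb P(3)) auto
   finally show ?thesis by (simp add: norm_divide[symmetric] diff_divide_distrib)
  qed
 qed
 have limP: "(%\<nu>. monomial_Cn b (X \<nu>) / \<sigma> j \<nu>) \<longlonglongrightarrow> (if w \<bullet> lattice_point b = \<mu> j then monomial_Cn b y else 0)"
  if jb: "j < k" "b \<in> P j" for j b
 proof -
  have "(%\<nu>. norm (monomial_Cn (a j) y) * (1/2) ^ \<nu>) \<longlonglongrightarrow> norm (monomial_Cn (a j) y) * 0"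
   by (intro tendsto_mult_left LIMSEQ_power_zero) auto
  then have "(%\<nu>. monomial_Cn b (X \<nu>) / \<sigma> j \<nu> - monomial_Cn b (X' \<nu>) / \<sigma> j \<nu>) \<longlonglongrightarrow> 0"
   by (intro Lim_null_comparison[OF negl[OF jb]]) simp
  from tendsto_add[OF this limX'[OF jb]] show ?thesis by simp
 qed
 have bdP: "norm (monomial_Cn b (X \<nu>) / \<sigma> j \<nu>) \<le> norm (monomial_Cn (a j) y)" if jb: "j < k" "b \<in> P j" for j b \<nu>
  using order_trans[OF divide_right_mono[OF m_le[of b \<nu>], of "norm (\<sigma> j \<nu>)"]] bdX'[OF jb, of \<nu>] by (simp add: norm_divide)
 define N where "N = Max (insert N0 ((%j. nat \<lceil>norm (monomial_Cn (a j) y)\<rceil>) ` {..<k}))"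
 have N: "N0 \<le> N" unfolding N_def by (rule Max_ge) auto
 have NC: "norm (monomial_Cn (a j) y) \<le> real N" if "j < k" for j
 proof -
  have "nat \<lceil>norm (monomial_Cn (a j) y)\<rceil> \<le> N" unfolding N_def by (rule Max_ge) (use that in auto)
  then show ?thesis by linarith
 qed
 have limL: "(%\<nu>. monomial_Cn b (X \<nu>) / \<sigma> j \<nu>) \<longlonglongrightarrow> (if w \<bullet> lattice_point b = \<mu> j then monomial_Cn b y else 0)"
  if jb: "j < k" "b \<in> ?L j" for j b
 proof (cases "b \<in> P j")
  case False
  obtain p where p: "p \<in> P j" "\<And>i. p $ i \<le> b $ i" using gen[OF jb] by blast
  have "p ~= b" using p False by auto
  then obtain l where l: "p $ l ~= b $ l" by (auto simp: Finite_Cartesian_Product.vec_eq_iff)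
  have "monomial_Cn (b - p) 0 = 0" unfolding monomial_Cn_def
   using l p(2)[of l] by (auto simp: intro!: exI[of _ l])
  then have "(%\<nu>. monomial_Cn (b - p) (X \<nu>)) \<longlonglongrightarrow> 0"
   using continuous_on_tendsto_compose[OF continuous_monomial Xlim, of "b - p"] by simp
  then have "(%\<nu>. monomial_Cn p (X \<nu>) / \<sigma> j \<nu> * monomial_Cn (b - p) (X \<nu>)) \<longlonglongrightarrow>
    (if w \<bullet> lattice_point p = \<mu> j then monomial_Cn p y else 0) * 0"
   by (intro tendsto_mult limP jb(1) p(1))
  moreover have "w \<bullet> lattice_point b ~= \<mu> j" using face_in_P[OF jb] False by blast
  ultimately show ?thesis by (simp add: monomial_split[OF p(2)])
 qed (use limP jb in blast)
 show thesis
 proof (rule that[of r w y \<sigma> \<mu> N e])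
  show "\<exists>a\<in>?L j. w \<bullet> lattice_point a = \<mu> j" if "j < k" for j
   using a(1)[OF that] by (intro bexI[of _ "a j"]) (auto simp: \<mu>_def P_def)
  show "\<mu> j \<le> w \<bullet> v" if "j < k" "v \<in> \<Delta> j" for j v
   by (rule newton_set_halfspace[OF \<Delta>(1)[OF that(1)] _ _ that(2)]) (use w \<mu>min that in \<open>auto intro: less_imp_le\<close>)
  show "(%\<nu>. monomial_Cn b (x (r \<nu>)) / \<sigma> j \<nu>) \<longlonglongrightarrow> (if w \<bullet> lattice_point b = \<mu> j then monomial_Cn b y else 0)"
   if "j < k" "b \<in> ?L j" for j b
   using limL[OF that] by (simp add: Xr)
  show "\<exists>p. (\<forall>i. p $ i \<le> N) \<and> (\<forall>i. p $ i \<le> b $ i) \<and> (\<forall>\<nu>. norm (monomial_Cn p (x (r \<nu>)) / \<sigma> j \<nu>) \<le> real N)"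
   if jb: "j < k" "b \<in> ?L j" for j b
  proof -
   obtain p where p: "p \<in> P j" "\<And>i. p $ i \<le> b $ i" using gen[OF jb] by blast
   have "p $ i \<le> N" for i using p(1) N by (auto simp: P_def intro: order_trans)
   moreover have "norm (monomial_Cn p (x (r \<nu>)) / \<sigma> j \<nu>) \<le> real N" for \<nu>
    using order_trans[OF bdP[OF jb(1) p(1), of \<nu>] NC[OF jb(1)]] by (simp add: Xr)
   ultimately show ?thesis using p(2) by (intro exI[of _ p] conjI allI)
  qed
  show elim: "(%\<nu>. x (r \<nu>) /\<^sub>R norm (x (r \<nu>))) \<longlonglongrightarrow> e"
   using LIMSEQ_subseq_LIMSEQ[OF r0(2) r1] by (simp add: o_def r_def)
  fix q :: "nat => nat^'m => complex"
  let ?F = "%j. {a. a \<in> ?L j \<and> w \<bullet> lattice_point a = \<mu> j}"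
  assume q0: "\<And>j. j < k ==> (\<Sum>a\<in>?F j. q j a) = 0"
  define \<theta> where "\<theta> = (%i. \<Sum>j<k. \<Sum>a\<in>?F j. q j a * of_nat (a $ i))"
  assume "\<And>i. e $ i = 0 ==> (\<Sum>j<k. \<Sum>a\<in>?F j. q j a * of_nat (a $ i)) = 0"
  then have \<theta>0: "\<theta> i = 0" if "e $ i = 0" for i using that by (simp add: \<theta>_def)
  let ?u = "%\<nu>. log_abs (X' \<nu>)"
  have pair: "(\<Sum>i\<in>UNIV. \<theta> i * of_real (?u \<nu> $ i)) = (\<Sum>j<k. \<Sum>b\<in>?F j. q j b * of_real ((lattice_point b - lattice_point (a j)) \<bullet> ?u \<nu>))" for \<nu>
  proof -
   have "(\<Sum>i\<in>UNIV. \<theta> i * of_real (?u \<nu> $ i)) = (\<Sum>i\<in>UNIV. \<Sum>j<k. \<Sum>b\<in>?F j. q j b * of_nat (b $ i) * of_real (?u \<nu> $ i))"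
    by (simp add: \<theta>_def sum_distrib_right)
   also have "\<dots> = (\<Sum>j<k. \<Sum>i\<in>UNIV. \<Sum>b\<in>?F j. q j b * of_nat (b $ i) * of_real (?u \<nu> $ i))"
    by (rule sum.swap)
   also have "\<dots> = (\<Sum>j<k. \<Sum>b\<in>?F j. \<Sum>i\<in>UNIV. q j b * of_nat (b $ i) * of_real (?u \<nu> $ i))"
    by (intro sum.cong refl sum.swap)
   also have "\<dots> = (\<Sum>j<k. \<Sum>b\<in>?F j. q j b * of_real (lattice_point b \<bullet> ?u \<nu>))"
    by (intro sum.cong refl) (simp add: inner_vec_def lattice_point_def sum_distrib_left mult.assoc)
   also have "\<dots> = (\<Sum>j<k. (\<Sum>b\<in>?F j. q j b * of_real (lattice_point b \<bullet> ?u \<nu>)) - (\<Sum>b\<in>?F j. q j b) * of_real (lattice_point (a j) \<bullet> ?u \<nu>))"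
    by (intro sum.cong refl) (simp add: q0)
   also have "\<dots> = (\<Sum>j<k. \<Sum>b\<in>?F j. q j b * of_real ((lattice_point b - lattice_point (a j)) \<bullet> ?u \<nu>))"
    by (simp add: inner_diff_left right_diff_distrib sum_subtractf sum_distrib_right)
   finally show ?thesis .
  qed
  have conv1: "convergent (%\<nu>. \<Sum>i\<in>UNIV. \<theta> i * of_real (?u \<nu> $ i))"
   unfolding pair
  proof (intro convergent_sum convergent_mult convergent_const)
   fix j b assume "j \<in> {..<k}" "b \<in> ?F j"
   then have "convergent (%\<nu>. (lattice_point b - lattice_point (a j)) \<bullet> ?u \<nu>)"
    unfolding X'_def by (intro cv face_in_P) (auto simp: \<mu>_def)
   then show "convergent (%\<nu>. complex_of_real ((lattice_point b - lattice_point (a j)) \<bullet> ?u \<nu>))"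
    unfolding convergent_def by (auto intro: tendsto_of_real)
  qed
  have eX: "(%\<nu>. norm (X \<nu> $ i) / norm (X \<nu>)) \<longlonglongrightarrow> norm (e $ i)" for i
  proof -
   have "(%\<nu>. norm ((X \<nu> /\<^sub>R norm (X \<nu>)) $ i)) \<longlonglongrightarrow> norm (e $ i)"
    using elim by (intro tendsto_norm tendsto_vec_nth) (simp add: Xr)
   then show ?thesis by (simp add: divide_inverse mult.commute)
  qed
  have conv2: "convergent (%\<nu>. \<theta> i * of_real (?u \<nu> $ i - ln (norm (X \<nu>))))" for i
  proof (cases "e $ i = 0")
   case False
   have "\<forall>\<^sub>F \<nu> in sequentially. 0 < norm (X \<nu> $ i) / norm (X \<nu>)"
    using eX[of i] False by (intro order_tendstoD) auto
   then have "\<forall>\<^sub>F \<nu> in sequentially. ln (norm (X \<nu> $ i) / norm (X \<nu>)) = ?u \<nu> $ i - ln (norm (X \<nu>))"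
   proof eventually_elim
    case (elim \<nu>)
    then have nz: "X \<nu> $ i ~= 0" "X \<nu> ~= 0" by auto
    then show ?case using X'X[OF nz(1)] by (simp add: log_abs_def ln_div)
   qed
   moreover have "(%\<nu>. ln (norm (X \<nu> $ i) / norm (X \<nu>))) \<longlonglongrightarrow> ln (norm (e $ i))"
    using False by (intro tendsto_ln eX) auto
   ultimately have "(%\<nu>. ?u \<nu> $ i - ln (norm (X \<nu>))) \<longlonglongrightarrow> ln (norm (e $ i))"
    by (rule Lim_transform_eventually[rotated])
   then have "(%\<nu>. \<theta> i * of_real (?u \<nu> $ i - ln (norm (X \<nu>)))) \<longlonglongrightarrow> \<theta> i * of_real (ln (norm (e $ i)))"
    by (intro tendsto_intros)
   then show ?thesis unfolding convergent_def by blast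
  qed (simp add: \<theta>0 convergent_const)
  have "convergent (%\<nu>. (\<Sum>i\<in>UNIV. \<theta> i * of_real (?u \<nu> $ i)) - (\<Sum>i\<in>UNIV. \<theta> i * of_real (?u \<nu> $ i - ln (norm (X \<nu>)))))"
   by (intro convergent_diff conv1 convergent_sum conv2)
  moreover have "(\<Sum>i\<in>UNIV. \<theta> i * of_real (?u \<nu> $ i)) - (\<Sum>i\<in>UNIV. \<theta> i * of_real (?u \<nu> $ i - ln (norm (X \<nu>))))
    = (\<Sum>i\<in>UNIV. \<theta> i) * of_real (ln (norm (X \<nu>)))" for \<nu>
   by (simp add: sum_subtractf[symmetric] sum_distrib_right algebra_simps)
  ultimately have "convergent (%\<nu>. (\<Sum>i\<in>UNIV. \<theta> i) * of_real (ln (norm (X \<nu>))))" by simp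
  then have bd: "Bseq (%\<nu>. (\<Sum>i\<in>UNIV. \<theta> i) * of_real (ln (norm (X \<nu>))))" by (rule convergent_imp_Bseq)
  have "(\<Sum>i\<in>UNIV. \<theta> i) = 0"
  proof (rule ccontr)
   assume nz: "(\<Sum>i\<in>UNIV. \<theta> i) ~= 0"
   from bd obtain K where K: "\<And>\<nu>. norm ((\<Sum>i\<in>UNIV. \<theta> i) * of_real (ln (norm (X \<nu>)))) \<le> K"
    by (auto simp: Bseq_def)
   have "filterlim (%\<nu>. ln (norm (X \<nu>))) at_bot sequentially"
   proof (rule filterlim_compose[OF ln_at_0])
    have "(%\<nu>. norm (X \<nu>)) \<longlonglongrightarrow> 0" using tendsto_norm[OF Xlim] by simp
    then show "filterlim (%\<nu>. norm (X \<nu>)) (at_right 0) sequentially"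
     by (rule tendsto_imp_filterlim_at_right) (simp add: Xr x(2))
   qed
   then have "\<forall>\<^sub>F \<nu> in sequentially. ln (norm (X \<nu>)) \<le> - (K / norm (\<Sum>i\<in>UNIV. \<theta> i)) - 1"
    by (simp add: filterlim_at_bot)
   then obtain \<nu> where \<nu>: "ln (norm (X \<nu>)) \<le> - (K / norm (\<Sum>i\<in>UNIV. \<theta> i)) - 1"
    by (auto simp: eventually_sequentially)
   then have "K / norm (\<Sum>i\<in>UNIV. \<theta> i) < \<bar>ln (norm (X \<nu>))\<bar>" by linarith
   then have "K < norm (\<Sum>i\<in>UNIV. \<theta> i) * \<bar>ln (norm (X \<nu>))\<bar>" using nz by (simp add: field_simps)
   then show False using K[of \<nu>] by (simp add: norm_mult)
  qed
  then show "(\<Sum>i\<in>UNIV. \<Sum>j<k. \<Sum>a\<in>?F j. q j a * of_nat (a $ i)) = 0" by (simp add: \<theta>_def)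
 qed (use r w y \<sigma>nz in auto)
qed

section \<open>Power series with a parameter\<close>

definition join_index :: "nat^'m => nat => nat^('m option)" where
 "join_index a n = (\<chi> i. case i of None => n | Some l => a $ l)"

definition xpart :: "'a^('m option) => 'a^'m" where
 "xpart b = (\<chi> i. b $ Some i)"

lemma join_index_nth [simp]: "join_index a n $ None = n" "join_index a n $ Some l = a $ l" "xpart (join_index a n) = a"
 by (simp_all add: join_index_def xpart_def Finite_Cartesian_Product.vec_eq_iff)

lemma xpart_nth [simp]: "xpart b $ l = b $ Some l" by (simp add: xpart_def)

lemma join_index_xpart [simp]: "join_index (xpart b) (b $ None) = b"
 by (simp add: Finite_Cartesian_Product.vec_eq_iff join_index_def split: option.split)

lemma with_param_nth [simp]: "with_param x t $ None = t" "with_param x t $ Some l = x $ l"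
 by (simp_all add: with_param_def)

lemma with_param_xpart [simp]: "with_param (xpart z) (z $ None) = z" "xpart (with_param x t) = x"
 by (simp_all add: Finite_Cartesian_Product.vec_eq_iff with_param_def xpart_def split: option.split)

lemma UNIV_option_split: "(UNIV :: 'm option set) = insert None (Some ` UNIV)"
 by (auto simp: UNIV_option_conv)

lemma sum_option: "(\<Sum>i\<in>UNIV. f i) = f None + (\<Sum>l\<in>UNIV. f (Some l))" for f :: "'m::finite option => 'a::comm_monoid_add"
 unfolding UNIV_option_split by (subst sum.insert) (auto simp: sum.reindex)

lemma prod_option: "(\<Prod>i\<in>UNIV. f i) = f None * (\<Prod>l\<in>UNIV. f (Some l))" for f :: "'m::finite option => 'a::comm_monoid_mult"
 unfolding UNIV_option_split by (subst prod.insert) (auto simp: prod.reindex)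

lemma monomial_with_param: "monomial_Cn b (with_param x t) = t ^ (b $ None) * monomial_Cn (xpart b) (x :: complex^'m::finite)"
 by (simp add: monomial_Cn_def prod_option)

text \<open>The Taylor coefficients of the members of a family, from those of the total space.\<close>

lemma slice_coefficients:
 fixes C :: "nat^('m::finite option) => complex"
 assumes r: "0 < r" and C: "\<And>b. norm (C b) \<le> M / r ^ (\<Sum>i\<in>UNIV. b $ i)"
  and f: "\<And>z. z \<in> polydisc r ==> ((%b. C b * monomial_Cn b z) has_sum f z) UNIV" and t: "norm t < r"
 shows "((%n. t ^ n * C (join_index a n)) has_sum taylor_coeff (%x. f (with_param x t)) a) UNIV"
proof -
 have M: "0 \<le> M" using order_trans[OF norm_ge_zero C[of 0]] by simp
 have "\<exists>S. ((%n. t ^ n * C (join_index a n)) has_sum S) UNIV" for a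
 proof -
  have "summable (%n. norm (t ^ n * C (join_index a n)))"
  proof (rule summable_comparison_test')
   have "summable (%n. (norm t / r) ^ n)" using t r by (intro summable_geometric) auto
   then show "summable (%n. M / r ^ (\<Sum>l\<in>UNIV. a $ l) * (norm t / r) ^ n)" by (rule summable_mult)
   fix n
   have "norm (t ^ n * C (join_index a n)) \<le> norm t ^ n * (M / r ^ (n + (\<Sum>l\<in>UNIV. a $ l)))"
    using mult_left_mono[OF C[of "join_index a n"], of "norm t ^ n"] by (simp add: norm_mult norm_power sum_option)
   then show "norm (norm (t ^ n * C (join_index a n))) \<le> M / r ^ (\<Sum>l\<in>UNIV. a $ l) * (norm t / r) ^ n"
    by (simp add: power_add power_divide mult_ac)
  qed
  then have "(%n. t ^ n * C (join_index a n)) summable_on UNIV" by (rule norm_summable_imp_summable_on)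
  then show ?thesis by (simp add: summable_on_def)
 qed
 then obtain S where S: "\<And>a. ((%n. t ^ n * C (join_index a n)) has_sum S a) UNIV" by metis
 have "taylor_coeff (%x. f (with_param x t)) = S"
 proof (rule taylor_coeff_eqI[OF r])
  fix x :: "complex^'m" assume "x \<in> polydisc r"
  then have z: "with_param x t \<in> polydisc r"
   using t by (auto simp: polydisc_def with_param_def split: option.split)
  have "((%(a, n). C (join_index a n) * monomial_Cn (join_index a n) (with_param x t)) has_sum f (with_param x t)) (Sigma UNIV (%_. UNIV))
   \<longleftrightarrow> ((%b. C b * monomial_Cn b (with_param x t)) has_sum f (with_param x t)) UNIV"
   by (rule has_sum_reindex_bij_witness[where i = "%b. (xpart b, b $ None)" and j = "%(a, n). join_index a n"]) auto
  then have "((%(a, n). C (join_index a n) * monomial_Cn (join_index a n) (with_param x t)) has_sum f (with_param x t)) (Sigma UNIV (%_. UNIV))"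
   using f[OF z] by simp
  then show "((%a. S a * monomial_Cn a x) has_sum f (with_param x t)) UNIV"
  proof (rule has_sum_SigmaD)
   fix a
   have "((%n. t ^ n * C (join_index a n) * monomial_Cn a x) has_sum S a * monomial_Cn a x) UNIV"
    by (rule has_sum_cmult_left[OF S])
   then show "((%n. case (a, n) of (a, n) => C (join_index a n) * monomial_Cn (join_index a n) (with_param x t)) has_sum S a * monomial_Cn a x) UNIV"
    by (simp add: monomial_with_param mult_ac)
  qed
 qed
 then show ?thesis using S by simp
qed

lemma slice_coefficient_0:
 fixes C :: "nat^('m::finite option) => complex"
 assumes r: "0 < r" and C: "\<And>b. norm (C b) \<le> M / r ^ (\<Sum>i\<in>UNIV. b $ i)"
  and f: "\<And>z. z \<in> polydisc r ==> ((%b. C b * monomial_Cn b z) has_sum f z) UNIV"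
 shows "taylor_coeff (%x. f (with_param x 0)) a = C (join_index a 0)"
proof -
 have "((%n. 0 ^ n * C (join_index a n)) has_sum taylor_coeff (%x. f (with_param x 0)) a) UNIV"
  using slice_coefficients[OF r C f, of 0 a] r by simp
 moreover have "((%n. 0 ^ n * C (join_index a n)) has_sum C (join_index a 0)) UNIV"
  by (rule has_sum_finite_neutralI[of "{0}"]) (auto simp: power_0_left)
 ultimately show ?thesis by (rule has_sum_unique)
qed

lemma slice_coefficient_zero:
 fixes C :: "nat^('m::finite option) => complex"
 assumes r: "0 < r" and C: "\<And>b. norm (C b) \<le> M / r ^ (\<Sum>i\<in>UNIV. b $ i)"
  and f: "\<And>z. z \<in> polydisc r ==> ((%b. C b * monomial_Cn b z) has_sum f z) UNIV"
  and \<rho>: "0 < \<rho>" "\<And>t. norm t < \<rho> ==> taylor_coeff (%x. f (with_param x t)) (xpart b) = 0"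
 shows "C b = 0"
proof -
 have "C (join_index (xpart b) (b $ None)) = 0"
 proof (rule power_series_zero_one[of "min r \<rho>" "%n. C (join_index (xpart b) n)"])
  fix t :: complex assume "norm t < min r \<rho>"
  then show "((%n. t ^ n * C (join_index (xpart b) n)) has_sum 0) UNIV"
   using slice_coefficients[OF r C f, of t "xpart b"] \<rho>(2)[of t] by simp
 qed (use r \<rho> in auto)
 then show ?thesis by simp
qed

text \<open>Dominated convergence for unordered sums.\<close>

lemma tannery:
 fixes g :: "nat => 'b => complex"
 assumes bd: "\<forall>\<^sub>F \<nu> in sequentially. \<forall>b. norm (g \<nu> b) \<le> B b" and B: "B summable_on UNIV"
  and lim: "\<And>b. (%\<nu>. g \<nu> b) \<longlonglongrightarrow> h b" and h: "(h has_sum l) UNIV"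
  and s: "\<forall>\<^sub>F \<nu> in sequentially. (g \<nu> has_sum s \<nu>) UNIV"
 shows "s \<longlonglongrightarrow> l"
proof -
 define Y where "Y = {\<nu>. (\<forall>b. norm (g \<nu> b) \<le> B b) \<and> (g \<nu> has_sum s \<nu>) UNIV}"
 have Y: "\<forall>\<^sub>F \<nu> in sequentially. \<nu> \<in> Y" using eventually_conj[OF bd s] by (simp add: Y_def)
 have "uniform_limit Y (%X \<nu>. \<Sum>b\<in>X. g \<nu> b) s (finite_subsets_at_top UNIV)"
  by (rule Weierstrass_m_test_general'[OF _ _ B]) (auto simp: Y_def)
 then show ?thesis
 proof (rule swap_uniform_limit'[rotated 2])
  show "\<forall>\<^sub>F X in finite_subsets_at_top UNIV. ((%\<nu>. \<Sum>b\<in>X. g \<nu> b) \<longlonglongrightarrow> (\<Sum>b\<in>X. h b))"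
   by (intro always_eventually allI tendsto_sum lim)
  show "((%X. \<Sum>b\<in>X. h b) \<longlongrightarrow> l) (finite_subsets_at_top UNIV)" using h by (simp add: has_sum_def)
 qed (use Y in auto)
qed

text \<open>The scaled limit of a series whose exponents lie in a Newton polyhedron: dominated convergence.\<close>

lemma scaled_series_limit:
 fixes K :: "nat^('m::finite option) => complex" and L :: "(nat^'m) set" and X :: "nat => complex^'m"
 assumes r: "0 < r" "r \<le> 1" and K: "\<And>b. norm (K b) \<le> A * 2 ^ (\<Sum>i\<in>UNIV. b $ i) / r ^ (\<Sum>i\<in>UNIV. b $ i)"
  and supp: "\<And>b. K b ~= 0 ==> xpart b \<in> L"
  and X: "X \<longlonglongrightarrow> 0" and t: "t \<longlonglongrightarrow> 0"
  and lim: "\<And>a. a \<in> L ==> (%\<nu>. monomial_Cn a (X \<nu>) / \<sigma> \<nu>) \<longlonglongrightarrow> (if a \<in> \<Gamma> then monomial_Cn a y else 0)"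
  and gen: "\<And>a. a \<in> L ==> \<exists>p. (\<forall>i. p $ i \<le> N) \<and> (\<forall>i. p $ i \<le> a $ i) \<and> (\<forall>\<nu>. norm (monomial_Cn p (X \<nu>) / \<sigma> \<nu>) \<le> real N)"
  and \<Gamma>: "finite \<Gamma>" "\<Gamma> \<subseteq> L"
  and s: "\<forall>\<^sub>F \<nu> in sequentially. ((%b. K b * monomial_Cn b (with_param (X \<nu>) (t \<nu>))) has_sum s \<nu>) UNIV"
 shows "(%\<nu>. s \<nu> / \<sigma> \<nu>) \<longlonglongrightarrow> (\<Sum>a\<in>\<Gamma>. K (join_index a 0) * monomial_Cn a y)"
proof -
 have A: "0 \<le> A" using order_trans[OF norm_ge_zero K[of 0]] by simp
 define C0 where "C0 = A * real N * (4 / r) ^ (N * CARD('m))"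
 have C0: "0 \<le> C0" using A r by (simp add: C0_def)
 define B where "B = (%b :: nat^('m option). C0 * (\<Prod>i\<in>UNIV. (1/2) ^ (b $ i)))"
 have smallX: "\<forall>\<^sub>F \<nu> in sequentially. norm (X \<nu>) < r / 4" using tendsto_norm[OF X] r by (intro order_tendstoD) auto
 have smallt: "\<forall>\<^sub>F \<nu> in sequentially. norm (t \<nu>) < r / 4" using tendsto_norm[OF t] r by (intro order_tendstoD) auto
 show ?thesis
 proof (rule tannery)
  show "B summable_on UNIV" unfolding B_def
   by (intro summable_on_cmult_right summable_on_geometric_multi) auto
  show "\<forall>\<^sub>F \<nu> in sequentially. \<forall>b. norm (K b * monomial_Cn b (with_param (X \<nu>) (t \<nu>)) / \<sigma> \<nu>) \<le> B b"
   using smallX smallt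
  proof eventually_elim
   case (elim \<nu>)
   show ?case
   proof
    fix b :: "nat^('m option)"
    show "norm (K b * monomial_Cn b (with_param (X \<nu>) (t \<nu>)) / \<sigma> \<nu>) \<le> B b"
    proof (cases "K b = 0")
     case True
     then show ?thesis using C0 by (simp add: B_def prod_nonneg)
    next
     case False
     let ?a = "xpart b"
     obtain p where p: "\<And>i. p $ i \<le> N" "\<And>i. p $ i \<le> ?a $ i" "norm (monomial_Cn p (X \<nu>) / \<sigma> \<nu>) \<le> real N"
      using gen[OF supp[OF False]] by blast
     have Xi: "norm (X \<nu> $ i) \<le> r / 4" for i
      using order_trans[OF Finite_Cartesian_Product.norm_nth_le less_imp_le[OF elim(1)]] .
     define h where "h = (\<Sum>i\<in>UNIV. b $ i)"
     define hp where "hp = (\<Sum>i\<in>UNIV. p $ i)"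
     have hp: "hp \<le> N * CARD('m)" unfolding hp_def using sum_bounded_above[of UNIV "%i. p $ i" N] p(1) by (simp add: mult.commute)
     have h_eq: "h = b $ None + ((\<Sum>i\<in>UNIV. (?a - p) $ i) + hp)"
      unfolding h_def hp_def sum_option sum.distrib[symmetric] using p(2) by simp
     have "norm (monomial_Cn b (with_param (X \<nu>) (t \<nu>)) / \<sigma> \<nu>)
       = norm (t \<nu>) ^ (b $ None) * (norm (monomial_Cn p (X \<nu>) / \<sigma> \<nu>) * norm (monomial_Cn (?a - p) (X \<nu>)))"
      by (simp add: monomial_with_param monomial_split[OF p(2)] norm_mult norm_divide norm_power)
     also have "\<dots> \<le> (r / 4) ^ (b $ None) * (real N * (r / 4) ^ (\<Sum>i\<in>UNIV. (?a - p) $ i))"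
     proof (intro mult_mono power_mono p(3))
      have "norm (monomial_Cn (?a - p) (X \<nu>)) \<le> (\<Prod>i\<in>UNIV. (r / 4) ^ ((?a - p) $ i))"
       unfolding norm_monomial by (intro prod_mono conjI power_mono Xi) auto
      then show "norm (monomial_Cn (?a - p) (X \<nu>)) \<le> (r / 4) ^ (\<Sum>i\<in>UNIV. (?a - p) $ i)"
       by (simp add: power_sum)
     qed (use elim r in auto)
     also have "\<dots> = real N * (r / 4) ^ h * (4 / r) ^ hp"
      unfolding h_eq power_add using r by (simp add: power_divide)
     also have "\<dots> \<le> real N * (r / 4) ^ h * (4 / r) ^ (N * CARD('m))"
      using hp r by (intro mult_left_mono power_increasing) (auto simp: field_simps)
     finally have m: "norm (monomial_Cn b (with_param (X \<nu>) (t \<nu>)) / \<sigma> \<nu>) \<le> real N * (r / 4) ^ h * (4 / r) ^ (N * CARD('m))" .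
     have "norm (K b * monomial_Cn b (with_param (X \<nu>) (t \<nu>)) / \<sigma> \<nu>) = norm (K b) * norm (monomial_Cn b (with_param (X \<nu>) (t \<nu>)) / \<sigma> \<nu>)"
      by (simp add: norm_mult norm_divide)
     also have "\<dots> \<le> A * 2 ^ h / r ^ h * (real N * (r / 4) ^ h * (4 / r) ^ (N * CARD('m)))"
      using K[of b] A r by (intro mult_mono m) (auto simp: h_def)
     also have "\<dots> = C0 * (1/2) ^ h"
     proof -
      have "(2::real) ^ h / r ^ h * (r / 4) ^ h = (2 / r * (r / 4)) ^ h"
       by (simp only: power_mult_distrib power_divide)
      also have "2 / r * (r / 4) = 1 / 2" using r by simp
      finally have "(2::real) ^ h / r ^ h * (r / 4) ^ h = (1/2) ^ h" .
      moreover have "A * 2 ^ h / r ^ h * (real N * (r / 4) ^ h * (4 / r) ^ (N * CARD('m))) = C0 * ((2::real) ^ h / r ^ h * (r / 4) ^ h)"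
       by (simp add: C0_def mult_ac)
      ultimately show ?thesis by simp
     qed
     also have "\<dots> = B b" by (simp add: B_def h_def power_sum)
     finally show ?thesis .
    qed
   qed
  qed
  define hh where "hh = (%b :: nat^('m option). if b $ None = 0 \<and> xpart b \<in> \<Gamma> then K b * monomial_Cn (xpart b) y else 0)"
  show "(%\<nu>. K b * monomial_Cn b (with_param (X \<nu>) (t \<nu>)) / \<sigma> \<nu>) \<longlonglongrightarrow> hh b" for b
  proof (cases "K b = 0")
   case False
   have "(%\<nu>. K b * (t \<nu> ^ (b $ None) * (monomial_Cn (xpart b) (X \<nu>) / \<sigma> \<nu>))) \<longlonglongrightarrow>
     K b * (0 ^ (b $ None) * (if xpart b \<in> \<Gamma> then monomial_Cn (xpart b) y else 0))"
    by (intro tendsto_mult tendsto_const tendsto_power t lim supp False)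
   moreover have "K b * (0 ^ (b $ None) * (if xpart b \<in> \<Gamma> then monomial_Cn (xpart b) y else 0)) = hh b"
    by (auto simp: hh_def power_0_left)
   ultimately show ?thesis by (simp add: monomial_with_param)
  qed (simp add: hh_def)
  show "(hh has_sum (\<Sum>a\<in>\<Gamma>. K (join_index a 0) * monomial_Cn a y)) UNIV"
  proof (rule has_sum_finite_neutralI[of "(%a. join_index a 0) ` \<Gamma>"])
   show "hh b = 0" if "b \<in> UNIV - (%a. join_index a 0) ` \<Gamma>" for b
   proof (rule ccontr)
    assume "hh b ~= 0"
    then have "b $ None = 0" "xpart b \<in> \<Gamma>" by (auto simp: hh_def split: if_splits)
    then have "b = join_index (xpart b) 0" by (metis join_index_xpart)
    then show False using that \<open>xpart b \<in> \<Gamma>\<close> by blast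
   qed
   have "inj_on (%a. join_index a 0) \<Gamma>" by (rule inj_onI) (metis join_index_nth(3))
   then show "(\<Sum>a\<in>\<Gamma>. K (join_index a 0) * monomial_Cn a y) = (\<Sum>b\<in>(%a. join_index a 0) ` \<Gamma>. hh b)"
    by (simp add: sum.reindex hh_def)
  qed (use \<Gamma> in auto)
  show "\<forall>\<^sub>F \<nu> in sequentially. ((%b. K b * monomial_Cn b (with_param (X \<nu>) (t \<nu>)) / \<sigma> \<nu>) has_sum s \<nu> / \<sigma> \<nu>) UNIV"
   using s
  proof eventually_elim
   case (elim \<nu>)
   from has_sum_cmult_left[OF elim, of "inverse (\<sigma> \<nu>)"] show ?case by (simp add: divide_inverse)
  qed
 qed
qed

section \<open>Face restrictions and singular points\<close>

lemma monomial_has_derivative: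
 fixes z :: "complex^'m::finite"
 shows "(monomial_Cn a has_derivative
  (%v. \<Sum>i\<in>UNIV. (of_nat (a $ i) * (z $ i) ^ (a $ i - 1) * (\<Prod>l\<in>UNIV - {i}. (z $ l) ^ (a $ l))) * v $ i)) (at z)"
proof -
 have nth: "((%z. z $ i) has_derivative (%v. v $ i)) (at z)" for i :: 'm
  by (rule bounded_linear_imp_has_derivative[OF bounded_linear_vec_nth])
 have "((%z. (z $ i) ^ (a $ i)) has_derivative (%v. of_nat (a $ i) * v $ i * (z $ i) ^ (a $ i - 1))) (at z)" for i
  by (rule has_derivative_power[OF nth])
 then have "((%z. \<Prod>i\<in>UNIV. (z $ i) ^ (a $ i)) has_derivative
   (%v. \<Sum>i\<in>UNIV. of_nat (a $ i) * v $ i * (z $ i) ^ (a $ i - 1) * (\<Prod>l\<in>UNIV - {i}. (z $ l) ^ (a $ l)))) (at z)"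
  by (intro has_derivative_prod)
 then show ?thesis by (simp add: monomial_Cn_def[abs_def] mult_ac)
qed

lemma restrict_to_face_holomorphic:
 fixes y :: "complex^'m::finite"
 shows "holomorphic_Cn_on (restrict_to_face f \<Gamma>) U"
  and "y $ l * pderivative l (restrict_to_face f \<Gamma>) y = (\<Sum>a | lattice_point a \<in> \<Gamma>. taylor_coeff f a * of_nat (a $ l) * monomial_Cn a y)"
proof -
 define c where "c = (%a i (z :: complex^'m). of_nat (a $ i) * (z $ i) ^ (a $ i - 1) * (\<Prod>l\<in>UNIV - {i}. (z $ l) ^ (a $ l)))"
 have d: "(restrict_to_face f \<Gamma> has_derivative (%v. \<Sum>i\<in>UNIV. (\<Sum>a | lattice_point a \<in> \<Gamma>. taylor_coeff f a * c a i z) * v $ i)) (at z)" for z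
 proof -
  have "((%z. \<Sum>a | lattice_point a \<in> \<Gamma>. taylor_coeff f a * monomial_Cn a z) has_derivative
    (%v. \<Sum>a | lattice_point a \<in> \<Gamma>. taylor_coeff f a * (\<Sum>i\<in>UNIV. c a i z * v $ i))) (at z)"
   unfolding c_def by (intro has_derivative_sum has_derivative_mult_right monomial_has_derivative)
  moreover have "(\<Sum>a | lattice_point a \<in> \<Gamma>. taylor_coeff f a * (\<Sum>i\<in>UNIV. c a i z * v $ i))
    = (\<Sum>i\<in>UNIV. (\<Sum>a | lattice_point a \<in> \<Gamma>. taylor_coeff f a * c a i z) * v $ i)" for v
   unfolding sum_distrib_left sum_distrib_right by (subst sum.swap) (simp add: mult_ac)
  ultimately show ?thesis by (simp add: restrict_to_face_def[abs_def])
 qed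
 show "holomorphic_Cn_on (restrict_to_face f \<Gamma>) U"
  by (rule holomorphic_Cn_onI, rule exI, rule d)
 have "pderivative l (restrict_to_face f \<Gamma>) y = (\<Sum>a | lattice_point a \<in> \<Gamma>. taylor_coeff f a * c a l y)"
  by (rule pderivative_unique[OF d])
 moreover have "y $ l * c a l y = of_nat (a $ l) * monomial_Cn a y" for a
 proof (cases "a $ l")
  case (Suc n)
  have "monomial_Cn a y = (y $ l) ^ (a $ l) * (\<Prod>i\<in>UNIV - {l}. (y $ i) ^ (a $ i))"
   unfolding monomial_Cn_def by (rule prod.remove) auto
  then show ?thesis by (simp add: c_def Suc mult_ac)
 qed (simp add: c_def)
 ultimately show "y $ l * pderivative l (restrict_to_face f \<Gamma>) y = (\<Sum>a | lattice_point a \<in> \<Gamma>. taylor_coeff f a * of_nat (a $ l) * monomial_Cn a y)"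
  by (simp add: sum_distrib_left mult_ac)
qed

abbreviation entry_gradients :: "(complex^'m => complex mat) => complex^'m => nat => nat => complex^'m" where
 "entry_gradients A z \<equiv> (%i j. gradient (%y. A y $$ (i, j)) z)"

lemma bilin_pull_back: "bilin (pull_back n k a \<Phi>) v = (\<Sum>i<n. \<Sum>j<k. \<Phi> i j * bilin (a i j) v)"
 by (simp add: pull_back_def bilin_sum_left)

lemma has_derivative_minor_entries:
 fixes A :: "complex^'m::finite => complex mat"
 assumes hol: "\<And>i j. i < n ==> j < k ==> holomorphic_Cn_on (%y. A y $$ (i, j)) U" and z: "z \<in> U"
  and IJ: "I \<subseteq> {..<n}" "J \<subseteq> {..<k}" "card I = card J"
 shows "((%y. minor I J (%i j. A y $$ (i, j))) has_derivative
   bilin (pull_back n k (entry_gradients A z) (minor_cofactor I J (%i j. A z $$ (i, j))))) (at z)"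
proof -
 have fin: "finite I" "finite J" using IJ by (auto intro: finite_subset)
 have "((%y. minor I J (%i j. A y $$ (i, j))) has_derivative
   (%v. \<Sum>i\<in>I. \<Sum>j\<in>J. minor_cofactor I J (%i j. A z $$ (i, j)) i j * bilin (entry_gradients A z i j) v)) (at z)"
  by (rule has_derivative_minor[OF fin IJ(3)], rule holomorphic_Cn_derivative_gradient[OF hol z]) (use IJ in auto)
 moreover have "(\<Sum>i\<in>I. \<Sum>j\<in>J. minor_cofactor I J (%i j. A z $$ (i, j)) i j * bilin (entry_gradients A z i j) v)
   = bilin (pull_back n k (entry_gradients A z) (minor_cofactor I J (%i j. A z $$ (i, j)))) v" for v
 proof -
  let ?c = "minor_cofactor I J (%i j. A z $$ (i, j))"
  have "(\<Sum>i<n. \<Sum>j<k. ?c i j * bilin (entry_gradients A z i j) v) = (\<Sum>i\<in>I. \<Sum>j<k. ?c i j * bilin (entry_gradients A z i j) v)"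
   using IJ by (intro sum.mono_neutral_right) (auto simp: minor_cofactor_outside[OF _ IJ(3)])
  also have "\<dots> = (\<Sum>i\<in>I. \<Sum>j\<in>J. ?c i j * bilin (entry_gradients A z i j) v)"
   using IJ by (intro sum.cong refl sum.mono_neutral_right) (auto simp: minor_cofactor_outside[OF _ IJ(3)])
  finally show ?thesis by (simp add: bilin_pull_back)
 qed
 ultimately show ?thesis by (simp add: fun_eq_iff[symmetric])
qed

lemma gradient_eqI: "(f has_derivative bilin g) (at z) ==> gradient f z = g"
 by (simp add: Finite_Cartesian_Product.vec_eq_iff gradient_nth bilin_def[abs_def] pderivative_unique)

lemma jacobian_rows_eq:
 fixes A :: "complex^'m::finite => complex mat"
 assumes hol: "\<And>i j. i < n ==> j < k ==> holomorphic_Cn_on (%y. A y $$ (i, j)) U" and U: "open U" "z \<in> U"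
  and A: "\<And>y. y \<in> U ==> A y \<in> carrier_mat n k"
 shows "jacobian_rows n k s A z = minor_gradients n k s (%i j. A z $$ (i, j)) (entry_gradients A z)"
proof -
 have "gradient (%y. Determinant.det (submatrix (A y) I J)) z =
   pull_back n k (entry_gradients A z) (minor_cofactor I J (%i j. A z $$ (i, j)))"
  if IJ: "I \<subseteq> {..<n}" "J \<subseteq> {..<k}" "card I = s" "card J = s" for I J
 proof (rule gradient_eqI, rule has_derivative_transform_within_open[OF has_derivative_minor_entries[OF hol U(2) IJ(1,2)] U])
  show "minor I J (%i j. A y $$ (i, j)) = Determinant.det (submatrix (A y) I J)" if "y \<in> U" for y
   using det_submatrix_eq_minor[OF A[OF that] IJ(1,2)] by simp
 qed (use IJ in auto)
 then show ?thesis unfolding jacobian_rows_def minor_gradients_def by (intro Collect_cong) metis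
qed

text \<open>Nonsingular points of a determinantal locus are those where the matrix is transversal.\<close>

lemma not_singular_iff_transversal:
 fixes A :: "complex^'m::finite => complex mat"
 assumes hol: "\<And>i j. i < n ==> j < k ==> holomorphic_Cn_on (%y. A y $$ (i, j)) U" and U: "open U" "z \<in> U"
  and A: "\<And>y. y \<in> U ==> A y \<in> carrier_mat n k" and s: "0 < s" "s \<le> n" "s \<le> k"
  and lr: "low_rank (s - 1) n k (%i j. A z $$ (i, j))"
 shows "z \<notin> singular_set n k s A \<longleftrightarrow> transversal n k s (%i j. A z $$ (i, j)) (entry_gradients A z)"
proof -
 have "z \<in> det_locus n s A" using lr rank_less_iff_low_rank[OF A[OF U(2)] s(1)] by (simp add: det_locus_def)
 then have "z \<notin> singular_set n k s A \<longleftrightarrow> det_codim n k s \<le> vec.dim (jacobian_rows n k s A z)"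
  by (auto simp: singular_set_def)
 also have "\<dots> \<longleftrightarrow> transversal n k s (%i j. A z $$ (i, j)) (entry_gradients A z)"
  using transversal_iff_dim[OF s lr, of "entry_gradients A z"] jacobian_rows_eq[of n k A U z s] hol U A by simp
 finally show ?thesis .
qed

text \<open>The faces on which a positive weight is minimal satisfy what nondegeneracy asks of a collection of
 faces.\<close>

lemma nondegenerate_weight_face:
 fixes A :: "complex^'m::finite => complex mat" and \<Delta> :: "nat => (real^'m) set"
 assumes nd: "newton_nondegenerate n k s \<Delta> A" and \<Delta>: "\<And>j. j < k ==> newton_set (\<Delta> j)"
  and w: "\<And>i. 0 < w $ i" and \<mu>: "\<And>j v. j < k ==> v \<in> \<Delta> j ==> \<mu> j \<le> w \<bullet> v"
  and ex: "\<And>j. j < k ==> \<exists>v\<in>\<Delta> j. w \<bullet> v = \<mu> j"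
  and y: "y \<in> complex_torus" and s: "0 < s" "s \<le> n" "s \<le> k"
 defines "R \<equiv> restrict_matrix n k A (%j. {v \<in> \<Delta> j. w \<bullet> v = \<mu> j})"
 assumes lr: "low_rank (s - 1) n k (%i j. R y $$ (i, j))"
 shows "transversal n k s (%i j. R y $$ (i, j)) (entry_gradients R y)"
proof -
 let ?\<Gamma> = "%j. {v \<in> \<Delta> j. w \<bullet> v = \<mu> j}"
 have face: "?\<Gamma> j face_of \<Delta> j" "?\<Gamma> j ~= {}" if "j < k" for j
 proof -
  have "(\<Delta> j \<inter> {v. w \<bullet> v = \<mu> j}) face_of \<Delta> j"
   by (rule face_of_Int_supporting_hyperplane_ge) (use that \<mu> newton_set_convex[OF \<Delta>] in auto)
  then show "?\<Gamma> j face_of \<Delta> j" by (simp add: Int_def)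
  show "?\<Gamma> j ~= {}" using ex[OF that] by auto
 qed
 have wsum: "w \<bullet> (\<Sum>j<k. g j) = (\<Sum>j<k. w \<bullet> g j)" for g by (rule inner_sum_right)
 have ge: "(\<Sum>j<k. \<mu> j) \<le> w \<bullet> v" if "v \<in> (\<Sum>j<k. \<Delta> j)" for v
 proof -
  obtain g where "\<forall>j\<in>{..<k}. g j \<in> \<Delta> j" "v = (\<Sum>j<k. g j)" using \<open>v \<in> _\<close> by (auto simp: set_sum_alt)
  then show ?thesis by (auto simp: wsum intro!: sum_mono \<mu>)
 qed
 have eq: "(\<Sum>j<k. ?\<Gamma> j) = (\<Sum>j<k. \<Delta> j) \<inter> {v. w \<bullet> v = (\<Sum>j<k. \<mu> j)}"
 proof (intro equalityI subsetI)
  fix v assume "v \<in> (\<Sum>j<k. ?\<Gamma> j)"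
  then obtain g where g: "\<forall>j\<in>{..<k}. g j \<in> ?\<Gamma> j" "v = (\<Sum>j<k. g j)" by (auto simp: set_sum_alt)
  then show "v \<in> (\<Sum>j<k. \<Delta> j) \<inter> {v. w \<bullet> v = (\<Sum>j<k. \<mu> j)}"
   by (auto simp: set_sum_alt wsum intro!: exI[of _ g])
 next
  fix v assume v: "v \<in> (\<Sum>j<k. \<Delta> j) \<inter> {v. w \<bullet> v = (\<Sum>j<k. \<mu> j)}"
  then obtain g where g: "\<forall>j\<in>{..<k}. g j \<in> \<Delta> j" "v = (\<Sum>j<k. g j)" by (auto simp: set_sum_alt)
  have "(\<Sum>j<k. w \<bullet> g j - \<mu> j) = 0" using v g(2) by (simp add: wsum sum_subtractf)
  then have "\<forall>j\<in>{..<k}. w \<bullet> g j - \<mu> j = 0"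
   using g(1) by (subst (asm) sum_nonneg_eq_0_iff) (auto simp: \<mu>)
  then show "v \<in> (\<Sum>j<k. ?\<Gamma> j)" using g by (auto simp: set_sum_alt intro!: exI[of _ g])
 qed
 have cvx: "convex (\<Sum>j<k. \<Delta> j)"
  by (rule convex_set_sum) (use newton_set_convex[OF \<Delta>] in auto)
 have sum_face: "(\<Sum>j<k. ?\<Gamma> j) face_of (\<Sum>j<k. \<Delta> j)"
  unfolding eq by (rule face_of_Int_supporting_hyperplane_ge[OF cvx ge])
 have "bounded (\<Sum>j<k. ?\<Gamma> j)"
  unfolding bounded_iff
 proof (intro exI ballI)
  fix v assume "v \<in> (\<Sum>j<k. ?\<Gamma> j)"
  then have v: "v \<in> (\<Sum>j<k. \<Delta> j)" "w \<bullet> v = (\<Sum>j<k. \<mu> j)" using eq by auto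
  obtain g where g: "\<forall>j\<in>{..<k}. g j \<in> \<Delta> j" "v = (\<Sum>j<k. g j)" using v(1) by (auto simp: set_sum_alt)
  have v0: "0 \<le> v $ i" for i
   using g newton_set_nonneg[OF \<Delta>] by (auto intro!: sum_nonneg)
  have vi: "\<bar>v $ i\<bar> \<le> (\<Sum>j<k. \<mu> j) / w $ i" for i
  proof -
   have "w $ i * v $ i \<le> (\<Sum>i\<in>UNIV. w $ i * v $ i)"
    by (rule member_le_sum) (auto intro!: mult_nonneg_nonneg v0 less_imp_le[OF w])
   also have "\<dots> = (\<Sum>j<k. \<mu> j)" using v(2) by (simp add: inner_vec_def)
   finally show ?thesis using w[of i] v0[of i] by (simp add: field_simps)
  qed
  have "norm v \<le> (\<Sum>i\<in>UNIV. \<bar>v $ i\<bar>)" by (rule norm_le_l1_cart)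
  also have "\<dots> \<le> (\<Sum>i\<in>UNIV. (\<Sum>j<k. \<mu> j) / w $ i)" by (rule sum_mono) (rule vi)
  finally show "norm v \<le> (\<Sum>i\<in>UNIV. (\<Sum>j<k. \<mu> j) / w $ i)" .
 qed
 with nd face sum_face have nd': "det_locus n s R \<inter> complex_torus = {} \<or> singular_set n k s R \<inter> complex_torus = {}"
  unfolding newton_nondegenerate_def R_def by (metis (no_types, lifting))
 have RA: "R z \<in> carrier_mat n k" for z by (simp add: R_def restrict_matrix_def)
 have "y \<in> det_locus n s R" using lr rank_less_iff_low_rank[OF RA s(1)] by (simp add: det_locus_def)
 then have ns: "y \<notin> singular_set n k s R" using nd' y by blast
 have hol: "holomorphic_Cn_on (%z. R z $$ (i, j)) UNIV" if "i < n" "j < k" for i j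
  using that restrict_to_face_holomorphic(1)[of "%y. A y $$ (i, j)" "?\<Gamma> j" UNIV] by (simp add: R_def restrict_matrix_def)
 show ?thesis
  using not_singular_iff_transversal[OF hol open_UNIV UNIV_I RA s lr] ns by blast
qed

section \<open>Limits onto faces\<close>

text \<open>The hypotheses on the family near one point of the parameter axis, with that point moved to the
 origin.\<close>

locale newton_germ =
 fixes n k s :: nat and F :: "complex^('m::finite option) => complex mat" and \<Delta> :: "nat => (real^'m) set"
  and U :: "(complex^('m option)) set" and \<rho> :: real
 assumes s: "0 < s" "s \<le> n" "s \<le> k"
  and U: "open U" "0 \<in> U" and \<rho>: "0 < \<rho>"
  and carrier: "\<And>z. z \<in> U ==> F z \<in> carrier_mat n k"
  and hol: "\<And>i j. i < n ==> j < k ==> holomorphic_Cn_on (%z. F z $$ (i, j)) U"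
  and newton: "\<And>t i j. norm t < \<rho> ==> i < n ==> j < k ==> newton_polyhedron (%x. F (with_param x t) $$ (i, j)) = \<Delta> j"
  and convenient: "\<And>j. j < k ==> convenient (\<Delta> j)"
  and nondegenerate: "newton_nondegenerate n k s \<Delta> (%x. F (with_param x 0))"
begin

lemma taylor_coeff_support:
 assumes "norm t < \<rho>" "i < n" "j < k" "taylor_coeff (%x. F (with_param x t) $$ (i, j)) a ~= 0"
 shows "a \<in> lattice_points (\<Delta> j)"
proof -
 have "lattice_point a + 0 \<in> newton_polyhedron (%x. F (with_param x t) $$ (i, j))"
  unfolding newton_polyhedron_def by (rule hull_inc) (use assms(4) in \<open>intro CollectI exI[of _ a] exI[of _ 0], simp\<close>)
 then show ?thesis by (simp add: newton[OF assms(1-3)] lattice_points_def)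
qed

lemma newton_set_polyhedron:
 assumes "j < k"
 shows "newton_set (\<Delta> j)"
proof -
 have "0 < n" using s by simp
 then have "\<Delta> j = newton_polyhedron (%x. F (with_param x 0) $$ (0, j))" using newton[of 0 0 j] \<rho> assms by simp
 then show ?thesis unfolding newton_set_def newton_polyhedron_def
  by (intro exI[of _ "{a. taylor_coeff (%x. F (with_param x 0) $$ (0, j)) a ~= 0}"]) simp
qed

lemma entry_expansion:
 assumes ij: "i < n" "j < k"
 obtains C M r where "0 < r" "r \<le> 1" "0 \<le> M" "\<And>b. norm (C b) \<le> M / r ^ (\<Sum>i\<in>UNIV. b $ i)"
  "\<And>z. z \<in> polydisc r ==> ((%b. C b * monomial_Cn b z) has_sum F z $$ (i, j)) UNIV"
  "\<And>b. C b ~= 0 ==> xpart b \<in> lattice_points (\<Delta> j)"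
  "\<And>a. C (join_index a 0) = taylor_coeff (%x. F (with_param x 0) $$ (i, j)) a"
proof -
 obtain R M where R: "0 < R" "0 \<le> M" "sep_holo R (%z. F (0 + z) $$ (i, j))"
  "\<And>z. z \<in> polydisc R ==> norm (F (0 + z) $$ (i, j)) \<le> M" "\<And>z. z \<in> polydisc R ==> 0 + z \<in> U"
  by (rule holomorphic_Cn_imp_sep_holo[OF hol[OF ij] U]) (assumption | rule that)+
 define r where "r = min 1 (R / 2)"
 have r: "0 < r" "r < R" "r \<le> 1" using R(1) by (auto simp: r_def)
 obtain C where C: "\<And>b. norm (C b) \<le> M / r ^ (\<Sum>i\<in>UNIV. b $ i)"
  "\<And>z. z \<in> polydisc r ==> ((%b. C b * monomial_Cn b z) has_sum F (0 + z) $$ (i, j)) UNIV"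
  using power_series_expansion[OF R(3,4) r(1,2)] by blast
 have C2: "((%b. C b * monomial_Cn b z) has_sum F z $$ (i, j)) UNIV" if "z \<in> polydisc r" for z
  using C(2)[OF that] by simp
 have supp: "xpart b \<in> lattice_points (\<Delta> j)" if nz: "C b ~= 0" for b
 proof (rule ccontr)
  assume "xpart b \<notin> lattice_points (\<Delta> j)"
  then have "taylor_coeff (%x. F (with_param x t) $$ (i, j)) (xpart b) = 0" if "norm t < \<rho>" for t
   using taylor_coeff_support[OF that ij] by blast
  with r(1) C(1) C2 \<rho> have "C b = 0" by (rule slice_coefficient_zero)
  with nz show False by simp
 qed
 show thesis
  by (rule that[OF r(1,3) R(2) C(1) C2 supp slice_coefficient_0[OF r(1) C(1) C2, symmetric]])
qed

lemma nat_le_2_power: "real (b $ l) \<le> 2 ^ (\<Sum>i\<in>UNIV. b $ i)" for b :: "nat^'n::finite"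
proof -
 have "b $ l \<le> (\<Sum>i\<in>UNIV. b $ i)" by (rule member_le_sum) auto
 also have "\<dots> < 2 ^ (\<Sum>i\<in>UNIV. b $ i)" by (rule less_exp)
 finally have "real (b $ l) \<le> real (2 ^ (\<Sum>i\<in>UNIV. b $ i))" by (simp only: of_nat_le_iff)
 then show ?thesis by simp
qed

text \<open>A scaling that makes the entries converge to their restrictions to a face does the same to the logarithmic
 derivatives; the derivative by the parameter keeps its support, hence stays bounded.\<close>

lemma entry_limits:
 fixes X :: "nat => complex^'m"
 assumes ij: "i < n" "j < k" and z: "z \<longlonglongrightarrow> 0"
  and lim: "\<And>a. a \<in> lattice_points (\<Delta> j) ==>
   (%\<nu>. monomial_Cn a (xpart (z \<nu>)) / \<sigma> \<nu>) \<longlonglongrightarrow> (if a \<in> \<Gamma> then monomial_Cn a y else 0)"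
  and gen: "\<And>a. a \<in> lattice_points (\<Delta> j) ==> \<exists>p. (\<forall>i. p $ i \<le> N) \<and> (\<forall>i. p $ i \<le> a $ i) \<and>
    (\<forall>\<nu>. norm (monomial_Cn p (xpart (z \<nu>)) / \<sigma> \<nu>) \<le> real N)"
  and \<Gamma>: "finite \<Gamma>" "\<Gamma> \<subseteq> lattice_points (\<Delta> j)"
 defines "tc \<equiv> taylor_coeff (%x. F (with_param x 0) $$ (i, j))"
 shows "(%\<nu>. F (z \<nu>) $$ (i, j) / \<sigma> \<nu>) \<longlonglongrightarrow> (\<Sum>a\<in>\<Gamma>. tc a * monomial_Cn a y)"
  and "(%\<nu>. z \<nu> $ Some l * pderivative (Some l) (%z. F z $$ (i, j)) (z \<nu>) / \<sigma> \<nu>) \<longlonglongrightarrow>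
   (\<Sum>a\<in>\<Gamma>. tc a * of_nat (a $ l) * monomial_Cn a y)"
  and "convergent (%\<nu>. pderivative None (%z. F z $$ (i, j)) (z \<nu>) / \<sigma> \<nu>)"
proof -
 obtain C M r where r: "0 < r" "r \<le> 1" and M: "0 \<le> M" and C: "\<And>b. norm (C b) \<le> M / r ^ (\<Sum>i\<in>UNIV. b $ i)"
  and f: "\<And>z. z \<in> polydisc r ==> ((%b. C b * monomial_Cn b z) has_sum F z $$ (i, j)) UNIV"
  and supp: "\<And>b. C b ~= 0 ==> xpart b \<in> lattice_points (\<Delta> j)"
  and C0': "\<And>a. C (join_index a 0) = taylor_coeff (%x. F (with_param x 0) $$ (i, j)) a"
  by (rule entry_expansion[OF ij]) (assumption | rule that)+
 note C0 = C0'[folded tc_def]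
 have X: "(%\<nu>. xpart (z \<nu>)) \<longlonglongrightarrow> 0"
 proof (rule vec_tendstoI)
  fix l show "(%\<nu>. xpart (z \<nu>) $ l) \<longlonglongrightarrow> 0 $ l" using tendsto_vec_nth[OF z, of "Some l"] by simp
 qed
 have t: "(%\<nu>. z \<nu> $ None) \<longlonglongrightarrow> 0" using tendsto_vec_nth[OF z, of None] by simp
 have zin: "\<forall>\<^sub>F \<nu> in sequentially. z \<nu> \<in> polydisc r"
  using eventually_compose_filterlim[OF polydisc_nhds[OF r(1)] z] .
 note scaled = scaled_series_limit[OF r _ _ X t lim gen \<Gamma>]
 have pos: "0 < r ^ m" for m using r by simp
 have one: "(1::real) \<le> 2 ^ m" for m by simp
 have "norm (C b) \<le> M * 2 ^ (\<Sum>i\<in>UNIV. b $ i) / r ^ (\<Sum>i\<in>UNIV. b $ i)" for b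
 proof (rule order_trans[OF C])
  have "M * 1 \<le> M * 2 ^ (\<Sum>i\<in>UNIV. b $ i)" by (rule mult_left_mono[OF one M])
  then show "M / r ^ (\<Sum>i\<in>UNIV. b $ i) \<le> M * 2 ^ (\<Sum>i\<in>UNIV. b $ i) / r ^ (\<Sum>i\<in>UNIV. b $ i)"
   using pos by (simp add: divide_right_mono less_imp_le)
 qed
 moreover have "\<forall>\<^sub>F \<nu> in sequentially. ((%b. C b * monomial_Cn b (with_param (xpart (z \<nu>)) (z \<nu> $ None))) has_sum F (z \<nu>) $$ (i, j)) UNIV"
  using zin by eventually_elim (simp add: f)
 ultimately show "(%\<nu>. F (z \<nu>) $$ (i, j) / \<sigma> \<nu>) \<longlonglongrightarrow> (\<Sum>a\<in>\<Gamma>. tc a * monomial_Cn a y)"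
  using scaled[of C M "%\<nu>. F (z \<nu>) $$ (i, j)"] supp by (simp add: C0)
 have pd: "((%b. of_nat (b $ l) * C b * monomial_Cn (vupd b l (b $ l - 1)) z) has_sum pderivative l (%z. F z $$ (i, j)) z) UNIV"
  if "z \<in> polydisc r" for z l
  using C f that by (rule power_series_pderivative)
 show "(%\<nu>. z \<nu> $ Some l * pderivative (Some l) (%z. F z $$ (i, j)) (z \<nu>) / \<sigma> \<nu>) \<longlonglongrightarrow>
   (\<Sum>a\<in>\<Gamma>. tc a * of_nat (a $ l) * monomial_Cn a y)"
 proof -
  let ?K = "%b. of_nat (b $ Some l) * C b"
  have K: "norm (?K b) \<le> M * 2 ^ (\<Sum>i\<in>UNIV. b $ i) / r ^ (\<Sum>i\<in>UNIV. b $ i)" for b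
   using mult_mono[OF nat_le_2_power[of b "Some l"] C[of b]] by (simp add: norm_mult mult_ac)
  have S: "((%b. ?K b * monomial_Cn b z) has_sum z $ Some l * pderivative (Some l) (%z. F z $$ (i, j)) z) UNIV"
   if z: "z \<in> polydisc r" for z
  proof -
   have "z $ Some l * (of_nat (b $ Some l) * C b * monomial_Cn (vupd b (Some l) (b $ Some l - 1)) z) = ?K b * monomial_Cn b z" for b
   proof (cases "b $ Some l")
    case (Suc m)
    have "monomial_Cn b z = z $ Some l ^ (b $ Some l) * (\<Prod>i\<in>UNIV - {Some l}. z $ i ^ (b $ i))"
     unfolding monomial_Cn_def by (rule prod.remove) auto
    moreover have "monomial_Cn (vupd b (Some l) m) z = z $ Some l ^ m * (\<Prod>i\<in>UNIV - {Some l}. z $ i ^ (vupd b (Some l) m $ i))"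
     unfolding monomial_Cn_def by (subst prod.remove[of _ "Some l"]) (auto simp: vupd_def)
    moreover have "(\<Prod>i\<in>UNIV - {Some l}. z $ i ^ (vupd b (Some l) m $ i)) = (\<Prod>i\<in>UNIV - {Some l}. z $ i ^ (b $ i))"
     by (rule prod.cong) (auto simp: vupd_def)
    ultimately show ?thesis by (simp add: Suc)
   qed simp
   then show ?thesis using has_sum_cmult_right[OF pd[OF z, of "Some l"], of "z $ Some l"] by (simp only:)
  qed
  have "\<forall>\<^sub>F \<nu> in sequentially. ((%b. ?K b * monomial_Cn b (with_param (xpart (z \<nu>)) (z \<nu> $ None))) has_sum
    z \<nu> $ Some l * pderivative (Some l) (%z. F z $$ (i, j)) (z \<nu>)) UNIV"
   using zin by eventually_elim (simp add: S)
  then have "(%\<nu>. z \<nu> $ Some l * pderivative (Some l) (%z. F z $$ (i, j)) (z \<nu>) / \<sigma> \<nu>) \<longlonglongrightarrow>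
   (\<Sum>a\<in>\<Gamma>. ?K (join_index a 0) * monomial_Cn a y)"
   by (intro scaled[of ?K M] K) (use supp in auto)
  then show ?thesis by (simp add: C0 mult_ac)
 qed
 show "convergent (%\<nu>. pderivative None (%z. F z $$ (i, j)) (z \<nu>) / \<sigma> \<nu>)"
 proof -
  let ?up = "%b :: nat^'m option. vupd b None (Suc (b $ None))"
  let ?K = "%b. of_nat (Suc (b $ None)) * C (?up b)"
  have sum_up: "(\<Sum>i\<in>UNIV. ?up b $ i) = Suc (\<Sum>i\<in>UNIV. b $ i)" for b
   by (simp add: sum_option vupd_def)
  have K: "norm (?K b) \<le> (M / r) * 2 ^ (\<Sum>i\<in>UNIV. b $ i) / r ^ (\<Sum>i\<in>UNIV. b $ i)" for b
  proof -
   have "Suc (b $ None) \<le> Suc (\<Sum>i\<in>UNIV. b $ i)" by (simp add: sum_option)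
   also have "\<dots> \<le> 2 ^ (\<Sum>i\<in>UNIV. b $ i)" using less_exp[of "\<Sum>i\<in>UNIV. b $ i"] by (rule Suc_leI)
   finally have "real (Suc (b $ None)) \<le> real (2 ^ (\<Sum>i\<in>UNIV. b $ i))" by (simp only: of_nat_le_iff)
   then have "real (Suc (b $ None)) \<le> 2 ^ (\<Sum>i\<in>UNIV. b $ i)" by simp
   moreover have "norm (C (?up b)) \<le> (M / r) / r ^ (\<Sum>i\<in>UNIV. b $ i)"
    using C[of "?up b"] unfolding sum_up by simp
   ultimately have "real (Suc (b $ None)) * norm (C (?up b)) \<le> 2 ^ (\<Sum>i\<in>UNIV. b $ i) * ((M / r) / r ^ (\<Sum>i\<in>UNIV. b $ i))"
    by (rule mult_mono) auto
   then show ?thesis by (simp only: norm_mult norm_of_nat) (simp add: mult_ac)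
  qed
  have S: "((%b. ?K b * monomial_Cn b z) has_sum pderivative None (%z. F z $$ (i, j)) z) UNIV" if z: "z \<in> polydisc r" for z
  proof -
   let ?g = "%b. of_nat (b $ None) * C b * monomial_Cn (vupd b None (b $ None - 1)) z"
   have "(?g has_sum pderivative None (%z. F z $$ (i, j)) z) {b. b $ None ~= 0}"
    using pd[OF z, of None] by (rule has_sum_cong_neutral[THEN iffD1, rotated -1]) auto
   moreover have "((%b. ?K b * monomial_Cn b z) has_sum pderivative None (%z. F z $$ (i, j)) z) UNIV \<longleftrightarrow>
    (?g has_sum pderivative None (%z. F z $$ (i, j)) z) {b. b $ None ~= 0}"
    by (rule has_sum_reindex_bij_witness[where j = ?up and i = "%b. vupd b None (b $ None - 1)"])
     (auto simp: vupd_nth)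
   ultimately show ?thesis by simp
  qed
  have "\<forall>\<^sub>F \<nu> in sequentially. ((%b. ?K b * monomial_Cn b (with_param (xpart (z \<nu>)) (z \<nu> $ None))) has_sum
    pderivative None (%z. F z $$ (i, j)) (z \<nu>)) UNIV"
   using zin
  proof eventually_elim
   case (elim \<nu>)
   show ?case using S[OF elim] by (simp only: with_param_xpart)
  qed
  moreover have "xpart b \<in> lattice_points (\<Delta> j)" if "?K b ~= 0" for b
  proof -
   have "xpart (?up b) \<in> lattice_points (\<Delta> j)" using that supp[of "?up b"] by simp
   moreover have "xpart (?up b) = xpart b" by (simp add: xpart_def vupd_def)
   ultimately show ?thesis by simp
  qed
  ultimately have "(%\<nu>. pderivative None (%z. F z $$ (i, j)) (z \<nu>) / \<sigma> \<nu>) \<longlonglongrightarrow> (\<Sum>a\<in>\<Gamma>. ?K (join_index a 0) * monomial_Cn a y)"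
   using K by (intro scaled[of ?K "M / r"])
  then show ?thesis unfolding convergent_def by blast
 qed
qed

end

context newton_germ
begin

text \<open>The limit data along a sequence: \<open>M\<close> and \<open>g\<close> are the values and gradients
 at the torus point \<open>y\<close> of the entries restricted to faces.\<close>

lemma face_limit:
 assumes z: "z \<longlonglongrightarrow> 0" and x: "\<And>\<nu>. xpart (z \<nu>) ~= (0 :: complex^'m)"
 obtains r \<sigma> M g e y G where "strict_mono (r :: nat => nat)" "\<And>j \<nu>. \<sigma> j \<nu> ~= (0 :: complex)" "y \<in> complex_torus"
  "\<And>i j. i < n ==> j < k ==> (%\<nu>. F (z (r \<nu>)) $$ (i, j) / \<sigma> j \<nu>) \<longlonglongrightarrow> M i j"
  "\<And>i j l. i < n ==> j < k ==> (%\<nu>. z (r \<nu>) $ Some l * pderivative (Some l) (%z. F z $$ (i, j)) (z (r \<nu>)) / \<sigma> j \<nu>)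
    \<longlonglongrightarrow> y $ l * g i j $ l"
  "\<And>i j. i < n ==> j < k ==> convergent (%\<nu>. pderivative None (%z. F z $$ (i, j)) (z (r \<nu>)) / \<sigma> j \<nu>)"
  "(%\<nu>. xpart (z (r \<nu>)) /\<^sub>R norm (xpart (z (r \<nu>)))) \<longlonglongrightarrow> (e :: complex^'m)"
  "low_rank (s - 1) n k M ==> transversal n k s M g"
  "\<And>\<Psi>. \<Psi> \<in> conormal n k M ==> (\<And>l. e $ l = 0 ==> y $ l * pull_back n k g \<Psi> $ l = 0) ==>
    (\<Sum>l\<in>UNIV. y $ l * pull_back n k g \<Psi> $ l) = 0"
  "\<And>j a. j < k ==> a \<in> lattice_points (\<Delta> j) ==>
    (%\<nu>. monomial_Cn a (xpart (z (r \<nu>))) / \<sigma> j \<nu>) \<longlonglongrightarrow> (if a \<in> G j then monomial_Cn a y else 0)"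
  "\<And>j. j < k ==> finite (G j) \<and> G j ~= {} \<and> G j \<subseteq> lattice_points (\<Delta> j)"
  "\<And>i j l. i < n ==> j < k ==> y $ l * g i j $ l =
    (\<Sum>a\<in>G j. taylor_coeff (%x. F (with_param x 0) $$ (i, j)) a * of_nat (a $ l) * monomial_Cn a y)"
proof -
 have X: "(%\<nu>. xpart (z \<nu>)) \<longlonglongrightarrow> 0"
 proof (rule vec_tendstoI)
  fix l show "(%\<nu>. xpart (z \<nu>) $ l) \<longlonglongrightarrow> 0 $ l" using tendsto_vec_nth[OF z, of "Some l"] by simp
 qed
 obtain r w y \<sigma> \<mu> N e where r: "strict_mono (r :: nat => nat)" and w: "\<And>i. 0 < w $ i" and y: "y \<in> complex_torus"
  and \<sigma>: "\<And>j \<nu>. \<sigma> j \<nu> ~= (0 :: complex)"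
  and \<mu>1: "\<And>j. j < k ==> \<exists>a\<in>lattice_points (\<Delta> j). w \<bullet> lattice_point a = \<mu> j"
  and \<mu>2: "\<And>j v. j < k ==> v \<in> \<Delta> j ==> \<mu> j \<le> w \<bullet> v"
  and lim: "\<And>j a. j < k ==> a \<in> lattice_points (\<Delta> j) ==> (%\<nu>. monomial_Cn a (xpart (z (r \<nu>))) / \<sigma> j \<nu>) \<longlonglongrightarrow>
    (if w \<bullet> lattice_point a = \<mu> j then monomial_Cn a y else 0)"
  and gen: "\<And>j a. j < k ==> a \<in> lattice_points (\<Delta> j) ==> \<exists>p. (\<forall>i. p $ i \<le> N) \<and> (\<forall>i. p $ i \<le> a $ i) \<and>
    (\<forall>\<nu>. norm (monomial_Cn p (xpart (z (r \<nu>))) / \<sigma> j \<nu>) \<le> real N)"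
  and e: "(%\<nu>. xpart (z (r \<nu>)) /\<^sub>R norm (xpart (z (r \<nu>)))) \<longlonglongrightarrow> e"
  and euler: "\<And>q :: nat => nat^'m => complex. (\<And>j. j < k ==> (\<Sum>a | a \<in> lattice_points (\<Delta> j) \<and> w \<bullet> lattice_point a = \<mu> j. q j a) = 0) ==>
    (\<And>i. e $ i = 0 ==> (\<Sum>j<k. \<Sum>a | a \<in> lattice_points (\<Delta> j) \<and> w \<bullet> lattice_point a = \<mu> j. q j a * of_nat (a $ i)) = 0) ==>
    (\<Sum>i\<in>UNIV. \<Sum>j<k. \<Sum>a | a \<in> lattice_points (\<Delta> j) \<and> w \<bullet> lattice_point a = \<mu> j. q j a * of_nat (a $ i)) = 0"
  apply (rule newton_limit[OF newton_set_polyhedron convenient X x])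
  apply assumption
  apply assumption
  subgoal premises p by (rule p(1)[OF p(2-)])
  done
 define G where "G = (%j. {a. a \<in> lattice_points (\<Delta> j) \<and> w \<bullet> lattice_point a = \<mu> j})"
 define face where "face = (%j. {v \<in> \<Delta> j. w \<bullet> v = \<mu> j})"
 have G_face: "{a. lattice_point a \<in> face j} = G j" for j by (auto simp: G_def face_def lattice_points_def)
 have G: "finite (G j)" "G j \<subseteq> lattice_points (\<Delta> j)" if "j < k" for j
 proof -
  define B where "B = (\<Sum>i\<in>UNIV. nat \<lceil>\<mu> j / w $ i\<rceil>)"
  have "a $ i \<le> B" if "a \<in> G j" for a i
  proof -
   have "w $ i * real (a $ i) \<le> (\<Sum>i\<in>UNIV. w $ i * real (a $ i))"
    by (rule member_le_sum) (auto intro!: mult_nonneg_nonneg less_imp_le[OF w])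
   also have "\<dots> = \<mu> j" using \<open>a \<in> G j\<close> by (simp add: G_def inner_lattice)
   finally have "real (a $ i) \<le> \<mu> j / w $ i" using w[of i] by (simp add: field_simps)
   then have "a $ i \<le> nat \<lceil>\<mu> j / w $ i\<rceil>" by linarith
   also have "\<dots> \<le> B" unfolding B_def by (rule member_le_sum) auto
   finally show ?thesis .
  qed
  then show "finite (G j)" by (intro finite_subset[OF _ finite_bounded_vec[of B]]) auto
 qed (auto simp: G_def)
 define R where "R = restrict_matrix n k (%x. F (with_param x 0)) face"
 define M where "M = (%i j. R y $$ (i, j))"
 define g where "g = entry_gradients R y"
 define tc where "tc = (%i j. taylor_coeff (%x. F (with_param x 0) $$ (i, j)))"
 have R: "R x $$ (i, j) = restrict_to_face (%x. F (with_param x 0) $$ (i, j)) (face j) x" if "i < n" "j < k" for i j x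
  using that by (simp add: R_def restrict_matrix_def)
 have M: "M i j = (\<Sum>a\<in>G j. tc i j a * monomial_Cn a y)" if "i < n" "j < k" for i j
  by (simp add: M_def R[OF that] restrict_to_face_def G_face tc_def)
 have g: "y $ l * g i j $ l = (\<Sum>a\<in>G j. tc i j a * of_nat (a $ l) * monomial_Cn a y)" if "i < n" "j < k" for i j l
  using restrict_to_face_holomorphic(2)[of y l "%x. F (with_param x 0) $$ (i, j)" "face j"]
  by (simp add: g_def gradient_nth R[OF that] G_face tc_def)
 have zr: "(%\<nu>. z (r \<nu>)) \<longlonglongrightarrow> 0" using LIMSEQ_subseq_LIMSEQ[OF z r] by (simp add: o_def)
 have limG: "(%\<nu>. monomial_Cn a (xpart (z (r \<nu>))) / \<sigma> j \<nu>) \<longlonglongrightarrow> (if a \<in> G j then monomial_Cn a y else 0)"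
  if "j < k" "a \<in> lattice_points (\<Delta> j)" for j a
  using lim[OF that] that by (simp add: G_def)
 have trans: "transversal n k s M g" if lr: "low_rank (s - 1) n k M"
  unfolding M_def g_def R_def face_def
 proof (rule nondegenerate_weight_face[OF nondegenerate newton_set_polyhedron w \<mu>2 _ y s])
  show "\<exists>v\<in>\<Delta> j. w \<bullet> v = \<mu> j" if "j < k" for j using \<mu>1[OF that] by (auto simp: lattice_points_def)
  show "low_rank (s - 1) n k (%i j. restrict_matrix n k (%x. F (with_param x 0)) (%j. {v \<in> \<Delta> j. w \<bullet> v = \<mu> j}) y $$ (i, j))"
   using lr by (simp add: M_def R_def face_def)
 qed
 have eu: "(\<Sum>l\<in>UNIV. y $ l * pull_back n k g \<Psi> $ l) = 0"
  if \<Psi>: "\<Psi> \<in> conormal n k M" and \<theta>0: "\<And>l. e $ l = 0 ==> y $ l * pull_back n k g \<Psi> $ l = 0" for \<Psi>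
 proof -
  define q where "q = (%j a. \<Sum>i<n. \<Psi> i j * tc i j a * monomial_Cn a y)"
  have q0: "(\<Sum>a\<in>G j. q j a) = 0" if "j < k" for j
  proof -
   have "(\<Sum>a\<in>G j. q j a) = (\<Sum>i<n. \<Sum>a\<in>G j. \<Psi> i j * tc i j a * monomial_Cn a y)"
    unfolding q_def by (rule sum.swap)
   also have "\<dots> = (\<Sum>i<n. \<Psi> i j * M i j)"
    using that by (intro sum.cong refl) (simp add: M sum_distrib_left mult.assoc)
   also have "\<dots> = 0" using \<Psi> that by (simp add: conormal_def)
   finally show ?thesis .
  qed
  have \<theta>: "(\<Sum>j<k. \<Sum>a\<in>G j. q j a * of_nat (a $ l)) = y $ l * pull_back n k g \<Psi> $ l" for l
  proof -
   have "(\<Sum>j<k. \<Sum>a\<in>G j. q j a * of_nat (a $ l)) = (\<Sum>j<k. \<Sum>a\<in>G j. \<Sum>i<n. \<Psi> i j * (tc i j a * of_nat (a $ l) * monomial_Cn a y))"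
    by (simp add: q_def sum_distrib_left sum_distrib_right mult_ac)
   also have "\<dots> = (\<Sum>j<k. \<Sum>i<n. \<Sum>a\<in>G j. \<Psi> i j * (tc i j a * of_nat (a $ l) * monomial_Cn a y))"
    by (intro sum.cong refl sum.swap)
   also have "\<dots> = (\<Sum>j<k. \<Sum>i<n. \<Psi> i j * (y $ l * g i j $ l))"
    by (intro sum.cong refl) (simp add: g sum_distrib_left)
   also have "\<dots> = (\<Sum>i<n. \<Sum>j<k. \<Psi> i j * (y $ l * g i j $ l))" by (rule sum.swap)
   also have "\<dots> = y $ l * pull_back n k g \<Psi> $ l"
    by (simp add: pull_back_def sum_distrib_left mult_ac)
   finally show ?thesis .
  qed
  have "(\<Sum>l\<in>UNIV. \<Sum>j<k. \<Sum>a\<in>G j. q j a * of_nat (a $ l)) = 0"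
   unfolding G_def
  proof (rule euler)
   show "(\<Sum>a | a \<in> lattice_points (\<Delta> j) \<and> w \<bullet> lattice_point a = \<mu> j. q j a) = 0" if "j < k" for j
    using q0[OF that] by (simp add: G_def)
   show "(\<Sum>j<k. \<Sum>a | a \<in> lattice_points (\<Delta> j) \<and> w \<bullet> lattice_point a = \<mu> j. q j a * of_nat (a $ i)) = 0" if "e $ i = 0" for i
    using \<theta>0[OF that] \<theta>[of i] by (simp add: G_def)
  qed
  then show ?thesis by (simp only: \<theta>)
 qed
 show thesis
 proof (rule that[of r \<sigma> y M g e G])
  fix i j assume ij: "i < n" "j < k"
  note E = entry_limits[OF ij zr limG[OF ij(2)] gen[OF ij(2)] G[OF ij(2)]]
  show "(%\<nu>. F (z (r \<nu>)) $$ (i, j) / \<sigma> j \<nu>) \<longlonglongrightarrow> M i j"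
   using E(1) by (simp add: M[OF ij] tc_def)
  show "(%\<nu>. z (r \<nu>) $ Some l * pderivative (Some l) (%z. F z $$ (i, j)) (z (r \<nu>)) / \<sigma> j \<nu>) \<longlonglongrightarrow> y $ l * g i j $ l" for l
   using E(2)[of l] by (simp only: g[OF ij]) (simp add: tc_def)
  show "convergent (%\<nu>. pderivative None (%z. F z $$ (i, j)) (z (r \<nu>)) / \<sigma> j \<nu>)"
   by (rule E(3))
 next
  fix j assume j: "j < k"
  have "G j ~= {}" using \<mu>1[OF j] by (auto simp: G_def)
  then show "finite (G j) \<and> G j ~= {} \<and> G j \<subseteq> lattice_points (\<Delta> j)" using G[OF j] by blast
 next
  fix i j l assume "i < n" "j < k"
  from g[OF this, of l] show "y $ l * g i j $ l =
    (\<Sum>a\<in>G j. taylor_coeff (%x. F (with_param x 0) $$ (i, j)) a * of_nat (a $ l) * monomial_Cn a y)"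
   by (simp only: tc_def)
 qed (fact r y trans e \<sigma> | (rule \<sigma> trans eu limG; assumption) | rule eu)+
qed

end

section \<open>Asymptotics of conormal vectors\<close>

lemma tendsto_minor:
 assumes fin: "finite I" "finite J" and card: "card I = card J"
  and lim: "\<And>i j. i \<in> I ==> j \<in> J ==> ((%\<nu>. N \<nu> i j) \<longlongrightarrow> M i j) G"
 shows "((%\<nu>. minor I J (N \<nu>)) \<longlongrightarrow> minor I J M) G"
 unfolding minor_expand[OF card]
proof (intro tendsto_sum tendsto_mult tendsto_const tendsto_prod lim)
 fix p a assume p: "p \<in> {p. p permutes {0..<card I}}" and a: "a \<in> {0..<card I}"
 show "pick I a \<in> I" using bij_betwE[OF bij_betw_pick[OF fin(1)]] a by blast
 have "p a \<in> {0..<card J}" using permutes_in_image[of p "{0..<card I}" a] p a card by auto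
 then show "pick J (p a) \<in> J" using bij_betwE[OF bij_betw_pick[OF fin(2)]] by blast
qed

lemma low_rank_scale_columns:
 assumes "low_rank r n k M"
 shows "low_rank r n k (%i j. M i j / \<sigma> j)"
proof -
 obtain L :: "nat set" and u v where L: "finite L" "card L \<le> r" "\<forall>i<n. \<forall>j<k. M i j = (\<Sum>l\<in>L. u l i * v l j)"
  using assms unfolding low_rank_def by (elim exE conjE)
 show ?thesis unfolding low_rank_def
  by (rule exI[of _ L], rule exI[of _ u], rule exI[of _ "%l j. v l j / \<sigma> j"])
   (use L in \<open>auto simp: sum_divide_distrib\<close>)
qed

lemma minor_scale_columns_nonzero:
 assumes fin: "finite I" "finite J" and card: "card I = card J" and \<sigma>: "\<And>j. \<sigma> j ~= (0 :: complex)"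
  and nz: "minor I J (%i j. M i j / \<sigma> j) ~= 0"
 shows "minor I J M ~= 0"
proof
 assume "minor I J M = 0"
 then obtain c where c: "\<exists>j\<in>J. c j ~= 0" "\<forall>i\<in>I. (\<Sum>j\<in>J. M i j * c j) = 0"
  using minor_eq_0_iff[OF fin card] by blast
 have "minor I J (%i j. M i j / \<sigma> j) = 0"
  unfolding minor_eq_0_iff[OF fin card]
  by (rule exI[of _ "%j. c j * \<sigma> j"]) (use c \<sigma> in auto)
 with nz show False by simp
qed

lemma low_rank_limit:
 assumes s: "0 < s" and lr: "\<And>\<nu>. low_rank (s - 1) n k (N \<nu>)"
  and lim: "\<And>i j. i < n ==> j < k ==> (%\<nu>. N \<nu> i j) \<longlonglongrightarrow> M i j"
 shows "low_rank (s - 1) n k M"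
proof (rule minors_zero_imp_low_rank)
 fix I J assume IJ: "I \<subseteq> {..<n}" "J \<subseteq> {..<k}" "card I = Suc (s - 1)" "card J = Suc (s - 1)"
 have "(%\<nu>. minor I J (N \<nu>)) \<longlonglongrightarrow> minor I J M"
  by (rule tendsto_minor) (use IJ lim in \<open>auto intro: finite_subset\<close>)
 moreover have "minor I J (N \<nu>) = 0" for \<nu>
  by (rule low_rank_imp_minor_zero[OF lr]) (use IJ in auto)
 ultimately show "minor I J M = 0" by (simp add: LIMSEQ_const_iff)
qed

context newton_germ
begin

text \<open>Scaling the columns of \<open>\<Phi>\<close> gives unit vectors with a limit in the conormal space
 of the face matrix.  Its pull-back is nonzero by nondegeneracy, so some product \<open>x_l \<eta>_l\<close>
 has the order of the scaling, whereas \<open>\<eta>_t\<close> is at most of that order and \<open>x_l\<close>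
 tends to zero.  If the sum of the limits is nonzero, a coordinate with vanishing limit direction takes the
 place of \<open>l\<close>.\<close>

lemma conormal_asymptotics:
 assumes z: "z \<longlonglongrightarrow> 0" and x: "\<And>\<nu>. xpart (z \<nu>) ~= 0" 
  and lr: "\<And>\<nu>. low_rank (s - 1) n k (%i j. F (z \<nu>) $$ (i, j))"
  and \<Phi>: "\<And>\<nu>. \<Phi> \<nu> \<in> conormal n k (%i j. F (z \<nu>) $$ (i, j))" and \<Phi>nz: "\<And>\<nu>. \<exists>i<n. \<exists>j<k. \<Phi> \<nu> i j ~= 0"
 defines "\<eta> \<equiv> %\<nu>. pull_back n k (entry_gradients F (z \<nu>)) (\<Phi> \<nu>)"
 obtains r where "strict_mono (r :: nat => nat)"
  "\<exists>I J. I \<subseteq> {..<n} \<and> J \<subseteq> {..<k} \<and> card I = s - 1 \<and> card J = s - 1 \<and>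
    (\<forall>\<^sub>F \<nu> in sequentially. minor I J (%i j. F (z (r \<nu>)) $$ (i, j)) ~= 0)"
  "\<forall>\<^sub>F \<nu> in sequentially. xpart (\<eta> (r \<nu>)) ~= 0"
  "(%\<nu>. norm (\<eta> (r \<nu>) $ None) / norm (\<eta> (r \<nu>))) \<longlonglongrightarrow> 0"
  "(%\<nu>. norm (\<Sum>l\<in>UNIV. z (r \<nu>) $ Some l * \<eta> (r \<nu>) $ Some l) / (norm (xpart (z (r \<nu>))) * norm (\<eta> (r \<nu>)))) \<longlonglongrightarrow> 0"
proof -
 obtain r0 \<sigma> M g e y where r0: "strict_mono (r0 :: nat => nat)" and \<sigma>: "\<And>j \<nu>. \<sigma> j \<nu> ~= (0 :: complex)"
  and y: "y \<in> complex_torus"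
  and limF: "\<And>i j. i < n ==> j < k ==> (%\<nu>. F (z (r0 \<nu>)) $$ (i, j) / \<sigma> j \<nu>) \<longlonglongrightarrow> M i j"
  and limG: "\<And>i j l. i < n ==> j < k ==> (%\<nu>. z (r0 \<nu>) $ Some l * pderivative (Some l) (%z. F z $$ (i, j)) (z (r0 \<nu>)) / \<sigma> j \<nu>)
    \<longlonglongrightarrow> y $ l * g i j $ l"
  and limT: "\<And>i j. i < n ==> j < k ==> convergent (%\<nu>. pderivative None (%z. F z $$ (i, j)) (z (r0 \<nu>)) / \<sigma> j \<nu>)"
  and e: "(%\<nu>. xpart (z (r0 \<nu>)) /\<^sub>R norm (xpart (z (r0 \<nu>)))) \<longlonglongrightarrow> (e :: complex^'m)"
  and trans: "low_rank (s - 1) n k M ==> transversal n k s M g"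
  and euler: "\<And>\<Psi>. \<Psi> \<in> conormal n k M ==> (\<And>l. e $ l = 0 ==> y $ l * pull_back n k g \<Psi> $ l = 0) ==>
    (\<Sum>l\<in>UNIV. y $ l * pull_back n k g \<Psi> $ l) = 0"
  apply (rule face_limit[OF z x])
  subgoal premises p by (rule p(1)[OF p(2-10)])
  done
 have lrM: "low_rank (s - 1) n k M"
  by (rule low_rank_limit[OF s(1) low_rank_scale_columns[OF lr] limF])
 from trans[OF lrM] obtain I J where IJ: "I \<subseteq> {..<n}" "J \<subseteq> {..<k}" "card I = s - 1" "card J = s - 1" "minor I J M ~= 0"
  unfolding transversal_def by (elim conjE exE)
 have inj: "\<forall>\<Phi>\<in>conormal n k M. pull_back n k g \<Phi> = 0 \<longrightarrow> (\<forall>i<n. \<forall>j<k. \<Phi> i j = 0)"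
  using trans[OF lrM] unfolding transversal_def by (rule conjunct2)
 have fin: "finite I" "finite J" using IJ by (auto intro: finite_subset)
 have "(%\<nu>. minor I J (%i j. F (z (r0 \<nu>)) $$ (i, j) / \<sigma> j \<nu>)) \<longlonglongrightarrow> minor I J M"
  by (rule tendsto_minor) (use IJ limF fin in auto)
 then have "\<forall>\<^sub>F \<nu> in sequentially. minor I J (%i j. F (z (r0 \<nu>)) $$ (i, j) / \<sigma> j \<nu>) ~= 0"
  by (rule tendsto_imp_eventually_ne) (rule IJ)
 then have minor_ev: "\<forall>\<^sub>F \<nu> in sequentially. minor I J (%i j. F (z (r0 \<nu>)) $$ (i, j)) ~= 0"
  by eventually_elim (rule minor_scale_columns_nonzero[OF fin], use IJ \<sigma> in auto)
 define m where "m = (%\<nu>. \<Sum>i<n. \<Sum>j<k. norm (\<Phi> (r0 \<nu>) i j * \<sigma> j \<nu>))"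
 define \<Psi> where "\<Psi> = (%\<nu> i j. \<Phi> (r0 \<nu>) i j * \<sigma> j \<nu> / of_real (m \<nu>))"
 have m: "0 < m \<nu>" for \<nu>
 proof -
  obtain i j where ij: "i < n" "j < k" "\<Phi> (r0 \<nu>) i j ~= 0" using \<Phi>nz[of "r0 \<nu>"] by blast
  have "0 < norm (\<Phi> (r0 \<nu>) i j * \<sigma> j \<nu>)" using ij \<sigma> by simp
  also have "\<dots> \<le> (\<Sum>j<k. norm (\<Phi> (r0 \<nu>) i j * \<sigma> j \<nu>))" by (rule member_le_sum) (use ij in auto)
  also have "\<dots> \<le> m \<nu>" unfolding m_def by (rule member_le_sum) (use ij in \<open>auto intro: sum_nonneg\<close>)
  finally show ?thesis .
 qed
 have sum1: "(\<Sum>i<n. \<Sum>j<k. norm (\<Psi> \<nu> i j)) = 1" for \<nu>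
 proof -
  have "(\<Sum>i<n. \<Sum>j<k. norm (\<Psi> \<nu> i j)) = m \<nu> / m \<nu>"
  proof -
   have "norm (\<Psi> \<nu> i j) = norm (\<Phi> (r0 \<nu>) i j * \<sigma> j \<nu>) / m \<nu>" for i j
    using m[of \<nu>] by (simp add: \<Psi>_def norm_divide)
   then show ?thesis by (simp only: sum_divide_distrib[symmetric]) (simp only: m_def)
  qed
  then show ?thesis using m[of \<nu>] by simp
 qed
 have \<Psi>1: "norm (\<Psi> \<nu> i j) \<le> 1" if "i < n" "j < k" for \<nu> i j
 proof -
  have "norm (\<Psi> \<nu> i j) \<le> (\<Sum>j<k. norm (\<Psi> \<nu> i j))" by (rule member_le_sum) (use that in auto)
  also have "\<dots> \<le> (\<Sum>i<n. \<Sum>j<k. norm (\<Psi> \<nu> i j))" by (rule member_le_sum) (use that in \<open>auto intro: sum_nonneg\<close>)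
  finally show ?thesis by (simp add: sum1)
 qed
 obtain r1 :: "nat => nat" where r1: "strict_mono r1"
  and cv: "\<And>p. p \<in> {..<n} \<times> {..<k} ==> convergent (%\<nu>. \<Psi> ((id \<circ> r1) \<nu>) (fst p) (snd p))"
 proof (rule common_subsequence[of "{..<n} \<times> {..<k}" "%p r. convergent (%\<nu>. \<Psi> (r \<nu>) (fst p) (snd p))" id])
  show "\<exists>r'. strict_mono (r' :: nat => nat) \<and> convergent (%\<nu>. \<Psi> ((r \<circ> r') \<nu>) (fst p) (snd p))"
   if pr: "p \<in> {..<n} \<times> {..<k}" "strict_mono (r :: nat => nat)" for p r
  proof -
   have "bounded (range (%\<nu>. \<Psi> (r \<nu>) (fst p) (snd p)))"
    unfolding bounded_iff by (rule exI[of _ 1]) (use pr \<Psi>1 in auto)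
   then obtain l r' where "strict_mono (r' :: nat => nat)" "((%\<nu>. \<Psi> (r \<nu>) (fst p) (snd p)) \<circ> r') \<longlonglongrightarrow> l"
    using bounded_imp_convergent_subsequence by blast
   then show ?thesis by (intro exI[of _ r']) (auto simp: convergent_def o_def)
  qed
  show "convergent (%\<nu>. \<Psi> ((r \<circ> r') \<nu>) (fst p) (snd p))"
   if "convergent (%\<nu>. \<Psi> (r \<nu>) (fst p) (snd p))" "strict_mono (r' :: nat => nat)" for p r r'
   using convergent_subseq_convergent[OF that] by (simp add: o_def)
 qed (auto simp: strict_mono_id)
 define \<Psi>' where "\<Psi>' = (%i j. lim (%\<nu>. \<Psi> (r1 \<nu>) i j))"
 have lim\<Psi>: "(%\<nu>. \<Psi> (r1 \<nu>) i j) \<longlonglongrightarrow> \<Psi>' i j" if "i < n" "j < k" for i j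
  using cv[of "(i, j)"] that by (simp add: \<Psi>'_def convergent_LIMSEQ_iff)
 define r where "r = r0 \<circ> r1"
 have r: "strict_mono r" unfolding r_def using r0 r1 by (rule strict_mono_o)
 have sub: "(%\<nu>. f (r1 \<nu>)) \<longlonglongrightarrow> L" if "f \<longlonglongrightarrow> L" for f :: "nat => 'z::topological_space" and L
  using LIMSEQ_subseq_LIMSEQ[OF that r1] by (simp add: o_def)
 have "(\<Sum>i<n. \<Sum>j<k. norm (\<Psi>' i j)) = 1"
 proof -
  have "(%\<nu>. \<Sum>i<n. \<Sum>j<k. norm (\<Psi> (r1 \<nu>) i j)) \<longlonglongrightarrow> (\<Sum>i<n. \<Sum>j<k. norm (\<Psi>' i j))"
   by (intro tendsto_sum tendsto_norm lim\<Psi>) auto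
  then show ?thesis by (simp add: sum1 LIMSEQ_const_iff)
 qed
 then have nz: "\<not> (\<forall>i<n. \<forall>j<k. \<Psi>' i j = 0)" by (intro notI) simp
 have con: "\<Psi>' \<in> conormal n k M"
  unfolding conormal_def
 proof (intro CollectI conjI allI impI)
  fix i i' assume i: "i < n" "i' < n"
  have "(%\<nu>. \<Sum>j<k. \<Psi> (r1 \<nu>) i j * (F (z (r0 (r1 \<nu>))) $$ (i', j) / \<sigma> j (r1 \<nu>))) \<longlonglongrightarrow> (\<Sum>j<k. \<Psi>' i j * M i' j)"
   by (intro tendsto_sum tendsto_mult lim\<Psi> sub[OF limF]) (use i in auto)
  moreover have "(\<Sum>j<k. \<Psi> \<nu> i j * (F (z (r0 \<nu>)) $$ (i', j) / \<sigma> j \<nu>)) = 0" for \<nu>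
  proof -
   have "(\<Sum>j<k. \<Psi> \<nu> i j * (F (z (r0 \<nu>)) $$ (i', j) / \<sigma> j \<nu>)) = (\<Sum>j<k. \<Phi> (r0 \<nu>) i j * F (z (r0 \<nu>)) $$ (i', j)) / of_real (m \<nu>)"
    unfolding sum_divide_distrib \<Psi>_def using \<sigma> by (intro sum.cong refl) simp
   also have "\<dots> = 0" using \<Phi>[of "r0 \<nu>"] i by (simp add: conormal_def)
   finally show ?thesis .
  qed
  ultimately show "(\<Sum>j<k. \<Psi>' i j * M i' j) = 0" by (simp add: LIMSEQ_const_iff)
 next
  fix j j' assume j: "j < k" "j' < k"
  have "(%\<nu>. \<Sum>i<n. \<Psi> (r1 \<nu>) i j * (F (z (r0 (r1 \<nu>))) $$ (i, j') / \<sigma> j' (r1 \<nu>))) \<longlonglongrightarrow> (\<Sum>i<n. \<Psi>' i j * M i j')"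
   by (intro tendsto_sum tendsto_mult lim\<Psi> sub[OF limF]) (use j in auto)
  moreover have "(\<Sum>i<n. \<Psi> \<nu> i j * (F (z (r0 \<nu>)) $$ (i, j') / \<sigma> j' \<nu>)) = 0" for \<nu>
  proof -
   have "(\<Sum>i<n. \<Psi> \<nu> i j * (F (z (r0 \<nu>)) $$ (i, j') / \<sigma> j' \<nu>))
     = (\<Sum>i<n. \<Phi> (r0 \<nu>) i j * F (z (r0 \<nu>)) $$ (i, j')) * (\<sigma> j \<nu> / (of_real (m \<nu>) * \<sigma> j' \<nu>))"
    unfolding sum_distrib_right \<Psi>_def by (intro sum.cong refl) simp
   also have "(\<Sum>i<n. \<Phi> (r0 \<nu>) i j * F (z (r0 \<nu>)) $$ (i, j')) = 0" using \<Phi>[of "r0 \<nu>"] j by (simp add: conormal_def)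
   finally show ?thesis by simp
  qed
  ultimately show "(\<Sum>i<n. \<Psi>' i j * M i j') = 0" by (simp add: LIMSEQ_const_iff)
 qed
 define \<theta> where "\<theta> = (%l. y $ l * pull_back n k g \<Psi>' $ l)"
 let ?h = "%\<nu>. \<eta> (r \<nu>)" and ?x = "%\<nu>. xpart (z (r \<nu>))" and ?m = "%\<nu>. m (r1 \<nu>)"
 have \<eta>: "?h \<nu> $ l = (\<Sum>i<n. \<Sum>j<k. \<Phi> (r \<nu>) i j * pderivative l (%z. F z $$ (i, j)) (z (r \<nu>)))" for \<nu> l
  by (simp add: \<eta>_def pull_back_def gradient_nth)
 have lim\<theta>: "(%\<nu>. ?x \<nu> $ l * ?h \<nu> $ Some l / of_real (?m \<nu>)) \<longlonglongrightarrow> \<theta> l" for l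
 proof -
  have "(%\<nu>. \<Sum>i<n. \<Sum>j<k. \<Psi> (r1 \<nu>) i j * (z (r0 (r1 \<nu>)) $ Some l * pderivative (Some l) (%z. F z $$ (i, j)) (z (r0 (r1 \<nu>))) / \<sigma> j (r1 \<nu>)))
    \<longlonglongrightarrow> (\<Sum>i<n. \<Sum>j<k. \<Psi>' i j * (y $ l * g i j $ l))"
   by (intro tendsto_sum tendsto_mult lim\<Psi> sub[OF limG]) auto
  moreover have "(\<Sum>i<n. \<Sum>j<k. \<Psi> (r1 \<nu>) i j * (z (r0 (r1 \<nu>)) $ Some l * pderivative (Some l) (%z. F z $$ (i, j)) (z (r0 (r1 \<nu>))) / \<sigma> j (r1 \<nu>)))
   = ?x \<nu> $ l * ?h \<nu> $ Some l / of_real (?m \<nu>)" for \<nu>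
   unfolding \<eta> unfolding \<Psi>_def sum_distrib_left sum_divide_distrib r_def using \<sigma> by (intro sum.cong refl) simp
  moreover have "(\<Sum>i<n. \<Sum>j<k. \<Psi>' i j * (y $ l * g i j $ l)) = \<theta> l"
   by (simp add: \<theta>_def pull_back_def sum_distrib_left mult_ac)
  ultimately show ?thesis by simp
 qed
 obtain \<tau> where lim\<tau>: "(%\<nu>. ?h \<nu> $ None / of_real (?m \<nu>)) \<longlonglongrightarrow> \<tau>"
 proof -
  have "convergent (%\<nu>. \<Sum>i<n. \<Sum>j<k. \<Psi> (r1 \<nu>) i j * (pderivative None (%z. F z $$ (i, j)) (z (r0 (r1 \<nu>))) / \<sigma> j (r1 \<nu>)))"
  proof (intro convergent_sum convergent_mult)
   fix i j assume "i \<in> {..<n}" "j \<in> {..<k}"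
   then show "convergent (%\<nu>. \<Psi> (r1 \<nu>) i j)" "convergent (%\<nu>. pderivative None (%z. F z $$ (i, j)) (z (r0 (r1 \<nu>))) / \<sigma> j (r1 \<nu>))"
    using lim\<Psi>[of i j] convergent_subseq_convergent[OF limT[of i j] r1] by (auto simp: convergent_def o_def)
  qed
  moreover have "(\<Sum>i<n. \<Sum>j<k. \<Psi> (r1 \<nu>) i j * (pderivative None (%z. F z $$ (i, j)) (z (r0 (r1 \<nu>))) / \<sigma> j (r1 \<nu>)))
   = ?h \<nu> $ None / of_real (?m \<nu>)" for \<nu>
   unfolding \<eta> unfolding \<Psi>_def sum_divide_distrib r_def using \<sigma> by (intro sum.cong refl) simp
  ultimately show thesis using that by (auto simp: convergent_def)
 qed
 obtain l0 where l0: "\<theta> l0 ~= 0"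
 proof (rule ccontr)
  assume "\<not> thesis"
  then have "\<theta> l = 0" for l using that by blast
  then have "pull_back n k g \<Psi>' = 0"
   using y by (simp add: \<theta>_def complex_torus_def Finite_Cartesian_Product.vec_eq_iff)
  then show False using inj con nz by blast
 qed
 have xr: "(%\<nu>. ?x \<nu> $ l) \<longlonglongrightarrow> 0" for l
  using tendsto_vec_nth[OF LIMSEQ_subseq_LIMSEQ[OF z r], of "Some l"] by (simp add: o_def)
 have er: "(%\<nu>. norm (?x \<nu> $ l) / norm (?x \<nu>)) \<longlonglongrightarrow> norm (e $ l)" for l
 proof -
  have "(%\<nu>. norm ((xpart (z (r0 (r1 \<nu>))) /\<^sub>R norm (xpart (z (r0 (r1 \<nu>))))) $ l)) \<longlonglongrightarrow> norm (e $ l)"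
   by (intro tendsto_norm tendsto_vec_nth sub[OF e])
  then show ?thesis by (simp add: divide_inverse mult.commute r_def)
 qed
 have evnz: "\<forall>\<^sub>F \<nu> in sequentially. ?x \<nu> $ l * ?h \<nu> $ Some l ~= 0" if "\<theta> l ~= 0" for l
 proof -
  have "\<forall>\<^sub>F \<nu> in sequentially. ?x \<nu> $ l * ?h \<nu> $ Some l / of_real (?m \<nu>) ~= 0"
   by (rule tendsto_imp_eventually_ne[OF lim\<theta> that])
  then show ?thesis by eventually_elim auto
 qed
 have hx: "norm (?h \<nu> $ l) \<le> norm (?h \<nu>)" "norm (?x \<nu> $ l') \<le> norm (?x \<nu>)" for \<nu> l l'
  by (rule Finite_Cartesian_Product.norm_nth_le)+
 have xpos: "0 < norm (?x \<nu>)" for \<nu> using x by simp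
 \<comment> \<open>A coordinate with a nonzero limit bounds \<open>\<eta>\<close> from below.\<close>
 have bound: "A / norm (?h \<nu>) \<le> (A / ?m \<nu>) * norm (?x \<nu> $ l) / norm (?x \<nu> $ l * ?h \<nu> $ Some l / of_real (?m \<nu>))"
  if nz: "?x \<nu> $ l * ?h \<nu> $ Some l ~= 0" and A: "0 \<le> A" for A \<nu> l
 proof -
  have "A / norm (?h \<nu>) \<le> A / norm (?h \<nu> $ Some l)"
  proof (rule divide_left_mono[OF hx(1) A])
   have "0 < norm (?h \<nu> $ Some l)" using nz by simp
   moreover from this have "0 < norm (?h \<nu>)" using hx(1) by (rule less_le_trans)
   ultimately show "0 < norm (?h \<nu>) * norm (?h \<nu> $ Some l)" by (rule mult_pos_pos[rotated])
  qed
  also have "\<dots> = (A / ?m \<nu>) * norm (?x \<nu> $ l) / norm (?x \<nu> $ l * ?h \<nu> $ Some l / of_real (?m \<nu>))"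
   using nz m[of "r1 \<nu>"] by (simp add: norm_mult norm_divide)
  finally show ?thesis .
 qed
 have normm: "norm w / ?m \<nu> = norm (w / of_real (?m \<nu>))" for w :: complex and \<nu>
  using m[of "r1 \<nu>"] by (simp add: norm_divide)
 have T: "(%\<nu>. norm (?h \<nu> $ None) / norm (?h \<nu>)) \<longlonglongrightarrow> 0"
 proof (rule tendsto_sandwich[OF _ _ tendsto_const])
  show "\<forall>\<^sub>F \<nu> in sequentially. norm (?h \<nu> $ None) / norm (?h \<nu>) \<le>
    norm (?h \<nu> $ None / of_real (?m \<nu>)) * norm (?x \<nu> $ l0) / norm (?x \<nu> $ l0 * ?h \<nu> $ Some l0 / of_real (?m \<nu>))"
   using evnz[OF l0]
  proof eventually_elim
   case (elim \<nu>)
   show ?case using bound[OF elim norm_ge_zero, of "?h \<nu> $ None"] unfolding normm .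
  qed
  have "(%\<nu>. norm (?h \<nu> $ None / of_real (?m \<nu>)) * norm (?x \<nu> $ l0) / norm (?x \<nu> $ l0 * ?h \<nu> $ Some l0 / of_real (?m \<nu>)))
    \<longlonglongrightarrow> norm \<tau> * norm (0 :: complex) / norm (\<theta> l0)"
   by (intro tendsto_divide tendsto_mult tendsto_norm lim\<tau> lim\<theta> xr) (use l0 in simp)
  then show "(%\<nu>. norm (?h \<nu> $ None / of_real (?m \<nu>)) * norm (?x \<nu> $ l0) / norm (?x \<nu> $ l0 * ?h \<nu> $ Some l0 / of_real (?m \<nu>))) \<longlonglongrightarrow> 0"
   by simp
 qed (simp)
 define S where "S = (%\<nu>. \<Sum>l\<in>UNIV. z (r \<nu>) $ Some l * ?h \<nu> $ Some l)"
 have limS: "(%\<nu>. S \<nu> / of_real (?m \<nu>)) \<longlonglongrightarrow> (\<Sum>l\<in>UNIV. \<theta> l)"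
  unfolding S_def sum_divide_distrib using lim\<theta> by (intro tendsto_sum) simp
 have "(%\<nu>. norm (S \<nu>) / (norm (?x \<nu>) * norm (?h \<nu>))) \<longlonglongrightarrow> 0"
 proof -
  obtain l1 where l1: "\<theta> l1 ~= 0" "e $ l1 = 0 \<or> (\<Sum>l\<in>UNIV. \<theta> l) = 0"
  proof (cases "(\<Sum>l\<in>UNIV. \<theta> l) = 0")
   case False
   then obtain l where "e $ l = 0" "\<theta> l ~= 0" using euler[OF con] unfolding \<theta>_def by blast
   then show thesis using that by blast
  qed (use l0 that in blast)
  show ?thesis
  proof (rule tendsto_sandwich[OF _ _ tendsto_const])
   show "\<forall>\<^sub>F \<nu> in sequentially. norm (S \<nu>) / (norm (?x \<nu>) * norm (?h \<nu>)) \<le>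
     norm (S \<nu> / of_real (?m \<nu>)) * (norm (?x \<nu> $ l1) / norm (?x \<nu>)) / norm (?x \<nu> $ l1 * ?h \<nu> $ Some l1 / of_real (?m \<nu>))"
    using evnz[OF l1(1)]
   proof eventually_elim
    case (elim \<nu>)
    have "norm (S \<nu>) / (norm (?x \<nu>) * norm (?h \<nu>)) = (norm (S \<nu>) / norm (?h \<nu>)) / norm (?x \<nu>)" by simp
    also have "\<dots> \<le> (norm (S \<nu> / of_real (?m \<nu>)) * norm (?x \<nu> $ l1) / norm (?x \<nu> $ l1 * ?h \<nu> $ Some l1 / of_real (?m \<nu>))) / norm (?x \<nu>)"
     using bound[OF elim norm_ge_zero, of "S \<nu>"] unfolding normm by (rule divide_right_mono) simp
    finally show ?case by (simp add: mult_ac)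
   qed
   have "(%\<nu>. norm (S \<nu> / of_real (?m \<nu>)) * (norm (?x \<nu> $ l1) / norm (?x \<nu>)) / norm (?x \<nu> $ l1 * ?h \<nu> $ Some l1 / of_real (?m \<nu>)))
     \<longlonglongrightarrow> norm (\<Sum>l\<in>UNIV. \<theta> l) * norm (e $ l1) / norm (\<theta> l1)"
    by (intro tendsto_divide tendsto_mult tendsto_norm limS lim\<theta> er) (use l1 in simp)
   then show "(%\<nu>. norm (S \<nu> / of_real (?m \<nu>)) * (norm (?x \<nu> $ l1) / norm (?x \<nu>)) / norm (?x \<nu> $ l1 * ?h \<nu> $ Some l1 / of_real (?m \<nu>))) \<longlonglongrightarrow> 0"
    using l1(2) by auto
  qed (simp)
 qed
 moreover have "\<forall>\<^sub>F \<nu> in sequentially. xpart (?h \<nu>) ~= 0"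
  using evnz[OF l0] by eventually_elim (auto simp: Finite_Cartesian_Product.vec_eq_iff)
 moreover have "\<forall>\<^sub>F \<nu> in sequentially. minor I J (%i j. F (z (r \<nu>)) $$ (i, j)) ~= 0"
  using eventually_subseq[OF r1 minor_ev] by (simp add: r_def)
 ultimately show thesis using IJ T by (intro that[OF r]) (auto simp: S_def)
qed

end

section \<open>Regular points of determinantal loci\<close>

lemma holomorphic_Cn_onI_bilin:
 assumes "\<And>z. z \<in> U ==> (f has_derivative bilin (g z)) (at z)"
 shows "holomorphic_Cn_on f U"
 by (rule holomorphic_Cn_onI) (use assms in \<open>auto simp: bilin_def[abs_def]\<close>)

text \<open>A largest nonzero minor has bordered minors with nonzero cofactors.\<close>

lemma conormal_nonzero_exists:
 assumes s: "0 < s" "s \<le> n" "s \<le> k" and lr: "low_rank (s - 1) n k M"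
 obtains \<Phi> where "\<Phi> \<in> conormal n k M" "\<exists>i<n. \<exists>j<k. \<Phi> i j ~= 0"
proof -
 let ?P = "%r. \<exists>I J. I \<subseteq> {..<n} \<and> J \<subseteq> {..<k} \<and> card I = r \<and> card J = r \<and> minor I J M ~= 0"
 define r where "r = (GREATEST r. ?P r)"
 have P0: "?P 0" by (rule exI[of _ "{}"], rule exI[of _ "{}"]) simp
 have bd: "\<forall>r. ?P r \<longrightarrow> r \<le> s - 1"
 proof (intro allI impI)
  fix r assume "?P r"
  then obtain I J where IJ: "I \<subseteq> {..<n}" "J \<subseteq> {..<k}" "card I = r" "card J = r" "minor I J M ~= 0" by (elim exE conjE)
  show "r \<le> s - 1"
  proof (rule ccontr)
   assume "\<not> r \<le> s - 1"
   then have "minor I J M = 0" by (intro low_rank_imp_minor_zero[OF lr]) (use IJ in auto)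
   with IJ show False by simp
  qed
 qed
 have "?P r" unfolding r_def by (rule GreatestI_nat[where P = ?P and b = "s - 1"], rule P0, use bd in blast)
 then obtain I J where IJ: "I \<subseteq> {..<n}" "J \<subseteq> {..<k}" "card I = r" "card J = r" "minor I J M ~= 0" by (elim exE conjE)
 have rs: "r \<le> s - 1" using bd \<open>?P r\<close> by blast
 have "low_rank r n k M"
 proof (rule minors_zero_imp_low_rank, rule ccontr)
  fix I J assume "I \<subseteq> {..<n}" "J \<subseteq> {..<k}" "card I = Suc r" "card J = Suc r" "minor I J M ~= 0"
  then have "?P (Suc r)" by (intro exI conjI)
  then have "Suc r \<le> r" unfolding r_def[symmetric]
   using Greatest_le_nat[where P = ?P and b = "s - 1", OF _ bd[rule_format]] by (simp add: r_def)
  then show False by simp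
 qed
 then have lr': "low_rank (Suc r - 1) n k M" by simp
 have s': "0 < Suc r" "Suc r \<le> n" "Suc r \<le> k" using rs s by auto
 have cards: "card I = Suc r - 1" "card J = Suc r - 1" using IJ by auto
 note c = s' lr' IJ(1) cards(1) IJ(2) cards(2) IJ(5)
 have "card (border n k I J) = det_codim n k (Suc r)" by (rule card_border[OF c])
 then have "border n k I J ~= {}" by (auto simp: det_codim_def)
 then obtain q where q: "q \<in> border n k I J" by blast
 show thesis
  by (rule that[OF border_cofactor_conormal[OF c q]], rule exI[of _ "fst q"])
   (use q border_cofactor_diag[OF c q] in \<open>auto simp: border_def[OF c] intro!: exI[of _ "snd q"]\<close>)
qed

text \<open>Near a transversal point the bordered minors are equations with independent gradients, and these gradients span
 the pull-back of the conormal space.\<close>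

lemma det_locus_regular:
 fixes A :: "complex^'m::finite => complex mat"
 assumes s: "0 < s" "s \<le> n" "s \<le> k"
  and hol: "\<And>i j. i < n ==> j < k ==> holomorphic_Cn_on (%y. A y $$ (i, j)) U" and U: "open U" "z \<in> U"
  and A: "\<And>y. y \<in> U ==> A y \<in> carrier_mat n k"
  and X: "\<And>y. y \<in> U ==> y \<in> X \<longleftrightarrow> low_rank (s - 1) n k (%i j. A y $$ (i, j))" and z: "z \<in> X"
  and trans: "transversal n k s (%i j. A z $$ (i, j)) (entry_gradients A z)"
 shows "\<exists>d. submanifold_at X z d"
  and "tangent_space X z = {u. \<forall>\<Phi>\<in>conormal n k (%i j. A z $$ (i, j)). bilin (pull_back n k (entry_gradients A z) \<Phi>) u = 0}"
  and "(\<And>u. u \<in> tangent_space X z ==> bilin c u = 0) ==>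
    \<exists>\<Phi>\<in>conormal n k (%i j. A z $$ (i, j)). c = pull_back n k (entry_gradients A z) \<Phi>"
proof -
 let ?M = "%y i j. A y $$ (i, j)" and ?G = "pull_back n k (entry_gradients A z)"
 have lr: "low_rank (s - 1) n k (?M z)" using X[OF U(2)] z by simp
 obtain I J where IJ: "I \<subseteq> {..<n}" "card I = s - 1" "J \<subseteq> {..<k}" "card J = s - 1" "minor I J (?M z) ~= 0"
  using trans unfolding transversal_def by (elim conjE exE)
 have inj: "\<forall>\<Phi>\<in>conormal n k (?M z). ?G \<Phi> = 0 \<longrightarrow> (\<forall>i<n. \<forall>j<k. \<Phi> i j = 0)"
  using trans unfolding transversal_def by (rule conjunct2)
 note c = s lr IJ
 let ?Q = "border n k I J"
 define h where "h = (%q y. minor (insert (fst q) I) (insert (snd q) J) (?M y))"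
 have hd: "(h q has_derivative bilin (pull_back n k (entry_gradients A y) (minor_cofactor (insert (fst q) I) (insert (snd q) J) (?M y)))) (at y)"
  if "q \<in> ?Q" "y \<in> U" for q y
  unfolding h_def
  by (rule has_derivative_minor_entries[OF hol that(2)]) (use border_sets[OF c that(1)] in auto)
 have hh: "holomorphic_Cn_on (h q) U" if "q \<in> ?Q" for q
  by (rule holomorphic_Cn_onI_bilin[OF hd[OF that]])
 have grad: "gradient (h q) z = ?G (border_cofactor (?M z) I J q)" if "q \<in> ?Q" for q
  using gradient_eqI[OF hd[OF that U(2)]] by (simp add: border_cofactor_def[OF c])
 have fQ: "finite ?Q" by (rule finite_border[OF c])
 have indep: "\<forall>q\<in>?Q. c' q = 0" if "(\<Sum>q\<in>?Q. c' q *s gradient (h q) z) = 0" for c'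
 proof (rule pull_back_border_independent[OF c inj])
  show "(\<Sum>q\<in>?Q. c' q *s ?G (border_cofactor (?M z) I J q)) = 0"
   using that by (simp add: grad)
 qed
 have mcont: "continuous_on U (%y. minor I J (?M y))"
 proof (rule continuous_at_imp_continuous_on, rule ballI)
  fix y assume "y \<in> U"
  then show "isCont (%y. minor I J (?M y)) y"
   by (intro has_derivative_continuous[OF has_derivative_minor_entries[OF hol]]) (use IJ in auto)
 qed
 define U' where "U' = U \<inter> (%y. minor I J (?M y)) -` (- {0})"
 have U': "open U'" "z \<in> U'" "U' \<subseteq> U"
 proof -
  show "open U'" unfolding U'_def by (rule continuous_open_preimage[OF mcont U(1)]) auto
 qed (use U IJ in \<open>auto simp: U'_def\<close>)
 have hh': "holomorphic_Cn_on (h q) U'" if "q \<in> ?Q" for q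
  using hh[OF that] U'(3) by (auto simp: holomorphic_Cn_on_def)
 have X': "y \<in> X \<longleftrightarrow> (\<forall>q\<in>?Q. h q y = 0)" if y: "y \<in> U'" for y
 proof
  assume "y \<in> X"
  then have lr: "low_rank (s - 1) n k (?M y)" using X y U'(3) by blast
  show "\<forall>q\<in>?Q. h q y = 0"
  proof
   fix q assume q: "q \<in> ?Q"
   show "h q y = 0" unfolding h_def
    by (rule low_rank_imp_minor_zero[OF lr]) (use border_sets[OF c q] s in auto)
  qed
 next
  assume h0: "\<forall>q\<in>?Q. h q y = 0"
  have "low_rank (card I) n k (?M y)"
  proof (rule bordered_minors_zero_imp_low_rank[OF IJ(1) IJ(3)])
   show "minor I J (?M y) ~= 0" using y by (simp add: U'_def)
   fix i j assume "i < n" "i \<notin> I" "j < k" "j \<notin> J"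
   then have "(i, j) \<in> ?Q" by (simp add: border_def[OF c])
   then show "minor (insert i I) (insert j J) (?M y) = 0" using h0 by (auto simp: h_def)
  qed (use IJ in auto)
  then show "y \<in> X" using X y U'(3) IJ by auto
 qed
 show "\<exists>d. submanifold_at X z d" by (rule regular_zero_set(1)[OF fQ U'(1,2) hh' X' z indep])
 have reg: "tangent_space X z = {u. \<forall>q\<in>?Q. bilin (gradient (h q) z) u = 0}"
  by (rule regular_zero_set(2)[OF fQ U'(1,2) hh' X' z indep])
 have expand: "?G \<Phi> = (\<Sum>q\<in>?Q. (\<Phi> (fst q) (snd q) / border_cofactor (?M z) I J q (fst q) (snd q)) *s gradient (h q) z)"
  if \<Phi>: "\<Phi> \<in> conormal n k (?M z)" for \<Phi>
 proof -
  have "?G \<Phi> = ?G (%i j. \<Sum>q\<in>?Q. \<Phi> (fst q) (snd q) / border_cofactor (?M z) I J q (fst q) (snd q) * border_cofactor (?M z) I J q i j)"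
   unfolding pull_back_def by (intro sum.cong refl arg_cong2[where f = "(*s)"]) (rule conormal_expand[OF c \<Phi>], auto)
  also have "\<dots> = (\<Sum>q\<in>?Q. (\<Phi> (fst q) (snd q) / border_cofactor (?M z) I J q (fst q) (snd q)) *s ?G (border_cofactor (?M z) I J q))"
   by (rule pull_back_sum)
  finally show ?thesis by (simp add: grad)
 qed
 show tan: "tangent_space X z = {u. \<forall>\<Phi>\<in>conormal n k (?M z). bilin (?G \<Phi>) u = 0}"
 unfolding reg
 proof (intro equalityI subsetI CollectI ballI)
  fix u \<Phi> assume u: "u \<in> {u. \<forall>q\<in>?Q. bilin (gradient (h q) z) u = 0}" and \<Phi>: "\<Phi> \<in> conormal n k (?M z)"
  show "bilin (?G \<Phi>) u = 0" unfolding expand[OF \<Phi>] using u by (simp add: bilin_sum_left)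
 next
  fix u q assume u: "u \<in> {u. \<forall>\<Phi>\<in>conormal n k (?M z). bilin (?G \<Phi>) u = 0}" and q: "q \<in> ?Q"
  show "bilin (gradient (h q) z) u = 0" using u border_cofactor_conormal[OF c q] by (simp add: grad[OF q])
 qed
 assume van: "\<And>u. u \<in> tangent_space X z ==> bilin c u = 0"
 obtain v where v: "\<And>q q'. q \<in> ?Q ==> q' \<in> ?Q ==> bilin (gradient (h q) z) (v q') = (if q = q' then 1 else 0)"
  by (rule dual_vectors[OF fQ indep]) (assumption | rule that)+
 have cb: "bilin c u = (\<Sum>q\<in>?Q. bilin (gradient (h q) z) u * bilin c (v q))" for u
 proof -
  let ?u = "u - (\<Sum>q\<in>?Q. bilin (gradient (h q) z) u *s v q)"
  have u0: "bilin (gradient (h q) z) ?u = 0" if q: "q \<in> ?Q" for q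
  proof -
   have "(\<Sum>q'\<in>?Q. bilin (gradient (h q') z) u * bilin (gradient (h q) z) (v q')) = (\<Sum>q'\<in>?Q. if q' = q then bilin (gradient (h q') z) u else 0)"
    by (rule sum.cong) (use v q in auto)
   then show ?thesis using q fQ by (simp add: bilin_sum)
  qed
  then have "?u \<in> tangent_space X z" unfolding reg by (intro CollectI ballI)
  then have "bilin c ?u = 0" by (rule van)
  then show ?thesis by (simp only: bilin_simps bilin_sum) simp
 qed
 have "c = (\<Sum>q\<in>?Q. bilin c (v q) *s gradient (h q) z)"
 proof (subst Finite_Cartesian_Product.vec_eq_iff, rule allI)
  fix i
  show "c $ i = (\<Sum>q\<in>?Q. bilin c (v q) *s gradient (h q) z) $ i"
   using cb[of "axis i 1"] by (simp add: bilin_axis mult.commute)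
 qed
 also have "\<dots> = ?G (%i j. \<Sum>q\<in>?Q. bilin c (v q) * border_cofactor (?M z) I J q i j)"
  by (simp add: pull_back_sum grad)
 finally have c_eq: "c = ?G (%i j. \<Sum>q\<in>?Q. bilin c (v q) * border_cofactor (?M z) I J q i j)" .
 have "(%i j. 0 - (\<Sum>q\<in>?Q. - bilin c (v q) * border_cofactor (?M z) I J q i j)) \<in> conormal n k (?M z)"
  by (rule conormal_diff_sum, simp add: conormal_def, rule border_cofactor_conormal[OF c])
 then have "(%i j. \<Sum>q\<in>?Q. bilin c (v q) * border_cofactor (?M z) I J q i j) \<in> conormal n k (?M z)"
  by (simp add: sum_negf)
 with c_eq show "\<exists>\<Phi>\<in>conormal n k (?M z). c = ?G \<Phi>" by (rule bexI)
qed

section \<open>Limits of tangent spaces\<close>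

lemma inner_complex_vec: "a \<bullet> b = Re (bilin (\<chi> i. cnj (a $ i)) b)" for a b :: "complex^'n::finite"
 by (simp add: inner_vec_def bilin_def inner_complex_def)

lemma bilin_cnj_self: "bilin (\<chi> i. cnj (a $ i)) a = of_real ((norm a)\<^sup>2)" for a :: "complex^'n::finite"
proof (rule complex_eqI)
 show "Re (bilin (\<chi> i. cnj (a $ i)) a) = Re (of_real ((norm a)\<^sup>2))"
  by (simp add: inner_complex_vec[symmetric] power2_norm_eq_inner del: of_real_power)
 show "Im (bilin (\<chi> i. cnj (a $ i)) a) = Im (of_real ((norm a)\<^sup>2))"
  by (simp add: bilin_def mult.commute del: of_real_power)
qed

lemma norm_cnj_vec: "norm (\<chi> i. cnj (a $ i)) = norm a" for a :: "complex^'n::finite"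
 by (simp add: norm_vec_def)

lemma scaleR_eq_vector_scalar_mult: "c *\<^sub>R v = complex_of_real c *s v" for v :: "complex^'n"
 by (simp add: Finite_Cartesian_Product.vec_eq_iff scaleR_conv_of_real[where 'a = complex])

lemma subspace_functionals:
 "Real_Vector_Spaces.subspace {u :: complex^'n::finite. \<forall>a\<in>S. bilin a u = 0}"
 by (auto simp: Real_Vector_Spaces.subspace_def scaleR_eq_vector_scalar_mult)

lemma closest_point_subspace:
 fixes L :: "'a::euclidean_space set"
 assumes L: "Real_Vector_Spaces.subspace L"
 shows "closest_point L v \<in> L" and "u \<in> L ==> (v - closest_point L v) \<bullet> u = 0"
  and "dist (closest_point L v) (closest_point L v') \<le> dist v v'"
  and "v \<in> L \<longleftrightarrow> closest_point L v = v"
proof -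
 have c: "closed L" "convex L" "L ~= {}"
  using L closed_subspace subspace_imp_convex Real_Vector_Spaces.subspace_0 by blast+
 show P: "closest_point L v \<in> L" by (rule closest_point_in_set[OF c(1,3)])
 show "dist (closest_point L v) (closest_point L v') \<le> dist v v'"
  by (rule closest_point_lipschitz[OF c(2,1,3)])
 show "v \<in> L \<longleftrightarrow> closest_point L v = v" using P closest_point_self by metis
 assume u: "u \<in> L"
 have le: "(v - closest_point L v) \<bullet> (u' - closest_point L v) \<le> 0" if "u' \<in> L" for u'
  by (rule closest_point_dot[OF c(2,1) that])
 have "closest_point L v + u \<in> L" "closest_point L v - u \<in> L"
  using P u L by (auto simp: Real_Vector_Spaces.subspace_add Real_Vector_Spaces.subspace_diff)
 from le[OF this(1)] le[OF this(2)] show "(v - closest_point L v) \<bullet> u = 0" by simp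
qed

text \<open>The difference of a vector and its projection to a complex subspace is, up to conjugation, a functional that vanishes
 on the subspace.\<close>

lemma projection_defect:
 fixes L :: "(complex^'n::finite) set"
 assumes L: "Real_Vector_Spaces.subspace L" and cL: "\<And>c u. u \<in> L ==> c *s u \<in> L"
  and ne: "closest_point L v ~= v"
 obtains \<eta> where "\<eta> ~= 0" "\<And>u. u \<in> L ==> bilin \<eta> u = 0" "norm (v - closest_point L v) = norm (bilin \<eta> v) / norm \<eta>"
proof -
 define a where "a = v - closest_point L v"
 define \<eta> where "\<eta> = (\<chi> i. cnj (a $ i))"
 have a: "a ~= 0" using ne by (simp add: a_def)
 have van: "bilin \<eta> u = 0" if u: "u \<in> L" for u
 proof -
  have "Re (bilin \<eta> u) = 0" using closest_point_subspace(2)[OF L u, of v] by (simp add: inner_complex_vec a_def \<eta>_def)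
  moreover have "Re (bilin \<eta> (\<i> *s u)) = 0" using closest_point_subspace(2)[OF L cL[OF u, of \<i>], of v]
   by (simp only: inner_complex_vec a_def \<eta>_def)
  ultimately show ?thesis by (simp add: complex_eq_iff)
 qed
 have "bilin \<eta> v = bilin \<eta> (a + closest_point L v)" by (simp add: a_def)
 also have "\<dots> = of_real ((norm a)\<^sup>2)"
  using van[OF closest_point_subspace(1)[OF L]] by (simp only: bilin_simps) (simp add: \<eta>_def bilin_cnj_self)
 finally have "norm (bilin \<eta> v) = (norm a)\<^sup>2" by (simp add: norm_power)
 moreover have n: "norm \<eta> = norm a" by (simp add: \<eta>_def norm_cnj_vec)
 ultimately have "norm a = norm (bilin \<eta> v) / norm \<eta>" using a by (simp add: power2_eq_square)
 moreover have "\<eta> ~= 0" using n a by auto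
 ultimately show thesis using van by (intro that[of \<eta>]) (auto simp: a_def)
qed

context newton_germ
begin

text \<open>A sequence of counterexamples would contradict the asymptotics of conormal vectors.\<close>

lemma transversal_near:
 obtains \<epsilon> where "0 < \<epsilon>" "\<And>z \<Phi>. norm z < \<epsilon> ==> xpart z ~= 0 ==> low_rank (s - 1) n k (%i j. F z $$ (i, j)) ==>
   (\<exists>I J. I \<subseteq> {..<n} \<and> J \<subseteq> {..<k} \<and> card I = s - 1 \<and> card J = s - 1 \<and> minor I J (%i j. F z $$ (i, j)) ~= 0) \<and>
   (\<Phi> \<in> conormal n k (%i j. F z $$ (i, j)) \<longrightarrow> xpart (pull_back n k (entry_gradients F z) \<Phi>) = 0 \<longrightarrow> (\<forall>i<n. \<forall>j<k. \<Phi> i j = 0))"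
proof (rule ccontr)
 assume no: "\<not> thesis"
 let ?M = "%z i j. F z $$ (i, j)"
 let ?min = "%z. \<exists>I J. I \<subseteq> {..<n} \<and> J \<subseteq> {..<k} \<and> card I = s - 1 \<and> card J = s - 1 \<and> minor I J (?M z) ~= 0"
 let ?bad = "%z \<Phi>. xpart z ~= 0 \<and> low_rank (s - 1) n k (?M z) \<and> \<Phi> \<in> conormal n k (?M z) \<and> (\<exists>i<n. \<exists>j<k. \<Phi> i j ~= 0) \<and>
   (\<not> ?min z \<or> xpart (pull_back n k (entry_gradients F z) \<Phi>) = 0)"
 have ex: "\<exists>p. norm (fst p) < 1 / Suc \<nu> \<and> ?bad (fst p) (snd p)" for \<nu>
 proof (rule ccontr)
  assume none: "\<nexists>p. norm (fst p) < 1 / Suc \<nu> \<and> ?bad (fst p) (snd p)"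
  have "thesis"
  proof (rule that[of "1 / Suc \<nu>"])
   fix z \<Phi> assume z: "norm z < 1 / Suc \<nu>" "xpart z ~= 0" and lr: "low_rank (s - 1) n k (?M z)"
   have nb: "\<not> ?bad z \<Phi>" for \<Phi>
   proof
    assume "?bad z \<Phi>"
    then have "norm (fst (z, \<Phi>)) < 1 / Suc \<nu> \<and> ?bad (fst (z, \<Phi>)) (snd (z, \<Phi>))" using z(1) by simp
    with none show False by (rule notE[OF _ exI])
   qed
   obtain \<Phi>0 where \<Phi>0: "\<Phi>0 \<in> conormal n k (?M z)" "\<exists>i<n. \<exists>j<k. \<Phi>0 i j ~= 0"
    using conormal_nonzero_exists[OF s lr] by blast
   have "?min z" using nb[of \<Phi>0] z lr \<Phi>0 by argo
   moreover have "\<Phi> \<in> conormal n k (?M z) \<longrightarrow> xpart (pull_back n k (entry_gradients F z) \<Phi>) = 0 \<longrightarrow> (\<forall>i<n. \<forall>j<k. \<Phi> i j = 0)"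
    using nb[of \<Phi>] z(2) lr by blast
   ultimately show "?min z \<and> (\<Phi> \<in> conormal n k (?M z) \<longrightarrow> xpart (pull_back n k (entry_gradients F z) \<Phi>) = 0 \<longrightarrow> (\<forall>i<n. \<forall>j<k. \<Phi> i j = 0))"
    by (rule conjI)
  qed simp
  with no show False by simp
 qed
 have "\<forall>\<nu>. \<exists>p. norm (fst p) < 1 / Suc \<nu> \<and> ?bad (fst p) (snd p)" by (rule allI) (rule ex)
 from choice[OF this] obtain p where p0: "\<forall>\<nu>. norm (fst (p \<nu>)) < 1 / Suc \<nu> \<and> ?bad (fst (p \<nu>)) (snd (p \<nu>))" ..
 note p = spec[OF p0]
 have z0: "(%\<nu>. fst (p \<nu>)) \<longlonglongrightarrow> 0"
 proof (rule tendsto_norm_zero_cancel, rule tendsto_sandwich[OF _ _ tendsto_const LIMSEQ_inverse_real_of_nat])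
  show "\<forall>\<^sub>F \<nu> in sequentially. norm (fst (p \<nu>)) \<le> inverse (real (Suc \<nu>))"
   using p by (intro always_eventually allI) (simp add: divide_inverse less_imp_le)
 qed simp
 have p': "xpart (fst (p \<nu>)) ~= 0" "low_rank (s - 1) n k (?M (fst (p \<nu>)))" "snd (p \<nu>) \<in> conormal n k (?M (fst (p \<nu>)))"
   "\<exists>i<n. \<exists>j<k. snd (p \<nu>) i j ~= 0" "\<not> ?min (fst (p \<nu>)) \<or> xpart (pull_back n k (entry_gradients F (fst (p \<nu>))) (snd (p \<nu>))) = 0" for \<nu>
  using p[of \<nu>] by argo+
 obtain r I J where 1: "I \<subseteq> {..<n}" "J \<subseteq> {..<k}" "card I = s - 1" "card J = s - 1"
   "\<forall>\<^sub>F \<nu> in sequentially. minor I J (?M (fst (p (r \<nu>)))) ~= 0"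
   "\<forall>\<^sub>F \<nu> in sequentially. xpart (pull_back n k (entry_gradients F (fst (p (r \<nu>)))) (snd (p (r \<nu>)))) ~= 0"
  apply (rule conormal_asymptotics[OF z0 p'(1-4)])
  apply (elim exE conjE)
  subgoal premises q for r I J by (rule q(1)[of I J r]) (rule q)+
  done
 have "\<forall>\<^sub>F \<nu> in sequentially. False"
  using 1(5,6)
 proof eventually_elim
  case (elim \<nu>)
  then have "?min (fst (p (r \<nu>)))" using 1(1-4) by blast
  then show False using p'(5)[of "r \<nu>"] elim(2) by blast
 qed
 then show False by simp
qed

text \<open>The expected tangent space: the common kernel of the pull-backs.\<close>

definition limit_tangent :: "complex^('m option) => (complex^('m option)) set" where
 "limit_tangent z = {u. \<forall>\<Phi>\<in>conormal n k (%i j. F z $$ (i, j)). bilin (pull_back n k (entry_gradients F z) \<Phi>) u = 0}"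

text \<open>The defect of the projection is measured by a functional that vanishes on the tangent space, hence
 by a pull-back, and the asymptotics make its value on the given vectors small.\<close>

lemma secant_limit:
 assumes z: "z \<longlonglongrightarrow> 0" and x: "\<And>\<nu>. xpart (z \<nu>) ~= 0"
  and lr: "\<And>\<nu>. low_rank (s - 1) n k (%i j. F (z \<nu>) $$ (i, j))"
  and normal: "\<And>\<nu> c. (\<And>u. u \<in> limit_tangent (z \<nu>) ==> bilin c u = 0) ==>
   \<exists>\<Phi>\<in>conormal n k (%i j. F (z \<nu>) $$ (i, j)). c = pull_back n k (entry_gradients F (z \<nu>)) \<Phi>"
  and v: "\<And>\<nu>. xpart (v \<nu>) = a \<nu> *s xpart (z \<nu>)" "\<And>\<nu>. norm (a \<nu>) * norm (xpart (z \<nu>)) \<le> B" "\<And>\<nu>. norm (v \<nu> $ None) \<le> B"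
 obtains r where "strict_mono (r :: nat => nat)" "(%\<nu>. v (r \<nu>) - closest_point (limit_tangent (z (r \<nu>))) (v (r \<nu>))) \<longlonglongrightarrow> 0"
proof -
 let ?P = "%\<nu>. closest_point (limit_tangent (z \<nu>)) (v \<nu>)"
 have sub: "Real_Vector_Spaces.subspace (limit_tangent w)" for w
  using subspace_functionals[of "pull_back n k (entry_gradients F w) ` conormal n k (%i j. F w $$ (i, j))"]
  by (simp add: limit_tangent_def)
 have csub: "c *s u \<in> limit_tangent w" if "u \<in> limit_tangent w" for c u w
  using that by (simp add: limit_tangent_def)
 show thesis
 proof (cases "infinite {\<nu>. ?P \<nu> = v \<nu>}")
  case True
  then obtain r where r: "strict_mono (r :: nat => nat)" "\<forall>\<nu>. r \<nu> \<in> {\<nu>. ?P \<nu> = v \<nu>}"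
   using infinite_enumerate by blast
  show thesis by (rule that[OF r(1)]) (use r(2) in simp)
 next
  case False
  then have "infinite {\<nu>. ?P \<nu> ~= v \<nu>}"
   using finite_Collect_not by blast
  then obtain r0 where r0: "strict_mono (r0 :: nat => nat)" "\<forall>\<nu>. r0 \<nu> \<in> {\<nu>. ?P \<nu> ~= v \<nu>}"
   using infinite_enumerate by blast
  let ?G = "%\<nu>. pull_back n k (entry_gradients F (z (r0 \<nu>)))"
  have "\<exists>\<Phi>. \<Phi> \<in> conormal n k (%i j. F (z (r0 \<nu>)) $$ (i, j)) \<and> ?G \<nu> \<Phi> ~= 0 \<and>
    norm (v (r0 \<nu>) - ?P (r0 \<nu>)) = norm (bilin (?G \<nu> \<Phi>) (v (r0 \<nu>))) / norm (?G \<nu> \<Phi>)" for \<nu>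
  proof -
   have ne: "?P (r0 \<nu>) ~= v (r0 \<nu>)" using r0(2) by simp
   obtain \<eta> where \<eta>: "\<eta> ~= 0" "\<And>u. u \<in> limit_tangent (z (r0 \<nu>)) ==> bilin \<eta> u = 0"
     "norm (v (r0 \<nu>) - ?P (r0 \<nu>)) = norm (bilin \<eta> (v (r0 \<nu>))) / norm \<eta>"
    using projection_defect[OF sub csub ne] by blast
   from normal[OF \<eta>(2)] obtain \<Phi> where "\<Phi> \<in> conormal n k (%i j. F (z (r0 \<nu>)) $$ (i, j))" "\<eta> = ?G \<nu> \<Phi>" by blast
   with \<eta>(1,3) show ?thesis by (intro exI[of _ \<Phi>]) auto
  qed
  then have "\<exists>\<Phi>. \<forall>\<nu>. \<Phi> \<nu> \<in> conormal n k (%i j. F (z (r0 \<nu>)) $$ (i, j)) \<and> ?G \<nu> (\<Phi> \<nu>) ~= 0 \<and>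
    norm (v (r0 \<nu>) - ?P (r0 \<nu>)) = norm (bilin (?G \<nu> (\<Phi> \<nu>)) (v (r0 \<nu>))) / norm (?G \<nu> (\<Phi> \<nu>))"
   by (intro choice allI)
  then obtain \<Phi> where \<Phi>: "\<And>\<nu>. \<Phi> \<nu> \<in> conormal n k (%i j. F (z (r0 \<nu>)) $$ (i, j))" "\<And>\<nu>. ?G \<nu> (\<Phi> \<nu>) ~= 0"
    "\<And>\<nu>. norm (v (r0 \<nu>) - ?P (r0 \<nu>)) = norm (bilin (?G \<nu> (\<Phi> \<nu>)) (v (r0 \<nu>))) / norm (?G \<nu> (\<Phi> \<nu>))"
   by blast
  have nz: "\<exists>i<n. \<exists>j<k. \<Phi> \<nu> i j ~= 0" for \<nu>
  proof (rule ccontr)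
   assume "\<not> ?thesis"
   then have "?G \<nu> (\<Phi> \<nu>) = 0" by (simp add: pull_back_def)
   with \<Phi>(2) show False by simp
  qed
  have zr: "(%\<nu>. z (r0 \<nu>)) \<longlonglongrightarrow> 0" using LIMSEQ_subseq_LIMSEQ[OF z r0(1)] by (simp add: o_def)
  define \<eta> where "\<eta> = (%\<nu>. ?G \<nu> (\<Phi> \<nu>))"
  obtain r1 where r1: "strict_mono (r1 :: nat => nat)"
   and lim1: "(%\<nu>. norm (\<eta> (r1 \<nu>) $ None) / norm (\<eta> (r1 \<nu>))) \<longlonglongrightarrow> 0"
   and lim2: "(%\<nu>. norm (\<Sum>l\<in>UNIV. z (r0 (r1 \<nu>)) $ Some l * \<eta> (r1 \<nu>) $ Some l) / (norm (xpart (z (r0 (r1 \<nu>)))) * norm (\<eta> (r1 \<nu>)))) \<longlonglongrightarrow> 0"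
   unfolding \<eta>_def
   by (rule conormal_asymptotics[OF zr x lr \<Phi>(1) nz]) (assumption | rule that)+
  define r where "r = r0 \<circ> r1"
  have r: "strict_mono r" unfolding r_def using r0(1) r1 by (rule strict_mono_o)
  let ?b = "%\<nu>. B * (norm (\<Sum>l\<in>UNIV. z (r0 (r1 \<nu>)) $ Some l * \<eta> (r1 \<nu>) $ Some l) / (norm (xpart (z (r0 (r1 \<nu>)))) * norm (\<eta> (r1 \<nu>))))
    + B * (norm (\<eta> (r1 \<nu>) $ None) / norm (\<eta> (r1 \<nu>)))"
  have le: "norm (v (r \<nu>) - ?P (r \<nu>)) \<le> ?b \<nu>" for \<nu>
  proof -
   let ?y = "r0 (r1 \<nu>)" and ?e = "\<eta> (r1 \<nu>)"
   define S where "S = (\<Sum>l\<in>UNIV. z ?y $ Some l * ?e $ Some l)"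
   have xz: "0 < norm (xpart (z ?y))" using x by simp
   have e: "0 < norm ?e" using \<Phi>(2)[of "r1 \<nu>"] by (simp add: \<eta>_def)
   have vl: "v ?y $ Some l = a ?y * z ?y $ Some l" for l
    using arg_cong[OF v(1)[of ?y], of "%w. w $ l"] by simp
   have "bilin ?e (v ?y) = ?e $ None * v ?y $ None + a ?y * S"
    by (simp add: bilin_def sum_option vl S_def sum_distrib_left mult_ac)
   then have "norm (bilin ?e (v ?y)) \<le> norm (?e $ None) * norm (v ?y $ None) + norm (a ?y) * norm S"
    using norm_triangle_ineq[of "?e $ None * v ?y $ None" "a ?y * S"] by (simp add: norm_mult)
   also have "\<dots> \<le> norm (?e $ None) * B + (B / norm (xpart (z ?y))) * norm S"
    using v(2,3)[of ?y] xz by (intro add_mono mult_left_mono mult_right_mono) (auto simp: field_simps)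
   finally have "norm (bilin ?e (v ?y)) / norm ?e \<le> (norm (?e $ None) * B + (B / norm (xpart (z ?y))) * norm S) / norm ?e"
    by (rule divide_right_mono) simp
   also have "\<dots> = B * (norm S / (norm (xpart (z ?y)) * norm ?e)) + B * (norm (?e $ None) / norm ?e)"
    by (simp add: add_divide_distrib mult_ac)
   finally show ?thesis using \<Phi>(3)[of "r1 \<nu>"] by (simp add: r_def \<eta>_def S_def)
  qed
  have lb: "?b \<longlonglongrightarrow> 0"
   using tendsto_add[OF tendsto_mult_right_zero[OF lim2] tendsto_mult_right_zero[OF lim1], of B B] by simp
  show thesis by (rule that[OF r]) (rule Lim_null_comparison[OF always_eventually[OF allI[OF le]] lb])
 qed
qed

end

section \<open>Approximate zeros of linear forms\<close>

definition independent_family :: "('q => complex^'n) => 'q set => bool" where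
 "independent_family g Q \<longleftrightarrow> (\<forall>c. (\<Sum>q\<in>Q. c q *s g q) = 0 \<longrightarrow> (\<forall>q\<in>Q. c q = 0))"

lemma independent_familyD:
 "independent_family g Q ==> (\<Sum>q\<in>Q. c q *s g q) = 0 ==> q \<in> Q ==> c q = 0"
 unfolding independent_family_def by blast

lemma independent_family_dim:
 assumes Q: "finite Q" and ind: "independent_family g Q" and sub: "g ` Q \<subseteq> vec.span S"
 shows "card Q \<le> vec.dim (S :: (complex^'n::finite) set)"
proof -
 have inj: "inj_on g Q"
 proof (rule inj_onI, rule ccontr)
  fix p q assume pq: "p \<in> Q" "q \<in> Q" "g p = g q" "p ~= q"
  let ?c = "%x. if x = p then 1 else if x = q then - 1 else (0 :: complex)"
  have "(\<Sum>x\<in>Q. ?c x *s g x) = (\<Sum>x\<in>{p, q}. ?c x *s g x)"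
   using Q pq by (intro sum.mono_neutral_right) auto
  also have "\<dots> = 0" using pq by simp
  finally have "?c p = 0" by (rule independent_familyD[OF ind _ pq(1)])
  then show False by simp
 qed
 have "vec.independent (g ` Q)"
 proof (rule vec.independent_if_scalars_zero)
  fix c x assume z: "(\<Sum>x\<in>g ` Q. c x *s x) = 0" and x: "x \<in> g ` Q"
  have "(\<Sum>q\<in>Q. c (g q) *s g q) = 0" using z by (simp add: sum.reindex[OF inj])
  then have "c (g q) = 0" if "q \<in> Q" for q by (rule independent_familyD[OF ind _ that])
  then show "c x = 0" using x by blast
 qed (use Q in simp)
 then have "card (g ` Q) \<le> vec.dim (vec.span S)" by (rule vec.independent_card_le_dim[OF sub])
 then have "card (g ` Q) \<le> vec.dim S" by (simp only: vec.dim_span)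
 then show ?thesis by (simp add: card_image[OF inj])
qed

lemma dependent_family_dim:
 assumes Q: "finite Q" and dep: "\<not> independent_family g Q"
 shows "vec.dim (g ` Q :: (complex^'n::finite) set) < card Q"
proof -
 obtain c q where c: "(\<Sum>q\<in>Q. c q *s g q) = 0" "q \<in> Q" "c q ~= 0"
  using dep unfolding independent_family_def by blast
 have "c q *s g q = - (\<Sum>p\<in>Q - {q}. c p *s g p)"
  using c(1) sum.remove[OF Q c(2), of "%q. c q *s g q"] by (simp add: add_eq_0_iff)
 also have "\<dots> \<in> vec.span (g ` (Q - {q}))"
  by (intro vec.span_neg vec.span_sum vec.span_scale) (auto intro: vec.span_base)
 finally have "inverse (c q) *s (c q *s g q) \<in> vec.span (g ` (Q - {q}))" by (rule vec.span_scale)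
 then have "g q \<in> vec.span (g ` (Q - {q}))" using c(3) by (simp add: vector_smult_assoc)
 then have "g ` Q \<subseteq> vec.span (g ` (Q - {q}))" by (auto intro: vec.span_base)
 then have "vec.dim (g ` Q) \<le> card (g ` (Q - {q}))" using vec.dim_le_card[of "g ` Q" "g ` (Q - {q})"] Q by simp
 also have "\<dots> \<le> card (Q - {q})" by (rule card_image_le) (use Q in simp)
 also have "\<dots> < card Q" using Q c(2) by (intro psubset_card_mono) auto
 finally show ?thesis .
qed

text \<open>A vector outside a span is detected by the dual basis of an extended basis.\<close>

lemma separating_vector:
 assumes c: "(c :: complex^'n::finite) \<notin> vec.span G"
 obtains u where "\<And>g. g \<in> G ==> bilin g u = 0" "bilin c u ~= 0"
proof -
 obtain B where B: "B \<subseteq> G" "vec.independent B" "G \<subseteq> vec.span B" by (metis vec.maximal_independent_subset)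
 have cB: "c \<notin> vec.span B" using c B(1) vec.span_mono by blast
 have fB: "finite B" using B(2) by (rule vec.finiteI_independent)
 have ind: "vec.independent (insert c B)" using B(2) cB by (simp add: vec.independent_insert)
 have "\<forall>q\<in>insert c B. d q = 0" if "(\<Sum>q\<in>insert c B. d q *s q) = 0" for d
  using ind that fB vec.independent_explicit_finite_subsets by blast
 then obtain v where v: "\<And>q q'. q \<in> insert c B ==> q' \<in> insert c B ==> bilin q (v q') = (if q = q' then 1 else 0)"
  using dual_vectors[of "insert c B" "%q. q"] fB by (metis (no_types, lifting) finite_insert)
 have "bilin g (v c) = 0" if "g \<in> G" for g
 proof -
  have "vec.span B \<subseteq> {g. bilin g (v c) = 0}"
  proof (rule vec.span_minimal)
   show "B \<subseteq> {g. bilin g (v c) = 0}" using v[of _ c] cB vec.span_base by fastforce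
   show "vec.subspace {g. bilin g (v c) = 0}" by (auto simp: vec.subspace_def)
  qed
  then show ?thesis using B(3) that by blast
 qed
 moreover have "bilin c (v c) ~= 0" using v[of c c] by simp
 ultimately show thesis using that by blast
qed

definition restrict_vec :: "'n set => complex^'n => complex^'n" where
 "restrict_vec R u = (\<chi> l. if l \<in> R then u $ l else 0)"

lemma restrict_vec_nth [simp]: "restrict_vec R u $ l = (if l \<in> R then u $ l else 0)"
 by (simp add: restrict_vec_def)

lemma bilin_restrict_vec:
 assumes "\<And>l. l \<notin> R ==> g $ l = 0"
 shows "bilin g (restrict_vec R u) = bilin g u"
 unfolding bilin_def by (rule sum.cong) (use assms in auto)

text \<open>A common zero of linear forms whose vanishing coordinates are only those that vanish on all common zeros.\<close>

lemma generic_kernel_vector: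
 fixes G :: "(complex^'n::finite) set"
 assumes G: "\<And>g l. g \<in> G ==> l \<notin> R ==> g $ l = 0"
 defines "I \<equiv> {l \<in> R. axis l 1 \<notin> vec.span G}"
 obtains \<kappa> where "\<And>g. g \<in> G ==> bilin g \<kappa> = 0" "\<And>l. \<kappa> $ l ~= 0 \<longleftrightarrow> l \<in> I"
proof -
 have ex: "\<exists>u. (\<forall>g\<in>G. bilin g u = 0) \<and> (\<forall>l. l \<notin> I \<longrightarrow> u $ l = 0) \<and> u $ i ~= 0" if i: "i \<in> I" for i
 proof -
  obtain u where u: "\<And>g. g \<in> G ==> bilin g u = 0" "bilin (axis i 1) u ~= 0"
   using separating_vector[of "axis i 1" G] i unfolding I_def by blast
  have "(restrict_vec R u) $ l = 0" if "l \<notin> I" for l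
  proof (cases "l \<in> R")
   case True
   then have "axis l 1 \<in> vec.span G" using that by (simp add: I_def)
   moreover have "vec.span G \<subseteq> {g. bilin g u = 0}"
    by (rule vec.span_minimal) (use u(1) in \<open>auto simp: vec.subspace_def\<close>)
   ultimately have "bilin (axis l 1) u = 0" by blast
   then show ?thesis by (simp add: bilin_def axis_def if_distrib if_distribR cong: if_cong)
  qed simp
  moreover have "(restrict_vec R u) $ i ~= 0"
   using u(2) i by (simp add: I_def bilin_def axis_def if_distrib if_distribR cong: if_cong)
  moreover have "\<forall>g\<in>G. bilin g (restrict_vec R u) = 0" using u(1) G by (simp add: bilin_restrict_vec)
  ultimately show ?thesis by blast
 qed
 have "\<exists>\<kappa>. (\<forall>g\<in>G. bilin g \<kappa> = 0) \<and> (\<forall>l. l \<notin> I \<longrightarrow> \<kappa> $ l = 0) \<and> (\<forall>l\<in>J. \<kappa> $ l ~= 0)" if "finite J" "J \<subseteq> I" for J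
  using that
 proof (induction J)
  case (insert i J)
  then obtain \<kappa> where \<kappa>: "\<forall>g\<in>G. bilin g \<kappa> = 0" "\<forall>l. l \<notin> I \<longrightarrow> \<kappa> $ l = 0" "\<forall>l\<in>J. \<kappa> $ l ~= 0" by auto
  obtain u where u: "\<forall>g\<in>G. bilin g u = 0" "\<forall>l. l \<notin> I \<longrightarrow> u $ l = 0" "u $ i ~= 0" using ex[of i] insert.prems by auto
  have "finite ((%l. - u $ l / \<kappa> $ l) ` insert i J)" using insert.hyps by simp
  then obtain c where c: "c \<notin> insert 0 ((%l. - u $ l / \<kappa> $ l) ` insert i J)"
   using ex_new_if_finite[OF infinite_UNIV_char_0] finite.insertI by metis
  show ?case
  proof (intro exI[of _ "c *s \<kappa> + u"] conjI ballI allI impI)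
   fix l assume l: "l \<in> insert i J"
   show "(c *s \<kappa> + u) $ l ~= 0"
   proof (cases "\<kappa> $ l = 0")
    case True
    then have "l = i" using l \<kappa>(3) by auto
    then show ?thesis using True u(3) by simp
   next
    case False
    have "c ~= - u $ l / \<kappa> $ l" using c l by blast
    then show ?thesis using False by (simp add: field_simps add_eq_0_iff)
   qed
  qed (use \<kappa> u in auto)
 qed (intro exI[of _ 0], auto)
 from this[of I] show thesis using that by auto
qed

text \<open>Linear forms \<open>f j q\<close> with supports \<open>S j\<close> that satisfy a counting condition: all but an independent part
 of them have a common approximate zero, with orders of vanishing \<open>e\<close>.\<close>

lemma staged_zero:
 fixes f :: "nat => nat => complex^'n::finite" and S :: "nat => 'n set"
 assumes supp: "\<forall>i<n. \<forall>j<k. \<forall>l. l \<notin> S j \<longrightarrow> f i j $ l = 0"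
  and hall: "\<And>R. n * card {j \<in> {..<k}. S j \<subseteq> R} \<le> card R"
 shows "\<exists>(\<kappa> :: complex^'n) (e :: 'n => nat) R0. R0 \<subseteq> R \<and>
   independent_family (%(i, j). f i j) ({..<n} \<times> {j \<in> {..<k}. S j \<subseteq> R0}) \<and>
   (\<forall>l. \<kappa> $ l ~= 0 \<longleftrightarrow> l \<in> R - R0) \<and>
   (\<forall>j<k. S j \<subseteq> R \<longrightarrow> \<not> S j \<subseteq> R0 \<longrightarrow> (\<exists>p. (\<forall>l\<in>S j - R0. p \<le> e l) \<and> (\<exists>l\<in>S j - R0. e l = p) \<and>
     (\<forall>i<n. (\<Sum>l\<in>{l \<in> S j - R0. e l = p}. f i j $ l * \<kappa> $ l) = 0))) \<and>
   (independent_family (%(i, j). f i j) ({..<n} \<times> {j \<in> {..<k}. S j \<subseteq> R}) \<or>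
    (\<forall>l. e l = 0 \<longleftrightarrow> l \<in> R - R0 \<and> axis l 1 \<notin> vec.span ((%(i, j). f i j) ` ({..<n} \<times> {j \<in> {..<k}. S j \<subseteq> R}))) \<and>
    (\<forall>l\<in>R0. axis l 1 \<in> vec.span ((%(i, j). f i j) ` ({..<n} \<times> {j \<in> {..<k}. S j \<subseteq> R}))))"
proof (induction "card R" arbitrary: R rule: less_induct)
 case (less R)
 let ?Q = "{..<n} \<times> {j \<in> {..<k}. S j \<subseteq> R}"
 show ?case
 proof (cases "independent_family (%(i, j). f i j) ?Q")
  case True
  then show ?thesis by (intro exI[of _ 0] exI[of _ "%_. 0"] exI[of _ R]) auto
 next
  case False
  let ?G = "(%(i, j). f i j) ` ?Q"
  have "vec.dim ?G < card ?Q" by (rule dependent_family_dim[OF _ False]) auto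
  also have "\<dots> \<le> card R" using hall[of R] by (simp add: card_cartesian_product)
  finally have dim: "vec.dim ?G < card R" .
  define I where "I = {l \<in> R. axis l 1 \<notin> vec.span ?G}"
  have "I ~= {}"
  proof
   assume "I = {}"
   then have "(%l. axis l 1) ` R \<subseteq> vec.span ?G" by (auto simp: I_def)
   moreover have "independent_family (%l. axis l 1 :: complex^'n) R"
    unfolding independent_family_def
   proof (intro allI impI ballI)
    fix c l assume "(\<Sum>l\<in>R. c l *s axis l 1) = (0 :: complex^'n)" "l \<in> R"
    then have "(\<Sum>l'\<in>R. c l' *s axis l' 1) $ l = (0 :: complex^'n) $ l" by simp
    then show "c l = 0" using \<open>l \<in> R\<close> by (simp add: axis_def if_distrib if_distribR cong: if_cong)
   qed
   ultimately have "card R \<le> vec.dim ?G" by (intro independent_family_dim) auto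
   then show False using dim by simp
  qed
  have IR: "I \<subseteq> R" by (auto simp: I_def)
  obtain \<kappa>0 where \<kappa>0: "\<And>g. g \<in> ?G ==> bilin g \<kappa>0 = 0" "\<And>l. \<kappa>0 $ l ~= 0 \<longleftrightarrow> l \<in> I"
   unfolding I_def
  proof (rule generic_kernel_vector[of ?G R])
   fix g l assume "g \<in> ?G" "l \<notin> R"
   then show "g $ l = 0" using supp by auto
  qed blast
  have "card (R - I) < card R" using IR \<open>I ~= {}\<close> by (intro psubset_card_mono) auto
  from less[OF this] obtain \<kappa> :: "complex^'n" and e :: "'n => nat" and R0 where IH: "R0 \<subseteq> R - I"
   "independent_family (%(i, j). f i j) ({..<n} \<times> {j \<in> {..<k}. S j \<subseteq> R0})" "\<forall>l. \<kappa> $ l ~= 0 \<longleftrightarrow> l \<in> R - I - R0"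
   "\<forall>j<k. S j \<subseteq> R - I \<longrightarrow> \<not> S j \<subseteq> R0 \<longrightarrow> (\<exists>p. (\<forall>l\<in>S j - R0. p \<le> e l) \<and> (\<exists>l\<in>S j - R0. e l = p) \<and>
     (\<forall>i<n. (\<Sum>l\<in>{l \<in> S j - R0. e l = p}. f i j $ l * \<kappa> $ l) = 0))" by (elim exE conjE)
  define e' where "e' = (%l. if l \<in> I then 0 else Suc (e l))"
  have \<kappa>nz: "(\<kappa> + \<kappa>0) $ l ~= 0 \<longleftrightarrow> l \<in> R - R0" for l
  proof (cases "l \<in> I")
   case True
   then have "\<kappa> $ l = 0" "\<kappa>0 $ l ~= 0" "l \<in> R - R0" using IH(1,3) \<kappa>0(2) IR by auto
   then show ?thesis by simp
  next
   case False
   then have "\<kappa>0 $ l = 0" using \<kappa>0(2) by blast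
   then show ?thesis using IH(3) False by simp
  qed
  have col: "\<exists>p. (\<forall>l\<in>S j - R0. p \<le> e' l) \<and> (\<exists>l\<in>S j - R0. e' l = p) \<and>
     (\<forall>i<n. (\<Sum>l\<in>{l \<in> S j - R0. e' l = p}. f i j $ l * (\<kappa> + \<kappa>0) $ l) = 0)"
   if j: "j < k" "S j \<subseteq> R" "\<not> S j \<subseteq> R0" for j
  proof (cases "S j \<inter> I = {}")
   case True
   then have "S j \<subseteq> R - I" using j by blast
   then obtain p where p: "\<forall>l\<in>S j - R0. p \<le> e l" "\<exists>l\<in>S j - R0. e l = p"
     "\<forall>i<n. (\<Sum>l\<in>{l \<in> S j - R0. e l = p}. f i j $ l * \<kappa> $ l) = 0" using IH(4) j by blast
   have eq: "{l \<in> S j - R0. e' l = Suc p} = {l \<in> S j - R0. e l = p}" using True by (auto simp: e'_def)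
   have "(\<Sum>l\<in>{l \<in> S j - R0. e l = p}. f i j $ l * (\<kappa> + \<kappa>0) $ l) = (\<Sum>l\<in>{l \<in> S j - R0. e l = p}. f i j $ l * \<kappa> $ l)" for i
   proof (rule sum.cong)
    fix l assume "l \<in> {l \<in> S j - R0. e l = p}"
    then have "\<kappa>0 $ l = 0" using True \<kappa>0(2) by blast
    then show "f i j $ l * (\<kappa> + \<kappa>0) $ l = f i j $ l * \<kappa> $ l" by simp
   qed simp
   then show ?thesis using p True unfolding eq[symmetric] by (intro exI[of _ "Suc p"]) (auto simp: e'_def)
  next
   case False
   then obtain l0 where l0: "l0 \<in> S j" "l0 \<in> I" by blast
   have eq: "{l \<in> S j - R0. e' l = 0} = S j \<inter> I" using IH(1) by (auto simp: e'_def)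
   have z: "(\<Sum>l\<in>S j \<inter> I. f i j $ l * (\<kappa> + \<kappa>0) $ l) = 0" if i: "i < n" for i
   proof -
    have "(\<Sum>l\<in>S j \<inter> I. f i j $ l * (\<kappa> + \<kappa>0) $ l) = (\<Sum>l\<in>S j \<inter> I. f i j $ l * \<kappa>0 $ l)"
    proof (rule sum.cong)
     fix l assume "l \<in> S j \<inter> I"
     then have "\<kappa> $ l = 0" using IH(3) by blast
     then show "f i j $ l * (\<kappa> + \<kappa>0) $ l = f i j $ l * \<kappa>0 $ l" by simp
    qed simp
    also have "\<dots> = bilin (f i j) \<kappa>0" unfolding bilin_def
     by (rule sum.mono_neutral_left) (use supp i j(1) \<kappa>0(2) in auto)
    also have "\<dots> = 0" by (rule \<kappa>0(1)) (use i j in auto)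
    finally show ?thesis .
   qed
   have "\<exists>l\<in>S j - R0. e' l = 0" using l0 eq by blast
   moreover have "\<forall>i<n. (\<Sum>l\<in>{l \<in> S j - R0. e' l = 0}. f i j $ l * (\<kappa> + \<kappa>0) $ l) = 0" unfolding eq using z by blast
   ultimately show ?thesis by (intro exI[of _ 0] conjI) auto
  qed
  have e'0: "\<forall>l. e' l = 0 \<longleftrightarrow> l \<in> R - R0 \<and> axis l 1 \<notin> vec.span ?G"
   using IH(1) by (auto simp: e'_def I_def)
  have R0_span: "\<forall>l\<in>R0. axis l 1 \<in> vec.span ?G" using IH(1) by (auto simp: I_def)
  have "R0 \<subseteq> R" using IH(1) by blast
  then show ?thesis
   by (intro exI[of _ "\<kappa> + \<kappa>0"] exI[of _ e'] exI[of _ R0] conjI disjI2 e'0 R0_span IH(2) allI impI \<kappa>nz col)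
 qed
qed

section \<open>Linear parts and Newton polyhedra\<close>

lemma monomial_0: "monomial_Cn a (0 :: complex^'n::finite) = (if a = 0 then 1 else 0)"
proof (cases "a = 0")
 case False
 then obtain l where "a $ l ~= 0" by (auto simp: Finite_Cartesian_Product.vec_eq_iff)
 then show ?thesis using False by (auto simp: monomial_Cn_def intro!: exI[of _ l])
qed (simp add: monomial_Cn_def)

lemma monomial_axis: "monomial_Cn (axis l 1) x = x $ l"
proof -
 have "monomial_Cn (axis l 1) x = (\<Prod>i\<in>UNIV. if i = l then x $ i else 1)"
  unfolding monomial_Cn_def by (rule prod.cong) (auto simp: axis_def)
 then show ?thesis by simp
qed

lemmas monomial_axis_Suc [simp] = monomial_axis[unfolded One_nat_def]

lemma linear_coefficients:
 fixes f :: "complex^'n::finite => complex"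
 assumes f: "holomorphic_Cn_on f V" and V: "open V" "0 \<in> V"
 shows "taylor_coeff f 0 = f 0" "taylor_coeff f (axis l 1) = gradient f 0 $ l"
proof -
 obtain R M where R: "0 < R" "0 \<le> M" "sep_holo R (%z. f (0 + z))" "\<And>z. z \<in> polydisc R ==> norm (f (0 + z)) \<le> M"
  by (rule holomorphic_Cn_imp_sep_holo[OF f V]) (assumption | rule that)+
 have r: "0 < R / 2" "R / 2 < R" using R(1) by auto
 obtain C where C: "\<And>b. norm (C b) \<le> M / (R / 2) ^ (\<Sum>i\<in>UNIV. b $ i)"
  "\<And>z. z \<in> polydisc (R / 2) ==> ((%b. C b * monomial_Cn b z) has_sum f (0 + z)) UNIV"
  by (rule power_series_expansion[OF R(3,4) r]) (assumption | rule that)+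
 have C2: "((%b. C b * monomial_Cn b z) has_sum f z) UNIV" if "z \<in> polydisc (R / 2)" for z
  using C(2)[OF that] by simp
 have tc: "taylor_coeff f = C" by (rule taylor_coeff_eqI[OF r(1) C2])
 have 0: "(0 :: complex^'n) \<in> polydisc (R / 2)" using r by (simp add: polydisc_def)
 have "((%b. C b * monomial_Cn b 0) has_sum C 0) UNIV"
  by (rule has_sum_finite_neutralI[of "{0}"]) (auto simp: monomial_0)
 then show "taylor_coeff f 0 = f 0" using C2[OF 0] tc by (simp add: has_sum_unique)
 have "((%b. of_nat (b $ l) * C b * monomial_Cn (vupd b l (b $ l - 1)) 0) has_sum C (axis l 1)) UNIV"
 proof (rule has_sum_finite_neutralI[of "{axis l 1}"])
  fix b :: "nat^'n" assume b: "b \<in> UNIV - {axis l 1}"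
  have "b $ l = 0 \<or> vupd b l (b $ l - 1) ~= 0"
  proof (rule ccontr)
   assume c: "\<not> ?thesis"
   then have "vupd b l (b $ l - 1) $ i = 0" for i by simp
   then have "b $ i = axis l 1 $ i" for i using c by (cases "i = l") (auto simp: vupd_nth axis_def split: if_splits dest: meta_spec[of _ i] meta_spec[of _ l])
   then have "b = axis l 1" by (simp add: Finite_Cartesian_Product.vec_eq_iff)
   with b show False by simp
  qed
  then show "of_nat (b $ l) * C b * monomial_Cn (vupd b l (b $ l - 1)) 0 = 0" by (auto simp: monomial_0)
 next
  have "vupd (axis l 1) l 0 = (0 :: nat^'n)" by (simp add: Finite_Cartesian_Product.vec_eq_iff vupd_nth axis_def)
  then show "C (axis l 1) = (\<Sum>b\<in>{axis l 1}. of_nat (b $ l) * C b * monomial_Cn (vupd b l (b $ l - 1)) 0)"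
   by (simp add: monomial_0)
 qed auto
 moreover have "((%b. of_nat (b $ l) * C b * monomial_Cn (vupd b l (b $ l - 1)) 0) has_sum pderivative l f 0) UNIV"
  using C(1) C2 0 by (rule power_series_pderivative)
 ultimately show "taylor_coeff f (axis l 1) = gradient f 0 $ l"
  unfolding gradient_nth tc by (rule has_sum_unique)
qed

lemma newton_polyhedron_lower_bound:
 fixes f :: "complex^'n::finite => complex"
 assumes w: "\<And>i. 0 \<le> w $ i" and c: "\<And>a. taylor_coeff f a ~= 0 ==> c \<le> w \<bullet> lattice_point a"
  and v: "v \<in> newton_polyhedron f"
 shows "c \<le> w \<bullet> v"
proof -
 have "newton_polyhedron f \<subseteq> {v. c \<le> w \<bullet> v}"
  unfolding newton_polyhedron_def
 proof (rule hull_minimal)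
  show "{lattice_point a + v |a v. taylor_coeff f a ~= 0 \<and> (\<forall>i. 0 \<le> v $ i)} \<subseteq> {v. c \<le> w \<bullet> v}"
  proof clarify
   fix a and v :: "real^'n" assume "taylor_coeff f a ~= 0" "\<forall>i. 0 \<le> v $ i"
   moreover from this have "0 \<le> w \<bullet> v" using w by (auto simp: inner_vec_def intro!: sum_nonneg)
   ultimately show "c \<le> w \<bullet> (lattice_point a + v)" using c[of a] by (simp add: inner_add_right)
  qed
  show "convex {v. c \<le> w \<bullet> v}" by (rule convex_halfspace_ge)
 qed
 then show ?thesis using v by blast
qed

text \<open>The Newton polyhedron knows the support of the linear part.\<close>

lemma newton_linear_support:
 fixes f :: "complex^'n::finite => complex"
 assumes f0: "taylor_coeff f 0 = 0"
 shows "axis l 1 \<in> lattice_points (newton_polyhedron f) \<longleftrightarrow> taylor_coeff f (axis l 1) ~= 0"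
  and "a \<in> lattice_points (newton_polyhedron f) ==> a ~= 0"
proof -
 show "axis l 1 \<in> lattice_points (newton_polyhedron f) \<longleftrightarrow> taylor_coeff f (axis l 1) ~= 0"
 proof
  assume "taylor_coeff f (axis l 1) ~= 0"
  then have "lattice_point (axis l 1) + 0 \<in> newton_polyhedron f"
   unfolding newton_polyhedron_def by (intro hull_inc CollectI exI[of _ "axis l 1"] exI[of _ 0]) simp
  then show "axis l 1 \<in> lattice_points (newton_polyhedron f)" by (simp add: lattice_points_def)
 next
  assume l: "axis l 1 \<in> lattice_points (newton_polyhedron f)"
  show "taylor_coeff f (axis l 1) ~= 0"
  proof
   assume z: "taylor_coeff f (axis l 1) = 0"
   define w :: "real^'n" where "w = (\<chi> i. if i = l then 1 else 2)"
   have "2 \<le> w \<bullet> lattice_point (axis l 1)"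
   proof (rule newton_polyhedron_lower_bound[of w f 2])
    fix a assume a: "taylor_coeff f a ~= 0"
    have "2 \<le> (\<Sum>i\<in>UNIV. (if i = l then 1 else 2) * a $ i)"
    proof (cases "\<exists>i. i ~= l \<and> a $ i ~= 0")
     case True
     then obtain i where i: "i ~= l" "a $ i ~= 0" by blast
     have "2 \<le> (if i = l then 1 else 2) * a $ i" using i by simp
     also have "\<dots> \<le> (\<Sum>i\<in>UNIV. (if i = l then 1 else 2) * a $ i)" by (rule member_le_sum) auto
     finally show ?thesis .
    next
     case False
     have "a $ l ~= 0"
     proof
      assume "a $ l = 0"
      then have "a = 0" using False by (metis Finite_Cartesian_Product.vec_eq_iff zero_index)
      then show False using a f0 by simp
     qed
     moreover have "a $ l ~= 1"
     proof
      assume "a $ l = 1"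
      then have "a = axis l 1" using False by (auto simp: Finite_Cartesian_Product.vec_eq_iff axis_def)
      then show False using a z by simp
     qed
     ultimately have "2 \<le> (if l = l then 1 else 2) * a $ l" by simp
     also have "\<dots> \<le> (\<Sum>i\<in>UNIV. (if i = l then 1 else 2) * a $ i)" by (rule member_le_sum) auto
     finally show ?thesis .
    qed
    then have "real 2 \<le> real (\<Sum>i\<in>UNIV. (if i = l then 1 else 2) * a $ i)" by (simp only: of_nat_le_iff)
    also have "\<dots> = w \<bullet> lattice_point a" unfolding inner_lattice w_def of_nat_sum by (rule sum.cong) auto
    finally show "2 \<le> w \<bullet> lattice_point a" by simp
   qed (use l in \<open>auto simp: w_def lattice_points_def\<close>)
   also have "w \<bullet> lattice_point (axis l 1) = 1"
    unfolding inner_lattice w_def by (simp add: axis_def if_distrib if_distribR cong: if_cong)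
   finally show False by simp
  qed
 qed
 assume a: "a \<in> lattice_points (newton_polyhedron f)"
 show "a ~= 0"
 proof
  assume "a = 0"
  have "1 \<le> (\<chi> i. 1) \<bullet> lattice_point a"
  proof (rule newton_polyhedron_lower_bound[of "\<chi> i. 1" f 1])
   fix b assume "taylor_coeff f b ~= 0"
   then have "b ~= 0" using f0 by auto
   then obtain i where "b $ i ~= 0" by (auto simp: Finite_Cartesian_Product.vec_eq_iff)
   then have "1 \<le> b $ i" by simp
   also have "\<dots> \<le> (\<Sum>i\<in>UNIV. b $ i)" by (rule member_le_sum) auto
   finally have "real 1 \<le> real (\<Sum>i\<in>UNIV. b $ i)" by (simp only: of_nat_le_iff)
   then show "1 \<le> (\<chi> i. 1) \<bullet> lattice_point b" by (simp add: inner_lattice)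
  qed (use a in \<open>auto simp: lattice_points_def\<close>)
  then show False by (simp add: \<open>a = 0\<close> inner_lattice)
 qed
qed

lemma norm_scalar_mult: "norm (c *s w) = norm c * norm w" for c :: complex and w :: "complex^'n::finite"
 by (simp add: norm_vec_def L2_set_def norm_mult power_mult_distrib sum_distrib_left[symmetric] real_sqrt_mult)

text \<open>The Taylor expansion of the restriction to complex lines, with Cauchy estimates that do not depend
 on the line.\<close>

lemma quadratic_remainder:
 fixes f :: "complex^'n::finite => complex"
 assumes f: "holomorphic_Cn_on f V" and V: "open V" "0 \<in> V"
 obtains C \<rho> where "0 < \<rho>" "0 \<le> C" "\<And>x. norm x < \<rho> ==> norm (f x - f 0 - bilin (gradient f 0) x) \<le> C * (norm x)\<^sup>2"
proof -
 obtain \<epsilon> where \<epsilon>: "0 < \<epsilon>" "cball 0 \<epsilon> \<subseteq> V" using V open_contains_cball by blast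
 have "continuous_on (cball (0 :: complex^'n) \<epsilon>) f"
 proof (rule continuous_at_imp_continuous_on, rule ballI)
  fix z :: "complex^'n" assume "z \<in> cball 0 \<epsilon>"
  then show "isCont f z" using \<epsilon>(2) by (intro has_derivative_continuous[OF holomorphic_Cn_derivative_gradient[OF f]]) auto
 qed
 then have "bounded (f ` cball 0 \<epsilon>)" by (intro compact_imp_bounded compact_continuous_image) auto
 then obtain M where M: "0 < M" "\<And>z. norm z \<le> \<epsilon> ==> norm (f z) \<le> M" by (auto simp: bounded_pos)
 define r where "r = \<epsilon> / 2"
 have r: "0 < r" "r < \<epsilon>" using \<epsilon>(1) by (auto simp: r_def)
 have main: "norm (f x - f 0 - bilin (gradient f 0) x) \<le> 2 * M / r\<^sup>2 * (norm x)\<^sup>2" if x: "norm x < r / 2" for x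
 proof (cases "x = 0")
  case False
  define e where "e = (1 / norm x) *\<^sub>R x"
  have e: "norm e = 1" using False by (simp add: e_def)
  have nsc: "norm (w *s e) = norm w" for w :: complex
   by (simp add: norm_scalar_mult e)
  define g where "g = (%w :: complex. f (w *s e))"
  have gd: "(g has_field_derivative bilin (gradient f (w *s e)) e) (at w)" if w: "norm w < \<epsilon>" for w
  proof -
   have "w *s e \<in> V" using \<epsilon>(2) w nsc by (auto simp: less_imp_le)
   then have "(f has_derivative bilin (gradient f (w *s e))) (at (w *s e))" by (rule holomorphic_Cn_derivative_gradient[OF f])
   moreover have "((%w. w *s e) has_derivative (%w. w *s e)) (at w)"
   proof (rule bounded_linear_imp_has_derivative, rule linear_conv_bounded_linear[THEN iffD1])
    show "linear (%w. w *s e)" by (rule linearI) (auto simp: Finite_Cartesian_Product.vec_eq_iff algebra_simps)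
   qed
   ultimately have "(g has_derivative (%h. bilin (gradient f (w *s e)) (h *s e))) (at w)"
    unfolding g_def by (rule has_derivative_compose[rotated])
   then show ?thesis unfolding has_field_derivative_def by (simp add: mult_commute_abs)
  qed
  have g: "g holomorphic_on ball 0 \<epsilon>" "\<And>w. norm w < \<epsilon> ==> norm (g w) \<le> M"
  proof -
   show "g holomorphic_on ball 0 \<epsilon>" using gd by (intro holomorphic_onI) (auto simp: field_differentiable_def intro: has_field_derivative_at_within)
   show "norm (g w) \<le> M" if "norm w < \<epsilon>" for w using M(2)[of "w *s e"] that nsc by (simp add: g_def)
  qed
  define a where "a = (%m. (deriv ^^ m) g 0 / fact m)"
  have a: "norm (a m) \<le> M / r ^ m" for m unfolding a_def by (rule one_variable_expansion(1)[OF g r])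
  let ?w = "complex_of_real (norm x)"
  have nw: "norm ?w < r" using x r by simp
  have "((%m. a m * ?w ^ m) has_sum g ?w) UNIV" unfolding a_def by (rule one_variable_expansion(2)[OF g r nw])
  then have "(%m. a m * ?w ^ m) sums g ?w" by (rule has_sum_imp_sums)
  then have s: "(%m. a (m + 2) * ?w ^ (m + 2)) sums (g ?w - (\<Sum>m<2. a m * ?w ^ m))" by (rule sums_split_initial_segment)
  have "(\<Sum>m<2. a m * ?w ^ m) = f 0 + bilin (gradient f 0) x"
  proof -
   have "deriv g 0 = bilin (gradient f 0) e" using DERIV_imp_deriv[OF gd[of 0]] \<epsilon>(1) by simp
   moreover have "?w *s e = x" using False by (simp add: e_def Finite_Cartesian_Product.vec_eq_iff scaleR_conv_of_real[where 'a = complex])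
   then have "bilin (gradient f 0) x = bilin (gradient f 0) e * ?w" by (metis bilin_simps(3) mult.commute)
   ultimately show ?thesis by (simp add: numeral_2_eq_2 a_def g_def)
  qed
  moreover have "g ?w = f x" using False by (simp add: g_def e_def Finite_Cartesian_Product.vec_eq_iff scaleR_conv_of_real[where 'a = complex] vector_scalar_mult_def)
  ultimately have s': "(%m. a (m + 2) * ?w ^ (m + 2)) sums (f x - f 0 - bilin (gradient f 0) x)" using s by (simp add: diff_diff_eq)
  have le: "norm (a (m + 2) * ?w ^ (m + 2)) \<le> M / r\<^sup>2 * (norm x)\<^sup>2 * (1 / 2) ^ m" for m
  proof -
   have "norm (a (m + 2) * ?w ^ (m + 2)) \<le> M / r ^ (m + 2) * norm x ^ (m + 2)"
    unfolding norm_mult norm_power by (intro mult_mono a) (use M(1) r(1) in auto)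
   also have "\<dots> = M / r\<^sup>2 * (norm x)\<^sup>2 * (norm x / r) ^ m" by (simp add: power_add power_divide power2_eq_square)
   also have "\<dots> \<le> M / r\<^sup>2 * (norm x)\<^sup>2 * (1 / 2) ^ m"
    using x r(1) M(1) by (intro mult_left_mono power_mono) (auto simp: field_simps)
   finally show ?thesis .
  qed
  have gs: "(%m. M / r\<^sup>2 * (norm x)\<^sup>2 * (1 / 2) ^ m) sums (M / r\<^sup>2 * (norm x)\<^sup>2 * 2)"
   using sums_mult[OF geometric_sums[of "1 / 2 :: real"], of "M / r\<^sup>2 * (norm x)\<^sup>2"] by simp
  have "norm (\<Sum>m. a (m + 2) * ?w ^ (m + 2)) \<le> (\<Sum>m. M / r\<^sup>2 * (norm x)\<^sup>2 * (1 / 2) ^ m)"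
   using le gs by (intro norm_suminf_le) (auto simp: sums_iff)
  then have "norm (f x - f 0 - bilin (gradient f 0) x) \<le> M / r\<^sup>2 * (norm x)\<^sup>2 * 2"
   using s' gs by (simp add: sums_iff)
  then show ?thesis by (simp add: mult_ac)
 qed simp
 show thesis by (rule that[of "r / 2" "2 * M / r\<^sup>2"]) (use main r M in auto)
qed

lemma norm_monomial_le:
 assumes x: "norm x \<le> 1" and m: "m \<le> (\<Sum>i\<in>UNIV. a $ i)"
 shows "norm (monomial_Cn a (x :: complex^'n::finite)) \<le> norm x ^ m"
proof -
 have "norm (monomial_Cn a x) \<le> (\<Prod>i\<in>UNIV. norm x ^ (a $ i))"
  unfolding norm_monomial by (intro prod_mono conjI power_mono Finite_Cartesian_Product.norm_nth_le) auto
 also have "\<dots> = norm x ^ (\<Sum>i\<in>UNIV. a $ i)" by (rule power_sum[symmetric])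
 also have "\<dots> \<le> norm x ^ m" by (rule power_decreasing[OF m]) (use x in auto)
 finally show ?thesis .
qed

lemma tendsto_quotient_zero:
 fixes f :: "nat => complex"
 assumes T: "T \<longlonglongrightarrow> (0::real)" "\<And>\<nu>. 0 < T \<nu>" "\<And>\<nu>. T \<nu> \<le> 1" and b: "\<And>\<nu>. norm (f \<nu>) \<le> C * T \<nu> ^ a" and ab: "b < a"
 shows "(%\<nu>. f \<nu> / of_real (T \<nu> ^ b)) \<longlonglongrightarrow> 0"
proof (rule Lim_null_comparison[OF always_eventually[OF allI]])
 fix \<nu>
 have C: "0 \<le> C" using order_trans[OF norm_ge_zero b, of \<nu>] zero_less_power[OF T(2), of \<nu> a] by (auto simp: zero_le_mult_iff)
 have "norm (f \<nu> / of_real (T \<nu> ^ b)) \<le> C * T \<nu> ^ a / T \<nu> ^ b"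
  using b[of \<nu>] T(2)[of \<nu>] by (simp add: norm_divide norm_power divide_right_mono)
 also have "\<dots> = C * T \<nu> ^ (a - b)" using T(2)[of \<nu>] ab by (simp add: power_diff)
 also have "\<dots> \<le> C * T \<nu> ^ 1" using C T(2,3)[of \<nu>] ab by (intro mult_left_mono power_decreasing) auto
 finally show "norm (f \<nu> / of_real (T \<nu> ^ b)) \<le> C * T \<nu>" by simp
 show "(%\<nu>. C * T \<nu>) \<longlonglongrightarrow> 0" using tendsto_mult_right_zero[OF T(1)] by simp
qed

text \<open>Points \<open>x\<close> whose coordinates have prescribed orders off \<open>R0\<close>, on which given functions with independent
 gradients supported in \<open>R0\<close> vanish.\<close>

lemma staged_curve:
 fixes h :: "'q => complex^'n::finite => complex" and \<kappa> :: "complex^'n"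
 assumes Q: "finite Q" and V: "open V" "0 \<in> V" and h: "\<And>q. q \<in> Q ==> holomorphic_Cn_on (h q) V"
  and h0: "\<And>q. q \<in> Q ==> h q 0 = 0" and ind: "independent_family (%q. gradient (h q) 0) Q"
  and supp: "\<And>q l. q \<in> Q ==> l \<notin> R0 ==> gradient (h q) 0 $ l = 0"
  and \<kappa>: "\<And>l. l \<in> R0 ==> \<kappa> $ l = 0" and N: "0 < N" and d: "0 < (d :: real)"
 obtains T C x where "T \<longlonglongrightarrow> (0 :: real)" "\<And>\<nu>. 0 < T \<nu>" "\<And>\<nu>. T \<nu> \<le> 1" "\<And>\<nu>. norm (x \<nu>) < d"
  "\<And>\<nu>. norm (x \<nu>) \<le> C * T \<nu> ^ N" "\<And>\<nu> l. l \<notin> R0 ==> x \<nu> $ l = \<kappa> $ l * of_real (T \<nu> ^ (N + e l))"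
  "\<And>\<nu> l. l \<in> R0 ==> norm (x \<nu> $ l) \<le> C * T \<nu> ^ (2 * N)" "\<And>\<nu> q. q \<in> Q ==> h q (x \<nu>) = 0"
proof -
 have ind': "\<forall>q\<in>Q. c q = 0" if "(\<Sum>q\<in>Q. c q *s gradient (h q) 0) = 0" for c
  using independent_familyD[OF ind that] by blast
 obtain v0 where v0: "\<And>q q'. q \<in> Q ==> q' \<in> Q ==> bilin (gradient (h q) 0) (v0 q') = (if q = q' then 1 else 0)"
  by (rule dual_vectors[OF Q ind']) (assumption | rule that)+
 define v where "v = (%q. restrict_vec R0 (v0 q))"
 have v: "bilin (gradient (h q) 0) (v q') = (if q = q' then 1 else 0)" if "q \<in> Q" "q' \<in> Q" for q q'
  using v0[OF that] supp[OF that(1)] by (simp add: v_def bilin_restrict_vec)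
 let ?\<phi> = "straighten Q h 0 v"
 obtain U' V' \<psi> where U': "U' \<subseteq> V" and V': "open V'" "?\<phi> 0 \<in> V'" and hom: "homeomorphism U' V' ?\<phi> \<psi>"
  and d\<psi>: "(\<psi> has_derivative (%u. u)) (at (?\<phi> 0))" and lin: "\<And>q z. q \<in> Q ==> bilin (gradient (h q) 0) (?\<phi> z) = h q z"
  and zU': "0 \<in> U'"
  by (rule straightening_chart[OF Q V h v]) (assumption | rule that)+
 have \<phi>0: "?\<phi> 0 = 0" using h0 by (simp add: straighten_def)
 have \<psi>0: "\<psi> 0 = 0" using homeomorphism_apply1[OF hom zU'] by (simp add: \<phi>0)
 have "\<forall>q\<in>Q. \<exists>p. 0 < fst p \<and> 0 \<le> snd p \<and> (\<forall>x. norm x < fst p \<longrightarrow> norm (h q x - h q 0 - bilin (gradient (h q) 0) x) \<le> snd p * (norm x)\<^sup>2)"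
 proof
  fix q assume q: "q \<in> Q"
  obtain C \<rho> where "0 < \<rho>" "0 \<le> C" "\<And>x. norm x < \<rho> ==> norm (h q x - h q 0 - bilin (gradient (h q) 0) x) \<le> C * (norm x)\<^sup>2"
   by (rule quadratic_remainder[OF h[OF q] V]) (assumption | rule that)+
  then show "\<exists>p. 0 < fst p \<and> 0 \<le> snd p \<and> (\<forall>x. norm x < fst p \<longrightarrow> norm (h q x - h q 0 - bilin (gradient (h q) 0) x) \<le> snd p * (norm x)\<^sup>2)"
   by (intro exI[of _ "(\<rho>, C)"]) simp
 qed
 from bchoice[OF this] obtain p where p0: "\<forall>q\<in>Q. 0 < fst (p q) \<and> 0 \<le> snd (p q) \<and>
   (\<forall>x. norm x < fst (p q) \<longrightarrow> norm (h q x - h q 0 - bilin (gradient (h q) 0) x) \<le> snd (p q) * (norm x)\<^sup>2)" ..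
 define \<rho> where "\<rho> = Min (insert d ((%q. fst (p q)) ` Q))"
 have \<rho>: "0 < \<rho>" "\<rho> \<le> d" "\<And>q. q \<in> Q ==> \<rho> \<le> fst (p q)"
  unfolding \<rho>_def using Q d p0 by (auto simp: Min_gr_iff)
 define B where "B = (\<Sum>q\<in>Q. snd (p q) * norm (v q))"
 have B: "0 \<le> B" unfolding B_def using p0 by (auto intro!: sum_nonneg)
 have near: "norm (?\<phi> x - x) \<le> B * (norm x)\<^sup>2" if x: "norm x < \<rho>" for x
 proof -
  have "norm (?\<phi> x - x) = norm (\<Sum>q\<in>Q. (h q x - bilin (gradient (h q) 0) x) *s v q)" by (simp add: straighten_def)
  also have "\<dots> \<le> (\<Sum>q\<in>Q. norm ((h q x - bilin (gradient (h q) 0) x) *s v q))" by (rule norm_sum)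
  also have "\<dots> \<le> (\<Sum>q\<in>Q. snd (p q) * (norm x)\<^sup>2 * norm (v q))"
  proof (rule sum_mono)
   fix q assume q: "q \<in> Q"
   have "norm (h q x - h q 0 - bilin (gradient (h q) 0) x) \<le> snd (p q) * (norm x)\<^sup>2"
    using bspec[OF p0 q] x \<rho>(3)[OF q] by auto
   then have "norm (h q x - bilin (gradient (h q) 0) x) \<le> snd (p q) * (norm x)\<^sup>2" using h0[OF q] by simp
   then show "norm ((h q x - bilin (gradient (h q) 0) x) *s v q) \<le> snd (p q) * (norm x)\<^sup>2 * norm (v q)"
    unfolding norm_scalar_mult by (rule mult_right_mono) simp
  qed
  also have "\<dots> = B * (norm x)\<^sup>2" by (simp add: B_def sum_distrib_left mult_ac)
  finally show ?thesis .
 qed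
 obtain d1 where d1: "0 < d1" "\<And>u. norm u < d1 ==> norm (\<psi> u - u) \<le> norm u"
 proof -
  have "\<exists>d>0. \<forall>y. norm (y - 0) < d \<longrightarrow> norm (\<psi> y - \<psi> 0 - (y - 0)) \<le> 1 * norm (y - 0)"
   using d\<psi> unfolding \<phi>0 has_derivative_at_alt by (elim conjE allE[of _ 1]) simp
  then show thesis using that by (auto simp: \<psi>0)
 qed
 obtain d2 where d2: "0 < d2" "ball 0 d2 \<subseteq> V'" using V' \<phi>0 open_contains_ball by metis
 define d3 where "d3 = min (min d1 d2) (\<rho> / 2)"
 have d3: "0 < d3" "d3 \<le> d1" "d3 \<le> d2" "d3 \<le> \<rho> / 2" using d1 d2 \<rho> by (auto simp: d3_def)
 define K where "K = (\<Sum>l\<in>UNIV. norm (\<kappa> $ l))"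
 have K: "0 \<le> K" unfolding K_def by (rule sum_nonneg) simp
 define \<delta> where "\<delta> = min 1 (d3 / (2 * (K + 1)))"
 have \<delta>: "0 < \<delta>" "\<delta> \<le> 1" "K * \<delta> < d3"
 proof -
  show "0 < \<delta>" "\<delta> \<le> 1" using d3 K by (auto simp: \<delta>_def)
  have "K * \<delta> \<le> K * (d3 / (2 * (K + 1)))" by (rule mult_left_mono) (use K in \<open>auto simp: \<delta>_def\<close>)
  also have "\<dots> < d3" using K d3(1) by (simp add: field_simps add_nonneg_pos)
  finally show "K * \<delta> < d3" .
 qed
 define T where "T = (%\<nu>. \<delta> * inverse (real (Suc \<nu>)))"
 have inv1: "inverse (real (Suc \<nu>)) \<le> 1" for \<nu> by (simp add: inverse_le_1_iff)
 have T: "0 < T \<nu>" "T \<nu> \<le> \<delta>" "T \<nu> \<le> 1" for \<nu>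
 proof -
  show "0 < T \<nu>" using \<delta> by (simp add: T_def)
  show "T \<nu> \<le> \<delta>" using mult_left_mono[OF inv1[of \<nu>], of \<delta>] \<delta>(1) by (simp add: T_def)
  then show "T \<nu> \<le> 1" using \<delta>(2) by simp
 qed
 have T0: "T \<longlonglongrightarrow> 0" unfolding T_def using tendsto_mult_right_zero[OF LIMSEQ_inverse_real_of_nat] by simp
 define u where "u = (%\<nu>. (\<chi> l. \<kappa> $ l * of_real (T \<nu> ^ (N + e l))) :: complex^'n)"
 have u: "norm (u \<nu>) \<le> K * T \<nu> ^ N" for \<nu>
 proof -
  have "norm (u \<nu>) \<le> (\<Sum>l\<in>UNIV. norm (u \<nu> $ l))"
   unfolding norm_vec_def by (rule L2_set_le_sum) simp
  also have "\<dots> \<le> (\<Sum>l\<in>UNIV. norm (\<kappa> $ l) * T \<nu> ^ N)"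
  proof (rule sum_mono)
   fix l
   have "T \<nu> ^ (N + e l) \<le> T \<nu> ^ N" by (rule power_decreasing) (use T[of \<nu>] in auto)
   then show "norm (u \<nu> $ l) \<le> norm (\<kappa> $ l) * T \<nu> ^ N"
    using T[of \<nu>] by (simp add: u_def norm_mult norm_power mult_left_mono)
  qed
  finally show ?thesis by (simp add: K_def sum_distrib_right)
 qed
 have u_small: "norm (u \<nu>) < d3" for \<nu>
 proof -
  have "T \<nu> ^ N \<le> T \<nu> ^ 1" by (rule power_decreasing) (use T[of \<nu>] N in auto)
  then have "K * T \<nu> ^ N \<le> K * \<delta>" using T(2)[of \<nu>] K by (intro mult_left_mono) auto
  then show ?thesis using u[of \<nu>] \<delta>(3) by linarith
 qed
 define x where "x = (%\<nu>. \<psi> (u \<nu>))"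
 have \<phi>x: "?\<phi> (x \<nu>) = u \<nu>" for \<nu>
 proof -
  have "u \<nu> \<in> V'" using u_small[of \<nu>] d3(3) d2(2) by auto
  then show ?thesis unfolding x_def by (rule homeomorphism_apply2[OF hom])
 qed
 have xu: "norm (x \<nu>) \<le> 2 * norm (u \<nu>)" for \<nu>
  using d1(2)[of "u \<nu>"] u_small[of \<nu>] d3(2) norm_triangle_ineq2[of "x \<nu>" "u \<nu>"] by (simp add: x_def)
 have xN: "norm (x \<nu>) \<le> 2 * K * T \<nu> ^ N" for \<nu> using xu[of \<nu>] u[of \<nu>] by simp
 have x\<rho>: "norm (x \<nu>) < \<rho>" for \<nu> using xu[of \<nu>] u_small[of \<nu>] d3(4) by linarith
 define C where "C = 2 * K + B * (2 * K)\<^sup>2"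
 show thesis
 proof (rule that[of T x C])
  show "norm (x \<nu>) < d" for \<nu> using x\<rho>[of \<nu>] \<rho>(2) by simp
  show "norm (x \<nu>) \<le> C * T \<nu> ^ N" for \<nu>
  proof -
   have "2 * K * T \<nu> ^ N \<le> C * T \<nu> ^ N" by (rule mult_right_mono) (use B T[of \<nu>] in \<open>auto simp: C_def\<close>)
   then show ?thesis using xN[of \<nu>] by simp
  qed
  show "x \<nu> $ l = \<kappa> $ l * of_real (T \<nu> ^ (N + e l))" if l: "l \<notin> R0" for \<nu> l
  proof -
   have "?\<phi> (x \<nu>) $ l = x \<nu> $ l" using l by (simp add: straighten_def v_def)
   then show ?thesis by (simp add: \<phi>x u_def)
  qed
  show "norm (x \<nu> $ l) \<le> C * T \<nu> ^ (2 * N)" if l: "l \<in> R0" for \<nu> l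
  proof -
   have "norm (x \<nu> $ l) = norm ((?\<phi> (x \<nu>) - x \<nu>) $ l)" using \<kappa>[OF l] by (simp add: \<phi>x u_def)
   also have "\<dots> \<le> norm (?\<phi> (x \<nu>) - x \<nu>)" by (rule Finite_Cartesian_Product.norm_nth_le)
   also have "\<dots> \<le> B * (norm (x \<nu>))\<^sup>2" by (rule near[OF x\<rho>])
   also have "\<dots> \<le> B * (2 * K * T \<nu> ^ N)\<^sup>2" by (intro mult_left_mono power_mono xN B) simp
   also have "\<dots> = B * (2 * K)\<^sup>2 * T \<nu> ^ (2 * N)" by (simp add: power_mult_distrib power_mult[symmetric] mult.commute)
   also have "\<dots> \<le> C * T \<nu> ^ (2 * N)" by (rule mult_right_mono) (use K T[of \<nu>] in \<open>auto simp: C_def\<close>)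
   finally show ?thesis .
  qed
  show "h q (x \<nu>) = 0" if q: "q \<in> Q" for \<nu> q
  proof -
   have "h q (x \<nu>) = bilin (gradient (h q) 0) (u \<nu>)" using lin[OF q, of "x \<nu>"] by (simp add: \<phi>x)
   also have "\<dots> = 0" unfolding bilin_def
   proof (rule sum.neutral, rule ballI)
    fix l show "gradient (h q) 0 $ l * u \<nu> $ l = 0" using supp[OF q, of l] \<kappa>[of l] by (cases "l \<in> R0") (auto simp: u_def)
   qed
   finally show ?thesis .
  qed
 qed (use T T0 in auto)
qed

section \<open>Linear parts of the members of a family\<close>

context newton_germ
begin

text \<open>Independence at \<open>t1\<close> gives the counting condition.  The staged zero for the linear
 parts at \<open>0\<close> is lifted to points at which all scaled entries tend to zero.  Nondegeneracy then
 makes the linear parts of the first columns independent in the coordinates \<open>I\<close>, and counting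
 dimensions shows that all linear parts at \<open>0\<close> are independent.\<close>

lemma linear_parts_dependent:
 assumes s1: "s = 1"
  and zero: "\<And>t. norm t < \<rho> ==> with_param 0 t \<in> U" "\<And>t i j. norm t < \<rho> ==> i < n ==> j < k ==> F (with_param 0 t) $$ (i, j) = 0"
 defines "L \<equiv> %t (i, j). gradient (%x. F (with_param x t) $$ (i, j)) (0 :: complex^'m)"
 assumes dep: "\<not> independent_family (L 0) ({..<n} \<times> {..<k})" and t1: "norm t1 < \<rho>"
 shows "\<not> independent_family (L t1) ({..<n} \<times> {..<k})"
proof
 assume ind1: "independent_family (L t1) ({..<n} \<times> {..<k})"
 have wp: "with_param x t = with_param 0 t + with_param x 0" for x :: "complex^'m" and t
  by (simp add: Finite_Cartesian_Product.vec_eq_iff with_param_def split: option.split)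
 have wpd: "((%x. with_param x t) has_derivative (%v. with_param v 0)) (at x)" for x :: "complex^'m" and t
 proof -
  have "bounded_linear (%v :: complex^'m. with_param v 0)"
   by (rule linear_conv_bounded_linear[THEN iffD1], rule linearI)
    (auto simp: Finite_Cartesian_Product.vec_eq_iff with_param_def split: option.split)
  from has_derivative_add[OF has_derivative_const[of "with_param 0 t"] bounded_linear_imp_has_derivative[OF this]]
  show ?thesis by (subst wp) simp
 qed
 define V where "V = (%t. {x :: complex^'m. with_param x t \<in> U})"
 have V: "open (V t)" for t
 proof -
  have "continuous_on UNIV (%x :: complex^'m. with_param x t)"
   by (rule continuous_at_imp_continuous_on, rule ballI, rule has_derivative_continuous[OF wpd])
  from open_vimage[OF U(1) this] show ?thesis by (simp add: V_def vimage_def)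
 qed
 have V0: "0 \<in> V t" if "norm t < \<rho>" for t using zero(1)[OF that] by (simp add: V_def)
 have holV: "holomorphic_Cn_on (%x. F (with_param x t) $$ (i, j)) (V t)" if ij: "i < n" "j < k" for i j t
  unfolding holomorphic_Cn_on_def
 proof
  fix x assume "x \<in> V t"
  then obtain f' where f': "((%z. F z $$ (i, j)) has_derivative f') (at (with_param x t))" "\<forall>c v. f' (c *s v) = c * f' v"
   using hol[OF ij] by (auto simp: V_def holomorphic_Cn_on_def)
  have "((%x. F (with_param x t) $$ (i, j)) has_derivative (%v. f' (with_param v 0))) (at x)"
   by (rule has_derivative_compose[OF wpd f'(1)])
  moreover have "with_param (c *s v) 0 = c *s (with_param v 0 :: complex^'m option)" for c v
   by (simp add: Finite_Cartesian_Product.vec_eq_iff with_param_def split: option.split)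
  ultimately show "\<exists>f'. ((%x. F (with_param x t) $$ (i, j)) has_derivative f') (at x) \<and> (\<forall>c v. f' (c *s v) = c * f' v)"
   using f'(2) by (intro exI[of _ "%v. f' (with_param v 0)"]) simp
 qed
 let ?f = "%t i j x. F (with_param x t) $$ (i, j)"
 have tc0: "taylor_coeff (?f t i j) 0 = 0" if "norm t < \<rho>" "i < n" "j < k" for t i j
  using linear_coefficients(1)[OF holV[OF that(2,3)] V V0[OF that(1)]] zero(2)[OF that] by simp
 have tc1: "taylor_coeff (?f t i j) (axis l 1) = L t (i, j) $ l" if "norm t < \<rho>" "i < n" "j < k" for t i j l
  using linear_coefficients(2)[OF holV[OF that(2,3)] V V0[OF that(1)]] by (simp add: L_def)
 define S where "S = (%j. {l. axis l 1 \<in> lattice_points (\<Delta> j)})"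
 have S: "l \<in> S j \<longleftrightarrow> L t (i, j) $ l ~= 0" if "norm t < \<rho>" "i < n" "j < k" for t i j l
  using newton_linear_support(1)[OF tc0[OF that], of l] unfolding newton[OF that] tc1[OF that] S_def mem_Collect_eq .
 have \<rho>0: "norm (0::complex) < \<rho>" using \<rho> by simp
 have nz: "a ~= 0" if "j < k" "a \<in> lattice_points (\<Delta> j)" for a j
 proof -
  have n0: "0 < n" using s by simp
  show ?thesis using newton_linear_support(2)[OF tc0[OF \<rho>0 n0 that(1)], of a] that(2) by (simp add: newton[OF \<rho>0 n0 that(1)])
 qed
 have axis_sum: "g = (\<Sum>l\<in>R. g $ l *s axis l 1)" if "\<And>l. l \<notin> R ==> g $ l = 0" for g :: "complex^'m" and R
  using that by (simp add: Finite_Cartesian_Product.vec_eq_iff axis_def if_distrib if_distribR cong: if_cong)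
 have hall: "n * card {j \<in> {..<k}. S j \<subseteq> R} \<le> card R" for R
 proof -
  let ?Q = "{..<n} \<times> {j \<in> {..<k}. S j \<subseteq> R}"
  have "independent_family (L t1) ?Q"
   unfolding independent_family_def
  proof (intro allI impI ballI)
   fix c q assume z: "(\<Sum>q\<in>?Q. c q *s L t1 q) = 0" and q: "q \<in> ?Q"
   have e1: "(\<Sum>q\<in>{..<n} \<times> {..<k}. (if q \<in> ?Q then c q else 0) *s L t1 q) = (\<Sum>q\<in>?Q. (if q \<in> ?Q then c q else 0) *s L t1 q)"
    by (rule sum.mono_neutral_right) auto
   have e2: "(\<Sum>q\<in>?Q. (if q \<in> ?Q then c q else 0) *s L t1 q) = (\<Sum>q\<in>?Q. c q *s L t1 q)"
    by (rule sum.cong[OF refl]) (simp only: if_True)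
   have "(\<Sum>q\<in>{..<n} \<times> {..<k}. (if q \<in> ?Q then c q else 0) *s L t1 q) = 0"
    by (rule trans[OF e1 trans[OF e2 z]])
   from independent_familyD[OF ind1 this, of q] show "c q = 0" using q by (auto split: if_splits)
  qed
  moreover have "L t1 ` ?Q \<subseteq> vec.span ((%l. axis l 1) ` R)"
  proof (rule image_subsetI)
   fix q assume "q \<in> ?Q"
   then obtain i j where q: "q = (i, j)" and ij: "i < n" "j < k" "S j \<subseteq> R" by auto
   have "L t1 (i, j) = (\<Sum>l\<in>R. L t1 (i, j) $ l *s axis l 1)"
    by (rule axis_sum) (use S[OF t1, of i j] ij in auto)
   also have "\<dots> \<in> vec.span ((%l. axis l 1) ` R)"
    by (intro vec.span_sum vec.span_scale vec.span_base) auto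
   finally show "L t1 q \<in> vec.span ((%l. axis l 1) ` R)" unfolding q .
  qed
  ultimately have "card ?Q \<le> vec.dim ((%l. axis l 1 :: complex^'m) ` R)"
   by (intro independent_family_dim) auto
  also have "\<dots> \<le> card ((%l. axis l 1 :: complex^'m) ` R)" by (rule vec.dim_le_card) (auto intro: vec.span_base)
  also have "\<dots> \<le> card R" by (rule card_image_le) simp
  finally show ?thesis by (simp add: card_cartesian_product)
 qed
 define f where "f = (%i j. L 0 (i, j))"
 have fL: "(%(i, j). f i j) = L 0" by (auto simp: f_def)
 have supp: "f i j $ l = 0" if "i < n" "j < k" "l \<notin> S j" for i j l
  using S[OF \<rho>0 that(1,2), of l] that(3) by (simp add: f_def)
 have supp': "\<forall>i<n. \<forall>j<k. \<forall>l. l \<notin> S j \<longrightarrow> f i j $ l = 0" using supp by blast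
 have allQ: "{j \<in> {..<k}. S j \<subseteq> UNIV} = {..<k}" by auto
 let ?G = "L 0 ` ({..<n} \<times> {..<k})"
 obtain \<kappa> :: "complex^'m" and e :: "'m => nat" and R0 where
   indR0: "independent_family (%(i, j). f i j) ({..<n} \<times> {j \<in> {..<k}. S j \<subseteq> R0})"
   and \<kappa>: "\<forall>l. \<kappa> $ l ~= 0 \<longleftrightarrow> l \<in> UNIV - R0"
   and col: "\<forall>j<k. S j \<subseteq> UNIV \<longrightarrow> \<not> S j \<subseteq> R0 \<longrightarrow> (\<exists>p. (\<forall>l\<in>S j - R0. p \<le> e l) \<and> (\<exists>l\<in>S j - R0. e l = p) \<and>
     (\<forall>i<n. (\<Sum>l\<in>{l \<in> S j - R0. e l = p}. f i j $ l * \<kappa> $ l) = 0))"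
   and fst: "independent_family (%(i, j). f i j) ({..<n} \<times> {j \<in> {..<k}. S j \<subseteq> UNIV}) \<or>
    (\<forall>l. e l = 0 \<longleftrightarrow> l \<in> UNIV - R0 \<and> axis l 1 \<notin> vec.span ((%(i, j). f i j) ` ({..<n} \<times> {j \<in> {..<k}. S j \<subseteq> UNIV}))) \<and>
    (\<forall>l\<in>R0. axis l 1 \<in> vec.span ((%(i, j). f i j) ` ({..<n} \<times> {j \<in> {..<k}. S j \<subseteq> UNIV})))"
  using staged_zero[of n k S f UNIV, OF supp' hall] by (elim exE conjE)
 have fst': "(\<forall>l. e l = 0 \<longleftrightarrow> l \<in> UNIV - R0 \<and> axis l 1 \<notin> vec.span ?G) \<and> (\<forall>l\<in>R0. axis l 1 \<in> vec.span ?G)"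
  using fst dep unfolding fL allQ by blast
 define I where "I = {l. axis l 1 \<notin> vec.span ?G}"
 have eI: "e l = 0 \<longleftrightarrow> l \<in> I" and IR0: "I \<inter> R0 = {}" for l using fst' by (auto simp: I_def)
 define J0 where "J0 = {j. j < k \<and> S j \<inter> I ~= {}}"
 have R0U: "R0 ~= UNIV"
 proof
  assume "R0 = UNIV"
  with indR0 have "independent_family (L 0) ({..<n} \<times> {..<k})" unfolding fL by (simp only: allQ)
  with dep show False by simp
 qed
 define N where "N = Suc (\<Sum>l\<in>UNIV. e l)"
 have eN: "e l < N" for l unfolding N_def by (rule le_imp_less_Suc, rule member_le_sum) auto
 have "\<forall>q\<in>{..<n} \<times> {..<k}. \<exists>p. 0 < fst p \<and> 0 \<le> snd p \<and> (\<forall>x. norm x < fst p \<longrightarrow> norm (?f 0 (fst q) (snd q) x - bilin (L 0 q) x) \<le> snd p * (norm x)\<^sup>2)"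
 proof
  fix q assume q: "q \<in> {..<n} \<times> {..<k}"
  then have q': "fst q < n" "snd q < k" by auto
  obtain C r where "0 < r" "0 \<le> C" "\<And>x. norm x < r ==>
    norm (?f 0 (fst q) (snd q) x - ?f 0 (fst q) (snd q) 0 - bilin (gradient (?f 0 (fst q) (snd q)) 0) x) \<le> C * (norm x)\<^sup>2"
   by (rule quadratic_remainder[OF holV[OF q', of 0] V V0[OF \<rho>0]]) (assumption | rule that)+
  then show "\<exists>p. 0 < fst p \<and> 0 \<le> snd p \<and> (\<forall>x. norm x < fst p \<longrightarrow> norm (?f 0 (fst q) (snd q) x - bilin (L 0 q) x) \<le> snd p * (norm x)\<^sup>2)"
   using zero(2)[OF \<rho>0 q'] by (intro exI[of _ "(r, C)"]) (simp add: L_def case_prod_beta)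
 qed
 from bchoice[OF this] obtain P where P0: "\<forall>q\<in>{..<n} \<times> {..<k}. 0 < fst (P q) \<and> 0 \<le> snd (P q) \<and>
   (\<forall>x. norm x < fst (P q) \<longrightarrow> norm (?f 0 (fst q) (snd q) x - bilin (L 0 q) x) \<le> snd (P q) * (norm x)\<^sup>2)" ..
 define d where "d = Min (insert 1 ((%q. fst (P q)) ` ({..<n} \<times> {..<k})))"
 have d: "0 < d" "d \<le> 1" "\<And>q. q \<in> {..<n} \<times> {..<k} ==> d \<le> fst (P q)"
  unfolding d_def using P0 by (auto simp: Min_gr_iff)
 let ?Q0 = "{..<n} \<times> {j \<in> {..<k}. S j \<subseteq> R0}"
 have gradQ: "gradient (?f 0 (fst q) (snd q)) 0 = L 0 q" for q by (simp add: L_def case_prod_beta)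
 obtain T C x where T0: "T \<longlonglongrightarrow> (0 :: real)" and T: "\<And>\<nu>. 0 < T \<nu>" "\<And>\<nu>. T \<nu> \<le> 1" and xd: "\<And>\<nu>. norm (x \<nu>) < d"
  and xN: "\<And>\<nu>. norm (x \<nu>) \<le> C * T \<nu> ^ N" and xl: "\<And>\<nu> l. l \<notin> R0 ==> x \<nu> $ l = \<kappa> $ l * of_real (T \<nu> ^ (N + e l))"
  and xR0: "\<And>\<nu> l. l \<in> R0 ==> norm (x \<nu> $ l) \<le> C * T \<nu> ^ (2 * N)"
  and xQ: "\<And>\<nu> q. q \<in> ?Q0 ==> ?f 0 (fst q) (snd q) (x \<nu>) = 0"
 proof (rule staged_curve[of ?Q0 "V 0" "%q. ?f 0 (fst q) (snd q)" R0 \<kappa> N d e])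
  show "independent_family (%q. gradient (?f 0 (fst q) (snd q)) 0) ?Q0" using indR0 unfolding fL gradQ .
  show "gradient (?f 0 (fst q) (snd q)) 0 $ l = 0" if "q \<in> ?Q0" "l \<notin> R0" for q l
  proof -
   have "l \<notin> S (snd q)" "fst q < n" "snd q < k" using that by auto
   then show ?thesis unfolding gradQ using supp[of "fst q" "snd q" l] by (simp add: f_def)
  qed
  show "?f 0 (fst q) (snd q) 0 = 0" if "q \<in> ?Q0" for q using that by (intro zero(2) \<rho>0) auto
  show "holomorphic_Cn_on (?f 0 (fst q) (snd q)) (V 0)" if "q \<in> ?Q0" for q using that by (intro holV) auto
  show "\<kappa> $ l = 0" if "l \<in> R0" for l using \<kappa> that by blast
 qed (auto simp: V V0[OF \<rho>0] N_def d(1))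
 have xlim: "x \<longlonglongrightarrow> 0"
 proof (rule Lim_null_comparison[OF always_eventually[OF allI[OF xN]]])
  have "(%\<nu>. C * T \<nu> ^ N) \<longlonglongrightarrow> C * 0 ^ N" by (intro tendsto_intros T0)
  then show "(%\<nu>. C * T \<nu> ^ N) \<longlonglongrightarrow> 0" by (simp add: N_def)
 qed
 \<comment> \<open>The leading terms of the coordinates, at an order that is reached outside \<open>R0\<close>.\<close>
 have lead: "(%\<nu>. x \<nu> $ l / of_real (T \<nu> ^ (N + p))) \<longlonglongrightarrow> (if l \<notin> R0 \<and> e l = p then \<kappa> $ l else 0)"
  if p: "p < N" and l: "l \<in> R0 \<or> p \<le> e l" for l p
 proof (cases "l \<in> R0")
  case True
  have "(%\<nu>. x \<nu> $ l / of_real (T \<nu> ^ (N + p))) \<longlonglongrightarrow> 0"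
   by (rule tendsto_quotient_zero[OF T0 T xR0[OF True]]) (use p in simp)
  then show ?thesis using True by simp
 next
  case False
  have Tp: "of_real (T \<nu> ^ a) ~= (0::complex)" for \<nu> a using T(1)[of \<nu>] by simp
  show ?thesis
  proof (cases "e l = p")
   case True
   then have "x \<nu> $ l / of_real (T \<nu> ^ (N + p)) = \<kappa> $ l" for \<nu> using xl[OF False, of \<nu>] Tp[of \<nu> "N + p"] by simp
   then show ?thesis using True False by simp
  next
   case F: False
   have "(%\<nu>. x \<nu> $ l / of_real (T \<nu> ^ (N + p))) \<longlonglongrightarrow> 0"
   proof (rule tendsto_quotient_zero[OF T0 T])
    show "norm (x \<nu> $ l) \<le> norm (\<kappa> $ l) * T \<nu> ^ (N + e l)" for \<nu>
     using T(1)[of \<nu>] by (simp add: xl[OF False] norm_mult norm_power)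
   qed (use F l False in auto)
   then show ?thesis using F by simp
  qed
 qed
 have T2: "norm (x \<nu>) ^ 2 \<le> C\<^sup>2 * T \<nu> ^ (2 * N)" for \<nu>
 proof -
  have "norm (x \<nu>) ^ 2 \<le> (C * T \<nu> ^ N) ^ 2" by (rule power_mono[OF xN norm_ge_zero])
  then show ?thesis by (simp add: power_mult_distrib power_mult[symmetric] mult.commute)
 qed
 have entry: "(%\<nu>. ?f 0 i j (x \<nu>) / of_real (T \<nu> ^ (N + p))) \<longlonglongrightarrow> 0"
  if ij: "i < n" "j < k" and p: "p < N" "\<forall>l\<in>S j - R0. p \<le> e l"
   "(\<Sum>l\<in>{l \<in> S j - R0. e l = p}. f i j $ l * \<kappa> $ l) = 0" for i j p
 proof -
  have q: "(i, j) \<in> {..<n} \<times> {..<k}" using ij by simp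
  have "(%\<nu>. (?f 0 i j (x \<nu>) - bilin (f i j) (x \<nu>)) / of_real (T \<nu> ^ (N + p))) \<longlonglongrightarrow> 0"
  proof (rule tendsto_quotient_zero[OF T0 T])
   fix \<nu>
   have "norm (?f 0 i j (x \<nu>) - bilin (f i j) (x \<nu>)) \<le> snd (P (i, j)) * (norm (x \<nu>))\<^sup>2"
    using bspec[OF P0 q] xd[of \<nu>] d(3)[OF q] by (auto simp: f_def)
   also have "\<dots> \<le> snd (P (i, j)) * (C\<^sup>2 * T \<nu> ^ (2 * N))"
    by (rule mult_left_mono[OF T2]) (use bspec[OF P0 q] in simp)
   finally show "norm (?f 0 i j (x \<nu>) - bilin (f i j) (x \<nu>)) \<le> (snd (P (i, j)) * C\<^sup>2) * T \<nu> ^ (2 * N)" by (simp add: mult_ac)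
  qed (use p in simp)
  moreover have "(%\<nu>. bilin (f i j) (x \<nu>) / of_real (T \<nu> ^ (N + p))) \<longlonglongrightarrow> 0"
  proof -
   have "(%\<nu>. \<Sum>l\<in>S j. f i j $ l * (x \<nu> $ l / of_real (T \<nu> ^ (N + p)))) \<longlonglongrightarrow>
     (\<Sum>l\<in>S j. f i j $ l * (if l \<notin> R0 \<and> e l = p then \<kappa> $ l else 0))"
    by (intro tendsto_sum tendsto_mult tendsto_const lead p(1)) (use p(2) in blast)
   moreover have "(\<Sum>l\<in>S j. f i j $ l * (if l \<notin> R0 \<and> e l = p then \<kappa> $ l else 0)) = (\<Sum>l\<in>{l \<in> S j - R0. e l = p}. f i j $ l * \<kappa> $ l)"
    by (rule sum.mono_neutral_cong_right) auto
   moreover have "(\<Sum>l\<in>S j. f i j $ l * (x \<nu> $ l / of_real (T \<nu> ^ (N + p)))) = bilin (f i j) (x \<nu>) / of_real (T \<nu> ^ (N + p))" for \<nu>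
    unfolding bilin_def sum_divide_distrib by (rule sum.mono_neutral_cong_left) (use supp[OF ij] in auto)
   ultimately show ?thesis using p(3) by simp
  qed
  ultimately have "(%\<nu>. (?f 0 i j (x \<nu>) - bilin (f i j) (x \<nu>)) / of_real (T \<nu> ^ (N + p)) + bilin (f i j) (x \<nu>) / of_real (T \<nu> ^ (N + p))) \<longlonglongrightarrow> 0 + 0"
   by (rule tendsto_add)
  then show ?thesis by (simp add: diff_divide_distrib)
 qed
 define z where "z = (%\<nu>. with_param (x \<nu>) 0 :: complex^'m option)"
 have zlim: "z \<longlonglongrightarrow> 0"
 proof (rule vec_tendstoI)
  fix i show "(%\<nu>. z \<nu> $ i) \<longlonglongrightarrow> 0 $ i"
   using tendsto_vec_nth[OF xlim] by (cases i) (auto simp: z_def)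
 qed
 have xz: "xpart (z \<nu>) = x \<nu>" for \<nu> by (simp add: z_def)
 have xne: "xpart (z \<nu>) ~= 0" for \<nu>
 proof -
  obtain l where l: "l \<notin> R0" using R0U by blast
  then have "x \<nu> $ l ~= 0" using xl[OF l, of \<nu>] \<kappa> T(1)[of \<nu>] by auto
  then show ?thesis unfolding xz by auto
 qed
 obtain r \<sigma> M g y G where r: "strict_mono (r :: nat => nat)" and \<sigma>: "\<And>j \<nu>. \<sigma> j \<nu> ~= (0 :: complex)" and y: "y \<in> complex_torus"
  and limF: "\<And>i j. i < n ==> j < k ==> (%\<nu>. F (z (r \<nu>)) $$ (i, j) / \<sigma> j \<nu>) \<longlonglongrightarrow> M i j"
  and trans: "low_rank (s - 1) n k M ==> transversal n k s M g"
  and limG: "\<And>j a. j < k ==> a \<in> lattice_points (\<Delta> j) ==>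
    (%\<nu>. monomial_Cn a (xpart (z (r \<nu>))) / \<sigma> j \<nu>) \<longlonglongrightarrow> (if a \<in> G j then monomial_Cn a y else 0)"
  and G: "\<And>j. j < k ==> finite (G j) \<and> G j ~= {} \<and> G j \<subseteq> lattice_points (\<Delta> j)"
  and g: "\<And>i j l. i < n ==> j < k ==> y $ l * g i j $ l =
    (\<Sum>a\<in>G j. taylor_coeff (%x. F (with_param x 0) $$ (i, j)) a * of_nat (a $ l) * monomial_Cn a y)"
  apply (rule face_limit[OF zlim xne])
  subgoal premises p by (rule p(1)[OF p(2-5) p(9) p(11-13)])
  done
 have sub: "(%\<nu>. h (r \<nu>)) \<longlonglongrightarrow> c" if "h \<longlonglongrightarrow> c" for h :: "nat => complex" and c
  using LIMSEQ_subseq_LIMSEQ[OF that r] by (simp add: o_def)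
 have limL: "(%\<nu>. x (r \<nu>) $ l / \<sigma> j \<nu>) \<longlonglongrightarrow> (if axis l 1 \<in> G j then y $ l else 0)" if "j < k" "l \<in> S j" for j l
 proof -
  have "axis l 1 \<in> lattice_points (\<Delta> j)" using that by (simp add: S_def)
  from limG[OF that(1) this] show ?thesis unfolding monomial_axis xz .
 qed
 have Tnz: "of_real (T \<nu> ^ a) ~= (0::complex)" for \<nu> a using T(1)[of \<nu>] by simp
 have M0: "M i j = 0" if ij: "i < n" "j < k" for i j
 proof (cases "S j \<subseteq> R0")
  case True
  have "F (z \<nu>) $$ (i, j) = 0" for \<nu> using xQ[of "(i, j)" \<nu>] ij True by (simp add: z_def)
  then show ?thesis using limF[OF ij] by (simp add: LIMSEQ_const_iff)
 next
  case False
  then obtain p l where p: "\<forall>l\<in>S j - R0. p \<le> e l" "l \<in> S j - R0" "e l = p"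
    "\<forall>i<n. (\<Sum>l\<in>{l \<in> S j - R0. e l = p}. f i j $ l * \<kappa> $ l) = 0" using col ij by blast
  have pN: "p < N" using eN[of l] p(3) by simp
  have \<kappa>l: "\<kappa> $ l ~= 0" using \<kappa> p(2) by blast
  have "(%\<nu>. ?f 0 i j (x (r \<nu>)) / of_real (T (r \<nu>) ^ (N + p)) / \<kappa> $ l * (x (r \<nu>) $ l / \<sigma> j \<nu>)) \<longlonglongrightarrow>
    0 / \<kappa> $ l * (if axis l 1 \<in> G j then y $ l else 0)"
   by (intro tendsto_mult tendsto_divide tendsto_const \<kappa>l limL ij(2) sub[OF entry[OF ij pN p(1) p(4)[rule_format, OF ij(1)]]])
    (use p(2) in simp)
  moreover have "?f 0 i j (x (r \<nu>)) / of_real (T (r \<nu>) ^ (N + p)) / \<kappa> $ l * (x (r \<nu>) $ l / \<sigma> j \<nu>) = F (z (r \<nu>)) $$ (i, j) / \<sigma> j \<nu>" for \<nu>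
  proof -
   have "x (r \<nu>) $ l = \<kappa> $ l * of_real (T (r \<nu>) ^ (N + p))" using xl[of l "r \<nu>"] p(2,3) by simp
   then show ?thesis using \<kappa>l Tnz[of "r \<nu>" "N + p"] by (simp add: z_def)
  qed
  ultimately have "(%\<nu>. F (z (r \<nu>)) $$ (i, j) / \<sigma> j \<nu>) \<longlonglongrightarrow> 0" by simp
  then show ?thesis using limF[OF ij] LIMSEQ_unique by blast
 qed
 have "low_rank 0 n k M" unfolding low_rank_def using M0 by (intro exI[of _ "{}"]) auto
 then have "transversal n k s M g" using trans s1 by simp
 then have inj: "\<forall>\<Phi>\<in>conormal n k M. pull_back n k g \<Phi> = 0 \<longrightarrow> (\<forall>i<n. \<forall>j<k. \<Phi> i j = 0)"
  unfolding transversal_def by (rule conjunct2)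
 have con: "\<Phi> \<in> conormal n k M" for \<Phi> using M0 by (simp add: conormal_def)
 \<comment> \<open>The columns of the first stage restrict to their linear parts in the coordinates of lowest order.\<close>
 have Gj: "G j = (%l. axis l 1) ` (S j \<inter> I)" if j: "j \<in> J0" for j
 proof -
  have jk: "j < k" using j by (simp add: J0_def)
  obtain l0 where l0: "l0 \<in> S j" "l0 \<in> I" using j by (auto simp: J0_def)
  have l0R: "l0 \<notin> R0" using IR0 l0 by blast
  have \<kappa>0: "\<kappa> $ l0 ~= 0" using \<kappa> l0R by blast
  define m where "m = (%a :: nat^'m. \<Sum>l\<in>{l \<in> I. axis l 1 = a}. \<kappa> $ l)"
  have axis_eq: "axis l 1 = (axis l' 1 :: nat^'m) \<longleftrightarrow> l = l'" for l l' by (simp add: axis_eq_axis)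
  have m: "(%\<nu>. monomial_Cn a (x \<nu>) / of_real (T \<nu> ^ N)) \<longlonglongrightarrow> m a" if a: "a ~= 0" for a
  proof (cases "\<exists>l. a = axis l 1")
   case True
   then obtain l where l: "a = axis l 1" by blast
   have "(%\<nu>. x \<nu> $ l / of_real (T \<nu> ^ (N + 0))) \<longlonglongrightarrow> (if l \<notin> R0 \<and> e l = 0 then \<kappa> $ l else 0)"
    by (rule lead) (auto simp: N_def)
   moreover have "m a = (if l \<notin> R0 \<and> e l = 0 then \<kappa> $ l else 0)"
   proof -
    have "{l' \<in> I. axis l' 1 = a} = (if l \<in> I then {l} else {})" unfolding l axis_eq by auto
    then show ?thesis using eI[of l] IR0 by (auto simp: m_def)
   qed
   ultimately show ?thesis unfolding l monomial_axis by simp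
  next
   case False
   have two: "2 \<le> (\<Sum>i\<in>UNIV. a $ i)"
   proof (rule ccontr)
    assume "\<not> ?thesis"
    then have le: "(\<Sum>i\<in>UNIV. a $ i) \<le> 1" by simp
    obtain l where l: "a $ l ~= 0" using a by (auto simp: Finite_Cartesian_Product.vec_eq_iff)
    have "(\<Sum>i\<in>UNIV. a $ i) = a $ l + (\<Sum>i\<in>UNIV - {l}. a $ i)" by (rule sum.remove) auto
    then have "a $ l = 1" "(\<Sum>i\<in>UNIV - {l}. a $ i) = 0" using l le by linarith+
    then have "a = axis l 1" by (auto simp: Finite_Cartesian_Product.vec_eq_iff axis_def)
    with False show False by blast
   qed
   have "m a = 0" using False by (auto simp: m_def intro!: sum.neutral)
   moreover have "(%\<nu>. monomial_Cn a (x \<nu>) / of_real (T \<nu> ^ N)) \<longlonglongrightarrow> 0"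
   proof (rule tendsto_quotient_zero[OF T0 T])
    show "norm (monomial_Cn a (x \<nu>)) \<le> C\<^sup>2 * T \<nu> ^ (2 * N)" for \<nu>
     using norm_monomial_le[OF _ two, of "x \<nu>"] xd[of \<nu>] d(2) T2[of \<nu>] by simp
   qed (simp add: N_def)
   ultimately show ?thesis by simp
  qed
  define c where "c = (if axis l0 1 \<in> G j then y $ l0 else 0)"
  have c: "(%\<nu>. x (r \<nu>) $ l0 / \<sigma> j \<nu>) \<longlonglongrightarrow> c"
   unfolding c_def by (rule limL[OF jk l0(1)])
  have val: "(if a \<in> G j then monomial_Cn a y else 0) = m a / \<kappa> $ l0 * c" if a: "a \<in> lattice_points (\<Delta> j)" for a
  proof -
   have "(%\<nu>. monomial_Cn a (x (r \<nu>)) / of_real (T (r \<nu>) ^ N) / \<kappa> $ l0 * (x (r \<nu>) $ l0 / \<sigma> j \<nu>)) \<longlonglongrightarrow> m a / \<kappa> $ l0 * c"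
    by (intro tendsto_mult tendsto_divide tendsto_const \<kappa>0 c sub[OF m[OF nz[OF jk a]]])
   moreover have "monomial_Cn a (x (r \<nu>)) / of_real (T (r \<nu>) ^ N) / \<kappa> $ l0 * (x (r \<nu>) $ l0 / \<sigma> j \<nu>) = monomial_Cn a (x (r \<nu>)) / \<sigma> j \<nu>" for \<nu>
   proof -
    have "x (r \<nu>) $ l0 = \<kappa> $ l0 * of_real (T (r \<nu>) ^ N)" using xl[OF l0R, of "r \<nu>"] eI[of l0] l0 by simp
    then show ?thesis using \<kappa>0 Tnz[of "r \<nu>" N] by simp
   qed
   ultimately have "(%\<nu>. monomial_Cn a (x (r \<nu>)) / \<sigma> j \<nu>) \<longlonglongrightarrow> m a / \<kappa> $ l0 * c" by simp
   then show ?thesis using limG[OF jk a] unfolding xz by (rule LIMSEQ_unique[rotated])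
  qed
  have c0: "c ~= 0"
  proof
   assume c0: "c = 0"
   obtain a where a: "a \<in> G j" using G[OF jk] by blast
   then have "a \<in> lattice_points (\<Delta> j)" using G[OF jk] by blast
   from val[OF this] show False using a c0 monomial_nonzero[OF y, of a] by simp
  qed
  have iff: "a \<in> G j \<longleftrightarrow> m a ~= 0" if "a \<in> lattice_points (\<Delta> j)" for a
   using val[OF that] c0 \<kappa>0 monomial_nonzero[OF y, of a] by (auto split: if_splits)
  have m_nz: "m a ~= 0 \<longleftrightarrow> (\<exists>l\<in>I. a = axis l 1)" for a
  proof
   assume "m a ~= 0"
   then obtain l where "l \<in> {l \<in> I. axis l 1 = a}" unfolding m_def by (metis (no_types, lifting) sum.neutral)
   then show "\<exists>l\<in>I. a = axis l 1" by auto
  next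
   assume "\<exists>l\<in>I. a = axis l 1"
   then obtain l where l: "l \<in> I" "a = axis l 1" by blast
   then have "{l \<in> I. axis l 1 = a} = {l}" using axis_eq by auto
   then show "m a ~= 0" using \<kappa> l IR0 by (auto simp: m_def)
  qed
  show ?thesis
  proof (intro equalityI subsetI)
   fix a :: "nat^'m" assume a: "a \<in> G j"
   then have aL: "a \<in> lattice_points (\<Delta> j)" using G[OF jk] by blast
   then obtain l where l: "l \<in> I" "a = axis l 1" using a iff m_nz by blast
   then show "a \<in> (%l. axis l 1) ` (S j \<inter> I)" using aL by (auto simp: S_def)
  next
   fix a :: "nat^'m" assume "a \<in> (%l. axis l 1) ` (S j \<inter> I)"
   then obtain l where l: "l \<in> S j" "l \<in> I" "a = axis l 1" by blast
   then have "a \<in> lattice_points (\<Delta> j)" by (simp add: S_def)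
   then show "a \<in> G j" using iff m_nz l by blast
  qed
 qed
 have gI: "g i j = restrict_vec I (f i j)" if i: "i < n" and j: "j \<in> J0" for i j
 proof -
  have jk: "j < k" using j by (simp add: J0_def)
  have "g i j $ l = restrict_vec I (f i j) $ l" for l
  proof -
   have "y $ l * g i j $ l = (\<Sum>l'\<in>S j \<inter> I. taylor_coeff (?f 0 i j) (axis l' 1) * of_nat (axis l' 1 $ l) * monomial_Cn (axis l' 1) y)"
    unfolding g[OF i jk] Gj[OF j] by (rule sum.reindex_cong[of "%l. axis l 1"]) (auto simp: inj_on_def axis_eq_axis)
   also have "\<dots> = (\<Sum>l'\<in>S j \<inter> I. if l' = l then f i j $ l * y $ l else 0)"
    by (rule sum.cong[OF refl], unfold tc1[OF \<rho>0 i jk] monomial_axis) (auto simp: f_def axis_def)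
   also have "\<dots> = y $ l * restrict_vec I (f i j) $ l"
    using supp[OF i jk, of l] by auto
   finally show ?thesis using y by (simp add: complex_torus_def)
  qed
  then show ?thesis by (simp add: Finite_Cartesian_Product.vec_eq_iff)
 qed
 have indJ: "independent_family (%(i, j). restrict_vec I (f i j)) ({..<n} \<times> J0)"
  unfolding independent_family_def
 proof (intro allI impI ballI)
  fix c q assume zero': "(\<Sum>q\<in>{..<n} \<times> J0. c q *s (case q of (i, j) => restrict_vec I (f i j))) = 0" and q: "q \<in> {..<n} \<times> J0"
  define \<Phi> where "\<Phi> = (%i j. if j \<in> J0 then c (i, j) else 0)"
  have "pull_back n k g \<Phi> = (\<Sum>i<n. \<Sum>j\<in>J0. c (i, j) *s restrict_vec I (f i j))"
   unfolding pull_back_def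
  proof (rule sum.cong[OF refl])
   fix i assume "i \<in> {..<n}"
   then show "(\<Sum>j<k. \<Phi> i j *s g i j) = (\<Sum>j\<in>J0. c (i, j) *s restrict_vec I (f i j))"
    by (intro sum.mono_neutral_cong_right) (auto simp: \<Phi>_def J0_def gI)
  qed
  also have "\<dots> = 0" using zero' by (simp add: sum.cartesian_product case_prod_beta)
  finally have all0: "\<forall>i<n. \<forall>j<k. \<Phi> i j = 0" using inj con by blast
  obtain i j where ij: "q = (i, j)" "i < n" "j \<in> J0" using q by auto
  then have "j < k" by (simp add: J0_def)
  with all0 ij(2) have "\<Phi> i j = 0" by blast
  then show "c q = 0" using ij by (simp add: \<Phi>_def)
 qed
 \<comment> \<open>Together with the coordinates outside \<open>I\<close> these forms are too many for the span of all linear parts.\<close>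
 let ?g = "%q. case q of Inl (i, j) => restrict_vec I (f i j) | Inr l => axis l 1"
 let ?QQ = "({..<n} \<times> J0) <+> (- I)"
 have fJ0: "finite J0" by (simp add: J0_def)
 have sumQQ: "(\<Sum>q\<in>?QQ. c q *s ?g q) = (\<Sum>q\<in>{..<n} \<times> J0. c (Inl q) *s (case q of (i, j) => restrict_vec I (f i j))) + (\<Sum>l\<in>-I. c (Inr l) *s axis l 1)" for c
  using fJ0 by (subst sum.Plus) (auto simp: case_prod_beta)
 have indQQ: "independent_family ?g ?QQ"
  unfolding independent_family_def
 proof (intro allI impI ballI)
  fix c q assume z: "(\<Sum>q\<in>?QQ. c q *s ?g q) = 0" and q: "q \<in> ?QQ"
  let ?A = "\<Sum>q\<in>{..<n} \<times> J0. c (Inl q) *s (case q of (i, j) => restrict_vec I (f i j))"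
  let ?B = "\<Sum>l\<in>-I. c (Inr l) *s (axis l 1 :: complex^'m)"
  have AB: "?A $ l + ?B $ l = 0" for l
   using arg_cong[OF z[unfolded sumQQ], of "%v. v $ l"] by (simp only: vector_add_component zero_index)
  have A: "?A $ l = 0" if "l \<notin> I" for l using that by (simp add: case_prod_beta)
  have B: "?B $ l = (if l \<in> I then 0 else c (Inr l))" for l
   by (simp add: axis_def if_distrib if_distribR cong: if_cong)
  have "?A = 0"
  proof (subst Finite_Cartesian_Product.vec_eq_iff, rule allI)
   fix l show "?A $ l = 0 $ l"
   proof (cases "l \<in> I")
    case True
    then show ?thesis using AB[of l] B[of l] by (simp only: zero_index if_True add_0_right)
   next
    case False
    then show ?thesis using A[OF False] by (simp only: zero_index)
   qed
  qed
  then have "c (Inl p) = 0" if "p \<in> {..<n} \<times> J0" for p by (rule independent_familyD[OF indJ _ that])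
  moreover have "c (Inr l) = 0" if "l \<notin> I" for l using A[OF that] AB[of l] B[of l] that by (simp only: if_False add_0_left)
  ultimately show "c q = 0" using q by auto
 qed
 have "?g ` ?QQ \<subseteq> vec.span ?G"
 proof (rule image_subsetI)
  fix q assume q: "q \<in> ?QQ"
  have ax: "axis l 1 \<in> vec.span ?G" if "l \<notin> I" for l using that by (simp add: I_def)
  show "?g q \<in> vec.span ?G"
  proof (cases q)
   case (Inl p)
   obtain i j where p: "p = (i, j)" "i < n" "j \<in> J0" using q Inl by auto
   then have jk: "j < k" by (simp add: J0_def)
   have "restrict_vec I (f i j) = L 0 (i, j) - (\<Sum>l\<in>-I. L 0 (i, j) $ l *s axis l 1)"
    by (simp add: Finite_Cartesian_Product.vec_eq_iff axis_def if_distrib if_distribR f_def cong: if_cong)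
   also have "\<dots> \<in> vec.span ?G"
    by (intro vec.span_diff vec.span_sum vec.span_scale ax vec.span_base) (use p jk in auto)
   finally show ?thesis by (simp add: Inl p)
  next
   case (Inr l)
   then show ?thesis using q ax by auto
  qed
 qed
 then have d1: "card ?QQ \<le> vec.dim ?G" using indQQ fJ0 by (intro independent_family_dim) auto
 have d2: "vec.dim ?G < n * k"
  using dependent_family_dim[OF _ dep] by (simp add: card_cartesian_product)
 have d3: "card ?QQ = n * card J0 + card (- I)"
  using fJ0 by (simp add: card_Plus card_cartesian_product)
 have d4: "n * card {j \<in> {..<k}. S j \<subseteq> - I} \<le> card (- I)" by (rule hall)
 have d5: "card {j \<in> {..<k}. S j \<subseteq> - I} + card J0 = k"
 proof -
  have "card ({j \<in> {..<k}. S j \<subseteq> - I} \<union> J0) = card {j \<in> {..<k}. S j \<subseteq> - I} + card J0"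
   by (rule card_Un_disjoint) (auto simp: J0_def)
  moreover have "{j \<in> {..<k}. S j \<subseteq> - I} \<union> J0 = {..<k}" by (auto simp: J0_def)
  ultimately show ?thesis by simp
 qed
 have "n * (card {j \<in> {..<k}. S j \<subseteq> - I} + card J0) = n * card {j \<in> {..<k}. S j \<subseteq> - I} + n * card J0"
  by (rule add_mult_distrib2)
 then have "n * k = n * card {j \<in> {..<k}. S j \<subseteq> - I} + n * card J0" unfolding d5 .
 then show False using d1 d2 d3 d4 by linarith
qed

end

section \<open>Whitney equisingularity\<close>

lemma norm_with_param: "norm (with_param x 0) = norm x" "norm (with_param (0 :: complex^'m) t) = norm t" "norm (with_param x t) \<le> norm x + norm t"
  for x :: "complex^'m::finite"
proof -
  show 1: "norm (with_param x 0) = norm x" by (simp add: norm_vec_def L2_set_def sum_option)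
  show 2: "norm (with_param (0 :: complex^'m) t) = norm t" by (simp add: norm_vec_def L2_set_def sum_option)
  have "with_param x t = with_param x 0 + with_param 0 t"
    by (simp add: Finite_Cartesian_Product.vec_eq_iff with_param_def split: option.split)
  then show "norm (with_param x t) \<le> norm x + norm t"
    using norm_triangle_ineq[of "with_param x 0" "with_param 0 t"] by (simp add: 1 2)
qed

lemma with_param_add: "with_param x t + with_param x' t' = with_param (x + x') (t + t')"
  by (simp add: Finite_Cartesian_Product.vec_eq_iff with_param_def split: option.split)

lemma xpart_simps [simp]: "xpart 0 = 0" "xpart (u + v) = xpart u + (xpart v :: complex^'m)" "xpart (u - v) = xpart u - (xpart v :: complex^'m)"
  "xpart (c *s v) = c *s (xpart v :: complex^'m)"
  by (simp_all add: Finite_Cartesian_Product.vec_eq_iff)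

lemma with_param_0 [simp]: "with_param 0 0 = 0"
  by (simp add: Finite_Cartesian_Product.vec_eq_iff with_param_def split: option.split)

lemma norm_xpart: "norm (xpart z) \<le> norm (z :: complex^('m::finite option))"
  by (simp add: norm_vec_def L2_set_def sum_option real_sqrt_le_iff)

lemma continuous_xpart: "continuous_on UNIV (xpart :: complex^('m::finite option) => complex^'m)"
  unfolding xpart_def by (intro continuous_on_vec_lambda continuous_intros)

lemma bilin_with_param: "bilin g (with_param v 0) = bilin (xpart g) v" for v :: "complex^'m::finite"
  by (simp add: bilin_def sum_option)

text \<open>The chain rule for the inclusion of a member of the family.\<close>

lemma slice_holomorphic:
  fixes f :: "complex^('m::finite option) => complex"
  assumes f: "holomorphic_Cn_on f U" and U: "open U"
  shows "open {x. with_param x t \<in> U}" "holomorphic_Cn_on (%x. f (with_param x t)) {x. with_param x t \<in> U}"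
    and "with_param x t \<in> U ==> gradient (%x. f (with_param x t)) x = xpart (gradient f (with_param x t))"
proof -
  have wpd: "((%x. with_param x t) has_derivative (%v. with_param v 0)) (at x)" for x :: "complex^'m"
  proof -
    have "bounded_linear (%v :: complex^'m. with_param v 0)"
      by (rule linear_conv_bounded_linear[THEN iffD1], rule linearI)
        (auto simp: Finite_Cartesian_Product.vec_eq_iff with_param_def split: option.split)
    from has_derivative_add[OF has_derivative_const[of "with_param 0 t"] bounded_linear_imp_has_derivative[OF this]]
    show ?thesis by (simp add: with_param_add)
  qed
  have "continuous_on UNIV (%x :: complex^'m. with_param x t)"
    by (rule continuous_at_imp_continuous_on, rule ballI, rule has_derivative_continuous[OF wpd])
  from open_vimage[OF U this] show "open {x. with_param x t \<in> U}" by (simp add: vimage_def)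
  have d: "((%x. f (with_param x t)) has_derivative bilin (xpart (gradient f (with_param x t)))) (at x)" if x: "with_param x t \<in> U" for x
  proof -
    have "((%x. f (with_param x t)) has_derivative (%v. bilin (gradient f (with_param x t)) (with_param v 0))) (at x)"
      by (rule has_derivative_compose[OF wpd holomorphic_Cn_derivative_gradient[OF f x]])
    then show ?thesis by (simp only: bilin_with_param)
  qed
  show "holomorphic_Cn_on (%x. f (with_param x t)) {x. with_param x t \<in> U}"
    by (rule holomorphic_Cn_onI_bilin) (use d in blast)
  show "gradient (%x. f (with_param x t)) x = xpart (gradient f (with_param x t))" if "with_param x t \<in> U"
    by (rule gradient_eqI[OF d[OF that]])
qed

lemma xpart_pull_back: "xpart (pull_back n k a \<Phi>) = pull_back n k (%i j. xpart (a i j)) \<Phi>" for a :: "nat => nat => complex^('m::finite option)"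
  by (simp add: Finite_Cartesian_Product.vec_eq_iff pull_back_def)

lemma transversal_zero_iff_independent:
  assumes M: "\<And>i j. i < n ==> j < k ==> M i j = 0"
  shows "transversal n k 1 M a \<longleftrightarrow> independent_family (%(i, j). a i j) ({..<n} \<times> {..<k})"
proof -
  have con: "\<Phi> \<in> conormal n k M" for \<Phi> using M by (simp add: conormal_def)
  have min: "\<exists>I J. I \<subseteq> {..<n} \<and> J \<subseteq> {..<k} \<and> card I = 1 - 1 \<and> card J = 1 - 1 \<and> minor I J M ~= 0"
    by (rule exI[of _ "{}"], rule exI[of _ "{}"]) simp
  have pb: "pull_back n k a \<Phi> = (\<Sum>q\<in>{..<n} \<times> {..<k}. (case q of (i, j) => \<Phi> i j) *s (case q of (i, j) => a i j))" for \<Phi>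
    by (simp add: pull_back_def sum.cartesian_product case_prod_beta)
  show ?thesis
  proof
    assume t: "transversal n k 1 M a"
    show "independent_family (%(i, j). a i j) ({..<n} \<times> {..<k})"
      unfolding independent_family_def
    proof (intro allI impI ballI)
      fix c q assume z: "(\<Sum>q\<in>{..<n} \<times> {..<k}. c q *s (case q of (i, j) => a i j)) = 0" and q: "q \<in> {..<n} \<times> {..<k}"
      have "pull_back n k a (%i j. c (i, j)) = 0" unfolding pb using z by (simp add: case_prod_beta)
      then have "\<forall>i<n. \<forall>j<k. c (i, j) = 0" using t con unfolding transversal_def by blast
      then show "c q = 0" using q by auto
    qed
  next
    assume ind: "independent_family (%(i, j). a i j) ({..<n} \<times> {..<k})"
    have "\<Phi> i j = 0" if z: "pull_back n k a \<Phi> = 0" and ij: "i < n" "j < k" for \<Phi> i j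
    proof -
      have "(case (i, j) of (i, j) => \<Phi> i j) = 0" by (rule independent_familyD[OF ind z[unfolded pb]]) (use ij in simp)
      then show ?thesis by simp
    qed
    then show "transversal n k 1 M a" unfolding transversal_def using min by blast
  qed
qed

text \<open>The axis is cut out by the coordinates \<open>x\<close>.\<close>

lemma parameter_axis_submanifold:
  fixes B :: "(complex^('m::finite option)) set"
  assumes B: "open B" and p: "p \<in> B" "xpart p = 0"
  shows "\<exists>d. submanifold_at {z \<in> B. xpart z = 0} p d"
    and "tangent_space {z \<in> B. xpart z = 0} p \<subseteq> {u. xpart u = 0}"
proof -
  let ?h = "%(l :: 'm) (z :: complex^('m option)). z $ Some l"
  have bl: "bilin (axis (Some l) 1) u = u $ Some l" for l :: 'm and u :: "complex^('m option)"
    by (simp add: bilin_def axis_def if_distrib if_distribR cong: if_cong)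
  have hd: "(?h l has_derivative bilin (axis (Some l) 1)) (at z)" for l z
  proof -
    have "(?h l has_derivative (%v. v $ Some l)) (at z)"
      by (rule bounded_linear_imp_has_derivative[OF bounded_linear_vec_nth])
    then show ?thesis by (simp add: bl[abs_def])
  qed
  have hol: "holomorphic_Cn_on (?h l) B" for l by (rule holomorphic_Cn_onI_bilin[OF hd])
  have gr: "gradient (?h l) z = axis (Some l) 1" for l z by (rule gradient_eqI[OF hd])
  have X: "z \<in> {z \<in> B. xpart z = 0} \<longleftrightarrow> (\<forall>l\<in>UNIV. ?h l z = 0)" if "z \<in> B" for z
    using that by (simp add: Finite_Cartesian_Product.vec_eq_iff)
  have p': "p \<in> {z \<in> B. xpart z = 0}" using p by simp
  have indep: "\<forall>l\<in>UNIV. c l = 0" if z: "(\<Sum>l\<in>UNIV. c l *s gradient (?h l) p) = 0" for c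
  proof
    fix l
    have "(\<Sum>l\<in>UNIV. c l *s gradient (?h l) p) $ Some l = 0" unfolding z by simp
    then show "c l = 0" by (simp add: gr axis_def if_distrib if_distribR cong: if_cong)
  qed
  show "\<exists>d. submanifold_at {z \<in> B. xpart z = 0} p d"
    by (rule regular_zero_set(1)[OF finite B p(1) hol X p' indep])
  have "tangent_space {z \<in> B. xpart z = 0} p = {u. \<forall>l\<in>UNIV. bilin (gradient (?h l) p) u = 0}"
    by (rule regular_zero_set(2)[OF finite B p(1) hol X p' indep])
  then show "tangent_space {z \<in> B. xpart z = 0} p \<subseteq> {u. xpart u = 0}"
    by (auto simp: gr bl Finite_Cartesian_Product.vec_eq_iff)
qed

theorem theorem1p1:
  fixes n k s d :: nat and r :: real
    and W :: "(complex^('m::finite option)) set"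
    and F :: "complex^('m option) \<Rightarrow> complex mat"
    and \<Delta> :: "nat \<Rightarrow> (real^'m) set"
  assumes "0 < s" and "s \<le> n" and "n \<le> k"
    and "open W" and "0 < r" and "\<forall>t\<in>ball 0 r. with_param 0 t \<in> W"
    and "\<forall>z\<in>W. F z \<in> carrier_mat n k"
    and "\<forall>i<n. \<forall>j<k. holomorphic_Cn_on (\<lambda>z. F z $$ (i, j)) W"
    and "\<forall>t\<in>ball 0 r. family_member F t 0 = 0\<^sub>m n k"
    and "\<forall>\<^sub>F \<epsilon> in at_right 0. determinantal_variety n k s (family_member F 0) (ball 0 \<epsilon>)"
    and "\<forall>\<^sub>F \<epsilon> in at_right 0. has_dimension (det_locus n s (family_member F 0) \<inter> ball 0 \<epsilon>) d"
    and "\<forall>\<^sub>F \<epsilon> in at_right 0. singular_set n k s (family_member F 0) \<inter> ball 0 \<epsilon> = {0}"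
    and "\<forall>t\<in>ball 0 r. newton_nondegenerate n k s \<Delta> (family_member F t)"
    and "\<forall>t\<in>ball 0 r. \<forall>i<n. \<forall>j<k. newton_polyhedron (\<lambda>x. family_member F t x $$ (i, j)) = \<Delta> j"
    and "\<forall>j<k. convenient (\<Delta> j)"
  shows "whitney_equisingular n k s W F"
proof -
 note W = \<open>open W\<close>
 have s: "0 < s" "s \<le> n" "s \<le> k" using assms(1-3) by auto
 have carrier: "F z \<in> carrier_mat n k" if "z \<in> W" for z using assms(7) that by blast
 have hol: "holomorphic_Cn_on (%z. F z $$ (i, j)) W" if "i < n" "j < k" for i j using assms(8) that by blast
 have axisW: "with_param 0 t \<in> W" if "norm t < r" for t using assms(6) that by simp
 let ?M = "%z i j. F z $$ (i, j)"
 have member: "family_member F t = (%x. F (with_param x t))" for t by (simp add: family_member_def fun_eq_iff)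
 have entry0: "F (with_param 0 t) $$ (i, j) = 0" if "norm t < r" "i < n" "j < k" for t i j
  using assms(9) that by (simp add: member)
 \<comment> \<open>The germ of the family at a point of the parameter axis.\<close>
 have germ: "newton_germ n k s (%z. F (with_param 0 t0 + z)) \<Delta> {z. with_param 0 t0 + z \<in> W} (r - norm t0)"
  if t0: "norm t0 < r" for t0
 proof
  show "0 < s" "s \<le> n" "s \<le> k" by (fact s)+
  show "open {z. with_param 0 t0 + z \<in> W}"
   using open_vimage[OF W, of "%z. with_param 0 t0 + z"] by (simp add: vimage_def continuous_intros)
  show "0 \<in> {z. with_param 0 t0 + z \<in> W}" using axisW[OF t0] by simp
  show "0 < r - norm t0" using t0 by simp
  show "F (with_param 0 t0 + z) \<in> carrier_mat n k" if "z \<in> {z. with_param 0 t0 + z \<in> W}" for z using carrier that by simp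
  show "holomorphic_Cn_on (%z. F (with_param 0 t0 + z) $$ (i, j)) {z. with_param 0 t0 + z \<in> W}" if "i < n" "j < k" for i j
   by (rule holomorphic_Cn_onI, rule exI, rule holomorphic_Cn_on_translate(1)[OF hol[OF that]]) simp
  show "newton_polyhedron (%x. F (with_param 0 t0 + with_param x t) $$ (i, j)) = \<Delta> j"
   if "norm t < r - norm t0" "i < n" "j < k" for t i j
  proof -
   have "norm (t0 + t) < r" using norm_triangle_ineq[of t0 t] that(1) by simp
   then show ?thesis using assms(14) that(2,3) by (simp add: member with_param_add)
  qed
  show "convenient (\<Delta> j)" if "j < k" for j using assms(15) that by blast
  show "newton_nondegenerate n k s \<Delta> (%x. F (with_param 0 t0 + with_param x 0))"
   using assms(13) t0 by (simp add: member with_param_add)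
 qed
 have germ0: "newton_germ n k s F \<Delta> W r" using germ[of 0] assms(5) by simp
 obtain \<epsilon>0 where \<epsilon>0: "0 < \<epsilon>0" and near: "\<And>z \<Phi>. norm z < \<epsilon>0 ==> xpart z ~= 0 ==> low_rank (s - 1) n k (?M z) ==>
   (\<exists>I J. I \<subseteq> {..<n} \<and> J \<subseteq> {..<k} \<and> card I = s - 1 \<and> card J = s - 1 \<and> minor I J (?M z) ~= 0) \<and>
   (\<Phi> \<in> conormal n k (?M z) \<longrightarrow> xpart (pull_back n k (entry_gradients F z) \<Phi>) = 0 \<longrightarrow> (\<forall>i<n. \<forall>j<k. \<Phi> i j = 0))"
  apply (rule newton_germ.transversal_near[OF germ0])
  subgoal premises p by (rule p(1)[OF p(2-)])
  done
 have "0 \<in> W" using axisW[of 0] assms(5) by simp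
 then obtain \<omega> where \<omega>: "0 < \<omega>" "ball 0 \<omega> \<subseteq> W" using W open_contains_ball by blast
 define \<epsilon> where "\<epsilon> = min \<epsilon>0 \<omega> / 2"
 define \<delta> where "\<delta> = min \<epsilon> r"
 have \<epsilon>: "0 < \<epsilon>" "0 < \<delta>" "\<delta> \<le> r" using \<epsilon>0 \<omega>(1) assms(5) by (auto simp: \<epsilon>_def \<delta>_def)
 have small: "norm (with_param x t) < \<epsilon>0 \<and> norm (with_param x t) < \<omega>" if "norm x < \<epsilon>" "norm t < \<delta>" for x :: "complex^'m" and t
  using norm_with_param(3)[of x t] that by (auto simp: \<epsilon>_def \<delta>_def)
 define B where "B = {with_param x t | x t. x \<in> ball (0 :: complex^'m) \<epsilon> \<and> t \<in> ball 0 \<delta>}"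
 define T where "T = {with_param (0 :: complex^'m) t | t. t \<in> ball 0 \<delta>}"
 have B: "z \<in> B \<longleftrightarrow> norm (xpart z) < \<epsilon> \<and> norm (z $ None) < \<delta>" for z
 proof
  assume "norm (xpart z) < \<epsilon> \<and> norm (z $ None) < \<delta>"
  then have "with_param (xpart z) (z $ None) \<in> B" unfolding B_def by (intro CollectI exI conjI) auto
  then show "z \<in> B" by simp
 qed (auto simp: B_def)
 have T: "T = {z \<in> B. xpart z = 0}"
 proof (intro equalityI subsetI)
  fix z assume "z \<in> {z \<in> B. xpart z = 0}"
  then have "norm (z $ None) < \<delta>" "with_param 0 (z $ None) = z" using B with_param_xpart(1)[of z] by auto
  then show "z \<in> T" unfolding T_def by (intro CollectI exI[of _ "z $ None"]) simp
 qed (use \<epsilon> in \<open>auto simp: T_def B\<close>)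
 have BW: "B \<subseteq> W" using small \<omega>(2) by (fastforce simp: B_def)
 have B\<epsilon>: "norm z < \<epsilon>0" if "z \<in> B" for z using that small by (auto simp: B_def)
 have oB: "open B"
 proof -
  have "open {z :: complex^('m option). norm (xpart z) < \<epsilon> \<and> norm (z $ None) < \<delta>}"
   by (intro open_Collect_conj open_Collect_less continuous_intros continuous_on_norm continuous_xpart)
  then show ?thesis by (simp add: B[symmetric])
 qed
 define X where "X = det_locus n s F \<inter> B - T"
 have X: "z \<in> X \<longleftrightarrow> z \<in> B \<and> xpart z ~= 0 \<and> low_rank (s - 1) n k (?M z)" for z
  using rank_less_iff_low_rank[OF carrier s(1), of z] BW by (auto simp: X_def T det_locus_def)
 have trans: "transversal n k s (?M z) (%i j. xpart (entry_gradients F z i j)) \<and> transversal n k s (?M z) (entry_gradients F z)"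
  if "z \<in> X" for z
 proof -
  have z: "norm z < \<epsilon>0" "xpart z ~= 0" "low_rank (s - 1) n k (?M z)" using that X B\<epsilon> by auto
  have inj: "\<forall>i<n. \<forall>j<k. \<Phi> i j = 0" if "\<Phi> \<in> conormal n k (?M z)" "xpart (pull_back n k (entry_gradients F z) \<Phi>) = 0" for \<Phi>
   using near[OF z, of \<Phi>] that by blast
  have "\<exists>I J. I \<subseteq> {..<n} \<and> J \<subseteq> {..<k} \<and> card I = s - 1 \<and> card J = s - 1 \<and> minor I J (?M z) ~= 0"
   using near[OF z] by (rule conjunct1)
  then show ?thesis using inj unfolding transversal_def xpart_pull_back[symmetric] by (metis xpart_simps(1))
 qed
 \<comment> \<open>The singular points of the members.\<close>
 have slice: "transversal n k s (?M (with_param x t)) (%i j. xpart (entry_gradients F (with_param x t) i j)) \<longleftrightarrow>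
   x \<notin> singular_set n k s (family_member F t)"
  if w: "with_param x t \<in> W" and lr: "low_rank (s - 1) n k (?M (with_param x t))" for x t
 proof -
  let ?V = "{x. with_param x t \<in> W}"
  have "x \<notin> singular_set n k s (family_member F t) \<longleftrightarrow>
    transversal n k s (%i j. family_member F t x $$ (i, j)) (entry_gradients (family_member F t) x)"
  proof (rule not_singular_iff_transversal[of n k _ ?V])
   show "holomorphic_Cn_on (%y. family_member F t y $$ (i, j)) ?V" if "i < n" "j < k" for i j
    unfolding member by (rule slice_holomorphic(2)[OF hol[OF that] W])
   show "open ?V" using slice_holomorphic(1)[OF hol[of 0 0] W] s by simp
  qed (use w lr carrier s in \<open>auto simp: member\<close>)
  also have "\<dots> \<longleftrightarrow> transversal n k s (?M (with_param x t)) (%i j. xpart (entry_gradients F (with_param x t) i j))"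
  proof -
   have "pull_back n k (entry_gradients (family_member F t) x) \<Phi> = pull_back n k (%i j. xpart (entry_gradients F (with_param x t) i j)) \<Phi>" for \<Phi>
    unfolding pull_back_def member
    by (intro sum.cong refl arg_cong2[where f = "(*s)"] slice_holomorphic(3)[OF hol W w]) auto
   then show ?thesis unfolding transversal_def by (simp add: member)
  qed
  finally show ?thesis by blast
 qed
 have low0: "low_rank (s - 1) n k (?M (with_param 0 t))" if "norm t < r" for t
  unfolding low_rank_def using entry0[OF that] by (intro exI[of _ "{}"]) auto
 have "\<exists>\<epsilon>'. singular_set n k s (family_member F 0) \<inter> ball 0 \<epsilon>' = {0}"
  using eventually_happens[OF assms(12)] by (simp add: trivial_limit_at_right_real)
 then have sing0: "0 \<in> singular_set n k s (family_member F 0)" by blast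
 have origin: "0 \<in> singular_set n k s (family_member F t)" if t: "norm t < r" for t
 proof (cases "s = 1")
  case False
  have "\<not> transversal n k s (?M (with_param 0 t)) (%i j. xpart (entry_gradients F (with_param 0 t) i j))"
  proof
   assume "transversal n k s (?M (with_param 0 t)) (%i j. xpart (entry_gradients F (with_param 0 t) i j))"
   then obtain I J where IJ: "I \<subseteq> {..<n}" "J \<subseteq> {..<k}" "card I = s - 1" "card J = s - 1" "minor I J (?M (with_param 0 t)) ~= 0"
    unfolding transversal_def by (elim conjE exE)
   have "low_rank 0 n k (?M (with_param 0 t))"
    unfolding low_rank_def using entry0[OF t] by (intro exI[of _ "{}"]) auto
   then have "minor I J (?M (with_param 0 t)) = 0"
    by (rule low_rank_imp_minor_zero) (use IJ False s in auto)
   with IJ show False by simp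
  qed
  then show ?thesis using slice[OF axisW[OF t] low0[OF t]] by blast
 next
  case True
  have ind: "0 \<notin> singular_set n k s (family_member F t) \<longleftrightarrow>
    independent_family (%(i, j). gradient (%x. F (with_param x t) $$ (i, j)) (0 :: complex^'m)) ({..<n} \<times> {..<k})"
   if t: "norm t < r" for t
  proof -
   have "0 \<notin> singular_set n k s (family_member F t) \<longleftrightarrow>
     independent_family (%(i, j). xpart (entry_gradients F (with_param 0 t) i j)) ({..<n} \<times> {..<k})"
   proof (rule HOL.trans)
    show "0 \<notin> singular_set n k s (family_member F t) \<longleftrightarrow>
      transversal n k 1 (?M (with_param 0 t)) (%i j. xpart (entry_gradients F (with_param 0 t) i j))"
     using slice[OF axisW[OF t] low0[OF t]] unfolding True by (rule sym)
   qed (rule transversal_zero_iff_independent[OF entry0[OF t]])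
   moreover have "(\<Sum>q\<in>{..<n} \<times> {..<k}. c q *s (case q of (i, j) => xpart (entry_gradients F (with_param 0 t) i j))) =
     (\<Sum>q\<in>{..<n} \<times> {..<k}. c q *s (case q of (i, j) => gradient (%x. F (with_param x t) $$ (i, j)) (0 :: complex^'m)))" for c
    by (rule sum.cong[OF refl]) (auto simp: slice_holomorphic(3)[OF hol W axisW[OF t]])
   ultimately show ?thesis unfolding independent_family_def by simp
  qed
  have "\<not> independent_family (%(i, j). gradient (%x. F (with_param x t) $$ (i, j)) (0 :: complex^'m)) ({..<n} \<times> {..<k})"
  proof (rule newton_germ.linear_parts_dependent[OF germ0 True axisW entry0 _ t])
   show "\<not> independent_family (%(i, j). gradient (%x. F (with_param x 0) $$ (i, j)) (0 :: complex^'m)) ({..<n} \<times> {..<k})"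
    using ind[of 0] sing0 assms(5) by simp
  qed
  then show ?thesis using ind[OF t] by blast
 qed
 have good: "good_on n k s F \<epsilon> (ball 0 \<delta>)"
  unfolding good_on_def
 proof (intro ballI equalityI subsetI)
  fix t :: complex and x :: "complex^'m" assume t: "t \<in> ball 0 \<delta>" and x: "x \<in> singular_set n k s (family_member F t) \<inter> ball 0 \<epsilon>"
  let ?z = "with_param x t"
  have zB: "?z \<in> B" using t x by (simp add: B)
  have "x \<in> det_locus n s (family_member F t)" using x by (simp add: singular_set_def)
  then have lr: "low_rank (s - 1) n k (?M ?z)"
   using rank_less_iff_low_rank[OF carrier s(1), of ?z] zB BW by (auto simp: det_locus_def member)
  show "x \<in> {0}"
  proof (rule ccontr)
   assume "x \<notin> {0}"
   then have "?z \<in> X" using zB lr by (simp add: X)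
   then have "x \<notin> singular_set n k s (family_member F t)" using trans slice[OF _ lr] zB BW by blast
   with x show False by blast
  qed
 next
  fix t :: complex and x :: "complex^'m" assume "t \<in> ball 0 \<delta>" "x \<in> {0}"
  then show "x \<in> singular_set n k s (family_member F t) \<inter> ball 0 \<epsilon>" using origin[of t] \<epsilon> by auto
 qed
 define Ox where "Ox = B \<inter> {z. xpart z ~= 0}"
 have Ox: "open Ox" "Ox \<subseteq> W"
 proof -
  have "open (xpart -` (- {0 :: complex^'m}))" by (rule open_vimage[OF _ continuous_xpart]) auto
  then show "open Ox" unfolding Ox_def using oB by (intro open_Int) (auto simp: vimage_def)
 qed (use BW in \<open>auto simp: Ox_def\<close>)
 have holO: "holomorphic_Cn_on (%z. F z $$ (i, j)) Ox" if "i < n" "j < k" for i j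
  using hol[OF that] Ox(2) by (auto simp: holomorphic_Cn_on_def)
 have carO: "F z \<in> carrier_mat n k" if "z \<in> Ox" for z using carrier Ox(2) that by blast
 have XO: "z \<in> X \<longleftrightarrow> low_rank (s - 1) n k (?M z)" if "z \<in> Ox" for z using that by (simp add: X Ox_def)
 have X_Ox: "z \<in> Ox" if "z \<in> X" for z using that by (simp add: X Ox_def)
 have manifold: "\<exists>d. submanifold_at X z d" if z: "z \<in> X" for z
  by (rule det_locus_regular(1)[OF s holO Ox(1) X_Ox[OF z] carO XO z conjunct2[OF trans[OF z]]])
 have tangent: "tangent_space X z = {u. \<forall>\<Phi>\<in>conormal n k (?M z). bilin (pull_back n k (entry_gradients F z) \<Phi>) u = 0}"
  if z: "z \<in> X" for z
  by (rule det_locus_regular(2)[OF s holO Ox(1) X_Ox[OF z] carO XO z conjunct2[OF trans[OF z]]])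
 have normal: "\<exists>\<Phi>\<in>conormal n k (?M z). c = pull_back n k (entry_gradients F z) \<Phi>"
  if z: "z \<in> X" and c: "\<And>u. u \<in> tangent_space X z ==> bilin c u = 0" for z c
  by (rule det_locus_regular(3)[OF s holO Ox(1) X_Ox[OF z] carO XO z conjunct2[OF trans[OF z]] c])
 \<comment> \<open>Limits of tangent spaces contain the limits of vectors that are multiples of the position vector up to the parameter
   direction.\<close>
 have limit: "v' \<in> L"
  if x: "\<And>i. x i \<in> X" "x \<longlonglongrightarrow> y0" and y0: "y0 \<in> T" and L: "subspaces_tendsto (%i. tangent_space X (x i)) L"
   and v: "\<And>i. xpart (v i) = a i *s xpart (x i)" "\<And>i. norm (v i) \<le> K" "v \<longlonglongrightarrow> v'" for x y0 L v a K v'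
 proof -
  obtain t0 where t0: "y0 = with_param 0 t0" "norm t0 < \<delta>" using y0 by (auto simp: T_def)
  then have t0r: "norm t0 < r" using \<epsilon>(3) by simp
  interpret G: newton_germ n k s "%z. F (with_param 0 t0 + z)" \<Delta> "{z. with_param 0 t0 + z \<in> W}" "r - norm t0"
   by (rule germ[OF t0r])
  define z where "z = (%i. x i - y0)"
  have zx: "with_param 0 t0 + z i = x i" for i by (simp add: z_def t0(1))
  have xz: "xpart (z i) = xpart (x i)" for i by (simp add: z_def t0(1))
  have xW: "x i \<in> W" for i using x(1) X BW by blast
  have pb: "pull_back n k (entry_gradients (%z. F (with_param 0 t0 + z)) (z i)) \<Phi> = pull_back n k (entry_gradients F (x i)) \<Phi>" for i \<Phi>
   unfolding pull_back_def
  proof (intro sum.cong refl arg_cong2[where f = "(*s)"])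
   fix i' j assume ij: "i' \<in> {..<n}" "j \<in> {..<k}"
   have "pderivative l (%z. F (with_param 0 t0 + z) $$ (i', j)) (z i) = pderivative l (%z. F z $$ (i', j)) (with_param 0 t0 + z i)" for l
    by (rule holomorphic_Cn_on_translate(2)[OF hol]) (use ij xW in \<open>auto simp: zx\<close>)
   then show "gradient (%z. F (with_param 0 t0 + z) $$ (i', j)) (z i) = gradient (%z. F z $$ (i', j)) (x i)"
    by (simp add: Finite_Cartesian_Product.vec_eq_iff gradient_nth zx)
  qed
  have tan: "G.limit_tangent (z i) = tangent_space X (x i)" for i
   using tangent[OF x(1)] by (simp add: G.limit_tangent_def zx pb)
  have z0: "z \<longlonglongrightarrow> 0" unfolding z_def using tendsto_diff[OF x(2) tendsto_const[of y0]] by simp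
  have K: "norm (a i) * norm (xpart (z i)) \<le> K" "norm (v i $ None) \<le> K" for i
  proof -
   have "norm (a i) * norm (xpart (z i)) = norm (xpart (v i))" by (simp add: v(1) xz norm_scalar_mult)
   also have "\<dots> \<le> K" using norm_xpart[of "v i"] v(2)[of i] by simp
   finally show "norm (a i) * norm (xpart (z i)) \<le> K" .
   show "norm (v i $ None) \<le> K" using Finite_Cartesian_Product.norm_nth_le[of "v i" None] v(2)[of i] by simp
  qed
  obtain \<tau> where \<tau>: "strict_mono (\<tau> :: nat => nat)" "(%i. v (\<tau> i) - closest_point (tangent_space X (x (\<tau> i))) (v (\<tau> i))) \<longlonglongrightarrow> 0"
  proof (rule G.secant_limit[OF z0, of v a K])
   show "xpart (z i) ~= 0" for i using x(1)[of i] by (simp add: xz X)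
   show "low_rank (s - 1) n k (%i' j. F (with_param 0 t0 + z i) $$ (i', j))" for i using x(1)[of i] by (simp add: zx X)
   show "\<exists>\<Phi>\<in>conormal n k (%i' j. F (with_param 0 t0 + z i) $$ (i', j)). c = pull_back n k (entry_gradients (%z. F (with_param 0 t0 + z)) (z i)) \<Phi>"
    if "\<And>u. u \<in> G.limit_tangent (z i) ==> bilin c u = 0" for i c
    using normal[OF x(1), of i c] that by (simp add: zx pb tan)
   show "xpart (v i) = a i *s xpart (z i)" for i by (simp add: v(1) xz)
  qed (use K tan in auto)
  have sub: "Real_Vector_Spaces.subspace (tangent_space X (x i))" for i
   using subspace_functionals[of "pull_back n k (entry_gradients F (x i)) ` conormal n k (?M (x i))"]
   by (simp add: tangent[OF x(1)])
  have subL: "Real_Vector_Spaces.subspace L" and limL: "(%i. closest_point (tangent_space X (x i)) v') \<longlonglongrightarrow> closest_point L v'"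
   using L by (auto simp: subspaces_tendsto_def)
  let ?P = "%i. closest_point (tangent_space X (x (\<tau> i)))"
  have v\<tau>: "(%i. v (\<tau> i)) \<longlonglongrightarrow> v'" using LIMSEQ_subseq_LIMSEQ[OF v(3) \<tau>(1)] by (simp add: o_def)
  have "(%i. ?P i v' - ?P i (v (\<tau> i))) \<longlonglongrightarrow> 0"
  proof (rule Lim_null_comparison[OF always_eventually[OF allI]])
   show "norm (?P i v' - ?P i (v (\<tau> i))) \<le> norm (v' - v (\<tau> i))" for i
    using closest_point_subspace(3)[OF sub, of "\<tau> i" v' "v (\<tau> i)"] by (simp add: dist_norm)
   show "(%i. norm (v' - v (\<tau> i))) \<longlonglongrightarrow> 0"
    using tendsto_norm[OF tendsto_diff[OF tendsto_const[of v'] v\<tau>]] by simp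
  qed
  from tendsto_add[OF this tendsto_diff[OF v\<tau> \<tau>(2)]] have "(%i. ?P i v') \<longlonglongrightarrow> v'" by simp
  moreover have "(%i. ?P i v') \<longlonglongrightarrow> closest_point L v'" using LIMSEQ_subseq_LIMSEQ[OF limL \<tau>(1)] by (simp add: o_def)
  ultimately have "closest_point L v' = v'" by (rule LIMSEQ_unique[symmetric])
  then show ?thesis using closest_point_subspace(4)[OF subL] by blast
 qed
 have "whitney_a X T"
  unfolding whitney_a_def
 proof (intro allI impI subsetI, elim conjE)
  fix x y L u assume x: "\<forall>i. x i \<in> X" "x \<longlonglongrightarrow> y" and y: "y \<in> T" and L: "subspaces_tendsto (%i. tangent_space X (x i)) L"
   and u: "u \<in> tangent_space T y"
  have "xpart u = 0" using u parameter_axis_submanifold(2)[OF oB, of y] y by (auto simp: T)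
  then show "u \<in> L"
   by (intro limit[of x y L "%_. u" "%_. 0" "norm u"]) (use x y L in auto)
 qed
 moreover have "whitney_b X T"
  unfolding whitney_b_def
 proof (intro allI impI subsetI, elim conjE)
  fix x y y0 L l u assume xy: "\<forall>i. x i \<in> X \<and> y i \<in> T \<and> x i ~= y i" and y0: "y0 \<in> T" and lim: "x \<longlonglongrightarrow> y0" "y \<longlonglongrightarrow> y0"
   and L: "subspaces_tendsto (%i. tangent_space X (x i)) L"
   and l: "subspaces_tendsto (%i. Real_Vector_Spaces.span {x i - y i}) l" and u: "u \<in> l"
  define v where "v = (%i. closest_point (Real_Vector_Spaces.span {x i - y i}) u)"
  have sl: "Real_Vector_Spaces.subspace l" and vl: "v \<longlonglongrightarrow> closest_point l u" using l by (auto simp: subspaces_tendsto_def v_def)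
  have vu: "v \<longlonglongrightarrow> u" using vl closest_point_subspace(4)[OF sl, of u] u by simp
  have "\<forall>i. \<exists>c. v i = c *\<^sub>R (x i - y i)"
   using closest_point_subspace(1)[OF Real_Vector_Spaces.subspace_span, of "{x _ - y _}" u]
   by (auto simp: v_def Real_Vector_Spaces.span_singleton)
  from choice[OF this] obtain c where c: "\<forall>i. v i = c i *\<^sub>R (x i - y i)" ..
  have "Bseq v" by (rule convergent_imp_Bseq[OF convergentI[OF vu]])
  then obtain K where K: "\<And>i. norm (v i) \<le> K" by (auto simp: Bseq_def)
  show "u \<in> L"
  proof (rule limit[of x y0 L v "%i. of_real (c i)" K])
   show "xpart (v i) = of_real (c i) *s xpart (x i)" for i
   proof -
    have "xpart (y i) = 0" using xy T by auto
    then show ?thesis using c by (simp add: scaleR_eq_vector_scalar_mult)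
   qed
  qed (use xy y0 lim L K vu in auto)
 qed
 moreover have "\<forall>p\<in>X. \<exists>d. submanifold_at X p d" using manifold by blast
 moreover have "\<forall>p\<in>T. \<exists>d. submanifold_at T p d"
  using parameter_axis_submanifold(1)[OF oB] by (auto simp: T)
 ultimately have "whitney_conditions X T" by (simp add: whitney_conditions_def)
 then show ?thesis
  unfolding whitney_equisingular_def Let_def B_def[symmetric] T_def[symmetric] X_def
  using BW good \<epsilon> by (intro exI[of _ \<epsilon>] exI[of _ \<delta>] conjI) (auto simp: B_def T_def)
qed

end
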